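(* Let $f$ be a predictable Lipschitz driver, let $(\xi_t)_{0\le t\le T}$ be a left-limited right upper-semicontinuous process in $\mathbb{S}^{2,0}$, and let $(Y,Z,A,C)$ be the solution to the reflected BSDE with parameters $(f,\xi)$. For $S\in\mathcal{T}_{0,T}$ consider the optimal stopping problem $$V(S)=\operatorname*{ess\,sup}_{\tau\in\mathcal{T}_{S,T}}E\Big[\xi_\tau+\int_S^\tau f(t,Y_t,Z_t(\cdot))\,dt\,\Big|\,\mathcal{F}_S\Big].$$ 1. For every $S\in\mathcal{T}_{0,T}$, $$Y_S=\operatorname*{ess\,sup}_{\tau\in\mathcal{T}_{S,T}}E\Big[\xi_\tau+\int_S^\tau f(t,Y_t,Z_t(\cdot))\,dt\,\Big|\,\mathcal{F}_S\Big]\quad\text{a.s.}$$ 2. For each $S\in\mathcal{T}_{0,T}$ and each $\epsilon>0$, the stopping time $\tau_S^\epsilon=\inf\{t\ge S: Y_t\le\xi_t+\epsilon\}$ is $\epsilon$-optimal for the problem $V(S)$, that is, $$Y_S\le E\Big[\xi_{\tau_S^\epsilon}+\int_S^{\tau_S^\epsilon}f(t,Y_t,Z_t(\cdot))\,dt\,\Big|\,\mathcal{F}_S\Big]+\epsilon\quad\text{a.s.}$$ 3. If in addition $\xi$ is a left upper-semicontinuous process, then for each $S\in\mathcal{T}_{0,T}$ the stopping time $\tau_S^*=\inf\{t\ge S: Y_t=\xi_t\}\wedge T$ is optimal for the problem $V(S)$ and is the smallest of all optimal stopping times.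
   Context: **Probabilistic setting.** $T>0$ is fixed, $(\mathcal{U},\mathcal{E})$ is a Lusin space, and $(\Omega,\mathcal{F},\mathbb{P},\mathbb{F}=(\mathcal{F}_t)_{t\ge0})$ is a filtered probability space with complete, right-continuous and quasi-left-continuous filtration. $\mathcal{P}$ is the predictable $\sigma$-field on $\Omega\times[0,T]$; for a measurable space $(G,\mathcal{G})$, a function on $\Omega\times[0,T]\times G$ that is $\mathcal{P}\otimes\mathcal{G}$-measurable is called predictable. $\mu$ is an integer-valued random measure on $\mathbb{R}_+\times\mathcal{U}$ (a multivariate point process $\mu(dt,dx)=\sum_n\varepsilon_{(S_n,X_n)}(dt,dx)$, where the $S_n$ are distinct times, the $X_n$ are marks, and $\varepsilon$ is the Dirac measure). It is discrete: the sections of $\{(\omega,t):\mu(\omega,\{t\}\times\mathcal{U})=1\}$ are finite on every finite interval. $\mathbb{F}$ is the natural filtration of $\mu$ (the smallest right-continuous filtration, completed, in which $\mu$ is optional). The predictable compensator $\nu$ of $\mu$ is disintegrated as $\nu(\omega,dt,dx)=dK_t(\omega)\,\phi_{\omega,t}(dx)$, where $K$ is a right-continuous nondecreasing predictable process with $K_0=0$ and $\phi$ is a transition probability from $(\Omega\times[0,T],\mathcal{P})$ to $(\mathcal{U},\mathcal{E})$; moreover $\Delta K_t=K_t-K_{t-}\le1$. Stochastic integrals $\int\int Z_s(x)(\mu-\nu)(dx,ds)$ are the usual compensated integrals of predictable functions with respect to $\mu-\nu$. **Notation.** $\mathcal{T}_{S,T}$ is the set of stopping times $\tau$ with $S\le\tau\le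 T$ a.s.; $\mathcal{T}^p_{0,T}$ is the set of predictable stopping times with values in $[0,T]$ a.s. $\mathcal{B}(\mathcal{U})$ is the set of Borel measurable real functions on $\mathcal{U}$; $Z_t=Z_t(\cdot)\in\mathcal{B}(\mathcal{U})$ denotes the section of $Z:\Omega\times[0,T]\times\mathcal{U}\to\mathbb{R}$. - $\mathbb{S}^{2,0}$ is the set of real-valued optional processes $Y$ with $E[\operatorname{ess\,sup}_{\tau\in\mathcal{T}_{0,T}}|Y_\tau|^2]<\infty$. - $\mathbb{H}^{2,0}$ is the set of real-valued predictable $Z$ on $\Omega\times[0,T]\times\mathcal{U}$ with $$E\Big[\int_0^T\int_{\mathcal{U}}|Z_t(x)-\bar Z_t|^2\nu(dx,dt)+\sum_{0<t\le T}|\bar Z_t|^2(1-\Delta K_t)\Big]<\infty,\qquad \bar Z_t=\int_{\mathcal{U}}Z_t(x)\nu(\{t\},dx).$$ **Drivers.** A driver is a function $f:\Omega\times[0,T]\times\mathbb{R}\times\mathcal{B}(\mathcal{U})\to\mathbb{R}$ such that, for every predictable $Z$ on $\Omega\times[0,T]\times\mathcal{U}$, $(\omega,t)\mapsto f(\omega,t,y,Z_t(\cdot))$ is predictable for each $y$ and $(\omega,t,y)\mapsto f(\omega,t,y,Z_t(\cdot))$ is measurable with respect to the product of the progressive $\sigma$-field and the Borel $\sigma$-field (for a predictable driver: of the predictable $\sigma$-field and the Borel $\sigma$-field), and such that $E[\int_0^T|f(t,0,0)|^2dt]<\infty$. It is a Lipschitz driver if moreover there is $L\ge0$ such that, $\mathbb{P}\otimes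 dt$-a.e., for all $y,y'\in\mathbb{R}$ and $z,z'\in L^2(\mathcal{U},\mathcal{E},\phi_{\omega,t}(dx))$, $$|f(\omega,t,y,z)-f(\omega,t,y',z')|\le L\Big(|y-y'|+\Big(\int_{\mathcal{U}}\Big|z(x)-z'(x)-\int_{\mathcal{U}}(z(u)-z'(u))\phi_{\omega,t}(du)\Big|^2\phi_{\omega,t}(dx)+(1-\Delta K_t)\Big|\int_{\mathcal{U}}(z(x)-z'(x))\phi_{\omega,t}(dx)\Big|^2\Big)^{1/2}\Big).$$ **Semicontinuity.** $\xi$ is right upper-semicontinuous if $\limsup_{s\downarrow t,\,s>t}\xi_s\le\xi_t$ for all $t$, and left upper-semicontinuous if $\limsup_{s\uparrow t,\,s<t}\xi_s\le\xi_t$ for all $t$ (i.e. $\xi_{t-}\le\xi_t$ for a left-limited process), almost surely. **Solution of the reflected BSDE with parameters $(f,\xi)$.** A quadruple $(Y,Z,A,C)\in\mathbb{S}^{2,0}\times\mathbb{H}^{2,0}\times\mathbb{S}^{2,0}\times\mathbb{S}^{2,0}$ such that: 1. for all $\tau\in\mathcal{T}_{0,T}$, a.s., $Y_\tau=\xi_T+\int_\tau^Tf(s,Y_s,Z_s(\cdot))ds-\int_\tau^T\int_{\mathcal{U}}Z_s(x)(\mu-\nu)(dx,ds)+A_T-A_\tau+C_{T-}-C_{\tau-}$; 2. $Y\ge\xi$ up to an evanescent set; 3. $A$ is nondecreasing, right-continuous, predictable, with $A_0=0$, $E(A_T)<\infty$, $\int_0^T1_{\{Y_t>\xi_t\}}dA^c_t=0$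 a.s., and $(Y_{\tau-}-\xi_{\tau-})(A^d_\tau-A^d_{\tau-})=0$ a.s. for all $\tau\in\mathcal{T}^p_{0,T}$, where $A^c$ and $A^d$ are the continuous and discontinuous parts of $A$; 4. $C$ is nondecreasing, right-continuous, adapted, purely discontinuous, with $C_{0-}=0$, $E(C_T)<\infty$, and $(Y_\tau-\xi_\tau)(C_\tau-C_{\tau-})=0$ a.s. for all $\tau\in\mathcal{T}_{0,T}$. **Optimality.** A stopping time $\hat\tau\in\mathcal{T}_{S,T}$ is optimal for $V(S)$ if $V(S)=E[\xi_{\hat\tau}+\int_S^{\hat\tau}f(t,Y_t,Z_t(\cdot))dt\,|\,\mathcal{F}_S]$ a.s. *)

theory Defs
  imports "HOL-Probability.Probability"
begin

text \<open>
  Processes are curried functions \<open>X \<omega> t\<close>, and filtrations are functions from \<open>real\<close> to measures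
  of which only the \<open>\<sigma>\<close>-algebras \<open>sets (F t)\<close> for \<open>t \<ge> 0\<close> matter. Time sets \<open>I\<close> are \<open>{0..T}\<close>
  or \<open>{0..}\<close>.
\<close>

section \<open>Filtrations and stopping times\<close>

definition right_continuous_filtration :: "'w measure \<Rightarrow> (real \<Rightarrow> 'w measure) \<Rightarrow> bool" where
  "right_continuous_filtration M F \<longleftrightarrow>
     filtration (space M) F \<and> (\<forall>t. subalgebra M (F t)) \<and>
     (\<forall>t\<ge>0. sets (F t) = (\<Inter>s\<in>{t<..}. sets (F s)))"

definition complete_filtration :: "'w measure \<Rightarrow> (real \<Rightarrow> 'w measure) \<Rightarrow> bool" where
  "complete_filtration M F \<longleftrightarrow> complete_measure M \<and> null_sets M \<subseteq> sets (F 0)"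

definition predictable_sigma :: "'w set \<Rightarrow> (real \<Rightarrow> 'w measure) \<Rightarrow> real set \<Rightarrow> ('w \<times> real) measure" where
  "predictable_sigma \<Omega> F I = sigma (\<Omega> \<times> I)
     ({B \<times> {0} |B. B \<in> sets (F 0)} \<union>
      {B \<times> {s<..t} |B s t. 0 \<le> s \<and> s \<le> t \<and> t \<in> I \<and> B \<in> sets (F s)})"

definition cadlag_adapted :: "'w set \<Rightarrow> (real \<Rightarrow> 'w measure) \<Rightarrow> real set \<Rightarrow> ('w \<Rightarrow> real \<Rightarrow> real) \<Rightarrow> bool" where
  "cadlag_adapted \<Omega> F I X \<longleftrightarrow>
     (\<forall>t\<in>I. (\<lambda>\<omega>. X \<omega> t) \<in> borel_measurable (F t)) \<and>
     (\<forall>\<omega>\<in>\<Omega>. \<forall>t\<in>I. (X \<omega> \<longlongrightarrow> X \<omega> t) (at t within I \<inter> {t<..})) \<and>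
     (\<forall>\<omega>\<in>\<Omega>. \<forall>t\<in>I. 0 < t \<longrightarrow> (\<exists>l. (X \<omega> \<longlongrightarrow> l) (at_left t)))"

definition optional_sigma :: "'w set \<Rightarrow> (real \<Rightarrow> 'w measure) \<Rightarrow> real set \<Rightarrow> ('w \<times> real) measure" where
  "optional_sigma \<Omega> F I = sigma (\<Omega> \<times> I)
     {{(\<omega>, t) \<in> \<Omega> \<times> I. X \<omega> t \<in> B} |X B. cadlag_adapted \<Omega> F I X \<and> B \<in> sets borel}"

text \<open>The set \<open>\<T>\<^bsub>S,T\<^esub>\<close>. The times are finite everywhere; as the filtration is complete, this
  loses nothing for times that are bounded by \<open>T\<close> almost surely.\<close>

definition stopping_times ::
  "'w measure \<Rightarrow> (real \<Rightarrow> 'w measure) \<Rightarrow> real \<Rightarrow> ('w \<Rightarrow> real) \<Rightarrow> ('w \<Rightarrow> real) set" where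
  "stopping_times M F T S =
     {\<tau>. stopping_time F \<tau> \<and> (\<forall>\<omega>\<in>space M. 0 \<le> \<tau> \<omega>) \<and> (AE \<omega> in M. S \<omega> \<le> \<tau> \<omega> \<and> \<tau> \<omega> \<le> T)}"

definition predictable_time :: "'w measure \<Rightarrow> (real \<Rightarrow> 'w measure) \<Rightarrow> ('w \<Rightarrow> real) \<Rightarrow> bool" where
  "predictable_time M F \<tau> \<longleftrightarrow>
     (\<forall>\<omega>\<in>space M. 0 \<le> \<tau> \<omega>) \<and>
     {(\<omega>, t) \<in> space M \<times> {0..}. \<tau> \<omega> \<le> t} \<in> sets (predictable_sigma (space M) F {0..})"

definition predictable_stopping_times ::
  "'w measure \<Rightarrow> (real \<Rightarrow> 'w measure) \<Rightarrow> real \<Rightarrow> ('w \<Rightarrow> real) set" where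
  "predictable_stopping_times M F T = {\<tau> \<in> stopping_times M F T (\<lambda>_. 0). predictable_time M F \<tau>}"

text \<open>The \<open>\<sigma>\<close>-algebra \<open>\<F>\<^bsub>\<tau>-\<^esub>\<close>.\<close>

definition strict_past :: "'w measure \<Rightarrow> (real \<Rightarrow> 'w measure) \<Rightarrow> ('w \<Rightarrow> real) \<Rightarrow> 'w measure" where
  "strict_past M F \<tau> = sigma (space M)
     (sets (F 0) \<union> {{\<omega> \<in> B. t < \<tau> \<omega>} |B t. 0 \<le> t \<and> B \<in> sets (F t)})"

text \<open>Predictable times with the value \<open>\<infinity>\<close> reduce to the finite ones \<open>min \<tau> n\<close>.\<close>

definition quasi_left_continuous_filtration :: "'w measure \<Rightarrow> (real \<Rightarrow> 'w measure) \<Rightarrow> bool" where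
  "quasi_left_continuous_filtration M F \<longleftrightarrow>
     (\<forall>\<tau>. predictable_time M F \<tau> \<longrightarrow>
        sets (filtration.pre_sigma (space M) F \<tau>) = sets (strict_past M F \<tau>))"


section \<open>Random measures\<close>

text \<open>Lusin measurable spaces in the sense of Dellacherie and Meyer: isomorphic to a Borel subset
  of a compact metrizable space. Every such space embeds into the Hilbert cube.\<close>

definition lusin_space :: "'u measure \<Rightarrow> bool" where
  "lusin_space U \<longleftrightarrow>
     (\<exists>(H :: (nat \<Rightarrow> real) set) f g.
        H \<in> sets borel \<and> (\<forall>x\<in>H. \<forall>i. 0 \<le> x i \<and> x i \<le> 1) \<and>
        f \<in> U \<rightarrow>\<^sub>M restrict_space borel H \<and> g \<in> restrict_space borel H \<rightarrow>\<^sub>M U \<and>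
        (\<forall>x\<in>space U. g (f x) = x) \<and> (\<forall>y\<in>H. f (g y) = y))"

text \<open>\<open>\<mu> = \<Sum>\<^sub>n \<epsilon>\<^bsub>(S\<^sub>n, X\<^sub>n)\<^esub>\<close>, where the points with \<open>S n \<omega> = \<infinity>\<close> are absent.\<close>

definition multivariate_point_process ::
  "'w measure \<Rightarrow> 'u measure \<Rightarrow> ('w \<Rightarrow> (real \<times> 'u) measure) \<Rightarrow> bool" where
  "multivariate_point_process M U \<mu> \<longleftrightarrow>
     (\<exists>(S :: nat \<Rightarrow> 'w \<Rightarrow> ereal) X.
        (\<forall>n. S n \<in> borel_measurable M \<and> X n \<in> M \<rightarrow>\<^sub>M U) \<and>
        (\<forall>\<omega>\<in>space M. (\<forall>n. 0 \<le> S n \<omega>) \<and>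
           (\<forall>m n. m \<noteq> n \<longrightarrow> S m \<omega> \<noteq> \<infinity> \<longrightarrow> S m \<omega> \<noteq> S n \<omega>) \<and>
           \<mu> \<omega> = distr (count_space {n. S n \<omega> \<noteq> \<infinity>}) (borel \<Otimes>\<^sub>M U)
                    (\<lambda>n. (real_of_ereal (S n \<omega>), X n \<omega>))))"

definition discrete_random_measure ::
  "'w measure \<Rightarrow> 'u measure \<Rightarrow> ('w \<Rightarrow> (real \<times> 'u) measure) \<Rightarrow> bool" where
  "discrete_random_measure M U \<mu> \<longleftrightarrow>
     (\<forall>\<omega>\<in>space M. \<forall>t. finite {s \<in> {0..t}. emeasure (\<mu> \<omega>) ({s} \<times> space U) = 1})"

text \<open>The random measure \<open>\<mu>\<close> is optional if \<open>W * \<mu>\<close> is an optional process for each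
  nonnegative optional function \<open>W\<close>.\<close>

definition optional_random_measure ::
  "'w measure \<Rightarrow> (real \<Rightarrow> 'w measure) \<Rightarrow> 'u measure \<Rightarrow> ('w \<Rightarrow> (real \<times> 'u) measure) \<Rightarrow> bool" where
  "optional_random_measure M F U \<mu> \<longleftrightarrow>
     (\<forall>W :: ('w \<times> real) \<times> 'u \<Rightarrow> ennreal.
        W \<in> borel_measurable (optional_sigma (space M) F {0..} \<Otimes>\<^sub>M U) \<longrightarrow>
        (\<lambda>(\<omega>, t). \<integral>\<^sup>+(s, x)\<in>{0..t} \<times> space U. W ((\<omega>, s), x) \<partial>\<mu> \<omega>)
          \<in> borel_measurable (optional_sigma (space M) F {0..}))"

definition natural_filtration ::
  "'w measure \<Rightarrow> 'u measure \<Rightarrow> ('w \<Rightarrow> (real \<times> 'u) measure) \<Rightarrow> (real \<Rightarrow> 'w measure) \<Rightarrow> bool" where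
  "natural_filtration M U \<mu> F \<longleftrightarrow>
     (\<exists>G. right_continuous_filtration M G \<and> optional_random_measure M G U \<mu> \<and>
        (\<forall>G'. right_continuous_filtration M G' \<and> optional_random_measure M G' U \<mu> \<longrightarrow>
           (\<forall>t\<ge>0. sets (G t) \<subseteq> sets (G' t))) \<and>
        (\<forall>t\<ge>0. sets (F t) = sigma_sets (space M) (sets (G t) \<union> null_sets M)))"

definition predictable_function ::
  "'w measure \<Rightarrow> (real \<Rightarrow> 'w measure) \<Rightarrow> real \<Rightarrow> 'u measure \<Rightarrow> ('w \<Rightarrow> real \<Rightarrow> 'u \<Rightarrow> real) \<Rightarrow> bool" where
  "predictable_function M F T U Z \<longleftrightarrow>
     (\<lambda>((\<omega>, t), x). Z \<omega> t x) \<in> borel_measurable (predictable_sigma (space M) F {0..T} \<Otimes>\<^sub>M U)"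

text \<open>The random measure \<open>\<nu>\<close> is predictable and has the same Doleans measure as \<open>\<mu>\<close> on the
  predictable \<open>\<sigma>\<close>-algebra over \<open>[0,T] \<times> \<U>\<close>.\<close>

definition predictable_compensator ::
  "'w measure \<Rightarrow> (real \<Rightarrow> 'w measure) \<Rightarrow> real \<Rightarrow> 'u measure \<Rightarrow>
   ('w \<Rightarrow> (real \<times> 'u) measure) \<Rightarrow> ('w \<Rightarrow> (real \<times> 'u) measure) \<Rightarrow> bool" where
  "predictable_compensator M F T U \<mu> \<nu> \<longleftrightarrow>
     (\<forall>W :: ('w \<times> real) \<times> 'u \<Rightarrow> ennreal.
        W \<in> borel_measurable (predictable_sigma (space M) F {0..T} \<Otimes>\<^sub>M U) \<longrightarrow>
        (\<lambda>(\<omega>, t). \<integral>\<^sup>+(s, x)\<in>{0..t} \<times> space U. W ((\<omega>, s), x) \<partial>\<nu> \<omega>)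
          \<in> borel_measurable (predictable_sigma (space M) F {0..T}) \<and>
        (\<integral>\<^sup>+\<omega>. (\<integral>\<^sup>+(s, x)\<in>{0..T} \<times> space U. W ((\<omega>, s), x) \<partial>\<mu> \<omega>) \<partial>M) =
        (\<integral>\<^sup>+\<omega>. (\<integral>\<^sup>+(s, x)\<in>{0..T} \<times> space U. W ((\<omega>, s), x) \<partial>\<nu> \<omega>) \<partial>M))"

text \<open>The left limit of the path \<open>x\<close> on \<open>[0,T]\<close>, with \<open>x\<^bsub>0-\<^esub> = a\<close>.\<close>

definition left_lim :: "real \<Rightarrow> (real \<Rightarrow> real) \<Rightarrow> real \<Rightarrow> real" where
  "left_lim a x t = (if t \<le> 0 then a else Lim (at_left t) x)"

text \<open>The Lebesgue-Stieltjes measure on \<open>(0,T]\<close> of a nondecreasing right-continuous path on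
  \<open>[0,T]\<close>, extended as a constant to the left of \<open>0\<close> and to the right of \<open>T\<close>.\<close>

definition stieltjes :: "real \<Rightarrow> (real \<Rightarrow> real) \<Rightarrow> real measure" where
  "stieltjes T a = interval_measure (\<lambda>t. a (max 0 (min t T)))"

definition compensator_disintegration ::
  "'w measure \<Rightarrow> (real \<Rightarrow> 'w measure) \<Rightarrow> real \<Rightarrow> 'u measure \<Rightarrow> ('w \<Rightarrow> (real \<times> 'u) measure) \<Rightarrow>
   ('w \<Rightarrow> real \<Rightarrow> real) \<Rightarrow> ('w \<Rightarrow> real \<Rightarrow> 'u measure) \<Rightarrow> bool" where
  "compensator_disintegration M F T U \<nu> K \<phi> \<longleftrightarrow>
     (\<lambda>(\<omega>, t). K \<omega> t) \<in> borel_measurable (predictable_sigma (space M) F {0..T}) \<and>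
     (\<forall>\<omega>\<in>space M. K \<omega> 0 = 0 \<and> mono_on {0..T} (K \<omega>) \<and>
        (\<forall>t\<in>{0..<T}. (K \<omega> \<longlongrightarrow> K \<omega> t) (at_right t)) \<and>
        (\<forall>t\<in>{0..T}. K \<omega> t - left_lim 0 (K \<omega>) t \<le> 1)) \<and>
     (\<lambda>(\<omega>, t). \<phi> \<omega> t) \<in> predictable_sigma (space M) F {0..T} \<rightarrow>\<^sub>M prob_algebra U \<and>
     (\<forall>\<omega>\<in>space M. sets (\<nu> \<omega>) = sets (borel \<Otimes>\<^sub>M U) \<and>
        (\<forall>B\<in>sets (borel \<Otimes>\<^sub>M U).
           emeasure (\<nu> \<omega>) B = (\<integral>\<^sup>+t\<in>{0..T}. emeasure (\<phi> \<omega> t) (Pair t -` B) \<partial>stieltjes T (K \<omega>))))"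

text \<open>The compensated integral over \<open>(a,b] \<times> \<U>\<close>. For a discrete multivariate point process and
  \<open>Z\<close> in the space \<open>\<H>\<^bsup>2,0\<^esup>\<close> below, both integrals exist almost surely, so that the integral
  with respect to \<open>\<mu> - \<nu>\<close> is a difference of pathwise integrals.\<close>

definition compensated_integral ::
  "'u measure \<Rightarrow> ('w \<Rightarrow> (real \<times> 'u) measure) \<Rightarrow> ('w \<Rightarrow> (real \<times> 'u) measure) \<Rightarrow>
   ('w \<Rightarrow> real \<Rightarrow> 'u \<Rightarrow> real) \<Rightarrow> 'w \<Rightarrow> real \<Rightarrow> real \<Rightarrow> real" where
  "compensated_integral U \<mu> \<nu> Z \<omega> a b =
     (LINT p : {a<..b} \<times> space U | \<mu> \<omega>. Z \<omega> (fst p) (snd p)) -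
     (LINT p : {a<..b} \<times> space U | \<nu> \<omega>. Z \<omega> (fst p) (snd p))"


section \<open>Essential suprema and spaces of processes\<close>

definition is_ess_sup ::
  "'w measure \<Rightarrow> ('w \<Rightarrow> 'b::{second_countable_topology, linorder_topology, complete_linorder}) set \<Rightarrow>
   ('w \<Rightarrow> 'b) \<Rightarrow> bool" where
  "is_ess_sup M \<X> V \<longleftrightarrow>
     V \<in> borel_measurable M \<and> (\<forall>X\<in>\<X>. AE \<omega> in M. X \<omega> \<le> V \<omega>) \<and>
     (\<forall>W\<in>borel_measurable M. (\<forall>X\<in>\<X>. AE \<omega> in M. X \<omega> \<le> W \<omega>) \<longrightarrow> (AE \<omega> in M. V \<omega> \<le> W \<omega>))"

text \<open>A version of the essential supremum, which is unique up to null sets.\<close>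

definition ess_sup ::
  "'w measure \<Rightarrow> ('w \<Rightarrow> 'b::{second_countable_topology, linorder_topology, complete_linorder}) set \<Rightarrow>
   'w \<Rightarrow> 'b" where
  "ess_sup M \<X> = (SOME V. is_ess_sup M \<X> V)"

definition optional_process ::
  "'w measure \<Rightarrow> (real \<Rightarrow> 'w measure) \<Rightarrow> real \<Rightarrow> ('w \<Rightarrow> real \<Rightarrow> real) \<Rightarrow> bool" where
  "optional_process M F T Y \<longleftrightarrow>
     (\<lambda>(\<omega>, t). Y \<omega> t) \<in> borel_measurable (optional_sigma (space M) F {0..T})"

definition predictable_process ::
  "'w measure \<Rightarrow> (real \<Rightarrow> 'w measure) \<Rightarrow> real \<Rightarrow> ('w \<Rightarrow> real \<Rightarrow> real) \<Rightarrow> bool" where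
  "predictable_process M F T Y \<longleftrightarrow>
     (\<lambda>(\<omega>, t). Y \<omega> t) \<in> borel_measurable (predictable_sigma (space M) F {0..T})"

definition S20 :: "'w measure \<Rightarrow> (real \<Rightarrow> 'w measure) \<Rightarrow> real \<Rightarrow> ('w \<Rightarrow> real \<Rightarrow> real) set" where
  "S20 M F T = {Y. optional_process M F T Y \<and>
     (\<integral>\<^sup>+\<omega>. ess_sup M {\<lambda>\<omega>. ennreal (\<bar>Y \<omega> (\<tau> \<omega>)\<bar>\<^sup>2) |\<tau>. \<tau> \<in> stopping_times M F T (\<lambda>_. 0)} \<omega> \<partial>M) < \<infinity>}"

definition Zbar ::
  "'u measure \<Rightarrow> ('w \<Rightarrow> (real \<times> 'u) measure) \<Rightarrow> ('w \<Rightarrow> real \<Rightarrow> 'u \<Rightarrow> real) \<Rightarrow> 'w \<Rightarrow> real \<Rightarrow> real" where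
  "Zbar U \<nu> Z \<omega> t = (LINT p : {t} \<times> space U | \<nu> \<omega>. Z \<omega> t (snd p))"

definition H20 ::
  "'w measure \<Rightarrow> (real \<Rightarrow> 'w measure) \<Rightarrow> real \<Rightarrow> 'u measure \<Rightarrow> ('w \<Rightarrow> (real \<times> 'u) measure) \<Rightarrow>
   ('w \<Rightarrow> real \<Rightarrow> real) \<Rightarrow> ('w \<Rightarrow> real \<Rightarrow> 'u \<Rightarrow> real) set" where
  "H20 M F T U \<nu> K = {Z. predictable_function M F T U Z \<and>
     (\<integral>\<^sup>+\<omega>. (\<integral>\<^sup>+(t, x)\<in>{0..T} \<times> space U. ennreal (\<bar>Z \<omega> t x - Zbar U \<nu> Z \<omega> t\<bar>\<^sup>2) \<partial>\<nu> \<omega>) +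
        (\<Sum>\<^sub>\<infinity>t\<in>{0<..T}. ennreal (\<bar>Zbar U \<nu> Z \<omega> t\<bar>\<^sup>2 * (1 - (K \<omega> t - left_lim 0 (K \<omega>) t)))) \<partial>M) < \<infinity>}"


section \<open>Drivers\<close>

definition predictable_driver ::
  "'w measure \<Rightarrow> (real \<Rightarrow> 'w measure) \<Rightarrow> real \<Rightarrow> 'u measure \<Rightarrow>
   ('w \<Rightarrow> real \<Rightarrow> real \<Rightarrow> ('u \<Rightarrow> real) \<Rightarrow> real) \<Rightarrow> bool" where
  "predictable_driver M F T U f \<longleftrightarrow>
     (\<forall>Z. predictable_function M F T U Z \<longrightarrow>
        (\<forall>y. (\<lambda>(\<omega>, t). f \<omega> t y (Z \<omega> t)) \<in> borel_measurable (predictable_sigma (space M) F {0..T})) \<and>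
        (\<lambda>((\<omega>, t), y). f \<omega> t y (Z \<omega> t))
           \<in> borel_measurable (predictable_sigma (space M) F {0..T} \<Otimes>\<^sub>M borel)) \<and>
     (\<integral>\<^sup>+\<omega>. (\<integral>\<^sup>+t\<in>{0..T}. ennreal (\<bar>f \<omega> t 0 (\<lambda>_. 0)\<bar>\<^sup>2) \<partial>lborel) \<partial>M) < \<infinity>"

definition square_integrable :: "'u measure \<Rightarrow> 'u measure \<Rightarrow> ('u \<Rightarrow> real) set" where
  "square_integrable U p = {z \<in> borel_measurable U. (\<integral>\<^sup>+x. ennreal (\<bar>z x\<bar>\<^sup>2) \<partial>p) < \<infinity>}"

definition lipschitz_driver ::
  "'w measure \<Rightarrow> real \<Rightarrow> 'u measure \<Rightarrow> ('w \<Rightarrow> real \<Rightarrow> real) \<Rightarrow> ('w \<Rightarrow> real \<Rightarrow> 'u measure) \<Rightarrow>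
   ('w \<Rightarrow> real \<Rightarrow> real \<Rightarrow> ('u \<Rightarrow> real) \<Rightarrow> real) \<Rightarrow> bool" where
  "lipschitz_driver M T U K \<phi> f \<longleftrightarrow>
     (\<exists>L\<ge>0. AE (\<omega>, t) in M \<Otimes>\<^sub>M restrict_space lborel {0..T}.
        \<forall>y y'. \<forall>z\<in>square_integrable U (\<phi> \<omega> t). \<forall>z'\<in>square_integrable U (\<phi> \<omega> t).
          \<bar>f \<omega> t y z - f \<omega> t y' z'\<bar> \<le>
            L * (\<bar>y - y'\<bar> +
              sqrt ((\<integral>x. \<bar>z x - z' x - (\<integral>u. z u - z' u \<partial>\<phi> \<omega> t)\<bar>\<^sup>2 \<partial>\<phi> \<omega> t) +
                    (1 - (K \<omega> t - left_lim 0 (K \<omega>) t)) * \<bar>\<integral>x. z x - z' x \<partial>\<phi> \<omega> t\<bar>\<^sup>2)))"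


section \<open>Obstacles and solutions of the reflected BSDE\<close>

definition left_limited :: "'w measure \<Rightarrow> real \<Rightarrow> ('w \<Rightarrow> real \<Rightarrow> real) \<Rightarrow> bool" where
  "left_limited M T \<xi> \<longleftrightarrow> (AE \<omega> in M. \<forall>t\<in>{0<..T}. \<exists>l. (\<xi> \<omega> \<longlongrightarrow> l) (at_left t))"

definition right_usc :: "'w measure \<Rightarrow> real \<Rightarrow> ('w \<Rightarrow> real \<Rightarrow> real) \<Rightarrow> bool" where
  "right_usc M T \<xi> \<longleftrightarrow>
     (AE \<omega> in M. \<forall>t\<in>{0..<T}. Limsup (at_right t) (\<lambda>s. ereal (\<xi> \<omega> s)) \<le> ereal (\<xi> \<omega> t))"

definition left_usc :: "'w measure \<Rightarrow> real \<Rightarrow> ('w \<Rightarrow> real \<Rightarrow> real) \<Rightarrow> bool" where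
  "left_usc M T \<xi> \<longleftrightarrow>
     (AE \<omega> in M. \<forall>t\<in>{0<..T}. Limsup (at_left t) (\<lambda>s. ereal (\<xi> \<omega> s)) \<le> ereal (\<xi> \<omega> t))"

definition nondecreasing_right_continuous :: "'w measure \<Rightarrow> real \<Rightarrow> ('w \<Rightarrow> real \<Rightarrow> real) \<Rightarrow> bool" where
  "nondecreasing_right_continuous M T A \<longleftrightarrow>
     (AE \<omega> in M. mono_on {0..T} (A \<omega>) \<and> (\<forall>t\<in>{0..<T}. (A \<omega> \<longlongrightarrow> A \<omega> t) (at_right t)))"

text \<open>The discontinuous and continuous parts of a nondecreasing right-continuous path \<open>x\<close>
  with \<open>x\<^bsub>0-\<^esub> = 0\<close>.\<close>

definition disc_part :: "(real \<Rightarrow> real) \<Rightarrow> real \<Rightarrow> real" where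
  "disc_part x t = (\<Sum>\<^sub>\<infinity>s\<in>{0..t}. x s - left_lim 0 x s)"

definition cont_part :: "(real \<Rightarrow> real) \<Rightarrow> real \<Rightarrow> real" where
  "cont_part x t = x t - disc_part x t"

text \<open>The integrability of the driver along the solution is part of the meaning of the equation;
  it is made explicit because \<open>set_lebesgue_integral\<close> of a nonintegrable function is \<open>0\<close>.
  The left limits at time \<open>0\<close> are \<open>Y\<^bsub>0-\<^esub> = Y\<^sub>0\<close>, \<open>\<xi>\<^bsub>0-\<^esub> = \<xi>\<^sub>0\<close>, and
  \<open>A\<^bsub>0-\<^esub> = C\<^bsub>0-\<^esub> = 0\<close>, so that \<open>C\<close> may jump at time \<open>0\<close>.\<close>

definition rbsde_solution ::
  "'w measure \<Rightarrow> (real \<Rightarrow> 'w measure) \<Rightarrow> real \<Rightarrow> 'u measure \<Rightarrow>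
   ('w \<Rightarrow> (real \<times> 'u) measure) \<Rightarrow> ('w \<Rightarrow> (real \<times> 'u) measure) \<Rightarrow> ('w \<Rightarrow> real \<Rightarrow> real) \<Rightarrow>
   ('w \<Rightarrow> real \<Rightarrow> real \<Rightarrow> ('u \<Rightarrow> real) \<Rightarrow> real) \<Rightarrow> ('w \<Rightarrow> real \<Rightarrow> real) \<Rightarrow>
   ('w \<Rightarrow> real \<Rightarrow> real) \<Rightarrow> ('w \<Rightarrow> real \<Rightarrow> 'u \<Rightarrow> real) \<Rightarrow>
   ('w \<Rightarrow> real \<Rightarrow> real) \<Rightarrow> ('w \<Rightarrow> real \<Rightarrow> real) \<Rightarrow> bool" where
  "rbsde_solution M F T U \<mu> \<nu> K f \<xi> Y Z A C \<longleftrightarrow>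
     Y \<in> S20 M F T \<and> Z \<in> H20 M F T U \<nu> K \<and> A \<in> S20 M F T \<and> C \<in> S20 M F T \<and>
     (AE \<omega> in M. set_integrable lborel {0..T} (\<lambda>s. f \<omega> s (Y \<omega> s) (Z \<omega> s))) \<and>
     (\<forall>\<tau>\<in>stopping_times M F T (\<lambda>_. 0). AE \<omega> in M.
        Y \<omega> (\<tau> \<omega>) = \<xi> \<omega> T + (LINT s : {\<tau> \<omega>..T} | lborel. f \<omega> s (Y \<omega> s) (Z \<omega> s))
          - compensated_integral U \<mu> \<nu> Z \<omega> (\<tau> \<omega>) T
          + A \<omega> T - A \<omega> (\<tau> \<omega>) + left_lim 0 (C \<omega>) T - left_lim 0 (C \<omega>) (\<tau> \<omega>)) \<and>
     (AE \<omega> in M. \<forall>t\<in>{0..T}. \<xi> \<omega> t \<le> Y \<omega> t) \<and>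
     nondecreasing_right_continuous M T A \<and> predictable_process M F T A \<and>
     (AE \<omega> in M. A \<omega> 0 = 0) \<and> (\<integral>\<^sup>+\<omega>. ennreal (A \<omega> T) \<partial>M) < \<infinity> \<and>
     (AE \<omega> in M. (\<integral>\<^sup>+t. indicator {t \<in> {0..T}. Y \<omega> t > \<xi> \<omega> t} t \<partial>stieltjes T (cont_part (A \<omega>))) = 0) \<and>
     (\<forall>\<tau>\<in>predictable_stopping_times M F T. AE \<omega> in M.
        (left_lim (Y \<omega> 0) (Y \<omega>) (\<tau> \<omega>) - left_lim (\<xi> \<omega> 0) (\<xi> \<omega>) (\<tau> \<omega>)) *
        (disc_part (A \<omega>) (\<tau> \<omega>) - left_lim 0 (disc_part (A \<omega>)) (\<tau> \<omega>)) = 0) \<and>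
     nondecreasing_right_continuous M T C \<and>
     (\<forall>t\<in>{0..T}. (\<lambda>\<omega>. C \<omega> t) \<in> borel_measurable (F t)) \<and>
     (AE \<omega> in M. 0 \<le> C \<omega> 0 \<and> (\<forall>t\<in>{0..T}. C \<omega> t = disc_part (C \<omega>) t)) \<and>
     (\<integral>\<^sup>+\<omega>. ennreal (C \<omega> T) \<partial>M) < \<infinity> \<and>
     (\<forall>\<tau>\<in>stopping_times M F T (\<lambda>_. 0). AE \<omega> in M.
        (Y \<omega> (\<tau> \<omega>) - \<xi> \<omega> (\<tau> \<omega>)) * (C \<omega> (\<tau> \<omega>) - left_lim 0 (C \<omega>) (\<tau> \<omega>)) = 0)"


section \<open>The optimal stopping problem\<close>

definition reward ::
  "'w measure \<Rightarrow> (real \<Rightarrow> 'w measure) \<Rightarrow> ('w \<Rightarrow> real \<Rightarrow> real \<Rightarrow> ('u \<Rightarrow> real) \<Rightarrow> real) \<Rightarrow>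
   ('w \<Rightarrow> real \<Rightarrow> real) \<Rightarrow> ('w \<Rightarrow> real \<Rightarrow> real) \<Rightarrow> ('w \<Rightarrow> real \<Rightarrow> 'u \<Rightarrow> real) \<Rightarrow>
   ('w \<Rightarrow> real) \<Rightarrow> ('w \<Rightarrow> real) \<Rightarrow> 'w \<Rightarrow> real" where
  "reward M F f \<xi> Y Z S \<tau> =
     real_cond_exp M (filtration.pre_sigma (space M) F S)
       (\<lambda>\<omega>. \<xi> \<omega> (\<tau> \<omega>) + (LINT t : {S \<omega>..\<tau> \<omega>} | lborel. f \<omega> t (Y \<omega> t) (Z \<omega> t)))"

definition value_at ::
  "'w measure \<Rightarrow> (real \<Rightarrow> 'w measure) \<Rightarrow> real \<Rightarrow> ('w \<Rightarrow> real \<Rightarrow> real \<Rightarrow> ('u \<Rightarrow> real) \<Rightarrow> real) \<Rightarrow>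
   ('w \<Rightarrow> real \<Rightarrow> real) \<Rightarrow> ('w \<Rightarrow> real \<Rightarrow> real) \<Rightarrow> ('w \<Rightarrow> real \<Rightarrow> 'u \<Rightarrow> real) \<Rightarrow>
   ('w \<Rightarrow> real) \<Rightarrow> 'w \<Rightarrow> ereal" where
  "value_at M F T f \<xi> Y Z S =
     ess_sup M {\<lambda>\<omega>. ereal (reward M F f \<xi> Y Z S \<tau> \<omega>) |\<tau>. \<tau> \<in> stopping_times M F T S}"

definition optimal_stopping_time ::
  "'w measure \<Rightarrow> (real \<Rightarrow> 'w measure) \<Rightarrow> real \<Rightarrow> ('w \<Rightarrow> real \<Rightarrow> real \<Rightarrow> ('u \<Rightarrow> real) \<Rightarrow> real) \<Rightarrow>
   ('w \<Rightarrow> real \<Rightarrow> real) \<Rightarrow> ('w \<Rightarrow> real \<Rightarrow> real) \<Rightarrow> ('w \<Rightarrow> real \<Rightarrow> 'u \<Rightarrow> real) \<Rightarrow>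
   ('w \<Rightarrow> real) \<Rightarrow> ('w \<Rightarrow> real) \<Rightarrow> bool" where
  "optimal_stopping_time M F T f \<xi> Y Z S \<tau> \<longleftrightarrow>
     \<tau> \<in> stopping_times M F T S \<and>
     (AE \<omega> in M. value_at M F T f \<xi> Y Z S \<omega> = ereal (reward M F f \<xi> Y Z S \<tau> \<omega>))"

text \<open>The infima are taken in \<open>ereal\<close>, with value \<open>\<infinity>\<close> for the empty set. For \<open>\<tau>\<^sub>S\<^sup>\<epsilon>\<close> the set
  is almost surely nonempty, since \<open>Y\<^sub>T = \<xi>\<^sub>T\<close>.\<close>

definition tau_eps ::
  "real \<Rightarrow> ('w \<Rightarrow> real \<Rightarrow> real) \<Rightarrow> ('w \<Rightarrow> real \<Rightarrow> real) \<Rightarrow> real \<Rightarrow> ('w \<Rightarrow> real) \<Rightarrow> 'w \<Rightarrow> real" where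
  "tau_eps T \<xi> Y \<epsilon> S \<omega> = real_of_ereal (INF t\<in>{t. S \<omega> \<le> t \<and> t \<le> T \<and> Y \<omega> t \<le> \<xi> \<omega> t + \<epsilon>}. ereal t)"

definition tau_star ::
  "real \<Rightarrow> ('w \<Rightarrow> real \<Rightarrow> real) \<Rightarrow> ('w \<Rightarrow> real \<Rightarrow> real) \<Rightarrow> ('w \<Rightarrow> real) \<Rightarrow> 'w \<Rightarrow> real" where
  "tau_star T \<xi> Y S \<omega> =
     real_of_ereal (min (INF t\<in>{t. S \<omega> \<le> t \<and> t \<le> T \<and> Y \<omega> t = \<xi> \<omega> t}. ereal t) (ereal T))"

end

theory Submission
  imports Defs
begin

text \<open>
  For stopping times \<open>S \<le> \<tau>\<close> the equation expresses the payoff of \<open>\<tau>\<close> as \<open>Y\<^sub>S\<close> plus an increment of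
  the compensated integral minus the gap \<open>(Y\<^sub>\<tau> - \<xi>\<^sub>\<tau>) + (A\<^sub>\<tau> - A\<^sub>S) + (C\<^bsub>\<tau>-\<^esub> - C\<^bsub>S-\<^esub>)\<close>. The increment
  has conditional mean zero, so every \<open>\<tau>\<close> earns at most \<open>Y\<^sub>S\<close>, with equality iff its gap vanishes. Up
  to the first time with \<open>Y \<le> \<xi> + \<epsilon>\<close> the Skorokhod conditions keep \<open>A\<close> and \<open>C\<^sub>-\<close> constant, and right
  upper semicontinuity makes the infimum attained, so the gap there is at most \<open>\<epsilon>\<close>. If \<open>\<xi>\<close> is left
  upper semicontinuous, \<open>A\<close> has no jumps and \<open>\<epsilon> = 0\<close> is allowed.

  The conditions at stopping times are turned into statements about all times by the optional section
  theorem and, for the jumps of \<open>A\<close>, by a predictable section theorem for sets with finite sections. The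
  mean zero property follows from an isometry for truncated integrands.
\<close>

section \<open>Measurable projection\<close>

text \<open>The equation and the Skorokhod conditions are given for one stopping time at a time,
  each with its own null set, while a first contact time looks at whole paths. \<open>Y\<close> need
  not be right-continuous: it is a right-continuous process minus the left limits of
  \<open>C\<close>, so agreement at rational times would not suffice and section theorems are used.
  For the jumps of \<open>A\<close> a full predictable section theorem is avoided: on each path only
  finitely many jumps exceed a given d > 0, so the first of them is attained. The norm of the
  integrands weights the mean at an atom of mass m by 1 - m, which degenerates as m approaches 1.
  Atoms heavier than 1/2 are finitely many on each path, and elsewhere the weight is at least 1/2;
  this gives pathwise integrability. Mean zero comes from localising: integrands are restricted to
  the predictable set where the jump measure and its compensator together have mass at most n
  strictly before the current time. All integrals are then bounded by constants, because a single
  time carries mass at most 1 for each measure.\<close>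

definition souslin :: "'a set set \<Rightarrow> 'a set \<Rightarrow> bool" where
  "souslin \<L> E \<longleftrightarrow> (\<exists>L. (\<forall>n \<sigma>. L n \<sigma> \<in> \<L>) \<and>
     (\<forall>n \<sigma> \<sigma>'. (\<forall>i\<le>n. \<sigma> i = \<sigma>' i) \<longrightarrow> L n \<sigma> = L n \<sigma>') \<and>
     E = (\<Union>\<sigma>::nat \<Rightarrow> nat. \<Inter>n. L n \<sigma>))"

lemma souslin_base: "E \<in> \<L> \<Longrightarrow> souslin \<L> E"
  unfolding souslin_def by (rule exI[of _ "\<lambda>_ _. E"]) auto

text \<open>Entry 0 of a branch encodes two numbers: which set of the union is meant, and entry 0 of
  that set's own branch. Every stage sees entry 0, so the dependence on initial segments
  survives.\<close>

lemma souslin_UN: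
  assumes "\<And>i::nat. souslin \<L> (E i)"
  shows "souslin \<L> (\<Union>i. E i)"
proof -
  obtain L where L: "\<And>i n \<sigma>. L i n \<sigma> \<in> \<L>"
    "\<And>i n \<sigma> \<sigma>'. (\<forall>j\<le>n. \<sigma> j = \<sigma>' j) \<Longrightarrow> L i n \<sigma> = L i n \<sigma>'"
    "\<And>i. E i = (\<Union>\<sigma>::nat \<Rightarrow> nat. \<Inter>n. L i n \<sigma>)"
    using assms unfolding souslin_def by metis
  define D where "D \<sigma> = (\<lambda>j. if j = 0 then snd (prod_decode (\<sigma> 0)) else \<sigma> j)" for \<sigma> :: "nat \<Rightarrow> nat"
  define L' where "L' n \<sigma> = L (fst (prod_decode (\<sigma> 0))) n (D \<sigma>)" for n \<sigma>
  have dep: "L' n \<sigma> = L' n \<sigma>'" if "\<forall>i\<le>n. \<sigma> i = \<sigma>' i" for n \<sigma> \<sigma>'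
  proof -
    have "\<sigma> 0 = \<sigma>' 0" using that by auto
    moreover have "L i n (D \<sigma>) = L i n (D \<sigma>')" for i
      using that by (intro L(2)) (auto simp: D_def)
    ultimately show ?thesis unfolding L'_def by simp
  qed
  have "(\<Union>i. E i) = (\<Union>\<sigma>. \<Inter>n. L' n \<sigma>)"
  proof (intro equalityI subsetI)
    fix x assume "x \<in> (\<Union>i. E i)"
    then obtain i \<sigma> where x: "\<And>n. x \<in> L i n \<sigma>" using L(3) by auto
    define \<sigma>' where "\<sigma>' = (\<lambda>j. if j = 0 then prod_encode (i, \<sigma> 0) else \<sigma> j)"
    have "D \<sigma>' = \<sigma>" "fst (prod_decode (\<sigma>' 0)) = i" by (auto simp: D_def \<sigma>'_def)
    then show "x \<in> (\<Union>\<sigma>. \<Inter>n. L' n \<sigma>)" using x by (auto simp: L'_def intro!: exI[of _ \<sigma>'])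
  next
    fix x assume "x \<in> (\<Union>\<sigma>. \<Inter>n. L' n \<sigma>)"
    then show "x \<in> (\<Union>i. E i)" unfolding L(3) L'_def by blast
  qed
  then show ?thesis unfolding souslin_def
  proof (intro exI[of _ L'] conjI allI impI)
    show "L' n \<sigma> \<in> \<L>" for n \<sigma> unfolding L'_def by (rule L(1))
    show "L' n \<sigma> = L' n \<sigma>'" if "\<forall>i\<le>n. \<sigma> i = \<sigma>' i" for n \<sigma> \<sigma>' by (rule dep[OF that])
  qed
qed

text \<open>A single branch interleaves one branch for each set through \<open>prod_encode\<close>;
  stage \<open>n\<close> of the new scheme is one stage of one of the old schemes.\<close>

lemma souslin_INT:
  assumes "\<And>i::nat. souslin \<L> (E i)"
  shows "souslin \<L> (\<Inter>i. E i)"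
proof -
  obtain L where L: "\<And>i n \<sigma>. L i n \<sigma> \<in> \<L>"
    "\<And>i n \<sigma> \<sigma>'. (\<forall>j\<le>n. \<sigma> j = \<sigma>' j) \<Longrightarrow> L i n \<sigma> = L i n \<sigma>'"
    "\<And>i. E i = (\<Union>\<sigma>::nat \<Rightarrow> nat. \<Inter>n. L i n \<sigma>)"
    using assms unfolding souslin_def by metis
  define D where "D i \<sigma> = (\<lambda>j. \<sigma> (prod_encode (i, j)))" for i and \<sigma> :: "nat \<Rightarrow> nat"
  define L' where "L' n \<sigma> = L (fst (prod_decode n)) (snd (prod_decode n)) (D (fst (prod_decode n)) \<sigma>)" for n \<sigma>
  \<comment> \<open>The stage coded by (i, j) reads the entries coded by (i, 0), ..., (i, j).
    Monotonicity of the pairing in its second argument puts these codes at or below the code of (i,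
    j), as the dependence condition demands.\<close>
  have mono: "prod_encode (i, j') \<le> prod_encode (i, j)" if "j' \<le> j" for i j j'
    using that unfolding prod_encode_def triangle_def
    by (auto intro!: div_le_mono add_mono mult_le_mono)
  have dep: "L' n \<sigma> = L' n \<sigma>'" if "\<forall>i\<le>n. \<sigma> i = \<sigma>' i" for n \<sigma> \<sigma>'
    unfolding L'_def
  proof (rule L(2), intro allI impI)
    fix j assume "j \<le> snd (prod_decode n)"
    from mono[OF this, of "fst (prod_decode n)"] have "prod_encode (fst (prod_decode n), j) \<le> n" by simp
    with that show "D (fst (prod_decode n)) \<sigma> j = D (fst (prod_decode n)) \<sigma>' j" by (auto simp: D_def)
  qed
  have "(\<Inter>i. E i) = (\<Union>\<sigma>. \<Inter>n. L' n \<sigma>)"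
  proof (intro equalityI subsetI)
    fix x assume "x \<in> (\<Inter>i. E i)"
    then have "\<forall>i. \<exists>\<sigma>. \<forall>n. x \<in> L i n \<sigma>" using L(3) by auto
    then obtain s where x: "\<And>i n. x \<in> L i n (s i)" by metis
    define \<sigma> where "\<sigma> = (\<lambda>n. s (fst (prod_decode n)) (snd (prod_decode n)))"
    have "D i \<sigma> = s i" for i by (auto simp: D_def \<sigma>_def)
    then show "x \<in> (\<Union>\<sigma>. \<Inter>n. L' n \<sigma>)" using x by (auto simp: L'_def intro!: exI[of _ \<sigma>])
  next
    fix x assume "x \<in> (\<Union>\<sigma>. \<Inter>n. L' n \<sigma>)"
    then obtain \<sigma> where x: "\<And>n. x \<in> L' n \<sigma>" by auto
    have "x \<in> L i n (D i \<sigma>)" for i n using x[of "prod_encode (i, n)"] by (auto simp: L'_def)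
    then show "x \<in> (\<Inter>i. E i)" unfolding L(3) by blast
  qed
  then show ?thesis unfolding souslin_def
  proof (intro exI[of _ L'] conjI allI impI)
    show "L' n \<sigma> \<in> \<L>" for n \<sigma> unfolding L'_def by (rule L(1))
    show "L' n \<sigma> = L' n \<sigma>'" if "\<forall>i\<le>n. \<sigma> i = \<sigma>' i" for n \<sigma> \<sigma>' by (rule dep[OF that])
  qed
qed

lemma souslin_Int:
  assumes "souslin \<L> A" "souslin \<L> B" shows "souslin \<L> (A \<inter> B)"
proof -
  have "A \<inter> B = (\<Inter>i::nat. if i = 0 then A else B)" by (auto split: if_splits)
  also have "souslin \<L> \<dots>" using assms by (intro souslin_INT) auto
  finally show ?thesis .
qed

lemma souslin_Un:
  assumes "souslin \<L> A" "souslin \<L> B" shows "souslin \<L> (A \<union> B)"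
proof -
  have "A \<union> B = (\<Union>i::nat. if i = 0 then A else B)" by (auto split: if_splits)
  also have "souslin \<L> \<dots>" using assms by (intro souslin_UN) auto
  finally show ?thesis .
qed

text \<open>The paving for the projection theorem. Three features matter: stability under finite
  unions and intersections, compact sections in time, and measurable projections to the first
  factor.\<close>

definition rect_unions :: "'w measure \<Rightarrow> ('w \<times> real) set set" where
  "rect_unions Q = {B. \<exists>J. finite J \<and> (\<forall>(A, a, b)\<in>J. A \<in> sets Q) \<and> B = (\<Union>(A, a, b)\<in>J. A \<times> {a..b})}"

lemma rect_unions_rect: "A \<in> sets Q \<Longrightarrow> A \<times> {a..b} \<in> rect_unions Q"
  unfolding rect_unions_def by (auto intro!: exI[of _ "{(A, a, b)}"])

lemma rect_unions_empty: "{} \<in> rect_unions Q"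
  using rect_unions_rect[of "{}" Q] by simp

lemma rect_unions_Un:
  assumes "B \<in> rect_unions Q" "B' \<in> rect_unions Q" shows "B \<union> B' \<in> rect_unions Q"
proof -
  from assms obtain J J' where "finite J" "\<forall>(A, a, b)\<in>J. A \<in> sets Q" "B = (\<Union>(A, a, b)\<in>J. A \<times> {a..b})"
    "finite J'" "\<forall>(A, a, b)\<in>J'. A \<in> sets Q" "B' = (\<Union>(A, a, b)\<in>J'. A \<times> {a..b})"
    unfolding rect_unions_def by auto
  then show ?thesis unfolding rect_unions_def by (intro CollectI exI[of _ "J \<union> J'"]) blast
qed

lemma rect_unions_Int:
  assumes "B \<in> rect_unions Q" "B' \<in> rect_unions Q" shows "B \<inter> B' \<in> rect_unions Q"
proof -
  from assms obtain J J' where J: "finite J" "\<forall>(A, a, b)\<in>J. A \<in> sets Q" "B = (\<Union>(A, a, b)\<in>J. A \<times> {a..b})"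
    "finite J'" "\<forall>(A, a, b)\<in>J'. A \<in> sets Q" "B' = (\<Union>(A, a, b)\<in>J'. A \<times> {a..b})"
    unfolding rect_unions_def by auto
  define g where "g = (\<lambda>((A :: 'a set, a :: real, b :: real), (A' :: 'a set, a' :: real, b' :: real)). (A \<inter> A', max a a', min b b'))"
  have "B \<inter> B' = (\<Union>(A, a, b)\<in>g ` (J \<times> J'). A \<times> {a..b})"
    unfolding J(3,6) g_def
    by (auto simp: split_beta)
  moreover have "\<forall>(A, a, b)\<in>g ` (J \<times> J'). A \<in> sets Q"
  proof
    fix p assume "p \<in> g ` (J \<times> J')"
    then obtain A a b A' a' b' where "p = (A \<inter> A', max a a', min b b')" "(A, a, b) \<in> J" "(A', a', b') \<in> J'"
      unfolding g_def by auto
    then show "case p of (A, a, b) \<Rightarrow> A \<in> sets Q" using J(2,5) by fastforce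
  qed
  moreover have "finite (g ` (J \<times> J'))" using J(1,4) by simp
  ultimately show ?thesis unfolding rect_unions_def
    by (intro CollectI exI[of _ "g ` (J \<times> J')"] conjI)
qed

lemma rect_unions_UN:
  "finite I \<Longrightarrow> (\<And>i. i \<in> I \<Longrightarrow> B i \<in> rect_unions Q) \<Longrightarrow> (\<Union>i\<in>I. B i) \<in> rect_unions Q"
  by (induction I rule: finite_induct) (auto intro: rect_unions_empty rect_unions_Un)

lemma rect_unions_INT:
  "(\<And>i. i \<le> n \<Longrightarrow> B i \<in> rect_unions Q) \<Longrightarrow> (\<Inter>i\<le>(n::nat). B i) \<in> rect_unions Q"
proof (induction n)
  case (Suc n)
  then have "(\<Inter>i\<le>n. B i) \<inter> B (Suc n) \<in> rect_unions Q" by (intro rect_unions_Int) auto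
  then show ?case by (simp add: atMost_Suc Int_commute)
qed auto

lemma sets_fst_rect_unions:
  assumes "B \<in> rect_unions Q" shows "fst ` B \<in> sets Q"
proof -
  from assms obtain J where J: "finite J" "\<forall>(A, a, b)\<in>J. A \<in> sets Q" "B = (\<Union>(A, a, b)\<in>J. A \<times> {a..b})"
    unfolding rect_unions_def by auto
  have "fst ` B = (\<Union>(A, a, b)\<in>J. if a \<le> b then A else {})"
    unfolding J(3) image_UN by (intro SUP_cong) (auto split: if_splits)
  then show ?thesis using J(1,2) by (auto intro!: sets.finite_UN split: prod.splits)
qed

lemma compact_section_rect_unions:
  assumes "B \<in> rect_unions Q" shows "compact {t. (w, t) \<in> B}"
proof -
  from assms obtain J where J: "finite J" "B = (\<Union>(A, a, b)\<in>J. A \<times> {a..b})"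
    unfolding rect_unions_def by auto
  have "{t. (w, t) \<in> B} = (\<Union>(A, a, b)\<in>J. if w \<in> A then {a..b} else {})"
    unfolding J(2) by (force split: if_splits)
  then show ?thesis using J(1) by (auto intro!: compact_UN split: prod.splits)
qed

text \<open>Projections do not commute with decreasing intersections in general; here the sections
  are nested nonempty compact sets, so they share a point.\<close>

lemma fst_INT_rect_unions:
  assumes "\<And>n. B n \<in> rect_unions Q" "decseq B"
  shows "fst ` (\<Inter>n. B n) = (\<Inter>n. fst ` B n)"
proof (intro equalityI subsetI)
  fix w assume u: "w \<in> (\<Inter>n. fst ` B n)"
  have "\<Inter> (range (\<lambda>n. {t. (w, t) \<in> B n})) \<noteq> {}"
  proof (rule compact_nest)
    fix n show "compact {t. (w, t) \<in> B n}" by (rule compact_section_rect_unions) fact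
    show "{t. (w, t) \<in> B n} \<noteq> {}" using u by force
  next
    fix m n :: nat assume "m \<le> n"
    then show "{t. (w, t) \<in> B n} \<subseteq> {t. (w, t) \<in> B m}" using decseqD[OF assms(2)] by blast
  qed
  then obtain t where "\<And>n. (w, t) \<in> B n" by auto
  then show "w \<in> fst ` (\<Inter>n. B n)" by force
qed auto

lemma finite_bounded_funs: "finite {\<sigma>::nat\<Rightarrow>nat. (\<forall>i\<le>n. \<sigma> i \<le> k i) \<and> (\<forall>i>n. \<sigma> i = 0)}" for n :: nat
proof -
  have "finite {\<sigma>::nat\<Rightarrow>nat. \<forall>i. (i \<in> {..n} \<longrightarrow> \<sigma> i \<in> {..Max (k ` {..n})}) \<and> (i \<notin> {..n} \<longrightarrow> \<sigma> i = 0)}"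
    by (rule finite_set_of_finite_funs) auto
  moreover have "{\<sigma>::nat\<Rightarrow>nat. (\<forall>i\<le>n. \<sigma> i \<le> k i) \<and> (\<forall>i>n. \<sigma> i = 0)} \<subseteq>
    {\<sigma>. \<forall>i. (i \<in> {..n} \<longrightarrow> \<sigma> i \<in> {..Max (k ` {..n})}) \<and> (i \<notin> {..n} \<longrightarrow> \<sigma> i = 0)}"
    by (auto intro: order.trans[OF _ Max_ge])
  ultimately show ?thesis by (rule rev_finite_subset)
qed

text \<open>K\<ouml>nig's lemma for trees in which the children of a node of depth \<open>i\<close> are numbered by
  \<open>0, \<dots>, k i\<close>.\<close>

lemma bounded_branch:
  fixes L :: "nat \<Rightarrow> (nat \<Rightarrow> nat) \<Rightarrow> 'a set"
  assumes dep: "\<And>n \<sigma> \<sigma>'. (\<forall>i\<le>n. \<sigma> i = \<sigma>' i) \<Longrightarrow> L n \<sigma> = L n \<sigma>'"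
    and x: "\<And>n. \<exists>\<sigma>. (\<forall>i\<le>n. \<sigma> i \<le> k i) \<and> (\<forall>j\<le>n. x \<in> L j \<sigma>)"
  shows "\<exists>\<sigma>. \<forall>n. x \<in> L n \<sigma>"
proof -
  define P where "P n \<sigma> \<longleftrightarrow> (\<forall>m. \<exists>\<sigma>'. (\<forall>i<n. \<sigma>' i = \<sigma> i) \<and> (\<forall>i\<le>m. \<sigma>' i \<le> k i) \<and> (\<forall>j\<le>m. x \<in> L j \<sigma>'))" for n :: nat and \<sigma>
  have step: "\<exists>\<sigma>'. P (Suc n) \<sigma>' \<and> (\<forall>i<n. \<sigma>' i = \<sigma> i)" if P: "P n \<sigma>" for n \<sigma>
  proof (rule ccontr)
    assume neg: "\<not> ?thesis"
    have "\<exists>m. \<not> (\<exists>\<sigma>'. (\<forall>i<Suc n. \<sigma>' i = (\<sigma>(n := v)) i) \<and> (\<forall>i\<le>m. \<sigma>' i \<le> k i) \<and> (\<forall>j\<le>m. x \<in> L j \<sigma>'))" for v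
    proof -
      have "\<forall>i<n. (\<sigma>(n := v)) i = \<sigma> i" by auto
      then have "\<not> P (Suc n) (\<sigma>(n := v))" using neg by blast
      then show ?thesis unfolding P_def by blast
    qed
    then obtain m where m: "\<And>v. \<not> (\<exists>\<sigma>'. (\<forall>i<Suc n. \<sigma>' i = (\<sigma>(n := v)) i) \<and> (\<forall>i\<le>m v. \<sigma>' i \<le> k i) \<and> (\<forall>j\<le>m v. x \<in> L j \<sigma>'))"
      by metis
    define N where "N = max n (Max (m ` {..k n}))"
    obtain \<sigma>' where s: "\<forall>i<n. \<sigma>' i = \<sigma> i" "\<forall>i\<le>N. \<sigma>' i \<le> k i" "\<forall>j\<le>N. x \<in> L j \<sigma>'"
      using P unfolding P_def by blast
    have "\<sigma>' n \<le> k n" using s(2) unfolding N_def by simp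
    then have "m (\<sigma>' n) \<le> N" unfolding N_def by (simp add: max.coboundedI2)
    moreover have "\<forall>i<Suc n. \<sigma>' i = (\<sigma>(n := \<sigma>' n)) i" using s(1) by (auto simp: less_Suc_eq)
    ultimately show False using m[of "\<sigma>' n"] s(2,3) by (metis order.trans)
  qed
  have "P 0 (\<lambda>_. 0)" unfolding P_def using x by auto
  then have "\<exists>\<sigma>. \<forall>n. P n (\<sigma> n) \<and> (\<forall>i<n. \<sigma> (Suc n) i = \<sigma> n i)"
    using step by (intro dependent_nat_choice) auto
  then obtain s where s: "\<And>n. P n (s n)" "\<And>n i. i < n \<Longrightarrow> s (Suc n) i = s n i" by blast
  have s2: "i < n \<Longrightarrow> s n i = s (Suc i) i" for i n
    by (induction n) (auto simp: less_Suc_eq s(2))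
  have "x \<in> L n (\<lambda>i. s (Suc i) i)" for n
  proof -
    obtain \<sigma>' where "\<forall>i<Suc n. \<sigma>' i = s (Suc n) i" "\<forall>j\<le>n. x \<in> L j \<sigma>'"
      using s(1)[of "Suc n"] unfolding P_def by metis
    moreover have "L n (\<lambda>i. s (Suc i) i) = L n \<sigma>'"
      using \<open>\<forall>i<Suc n. \<sigma>' i = s (Suc n) i\<close> s2[of _ "Suc n"] by (intro dep) (auto simp: less_Suc_eq_le)
    ultimately show ?thesis by auto
  qed
  then show ?thesis by blast
qed

text \<open>Choquet's capacitability argument. Bounds \<open>k 0\<close>, \<open>k 1\<close>, ... on
  the entries of the branches are chosen one after another so that the part of \<open>E\<close>
  reached by bounded branches keeps outer measure above \<open>c\<close>. Only finitely many initial
  segments are then left at each stage, which gives members \<open>B n\<close> of the paving, and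
  Koenig's lemma puts their intersection inside \<open>E\<close>.\<close>

lemma souslin_capacitable:
  fixes Q :: "'w measure" and E :: "('w \<times> real) set"
  assumes Q: "finite_measure Q" and E: "souslin (rect_unions Q) E"
    and sub: "E \<subseteq> space Q \<times> UNIV" and c: "c < outer_measure_of Q (fst ` E)"
  obtains B where "\<And>n. B n \<in> rect_unions Q" "decseq B" "(\<Inter>n. B n) \<subseteq> E"
    "c \<le> emeasure Q (fst ` (\<Inter>n. B n))"
proof -
  interpret finite_measure Q by fact
  obtain L where L: "\<And>n \<sigma>. L n \<sigma> \<in> rect_unions Q"
    and dep: "\<And>n \<sigma> \<sigma>'. (\<forall>i\<le>n. \<sigma> i = \<sigma>' i) \<Longrightarrow> L n \<sigma> = L n \<sigma>'"
    and EL: "E = (\<Union>\<sigma>::nat \<Rightarrow> nat. \<Inter>n. L n \<sigma>)"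
    using E unfolding souslin_def by auto
  define G where "G n k = (\<Union>\<sigma>\<in>{\<sigma>. \<forall>i<n. \<sigma> i \<le> k i}. \<Inter>n. L n \<sigma>)" for n :: nat and k :: "nat \<Rightarrow> nat"
  have G_E: "G n k \<subseteq> E" for n k unfolding G_def EL by auto
  have G_cong: "G n k = G n k'" if "\<forall>i<n. k i = k' i" for n k k'
  proof -
    have "{\<sigma>. \<forall>i<n. \<sigma> i \<le> k i} = {\<sigma>. \<forall>i<n. \<sigma> i \<le> k' i}" using that by auto
    then show ?thesis unfolding G_def by simp
  qed
  have step: "\<exists>k'. c < outer_measure_of Q (fst ` G (Suc n) k') \<and> (\<forall>i<n. k' i = k i)"
    if "c < outer_measure_of Q (fst ` G n k)" for n k
  proof -
    have "G n k = (\<Union>v. G (Suc n) (k(n := v)))"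
      unfolding G_def by (auto simp: less_Suc_eq)
    then have "fst ` G n k = (\<Union>v. fst ` G (Suc n) (k(n := v)))" by (simp add: image_UN)
    \<comment> \<open>Outer measure is continuous along increasing sequences of arbitrary sets. The
      projections involved here are not yet known to be measurable.\<close>
    moreover have "(SUP v. outer_measure_of Q (fst ` G (Suc n) (k(n := v)))) = outer_measure_of Q (\<Union>v. fst ` G (Suc n) (k(n := v)))"
    proof (rule SUP_outer_measure_of_incseq)
      show "fst ` G (Suc n) (k(n := v)) \<subseteq> space Q" for v using G_E sub by fastforce
      have "{\<sigma>. \<forall>i<Suc n. \<sigma> i \<le> (k(n := v)) i} \<subseteq> {\<sigma>. \<forall>i<Suc n. \<sigma> i \<le> (k(n := u)) i}" if "v \<le> u" for v u
        using that by (auto simp: less_Suc_eq)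
      then show "incseq (\<lambda>v. fst ` G (Suc n) (k(n := v)))"
        unfolding incseq_def G_def by (intro allI impI image_mono UN_mono) auto
    qed
    ultimately have "c < (SUP v. outer_measure_of Q (fst ` G (Suc n) (k(n := v))))" using that by simp
    then obtain v where "c < outer_measure_of Q (fst ` G (Suc n) (k(n := v)))" by (auto simp: less_SUP_iff)
    then show ?thesis by (intro exI[of _ "k(n := v)"]) auto
  qed
  have "G 0 (\<lambda>_. 0) = E" unfolding G_def EL by auto
  with c have "\<exists>k. \<forall>n. c < outer_measure_of Q (fst ` G n (k n)) \<and> (\<forall>i<n. k (Suc n) i = k n i)"
    by (intro dependent_nat_choice step) auto
  then obtain s where s: "\<And>n. c < outer_measure_of Q (fst ` G n (s n))" "\<And>n i. i < n \<Longrightarrow> s (Suc n) i = s n i"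
    by blast
  define k where "k i = s (Suc i) i" for i
  have s2: "i < n \<Longrightarrow> s n i = k i" for i n
    by (induction n) (auto simp: less_Suc_eq s(2) k_def)
  have Gk: "c < outer_measure_of Q (fst ` G n k)" for n
    using s(1)[of n] G_cong[of n "s n" k] s2[of _ n] by auto
  \<comment> \<open>Padding by zeros beyond entry \<open>n\<close> makes the index set finite; it
    changes none of the sets \<open>L j \<sigma>\<close> with j at most n.\<close>
  define B where "B n = (\<Union>\<sigma>\<in>{\<sigma>. (\<forall>i\<le>n. \<sigma> i \<le> k i) \<and> (\<forall>i>n. \<sigma> i = 0)}. \<Inter>j\<le>n. L j \<sigma>)" for n
  have B_iff: "x \<in> B n \<longleftrightarrow> (\<exists>\<sigma>. (\<forall>i\<le>n. \<sigma> i \<le> k i) \<and> (\<forall>j\<le>n. x \<in> L j \<sigma>))" for x n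
  proof
    assume "\<exists>\<sigma>. (\<forall>i\<le>n. \<sigma> i \<le> k i) \<and> (\<forall>j\<le>n. x \<in> L j \<sigma>)"
    then obtain \<sigma> where \<sigma>: "\<forall>i\<le>n. \<sigma> i \<le> k i" "\<forall>j\<le>n. x \<in> L j \<sigma>" by blast
    define \<sigma>' where "\<sigma>' i = (if i \<le> n then \<sigma> i else 0)" for i
    have "L j \<sigma>' = L j \<sigma>" if "j \<le> n" for j using that by (intro dep) (auto simp: \<sigma>'_def)
    then show "x \<in> B n" unfolding B_def using \<sigma> by (auto simp: \<sigma>'_def intro!: exI[of _ \<sigma>'])
  qed (auto simp: B_def)
  have B: "B n \<in> rect_unions Q" for n
    unfolding B_def by (intro rect_unions_UN rect_unions_INT L finite_bounded_funs)
  have dec: "decseq B"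
  proof (rule decseq_SucI, rule subsetI)
    fix n x assume "x \<in> B (Suc n)" then show "x \<in> B n" unfolding B_iff by (meson le_SucI)
  qed
  have "c \<le> emeasure Q (fst ` B n)" for n
  proof -
    have "G (Suc n) k \<subseteq> B n" unfolding G_def B_iff subset_iff less_Suc_eq_le by blast
    then have "outer_measure_of Q (fst ` G (Suc n) k) \<le> outer_measure_of Q (fst ` B n)"
      by (intro outer_measure_of_mono image_mono)
    with Gk[of "Suc n"] show ?thesis using sets_fst_rect_unions[OF B[of n]] by simp
  qed
  moreover have "(INF n. emeasure Q (fst ` B n)) = emeasure Q (\<Inter>n. fst ` B n)"
    using sets_fst_rect_unions[OF B] dec
    by (intro INF_emeasure_decseq) (auto simp: decseq_def image_mono)
  ultimately have "c \<le> emeasure Q (\<Inter>n. fst ` B n)" by (metis INF_greatest)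
  moreover have "(\<Inter>n. B n) \<subseteq> E"
  proof
    fix x assume "x \<in> (\<Inter>n. B n)"
    then have "\<exists>\<sigma>. \<forall>n. x \<in> L n \<sigma>" by (intro bounded_branch[of L k] dep) (auto simp: B_iff)
    then show "x \<in> E" unfolding EL by auto
  qed
  ultimately show ?thesis using that[of B] B dec fst_INT_rect_unions[OF B dec] by simp
qed

text \<open>Souslin sets are not closed under complements, so the induction over the
  \<sigma>-algebra carries each set together with its complement. Complements are taken in a strip
  of bounded time, where the complement of a rectangle is again built from compact
  intervals.\<close>

lemma souslin_pair:
  fixes Q :: "'w measure" and a b :: real
  assumes "E \<in> sets (Q \<Otimes>\<^sub>M borel)"
  shows "souslin (rect_unions Q) (E \<inter> (space Q \<times> {a..b}))"
proof -
  let ?W = "space Q \<times> {a..b}" and ?L = "rect_unions Q"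
  define good where "good E \<longleftrightarrow> souslin ?L (E \<inter> ?W) \<and> souslin ?L (?W - E)" for E
  have good_compl: "good (space Q \<times> UNIV - E)" if "good E" for E
  proof -
    have "(space Q \<times> UNIV - E) \<inter> ?W = ?W - E" "?W - (space Q \<times> UNIV - E) = E \<inter> ?W" by auto
    with that show ?thesis unfolding good_def by simp
  qed
  have good_UN: "good (\<Union>i. E i)" if "\<And>i::nat. good (E i)" for E
  proof -
    have "(\<Union>i. E i) \<inter> ?W = (\<Union>i. E i \<inter> ?W)" "?W - (\<Union>i. E i) = (\<Inter>i. ?W - E i)" by auto
    with that show ?thesis unfolding good_def by (metis souslin_UN souslin_INT)
  qed
  have good_Int: "good (A \<inter> B)" if "good A" "good B" for A B
  proof -
    have "(A \<inter> B) \<inter> ?W = (A \<inter> ?W) \<inter> (B \<inter> ?W)" "?W - (A \<inter> B) = (?W - A) \<union> (?W - B)" by auto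
    with that show ?thesis unfolding good_def by (auto intro: souslin_Int souslin_Un)
  qed
  have good_fst: "good (A \<times> UNIV)" if "A \<in> sets Q" for A
  proof -
    have "(A \<times> UNIV) \<inter> ?W = A \<times> {a..b}" "?W - (A \<times> UNIV) = (space Q - A) \<times> {a..b}"
      using sets.sets_into_space[OF that] by auto
    then show ?thesis unfolding good_def using that
      by (auto intro!: souslin_base rect_unions_rect)
  qed
  have good_empty: "good {}" using good_fst[of "{}"] by simp
  have good_snd: "good (space Q \<times> B)" if "B \<in> sets borel" for B :: "real set"
  proof -
    have "B \<in> sigma_sets UNIV (range (\<lambda>x. {..x}))"
      using that unfolding borel_eq_atMost by (simp add: sets_measure_of)
    then show ?thesis
    proof induction
      case (Basic B)
      then obtain x where x: "B = {..x}" by auto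
      have 1: "(space Q \<times> B) \<inter> ?W = space Q \<times> {a..min b x}" using x by auto
      have 2: "?W - (space Q \<times> B) = (\<Union>n. space Q \<times> {max a (x + 1 / real (Suc n))..b})"
      proof (intro equalityI subsetI)
        fix p assume p: "p \<in> ?W - (space Q \<times> B)"
        then have "0 < snd p - x" using x by auto
        then obtain n where "1 / real (Suc n) < snd p - x" using nat_approx_posE by metis
        then show "p \<in> (\<Union>n. space Q \<times> {max a (x + 1 / real (Suc n))..b})"
          using p by (auto intro!: exI[of _ n])
      next
        fix p assume "p \<in> (\<Union>n. space Q \<times> {max a (x + 1 / real (Suc n))..b})"
        then obtain n where n: "p \<in> space Q \<times> {max a (x + 1 / real (Suc n))..b}" by blast
        define d where "d = 1 / real (Suc n)"
        have "0 < d" "p \<in> space Q \<times> {max a (x + d)..b}" using n by (simp_all add: d_def)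
        then have "x < snd p \<and> p \<in> ?W" by auto
        then show "p \<in> ?W - (space Q \<times> B)" using x by auto
      qed
      show ?case unfolding good_def 1 2
        by (intro conjI souslin_UN) (auto intro!: souslin_base rect_unions_rect)
    next
      case Empty then show ?case using good_empty by simp
    next
      case (Compl B)
      have "space Q \<times> (UNIV - B) = (space Q \<times> UNIV - space Q \<times> B)" by auto
      then show ?case using good_compl Compl by simp
    next
      case (Union B)
      have "space Q \<times> (\<Union>i. B i) = (\<Union>i. space Q \<times> B i)" by auto
      then show ?case using good_UN Union by simp
    qed
  qed
  have "E \<in> sigma_sets (space Q \<times> UNIV) {A \<times> B |A B. A \<in> sets Q \<and> B \<in> sets borel}"
    using assms by (simp add: sets_pair_measure)
  then have "good E"
  proof induction
    case (Basic E)
    then obtain A B where AB: "E = A \<times> B" "A \<in> sets Q" "B \<in> sets borel" by auto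
    have "E = (A \<times> UNIV) \<inter> (space Q \<times> B)" using AB sets.sets_into_space[OF AB(2)] by auto
    then show ?case using good_Int good_fst good_snd AB by simp
  qed (use good_empty good_compl good_UN in auto)
  then show ?thesis unfolding good_def by simp
qed

text \<open>The capacitability argument also yields a selector: \<open>R\<close> takes the earliest
  time of the compact section. Its sublevel sets are projections of the same approximating set cut
  at time t, hence measurable without completeness.\<close>

lemma measurable_section_approx:
  fixes Q :: "'w measure" and a b :: real
  assumes Q: "finite_measure Q" and E: "E \<in> sets (Q \<Otimes>\<^sub>M borel)"
    and sub: "E \<subseteq> space Q \<times> {a..b}" and c: "c < outer_measure_of Q (fst ` E)"
  obtains D R where "D \<in> sets Q" "c \<le> emeasure Q D" "R \<in> borel_measurable Q"
    "\<And>w. w \<in> D \<Longrightarrow> (w, R w) \<in> E"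
proof -
  interpret finite_measure Q by fact
  have EW: "E \<inter> (space Q \<times> {a..b}) = E" using sub by auto
  have "souslin (rect_unions Q) E" using souslin_pair[OF E, of a b] EW by simp
  from souslin_capacitable[OF Q this _ c] sub
  obtain B where B: "\<And>n. B n \<in> rect_unions Q" "decseq B" "(\<Inter>n. B n) \<subseteq> E"
    "c \<le> emeasure Q (fst ` (\<Inter>n. B n))" by auto
  define D where "D = fst ` (\<Inter>n. B n)"
  have D: "D \<in> sets Q" unfolding D_def fst_INT_rect_unions[OF B(1,2)]
    by (intro sets.countable_INT') (auto intro!: sets_fst_rect_unions B)
  define sec where "sec w = {t. (w, t) \<in> (\<Inter>n. B n)}" for w
  define R where "R w = (if w \<in> D then Inf (sec w) else b + 1)" for w
  have sec: "compact (sec w)" for w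
  proof -
    have "sec w = (\<Inter>n. {t. (w, t) \<in> B n})" by (auto simp: sec_def)
    then show ?thesis using compact_section_rect_unions[OF B(1)]
      by (auto intro!: compact_Inter)
  qed
  have ne: "sec w \<noteq> {} \<longleftrightarrow> w \<in> D" for w unfolding sec_def D_def by force
  have R_in: "R w \<in> sec w" if "w \<in> D" for w
    using closed_contains_Inf[OF _ bounded_imp_bdd_below compact_imp_closed, OF _ compact_imp_bounded] sec[of w] ne[of w] that
    unfolding R_def by auto
  have R_le: "R w \<le> t" if "t \<in> sec w" for w t
  proof -
    have "bdd_below (sec w)" using sec[of w] by (intro bounded_imp_bdd_below compact_imp_bounded)
    then show ?thesis using that ne[of w] cInf_lower[OF that] unfolding R_def by auto
  qed
  have "R \<in> borel_measurable Q"
  proof (rule borel_measurableI_le)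
    fix t
    have I: "{w \<in> D. R w \<le> t} = fst ` (\<Inter>n. B n \<inter> (space Q \<times> {a..t}))"
    proof (intro equalityI subsetI)
      fix w assume u: "w \<in> {w \<in> D. R w \<le> t}"
      then have "(w, R w) \<in> (\<Inter>n. B n)" using R_in[of w] by (auto simp: sec_def)
      moreover from this have "(w, R w) \<in> space Q \<times> {a..b}" using B(3) sub by blast
      ultimately show "w \<in> fst ` (\<Inter>n. B n \<inter> (space Q \<times> {a..t}))" using u by force
    next
      fix w assume "w \<in> fst ` (\<Inter>n. B n \<inter> (space Q \<times> {a..t}))"
      then obtain s where s: "s \<in> sec w" "s \<le> t" by (auto simp: sec_def)
      then show "w \<in> {w \<in> D. R w \<le> t}" using R_le[OF s(1)] ne[of w] by auto
    qed
    have R: "B n \<inter> (space Q \<times> {a..t}) \<in> rect_unions Q" for n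
      using B(1) by (auto intro!: rect_unions_Int rect_unions_rect)
    have "{w \<in> D. R w \<le> t} \<in> sets Q" unfolding I
      using B(2) by (subst fst_INT_rect_unions[OF R])
        (auto simp: decseq_def intro!: sets.countable_INT' sets_fst_rect_unions R)
    moreover have "{w \<in> space Q. R w \<le> t} = {w \<in> D. R w \<le> t} \<union> (if b + 1 \<le> t then space Q - D else {})"
      using sets.sets_into_space[OF D] by (auto simp: R_def)
    ultimately show "{w \<in> space Q. R w \<le> t} \<in> sets Q" using D by auto
  qed
  moreover have "(w, R w) \<in> E" if "w \<in> D" for w using R_in[OF that] B(3) by (auto simp: sec_def)
  ultimately show ?thesis using that[of D R] D B(4) unfolding D_def by auto
qed

text \<open>Measurable subsets of the projection come arbitrarily close to its measurable hull
  \<open>X\<close> in measure, so the projection differs from a measurable set by a subset of a null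
  set. This is where completeness is used.\<close>

lemma measurable_projection:
  fixes Q :: "'w measure" and a b :: real
  assumes Q: "finite_measure Q" "complete_measure Q" and E: "E \<in> sets (Q \<Otimes>\<^sub>M borel)"
    and sub: "E \<subseteq> space Q \<times> {a..b}"
  shows "fst ` E \<in> sets Q"
proof -
  interpret finite_measure Q by fact
  interpret complete_measure Q by fact
  have ss: "fst ` E \<subseteq> space Q" using sub by auto
  obtain X where X: "X \<in> sets Q" "fst ` E \<subseteq> X" "emeasure Q X = outer_measure_of Q (fst ` E)"
    using outer_measure_of_attain[OF ss] by metis
  have H: "\<exists>D. D \<in> sets Q \<and> D \<subseteq> fst ` E \<and> c \<le> emeasure Q D" if "c < emeasure Q X" for c
  proof -
    from that X(3) have "c < outer_measure_of Q (fst ` E)" by simp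
    from measurable_section_approx[OF Q(1) E sub this] obtain D R
      where "D \<in> sets Q" "c \<le> emeasure Q D" "\<And>w. w \<in> D \<Longrightarrow> (w, R w) \<in> E" by metis
    then show ?thesis by (intro exI[of _ D]) force
  qed
  show ?thesis
  proof (cases "emeasure Q X = 0")
    case True
    then show ?thesis using X complete2[of "fst ` E" X] by (auto simp: null_sets_def)
  next
    case False
    then have "0 < emeasure Q X" by (simp add: zero_less_iff_neq_zero)
    from approx_from_below_dense_linorder[OF this] obtain u
      where u: "\<And>n. u n < emeasure Q X" "u \<longlonglongrightarrow> emeasure Q X" by auto
    obtain D where D: "\<And>n::nat. D n \<in> sets Q" "\<And>n. D n \<subseteq> fst ` E" "\<And>n. u n \<le> emeasure Q (D n)"
      using H[OF u(1)] by metis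
    let ?D = "\<Union>n. D n"
    have DD: "?D \<in> sets Q" "?D \<subseteq> fst ` E" using D by auto
    have "u n \<le> emeasure Q ?D" for n
      by (rule order.trans[OF D(3)]) (intro emeasure_mono DD UN_upper UNIV_I)
    then have "emeasure Q X \<le> emeasure Q ?D" using u(2) by (intro LIMSEQ_le_const2) auto
    moreover have "emeasure Q ?D \<le> emeasure Q X"
      using DD X by (intro emeasure_mono) auto
    ultimately have "emeasure Q ?D = emeasure Q X" by (rule antisym[rotated])
    moreover have "emeasure Q (X - ?D) = emeasure Q X - emeasure Q ?D"
      using X DD by (intro emeasure_Diff) auto
    ultimately have "emeasure Q (X - ?D) = emeasure Q X - emeasure Q X" by simp
    also have "\<dots> = 0" using emeasure_finite[of X] by (intro ennreal_diff_self) simp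
    finally have "emeasure Q (X - ?D) = 0" .
    then have "X - ?D \<in> null_sets Q" by (rule null_setsI) (rule sets.Diff[OF X(1) DD(1)])
    then have "fst ` E - ?D \<in> null_sets Q" by (rule complete2[rotated]) (use X(2) in auto)
    moreover have "fst ` E = ?D \<union> (fst ` E - ?D)" using DD by auto
    ultimately show ?thesis using sets.Un[OF DD(1) null_setsD2] by metis
  qed
qed

section \<open>Optional and predictable sets\<close>

lemma restr_to_subalg_complete:
  assumes "complete_measure M" "subalgebra M G" "null_sets M \<subseteq> sets G"
  shows "complete_measure (restr_to_subalg M G)"
proof
  fix A B assume "B \<subseteq> A" "A \<in> null_sets (restr_to_subalg M G)"
  then have "A \<in> null_sets M" using null_sets_restr_to_subalg[OF assms(2)] by auto
  then have "B \<in> null_sets M" using \<open>B \<subseteq> A\<close> complete_measure.complete2[OF assms(1)] by auto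
  then show "B \<in> sets (restr_to_subalg M G)"
    using assms(3) sets_restr_to_subalg[OF assms(2)] by auto
qed

section \<open>Filtrations under the usual conditions and their stopping times\<close>

locale usual_filtration = prob_space M for M :: "'w measure" +
  fixes F :: "real \<Rightarrow> 'w measure" and T :: real
  assumes right_continuous: "right_continuous_filtration M F"
    and complete_filt: "complete_filtration M F" and T_pos: "0 < T"
begin

sublocale filtration "space M" F
  using right_continuous unfolding right_continuous_filtration_def by auto

sublocale complete_measure M
  using complete_filt unfolding complete_filtration_def by auto

lemma subalgebra_F: "subalgebra M (F t)"
  using right_continuous unfolding right_continuous_filtration_def by auto

lemma sets_F_sub: "A \<in> sets (F t) \<Longrightarrow> A \<in> sets M"
  using subalgebra_F[of t] unfolding subalgebra_def by auto

lemma measurable_F_sub: "f \<in> measurable (F t) N \<Longrightarrow> f \<in> measurable M N"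
  using measurable_from_subalg[OF subalgebra_F] .

lemma measurable_F_mono: "f \<in> measurable (F s) N \<Longrightarrow> s \<le> t \<Longrightarrow> f \<in> measurable (F t) N"
  using sets_F_mono[of s t] space_F[of s] space_F[of t] unfolding measurable_def by auto

lemma null_sets_F:
  assumes "A \<in> null_sets M" "0 \<le> t" shows "A \<in> sets (F t)"
proof -
  have "null_sets M \<subseteq> sets (F 0)" using complete_filt unfolding complete_filtration_def by (rule conjunct2)
  from subsetD[OF this assms(1)] show ?thesis using sets_F_mono[OF assms(2)] by (rule subsetD[rotated])
qed

lemma sets_F_right:
  assumes "0 \<le> t" "\<And>s. t < s \<Longrightarrow> A \<in> sets (F s)" shows "A \<in> sets (F t)"
proof -
  have "sets (F t) = (\<Inter>s\<in>{t<..}. sets (F s))"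
    using right_continuous assms(1) unfolding right_continuous_filtration_def by blast
  moreover have "A \<in> (\<Inter>s\<in>{t<..}. sets (F s))" using assms(2) by blast
  ultimately show ?thesis by simp
qed

lemma sets_F_AE:
  assumes "0 \<le> t" "B \<in> sets (F t)" "A \<subseteq> space M" "AE w in M. w \<in> A \<longleftrightarrow> w \<in> B"
  shows "A \<in> sets (F t)"
proof -
  have Bs: "B \<subseteq> space M" using sets.sets_into_space[OF assms(2)] space_F by auto
  let ?N = "{w\<in>space M. \<not> (w \<in> A \<longleftrightarrow> w \<in> B)}"
  have N: "?N \<in> null_sets M" using assms(4) unfolding AE_iff_null_sets .
  have *: "X \<inter> ?N \<in> sets (F t)" for X
    using assms(1) by (intro null_sets_F complete2[OF _ N] Int_lower2)
  have "A = (B - B \<inter> ?N) \<union> A \<inter> ?N" using assms(3) Bs by blast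
  also have "\<dots> \<in> sets (F t)" by (rule sets.Un[OF sets.Diff[OF assms(2) *] *])
  finally show ?thesis .
qed

lemma measurable_F_AE:
  fixes f g :: "'w \<Rightarrow> 'b::topological_space"
  assumes "0 \<le> t" "g \<in> borel_measurable (F t)" "AE w in M. f w = g w"
  shows "f \<in> borel_measurable (F t)"
proof (rule measurableI)
  fix A :: "'b set" assume A: "A \<in> sets borel"
  show "f -` A \<inter> space (F t) \<in> sets (F t)"
    by (rule sets_F_AE[OF assms(1) measurable_sets[OF assms(2) A]])
      (use assms(3) in \<open>auto simp: space_F\<close>)
qed simp

lemma measurable_AE:
  fixes f g :: "'w \<Rightarrow> 'b::topological_space"
  assumes "g \<in> borel_measurable M" "AE w in M. f w = g w"
  shows "f \<in> borel_measurable M"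
proof (rule measurableI)
  fix A :: "'b set" assume A: "A \<in> sets borel"
  show "f -` A \<inter> space M \<in> sets M"
    by (rule in_sets_AE[OF _ measurable_sets[OF assms(1) A]]) (use assms(2) in \<open>auto elim: eventually_mono\<close>)
qed simp

lemma stopping_time_AE:
  assumes "stopping_time F \<sigma>" "AE w in M. \<tau> w = \<sigma> w" "\<And>w. w \<in> space M \<Longrightarrow> 0 \<le> (\<tau> w :: real)"
  shows "stopping_time F \<tau>"
proof
  fix t
  show "Measurable.pred (F t) (\<lambda>x. \<tau> x \<le> t)"
  proof (cases "0 \<le> t")
    case True
    have "{w\<in>space M. \<sigma> w \<le> t} \<in> sets (F t)" using stopping_timeD[OF assms(1), of t] by (simp add: pred_def space_F)
    then have "{w\<in>space M. \<tau> w \<le> t} \<in> sets (F t)"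
      by (rule sets_F_AE[OF True]) (use assms(2) in auto)
    then show ?thesis by (simp add: pred_def space_F)
  next
    case False
    then have "{w\<in>space M. \<tau> w \<le> t} = {}" using assms(3) by fastforce
    then show ?thesis by (metis pred_def sets.empty_sets space_F)
  qed
qed

lemma stopping_timesD:
  assumes "\<tau> \<in> stopping_times M F T S"
  shows "stopping_time F \<tau>" "\<And>w. w \<in> space M \<Longrightarrow> 0 \<le> \<tau> w"
    "AE w in M. S w \<le> \<tau> w \<and> 0 \<le> \<tau> w \<and> \<tau> w \<le> T"
  using assms unfolding stopping_times_def by auto

lemma stopping_times_0: "\<tau> \<in> stopping_times M F T S \<Longrightarrow> \<tau> \<in> stopping_times M F T (\<lambda>_. 0)"
  unfolding stopping_times_def by auto

lemma stopping_times_AE: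
  assumes "\<sigma> \<in> stopping_times M F T S" "AE w in M. \<tau> w = \<sigma> w" "\<And>w. w \<in> space M \<Longrightarrow> 0 \<le> \<tau> w"
  shows "\<tau> \<in> stopping_times M F T S"
  using assms stopping_time_AE[of \<sigma> \<tau>] unfolding stopping_times_def by auto

lemma stopping_times_const: "0 \<le> c \<Longrightarrow> c \<le> T \<Longrightarrow> (\<lambda>_. c) \<in> stopping_times M F T (\<lambda>_. 0)"
  unfolding stopping_times_def by (auto intro: stopping_time_const)

lemma subalgebra_pre_sigma:
  assumes "stopping_time F \<tau>" shows "subalgebra M (pre_sigma \<tau>)"
  unfolding subalgebra_def
proof (intro conjI subsetI)
  fix A assume A: "A \<in> sets (pre_sigma \<tau>)"
  have "{w\<in>A. \<tau> w \<le> real n} \<in> sets M" for n :: nat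
    using sets_pre_sigmaD[OF assms A] by (rule sets_F_sub)
  then have "(\<Union>n::nat. {w\<in>A. \<tau> w \<le> real n}) \<in> sets M" by blast
  also have "(\<Union>n::nat. {w\<in>A. \<tau> w \<le> real n}) = A" using real_arch_simple by auto
  finally show "A \<in> sets M" .
qed (simp add: space_pre_sigma)

section \<open>Optional and predictable \<sigma>-algebras on [0,T]\<close>

abbreviation "Opt \<equiv> optional_sigma (space M) F {0..T}"
abbreviation "Prd \<equiv> predictable_sigma (space M) F {0..T}"

lemma optional_sigma_gen:
  "{{(w, t) \<in> \<Omega> \<times> I. X w t \<in> B} |X B. cadlag_adapted \<Omega> F I X \<and> B \<in> sets borel} \<subseteq> Pow (\<Omega> \<times> I)"
  by auto

lemma space_Opt: "space Opt = space M \<times> {0..T}"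
  unfolding optional_sigma_def by (rule space_measure_of[OF optional_sigma_gen])

lemma sets_Opt: "sets Opt = sigma_sets (space M \<times> {0..T})
     {{(w, t) \<in> space M \<times> {0..T}. X w t \<in> B} |X B. cadlag_adapted (space M) F {0..T} X \<and> B \<in> sets borel}"
  unfolding optional_sigma_def by (rule sets_measure_of[OF optional_sigma_gen])

lemma predictable_sigma_gen:
  assumes "I = {0..T'} \<and> 0 \<le> T' \<or> I = {0..}"
  shows "{B \<times> {0} |B. B \<in> sets (F 0)} \<union>
      {B \<times> {s<..t} |B s t. 0 \<le> s \<and> s \<le> t \<and> t \<in> I \<and> B \<in> sets (F s)} \<subseteq> Pow (space M \<times> I)"
  using assms sets.sets_into_space space_F by (fastforce simp: subset_iff)

lemma space_predictable_sigma:
  assumes "I = {0..T'} \<and> 0 \<le> T' \<or> I = {0..}"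
  shows "space (predictable_sigma (space M) F I) = space M \<times> I"
  unfolding predictable_sigma_def by (rule space_measure_of[OF predictable_sigma_gen[OF assms]])

lemma sets_predictable_sigma:
  assumes "I = {0..T'} \<and> 0 \<le> T' \<or> I = {0..}"
  shows "sets (predictable_sigma (space M) F I) = sigma_sets (space M \<times> I)
    ({B \<times> {0} |B. B \<in> sets (F 0)} \<union>
      {B \<times> {s<..t} |B s t. 0 \<le> s \<and> s \<le> t \<and> t \<in> I \<and> B \<in> sets (F s)})"
  unfolding predictable_sigma_def by (rule sets_measure_of[OF predictable_sigma_gen[OF assms]])

lemma space_Prd: "space Prd = space M \<times> {0..T}"
  using space_predictable_sigma[of "{0..T}" T] T_pos by auto

lemmas sets_Prd = sets_predictable_sigma[of "{0..T}" T, OF disjI1, OF conjI, OF refl less_imp_le[OF T_pos]]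

lemma predictable_zero:
  assumes "I = {0..T'} \<and> 0 \<le> T' \<or> I = {0..}" "B \<in> sets (F 0)"
  shows "B \<times> {0} \<in> sets (predictable_sigma (space M) F I)"
  unfolding sets_predictable_sigma[OF assms(1)] using assms(2) by (intro sigma_sets.Basic) auto

lemma predictable_interval:
  assumes "I = {0..T'} \<and> 0 \<le> T' \<or> I = {0..}" "B \<in> sets (F s)" "0 \<le> s" "s \<le> t" "t \<in> I"
  shows "B \<times> {s<..t} \<in> sets (predictable_sigma (space M) F I)"
  unfolding sets_predictable_sigma[OF assms(1)] using assms(2-) by (intro sigma_sets.Basic) auto

lemma predictable_after:
  assumes I: "I = {0..T'} \<and> 0 \<le> T' \<or> I = {0..}" and B: "B \<in> sets (F s)" "0 \<le> s"
  shows "B \<times> ({s<..} \<inter> I) \<in> sets (predictable_sigma (space M) F I)"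
proof -
  have *: "B \<times> {s<..max s t} \<in> sets (predictable_sigma (space M) F I)" if "max s t \<in> I" for t
    using that B by (intro predictable_interval[OF I]) auto
  show ?thesis
  proof (cases "I = {0..}")
    case True
    have "B \<times> ({s<..} \<inter> I) = (\<Union>n::nat. B \<times> {s<..max s (real n)})"
    proof (intro equalityI subsetI)
      fix p assume p: "p \<in> B \<times> ({s<..} \<inter> I)"
      obtain n :: nat where "snd p \<le> real n" using real_arch_simple by blast
      then show "p \<in> (\<Union>n::nat. B \<times> {s<..max s (real n)})" using p by (auto intro!: exI[of _ n])
    qed (use B(2) True in auto)
    then show ?thesis using * B(2) True by auto
  next
    case False
    then have I': "I = {0..T'}" "0 \<le> T'" using I by auto
    show ?thesis
    proof (cases "s \<le> T'")
      case True
      have "B \<times> ({s<..} \<inter> I) = B \<times> {s<..max s T'}" using I' B(2) True by auto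
      then show ?thesis using *[of T'] True I' by auto
    next
      case False
      then have "{s<..} \<inter> I = {}" using I' by auto
      then have e: "B \<times> ({s<..} \<inter> I) = {}" by (simp only: Sigma_empty2)
      show ?thesis unfolding e by (rule sets.empty_sets)
    qed
  qed
qed

text \<open>A time strictly after \<open>\<tau>\<close> is separated from it by a rational q, and
  the part of \<open>B\<close> where \<tau> is at most q belongs to \<open>F q\<close>. Stochastic
  intervals built this way are the integrands that test conditional expectations given the past of a
  stopping time.\<close>

lemma predictable_after_stopping:
  assumes I: "I = {0..T'} \<and> 0 \<le> T' \<or> I = {0..}"
    and \<tau>: "stopping_time F \<tau>" "\<And>w. w \<in> space M \<Longrightarrow> 0 \<le> \<tau> w" and B: "B \<in> sets (pre_sigma \<tau>)"
  shows "{(w, t) \<in> space M \<times> I. w \<in> B \<and> \<tau> w < t} \<in> sets (predictable_sigma (space M) F I)"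
proof -
  have Bs: "B \<subseteq> space M" using sets.sets_into_space[OF B] by (simp add: space_pre_sigma)
  let ?Q = "{q \<in> \<rat>. 0 \<le> q} :: real set"
  have "{(w, t) \<in> space M \<times> I. w \<in> B \<and> \<tau> w < t} = (\<Union>q\<in>?Q. {w\<in>B. \<tau> w \<le> q} \<times> ({q<..} \<inter> I))"
  proof (intro equalityI subsetI)
    fix p assume "p \<in> {(w, t) \<in> space M \<times> I. w \<in> B \<and> \<tau> w < t}"
    then obtain w t where p: "p = (w, t)" "w \<in> space M" "t \<in> I" "w \<in> B" "\<tau> w < t" by auto
    obtain q where "q \<in> \<rat>" "\<tau> w < q" "q < t" using Rats_dense_in_real[OF p(5)] by auto
    then show "p \<in> (\<Union>q\<in>?Q. {w\<in>B. \<tau> w \<le> q} \<times> ({q<..} \<inter> I))"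
      using p \<tau>(2)[OF p(2)] by (auto intro!: bexI[of _ q])
  qed (use Bs in auto)
  also have "\<dots> \<in> sets (predictable_sigma (space M) F I)"
  proof (rule sets.countable_UN'')
    show "countable ?Q" by (rule countable_subset[OF _ countable_rat]) auto
  next
    fix q assume "q \<in> ?Q"
    then show "{w\<in>B. \<tau> w \<le> q} \<times> ({q<..} \<inter> I) \<in> sets (predictable_sigma (space M) F I)"
      using sets_pre_sigmaD[OF \<tau>(1) B] by (intro predictable_after[OF I]) auto
  qed
  finally show ?thesis .
qed

lemma Prd_after:
  assumes "B \<in> sets (F s)" "0 \<le> s" shows "B \<times> {s<..T} \<in> sets Prd"
proof -
  have "B \<times> {s<..T} = B \<times> ({s<..} \<inter> {0..T})" using assms(2) by auto
  then show ?thesis using predictable_after[of "{0..T}" T B s] assms T_pos by auto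
qed

lemma Prd_rect:
  assumes "B \<in> sets (F 0)" shows "B \<times> {0..T} \<in> sets Prd"
proof -
  have "B \<times> {0..T} = B \<times> {0} \<union> B \<times> {0<..T}" using T_pos by auto
  then show ?thesis using predictable_zero[of "{0..T}" T B] Prd_after[of B 0] assms T_pos by auto
qed

text \<open>Predictable times are defined on the half line, whereas processes and integrands live on
  [0,T]; this bridges the two \<sigma>-algebras.\<close>

lemma Prd_extend:
  assumes "E \<in> sets Prd" shows "E \<in> sets (predictable_sigma (space M) F {0..})"
  using assms unfolding sets_Prd
proof induction
  case (Basic E)
  then show ?case
  proof
    assume "E \<in> {B \<times> {0} |B. B \<in> sets (F 0)}"
    then show ?thesis by (auto intro!: predictable_zero[of "{0..}"])
  next
    assume "E \<in> {B \<times> {s<..t} |B s t. 0 \<le> s \<and> s \<le> t \<and> t \<in> {0..T} \<and> B \<in> sets (F s)}"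
    then show ?thesis by (auto intro!: predictable_interval[of "{0..}"])
  qed
next
  case (Compl E)
  have "space M \<times> {0..T} = space M \<times> {0} \<union> space M \<times> {0<..T}" using T_pos by auto
  also have "\<dots> \<in> sets (predictable_sigma (space M) F {0..})"
    using T_pos sets.top[of "F 0"] by (auto intro!: sets.Un predictable_zero[of "{0..}"] predictable_interval[of "{0..}"] simp: space_F)
  finally show ?case using Compl by auto
qed auto

lemma measurable_snd_Prd: "snd \<in> borel_measurable Prd"
proof (rule borel_measurableI_greater)
  fix a :: real
  have "{x \<in> space Prd. a < snd x} = (if a < 0 then space Prd else space M \<times> {a<..T})"
    by (auto simp: space_Prd)
  then show "{x \<in> space Prd. a < snd x} \<in> sets Prd"
    using Prd_after[of "space M" a] sets.top[of "F a"] by (auto simp: space_F)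
qed

lemma measurable_after_Prd:
  assumes g: "g \<in> borel_measurable (F u)" and u: "0 \<le> u"
  shows "(\<lambda>(w, t). indicator {u<..} t * g w :: real) \<in> borel_measurable Prd"
proof (rule borel_measurableI_greater)
  fix c :: real
  have *: "{w \<in> space M. c < g w} \<in> sets (F u)" "{w \<in> space M. g w \<le> c} \<in> sets (F u)"
    using g measurable_sets[OF g, of "{c<..}"] measurable_sets[OF g, of "{..c}"]
    by (auto simp: space_F vimage_def Int_def conj_commute)
  have "{x \<in> space Prd. c < (case x of (w, t) \<Rightarrow> indicator {u<..} t * g w)} =
    (if 0 \<le> c then {w \<in> space M. c < g w} \<times> {u<..T} else space Prd - {w \<in> space M. g w \<le> c} \<times> {u<..T})"
    using u by (auto simp: space_Prd split: split_indicator if_splits split_indicator_asm)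
  then show "{x \<in> space Prd. c < (case x of (w, t) \<Rightarrow> indicator {u<..} t * g w)} \<in> sets Prd"
    using Prd_after[OF *(1) u] Prd_after[OF *(2) u] by auto
qed

text \<open>The approximation is the last multiple of 2^-n strictly before \<open>t\<close>. Ceiling
  minus one, rather than floor, keeps it strictly before \<open>t\<close> when \<open>t\<close> is
  itself dyadic.\<close>

lemma dyadic_left:
  fixes t :: real
  assumes "0 < t"
  shows "filterlim (\<lambda>n. max 0 ((of_int \<lceil>2 ^ n * t\<rceil> - 1) / 2 ^ n)) (at_left t) sequentially"
proof -
  define e :: "nat \<Rightarrow> real" where "e n = (of_int \<lceil>2 ^ n * t\<rceil> - 1) / 2 ^ n" for n
  have lt: "e n < t" for n
    using ceiling_correct[of "2 ^ n * t"] unfolding e_def by (simp add: pos_divide_less_eq mult.commute)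
  have ge: "t - (1/2) ^ n \<le> e n" for n
  proof -
    have "t \<le> of_int \<lceil>2 ^ n * t\<rceil> / 2 ^ n"
      using ceiling_correct[of "2 ^ n * t"] by (simp add: pos_le_divide_eq mult.commute)
    then show ?thesis unfolding e_def by (simp add: diff_divide_distrib power_divide)
  qed
  have ev: "max 0 (e n) \<in> {..<t} \<and> max 0 (e n) \<noteq> t" for n using lt[of n] assms by auto
  have "(\<lambda>n. t - (1/2) ^ n) \<longlonglongrightarrow> t - 0" by (intro tendsto_intros LIMSEQ_realpow_zero) auto
  then have l: "(\<lambda>n. t - (1/2) ^ n) \<longlonglongrightarrow> t" by simp
  have "(\<lambda>n. max 0 (e n)) \<longlonglongrightarrow> t"
  proof (rule tendsto_sandwich[OF _ _ l tendsto_const])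
    show "\<forall>\<^sub>F n in sequentially. t - (1/2) ^ n \<le> max 0 (e n)"
      using ge by (intro always_eventually allI) (simp add: le_max_iff_disj)
    show "\<forall>\<^sub>F n in sequentially. max 0 (e n) \<le> t"
      using lt assms by (intro always_eventually allI) (simp add: less_imp_le)
  qed
  moreover have "\<forall>\<^sub>F n in sequentially. max 0 (e n) \<in> {..<t} \<and> max 0 (e n) \<noteq> t"
    by (rule always_eventually) (rule allI, rule ev)
  ultimately show ?thesis unfolding filterlim_at e_def[symmetric] by (rule conjI[rotated])
qed

text \<open>The mirror image: floor plus one gives a dyadic number strictly after \<open>s\<close>.
  The cut at \<open>t\<close> keeps the approximation observable at time \<open>t\<close>.\<close>

lemma dyadic_right:
  fixes s t :: real
  assumes "0 \<le> s" "s < t" "t \<le> T"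
  shows "filterlim (\<lambda>n. max 0 (min t ((of_int \<lfloor>2 ^ n * s\<rfloor> + 1) / 2 ^ n))) (at s within {0..T} \<inter> {s<..}) sequentially"
proof -
  define e :: "nat \<Rightarrow> real" where "e n = (of_int \<lfloor>2 ^ n * s\<rfloor> + 1) / 2 ^ n" for n
  have lt: "s < e n" for n
    using floor_correct[of "2 ^ n * s"] unfolding e_def by (simp add: pos_less_divide_eq mult.commute)
  have ge: "e n \<le> s + (1/2) ^ n" for n
  proof -
    have "of_int \<lfloor>2 ^ n * s\<rfloor> / 2 ^ n \<le> s"
      using floor_correct[of "2 ^ n * s"] by (simp add: pos_divide_le_eq mult.commute)
    then show ?thesis unfolding e_def by (simp add: add_divide_distrib power_divide)
  qed
  have ev: "max 0 (min t (e n)) \<in> {0..T} \<inter> {s<..} \<and> max 0 (min t (e n)) \<noteq> s" for n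
    using lt[of n] assms by auto
  have "(\<lambda>n. s + (1/2) ^ n) \<longlonglongrightarrow> s + 0" by (intro tendsto_intros LIMSEQ_realpow_zero) auto
  then have l: "(\<lambda>n. s + (1/2) ^ n) \<longlonglongrightarrow> s" by simp
  have "(\<lambda>n. max 0 (min t (e n))) \<longlonglongrightarrow> s"
  proof (rule tendsto_sandwich[OF _ _ tendsto_const l])
    show "\<forall>\<^sub>F n in sequentially. s \<le> max 0 (min t (e n))"
      using lt assms by (intro always_eventually allI) (simp add: less_imp_le le_max_iff_disj)
    show "\<forall>\<^sub>F n in sequentially. max 0 (min t (e n)) \<le> s + (1/2) ^ n"
      using ge assms by (intro always_eventually allI) (simp add: min_le_iff_disj)
  qed
  moreover have "\<forall>\<^sub>F n in sequentially. max 0 (min t (e n)) \<in> {0..T} \<inter> {s<..} \<and> max 0 (min t (e n)) \<noteq> s"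
    by (rule always_eventually) (rule allI, rule ev)
  ultimately show ?thesis unfolding filterlim_at e_def[symmetric] by (rule conjI[rotated])
qed

text \<open>A step process that at time t shows a value of \<open>X\<close> from a strictly earlier
  dyadic time is predictable, and so is the limit of such processes. Existence of left limits is not
  assumed; the second conclusion speaks only where the limit exists.\<close>

lemma left_limit_predictable:
  assumes X: "\<And>t. t \<in> {0..T} \<Longrightarrow> (\<lambda>w. X w t) \<in> borel_measurable (F t)"
  obtains X' :: "'w \<Rightarrow> real \<Rightarrow> real" where "predictable_process M F T X'"
    "\<And>w t l. 0 < t \<Longrightarrow> (X w \<longlongrightarrow> l) (at_left t) \<Longrightarrow> X' w t = l"
proof -
  define u where "u n k = max 0 ((of_int k - 1) / 2 ^ n :: real)" for n :: nat and k :: int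
  \<comment> \<open>At a time t > 0 the process \<open>Xn\<close> uses k = ceiling (2^n t), for
    which \<open>u n k\<close> lies strictly before t and the indicator is 1. The indicator serves
    to make each single \<open>f n k\<close> predictable.\<close>
  define f where "f n k = (\<lambda>(w, t). indicator {u n k<..} t * X w (u n k))" for n k
  define Xn where "Xn n = (\<lambda>(w, t). f n \<lceil>2 ^ n * t\<rceil> (w, t))" for n
  have f: "f n k \<in> borel_measurable Prd" for n k
  proof (cases "u n k \<le> T")
    case True
    then show ?thesis unfolding f_def by (intro measurable_after_Prd X) (auto simp: u_def)
  next
    case False
    then have "f n k x = 0" if "x \<in> space Prd" for x
      using that by (auto simp: f_def space_Prd indicator_def split: prod.splits)
    then show ?thesis by (subst measurable_cong[where g="\<lambda>_. 0"]) auto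
  qed
  have Xn: "Xn n \<in> borel_measurable Prd" for n
  proof -
    have "(\<lambda>x. f n \<lceil>2 ^ n * snd x\<rceil> x) \<in> borel_measurable Prd"
      by (rule measurable_compose_countable[OF f])
        (use measurable_snd_Prd in measurable)
    then show ?thesis unfolding Xn_def by (simp add: split_beta')
  qed
  define X' where "X' w t = lim (\<lambda>n. Xn n (w, t))" for w t
  have "(\<lambda>x. lim (\<lambda>n. Xn n x)) \<in> borel_measurable Prd"
    by (rule borel_measurable_lim_metric) (rule Xn)
  then have "predictable_process M F T X'"
    unfolding predictable_process_def X'_def by (simp add: split_beta')
  moreover have "X' w t = l" if "0 < t" "(X w \<longlongrightarrow> l) (at_left t)" for w t l
  proof -
    have "(\<lambda>n. X w (max 0 ((of_int \<lceil>2 ^ n * t\<rceil> - 1) / 2 ^ n))) \<longlonglongrightarrow> l"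
      using filterlim_compose[OF that(2) dyadic_left[OF that(1)]] .
    moreover have "Xn n (w, t) = X w (max 0 ((of_int \<lceil>2 ^ n * t\<rceil> - 1) / 2 ^ n))" for n
    proof -
      have "(of_int \<lceil>2 ^ n * t\<rceil> - 1) / 2 ^ n < t"
        using ceiling_correct[of "2 ^ n * t"] by (simp add: pos_divide_less_eq mult.commute)
      then show ?thesis using that(1) unfolding Xn_def f_def u_def by auto
    qed
    ultimately show ?thesis unfolding X'_def by (simp add: limI)
  qed
  ultimately show ?thesis using that by blast
qed

text \<open>Approximation from the right by dyadic times cut at \<open>t\<close>: up to time
  \<open>t\<close> only values known at \<open>t\<close> enter, and right continuity of every path
  gives the limit.\<close>

lemma cadlag_progressive:
  assumes X: "cadlag_adapted (space M) F {0..T} X" and t: "t \<in> {0..T}"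
  shows "(\<lambda>(w, s). X w (max 0 (min t s))) \<in> borel_measurable (F t \<Otimes>\<^sub>M borel)"
proof -
  define f where "f n = (\<lambda>p :: 'w \<times> real. X (fst p) (max 0 (min t ((of_int \<lfloor>2 ^ n * snd p\<rfloor> + 1) / 2 ^ n))))" for n :: nat
  have f: "f n \<in> borel_measurable (F t \<Otimes>\<^sub>M borel)" for n
    unfolding f_def
  proof (rule measurable_compose_countable[where g="\<lambda>p. \<lfloor>2 ^ n * snd p\<rfloor>" and f="\<lambda>k p. X (fst p) (max 0 (min t ((of_int k + 1) / 2 ^ n)))"])
    fix k :: int
    let ?v = "max 0 (min t ((of_int k + 1) / 2 ^ n)) :: real"
    have "?v \<in> {0..T}" "?v \<le> t" using t by auto
    then have "(\<lambda>w. X w ?v) \<in> borel_measurable (F t)"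
      using X measurable_F_mono[of _ ?v borel t] unfolding cadlag_adapted_def by blast
    then show "(\<lambda>p. X (fst p) ?v) \<in> borel_measurable (F t \<Otimes>\<^sub>M borel)"
      by (rule measurable_compose[OF measurable_fst])
  qed measurable
  have "(\<lambda>p. X (fst p) (max 0 (min t (snd p)))) \<in> borel_measurable (F t \<Otimes>\<^sub>M borel)"
  proof (rule borel_measurable_LIMSEQ_metric[OF f])
    fix p :: "'w \<times> real" assume "p \<in> space (F t \<Otimes>\<^sub>M borel)"
    then have w: "fst p \<in> space M" by (auto simp: space_pair_measure space_F)
    show "(\<lambda>n. f n p) \<longlonglongrightarrow> X (fst p) (max 0 (min t (snd p)))"
    proof (cases "0 \<le> snd p \<and> snd p < t")
      case True
      then have s: "snd p \<in> {0..T}" "t \<le> T" using t by auto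
      have "(X (fst p) \<longlongrightarrow> X (fst p) (snd p)) (at (snd p) within {0..T} \<inter> {snd p<..})"
        using X w s unfolding cadlag_adapted_def by blast
      from filterlim_compose[OF this dyadic_right[of "snd p" t]] True s
      show ?thesis unfolding f_def by simp
    next
      case False
      have "f n p = X (fst p) (max 0 (min t (snd p)))" for n
      proof (cases "snd p < 0")
        case True
        then have "2 ^ n * snd p < 0" by (simp add: mult_pos_neg)
        then have "\<lfloor>2 ^ n * snd p\<rfloor> + 1 \<le> 0" by linarith
        then have "(of_int \<lfloor>2 ^ n * snd p\<rfloor> + 1) / 2 ^ n \<le> (0::real)"
          by (metis divide_nonpos_pos of_int_1 of_int_add of_int_le_0_iff zero_less_numeral zero_less_power)
        then have "max 0 (min t ((of_int \<lfloor>2 ^ n * snd p\<rfloor> + 1) / 2 ^ n)) = 0"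
          by (intro max_absorb1) (simp add: min_le_iff_disj)
        moreover have "max 0 (min t (snd p)) = 0" using True by (intro max_absorb1) (simp add: min_le_iff_disj)
        ultimately show ?thesis unfolding f_def by simp
      next
        case F: False
        then have "t \<le> snd p" using False by auto
        moreover have "snd p < (of_int \<lfloor>2 ^ n * snd p\<rfloor> + 1) / 2 ^ n"
          using floor_correct[of "2 ^ n * snd p"] by (simp add: pos_less_divide_eq mult.commute)
        ultimately show ?thesis unfolding f_def by (simp add: min_absorb1)
      qed
      then show ?thesis by simp
    qed
  qed
  then show ?thesis by (simp add: split_beta')
qed

text \<open>Brings optional sets into the product \<sigma>-algebra at each time, where the
  projection theorem applies.\<close>

lemma optional_progressive:
  assumes "E \<in> sets Opt" and t: "t \<in> {0..T}"
  shows "E \<inter> (space M \<times> {0..t}) \<in> sets (F t \<Otimes>\<^sub>M borel)"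
  using assms(1) unfolding sets_Opt
proof induction
  case (Basic E)
  then obtain X B where X: "E = {(w, t) \<in> space M \<times> {0..T}. X w t \<in> B}"
    "cadlag_adapted (space M) F {0..T} X" "B \<in> sets borel" by auto
  let ?g = "\<lambda>(w, s). X w (max 0 (min t s))"
  have "E \<inter> (space M \<times> {0..t}) = (?g -` B \<inter> space (F t \<Otimes>\<^sub>M borel)) \<inter> (space M \<times> {0..t})"
    using t unfolding X(1) by (auto simp: space_pair_measure space_F)
  also have "\<dots> \<in> sets (F t \<Otimes>\<^sub>M borel)"
    by (rule sets.Int[OF measurable_sets[OF cadlag_progressive[OF X(2) t] X(3)] pair_measureI])
      (use sets.top[of "F t"] in \<open>auto simp: space_F\<close>)
  finally show ?case .
next
  case (Compl E)
  have "(space M \<times> {0..T} - E) \<inter> (space M \<times> {0..t}) = space M \<times> {0..t} - E \<inter> (space M \<times> {0..t})"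
    using t by auto
  then show ?case using Compl sets.top[of "F t"] by (auto simp: space_F intro!: sets.Diff pair_measureI)
next
  case (Union E)
  have "(\<Union>i. E i) \<inter> (space M \<times> {0..t}) = (\<Union>i. E i \<inter> (space M \<times> {0..t}))" by auto
  also have "\<dots> \<in> sets (F t \<Otimes>\<^sub>M borel)" using Union.IH by (intro sets.countable_UN) auto
  finally show ?case .
qed auto

lemma optional_cadlag:
  assumes "cadlag_adapted (space M) F {0..T} X" shows "optional_process M F T X"
  unfolding optional_process_def
proof (rule measurableI)
  fix B :: "real set" assume "B \<in> sets borel"
  then have "{(w, t) \<in> space M \<times> {0..T}. X w t \<in> B} \<in> sets Opt"
    using assms unfolding sets_Opt by (intro sigma_sets.Basic) auto
  also have "{(w, t) \<in> space M \<times> {0..T}. X w t \<in> B} = (\<lambda>(w, t). X w t) -` B \<inter> space Opt"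
    by (auto simp: space_Opt)
  finally show "(\<lambda>(w, t). X w t) -` B \<inter> space Opt \<in> sets Opt" .
qed simp

lemma Opt_from:
  assumes B: "B \<in> sets (F u)" and u: "0 \<le> u"
  shows "B \<times> {u..T} \<in> sets Opt"
proof -
  define X where "X w t = (indicator B w * indicator {u..} t :: real)" for w t
  have "cadlag_adapted (space M) F {0..T} X"
    unfolding cadlag_adapted_def
  proof (intro conjI ballI impI)
    fix t assume t: "t \<in> {0..T}"
    show "(\<lambda>w. X w t) \<in> borel_measurable (F t)"
    proof (cases "u \<le> t")
      case True
      then have "B \<in> sets (F t)" using B sets_F_mono[of u t] by auto
      then show ?thesis unfolding X_def by (intro borel_measurable_times borel_measurable_indicator) auto
    next
      case False then show ?thesis unfolding X_def by simp
    qed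
  next
    fix w t assume "t \<in> {0..T}"
    have "\<forall>\<^sub>F s in at t within {0..T} \<inter> {t<..}. X w s = X w t"
    proof (cases "u \<le> t")
      case True
      then show ?thesis unfolding X_def eventually_at by (auto intro!: exI[of _ 1])
    next
      case False
      then show ?thesis unfolding X_def eventually_at by (auto simp: dist_real_def intro!: exI[of _ "u - t"])
    qed
    then show "(X w \<longlongrightarrow> X w t) (at t within {0..T} \<inter> {t<..})" by (rule tendsto_eventually)
  next
    fix w t assume "t \<in> {0..T}" "0 < t"
    have "\<forall>\<^sub>F s in at_left t. X w s = (if u < t then indicator B w else 0)"
    proof (cases "u < t")
      case True
      then show ?thesis unfolding X_def eventually_at by (auto simp: dist_real_def intro!: exI[of _ "t - u"])
    next
      case False
      then show ?thesis unfolding X_def eventually_at by (auto intro!: exI[of _ 1])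
    qed
    then show "\<exists>l. (X w \<longlongrightarrow> l) (at_left t)" by (intro exI tendsto_eventually)
  qed
  then have X: "(\<lambda>(w, t). X w t) \<in> borel_measurable Opt" using optional_cadlag unfolding optional_process_def by blast
  have "B \<times> {u..T} = (\<lambda>(w, t). X w t) -` {1} \<inter> space Opt"
    using sets.sets_into_space[OF B] u by (auto simp: X_def space_Opt space_F split: split_indicator split_indicator_asm)
  then show ?thesis using measurable_sets[OF X, of "{1}"] by simp
qed

lemma Opt_after:
  assumes B: "B \<in> sets (F u)" and u: "0 \<le> u"
  shows "B \<times> {u<..T} \<in> sets Opt"
proof -
  have "B \<times> {u<..T} = (\<Union>n. B \<times> {u + 1 / real (Suc n)..T})"
  proof (intro equalityI subsetI)
    fix p assume p: "p \<in> B \<times> {u<..T}"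
    then have "0 < snd p - u" by auto
    then obtain n where "1 / real (Suc n) < snd p - u" using nat_approx_posE by metis
    then show "p \<in> (\<Union>n. B \<times> {u + 1 / real (Suc n)..T})" using p by (auto intro!: exI[of _ n])
  next
    fix p assume "p \<in> (\<Union>n. B \<times> {u + 1 / real (Suc n)..T})"
    then obtain n where n: "p \<in> B \<times> {u + 1 / real (Suc n)..T}" by blast
    define d where "d = 1 / real (Suc n)"
    have "0 < d" "p \<in> B \<times> {u + d..T}" using n by (simp_all add: d_def)
    then show "p \<in> B \<times> {u<..T}" by auto
  qed
  moreover have "B \<times> {u + 1 / real (Suc n)..T} \<in> sets Opt" for n
    using B u sets_F_mono[of u "u + 1 / real (Suc n)"] by (intro Opt_from) auto
  ultimately show ?thesis by auto
qed

lemma predictable_optional: "E \<in> sets Prd \<Longrightarrow> E \<in> sets Opt"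
  unfolding sets_Prd
proof (induction rule: sigma_sets.induct)
  case (Basic E)
  then show ?case
  proof
    assume "E \<in> {B \<times> {0} |B. B \<in> sets (F 0)}"
    then obtain B where B: "E = B \<times> {0}" "B \<in> sets (F 0)" by auto
    have "E = B \<times> {0..T} - B \<times> {0<..T}" using B T_pos by auto
    then show ?thesis using Opt_from[OF B(2)] Opt_after[OF B(2)] by auto
  next
    assume "E \<in> {B \<times> {s<..t} |B s t. 0 \<le> s \<and> s \<le> t \<and> t \<in> {0..T} \<and> B \<in> sets (F s)}"
    then obtain B s t where B: "E = B \<times> {s<..t}" "0 \<le> s" "s \<le> t" "t \<le> T" "B \<in> sets (F s)" by auto
    then have "E = B \<times> {s<..T} - B \<times> {t<..T}" "B \<in> sets (F t)" using sets_F_mono[of s t] by auto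
    then show ?thesis using Opt_after[OF B(5)] Opt_after[of B t] B(2,3) by auto
  qed
next
  case (Compl E)
  then show ?case using sets.compl_sets[of E Opt] by (simp add: space_Opt)
qed auto

lemma measurable_Prd_Opt: "f \<in> measurable Prd N \<Longrightarrow> f \<in> measurable Opt N"
  using predictable_optional unfolding measurable_def space_Prd space_Opt by auto

lemma predictable_process_optional: "predictable_process M F T X \<Longrightarrow> optional_process M F T X"
  unfolding predictable_process_def optional_process_def by (rule measurable_Prd_Opt)

lemma optional_adapted:
  assumes X: "optional_process M F T X" and t: "t \<in> {0..T}"
  shows "(\<lambda>w. X w t) \<in> borel_measurable (F t)"
proof (rule measurableI)
  fix B :: "real set" assume "B \<in> sets borel"
  then have "(\<lambda>(w, t). X w t) -` B \<inter> space Opt \<in> sets Opt"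
    using X measurable_sets unfolding optional_process_def by blast
  from optional_progressive[OF this t]
  have "(\<lambda>w. (w, t)) -` ((\<lambda>(w, t). X w t) -` B \<inter> space Opt \<inter> (space M \<times> {0..t})) \<in> sets (F t)"
    by (rule sets_Pair2)
  also have "(\<lambda>w. (w, t)) -` ((\<lambda>(w, t). X w t) -` B \<inter> space Opt \<inter> (space M \<times> {0..t})) = (\<lambda>w. X w t) -` B \<inter> space (F t)"
    using t by (auto simp: space_Opt space_F)
  finally show "(\<lambda>w. X w t) -` B \<inter> space (F t) \<in> sets (F t)" .
qed simp

lemma optional_at_stopping_time:
  assumes X: "optional_process M F T X" and \<tau>: "\<tau> \<in> stopping_times M F T S"
  shows "(\<lambda>w. X w (\<tau> w)) \<in> borel_measurable (pre_sigma \<tau>)"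
proof (rule measurableI)
  fix B :: "real set" assume B: "B \<in> sets borel"
  note \<tau>' = stopping_timesD[OF \<tau>]
  show "(\<lambda>w. X w (\<tau> w)) -` B \<inter> space (pre_sigma \<tau>) \<in> sets (pre_sigma \<tau>)"
  proof (rule sets_pre_sigmaI[OF \<tau>'(1)])
    fix t
    \<comment> \<open>The process is indexed by [0,T] and \<open>\<tau>\<close> exceeds
      \<open>T\<close> only on a null set. Events at time \<open>t\<close> are therefore read at
      time \<open>t'\<close> and corrected by completeness.\<close>
    define t' where "t' = min t T"
    show "{w \<in> (\<lambda>w. X w (\<tau> w)) -` B \<inter> space (pre_sigma \<tau>). \<tau> w \<le> t} \<in> sets (F t)"
    proof (cases "0 \<le> t")
      case False
      then have "{w \<in> (\<lambda>w. X w (\<tau> w)) -` B \<inter> space (pre_sigma \<tau>). \<tau> w \<le> t} = {}"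
        using \<tau>'(2) by (fastforce simp: space_pre_sigma)
      then show ?thesis by (metis sets.empty_sets)
    next
      case True
      then have t': "t' \<in> {0..T}" "t' \<le> t" using T_pos by (auto simp: t'_def)
      have E: "(\<lambda>(w, t). X w t) -` B \<inter> space Opt \<in> sets Opt"
        using X B measurable_sets unfolding optional_process_def by blast
      have m: "(\<lambda>w. (w, max 0 (min t' (\<tau> w)))) \<in> F t' \<rightarrow>\<^sub>M F t' \<Otimes>\<^sub>M borel"
      proof (rule measurable_Pair)
        have "(\<lambda>w. min t' (\<tau> w)) \<in> borel_measurable (F t')"
        proof (rule borel_measurableI_le)
          fix c
          have "{w \<in> space (F t'). min t' (\<tau> w) \<le> c} = (if t' \<le> c then space (F t') else {w \<in> space (F c). \<tau> w \<le> c})"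
            by (auto simp: space_F)
          moreover have "{w \<in> space (F c). \<tau> w \<le> c} \<in> sets (F t')" if "c \<le> t'"
            using stopping_timeD[OF \<tau>'(1), of c] sets_F_mono[OF that] by (auto simp: pred_def)
          ultimately show "{w \<in> space (F t'). min t' (\<tau> w) \<le> c} \<in> sets (F t')" by auto
        qed
        then show "(\<lambda>w. max 0 (min t' (\<tau> w))) \<in> borel_measurable (F t')" by simp
      qed simp
      let ?E = "(\<lambda>(w, t). X w t) -` B \<inter> space Opt \<inter> (space M \<times> {0..t'})"
      have 1: "(\<lambda>w. (w, max 0 (min t' (\<tau> w)))) -` ?E \<inter> space (F t') \<in> sets (F t')"
        by (rule measurable_sets[OF m optional_progressive[OF E t'(1)]])
      have 2: "{w \<in> space (F t'). \<tau> w \<le> t'} \<in> sets (F t')"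
        using stopping_timeD[OF \<tau>'(1), of t'] by (auto simp: pred_def)
      have 3: "((\<lambda>w. (w, max 0 (min t' (\<tau> w)))) -` ?E \<inter> space (F t')) \<inter> {w \<in> space (F t'). \<tau> w \<le> t'} \<in> sets (F t)"
        using sets.Int[OF 1 2] sets_F_mono[OF t'(2)] by blast
      show ?thesis
      proof (rule sets_F_AE[OF True 3])
        show "AE w in M. (w \<in> {w \<in> (\<lambda>w. X w (\<tau> w)) -` B \<inter> space (pre_sigma \<tau>). \<tau> w \<le> t}) =
          (w \<in> ((\<lambda>w. (w, max 0 (min t' (\<tau> w)))) -` ?E \<inter> space (F t')) \<inter> {w \<in> space (F t'). \<tau> w \<le> t'})"
          using \<tau>'(3) AE_space
        proof eventually_elim
          case (elim w)
          then have "\<tau> w \<le> t \<longleftrightarrow> \<tau> w \<le> t'" unfolding t'_def by auto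
          moreover have "max 0 (min t' (\<tau> w)) = \<tau> w" if "\<tau> w \<le> t'" using that elim by auto
          ultimately show ?case using elim by (auto simp: space_pre_sigma space_F space_Opt)
        qed
      qed (auto simp: space_pre_sigma)
    qed
  qed
qed simp

lemma optional_at_stopping_time_M:
  assumes X: "optional_process M F T X" and \<tau>: "\<tau> \<in> stopping_times M F T S"
  shows "(\<lambda>w. X w (\<tau> w)) \<in> borel_measurable M"
  using measurable_from_subalg[OF subalgebra_pre_sigma[OF stopping_timesD(1)[OF \<tau>]] optional_at_stopping_time[OF X \<tau>]] .

text \<open>The optional \<sigma>-algebra is generated by processes all of whose paths are regular,
  but regularity is available only almost surely. Exceptional paths are set to zero, and
  completeness preserves adaptedness.\<close>

lemma cadlag_modification:
  assumes ad: "\<And>t. t \<in> {0..T} \<Longrightarrow> (\<lambda>w. X w t) \<in> borel_measurable (F t)"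
    and r: "AE w in M. \<forall>t\<in>{0..<T}. (X w \<longlongrightarrow> X w t) (at_right t)"
    and l: "AE w in M. \<forall>t\<in>{0<..T}. \<exists>l. (X w \<longlongrightarrow> l) (at_left t)"
  obtains X' where "cadlag_adapted (space M) F {0..T} X'" "AE w in M. X' w = X w"
proof -
  define G where "G w \<longleftrightarrow> (\<forall>t\<in>{0..<T}. (X w \<longlongrightarrow> X w t) (at_right t)) \<and> (\<forall>t\<in>{0<..T}. \<exists>l. (X w \<longlongrightarrow> l) (at_left t))" for w
  define X' where "X' w = (if G w then X w else (\<lambda>_. 0))" for w
  have AE: "AE w in M. X' w = X w" using r l unfolding X'_def G_def by eventually_elim auto
  moreover have "cadlag_adapted (space M) F {0..T} X'"
    unfolding cadlag_adapted_def
  proof (intro conjI ballI impI)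
    fix t assume "t \<in> {0..T}"
    then show "(\<lambda>w. X' w t) \<in> borel_measurable (F t)"
      using AE by (intro measurable_F_AE[OF _ ad[of t]]) (auto elim: eventually_mono)
  next
    fix w t assume t: "t \<in> {0..T}"
    show "(X' w \<longlongrightarrow> X' w t) (at t within {0..T} \<inter> {t<..})"
    proof (cases "t = T")
      case True
      then have "{0..T} \<inter> {t<..} = {}" by auto
      then show ?thesis by simp
    next
      case False
      then have "G w \<Longrightarrow> (X w \<longlongrightarrow> X w t) (at_right t)" using t unfolding G_def by auto
      then have "G w \<Longrightarrow> (X w \<longlongrightarrow> X w t) (at t within {0..T} \<inter> {t<..})"
        by (auto intro: tendsto_within_subset)
      then show ?thesis unfolding X'_def by auto
    qed
  next
    fix w t assume t: "t \<in> {0..T}" "0 < t"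
    then show "\<exists>l. (X' w \<longlongrightarrow> l) (at_left t)" unfolding X'_def G_def by auto
  qed
  ultimately show ?thesis using that by blast
qed

end

section \<open>Debuts and sections\<close>

context usual_filtration
begin

lemma complete_restr: "0 \<le> t \<Longrightarrow> complete_measure (restr_to_subalg M (F t))"
  using null_sets_F by (intro restr_to_subalg_complete subalgebra_F complete_measure_axioms) blast

lemma projection_F:
  fixes a b :: real
  assumes E: "E \<in> sets (F t \<Otimes>\<^sub>M borel)" and sub: "E \<subseteq> space M \<times> {a..b}" and t: "0 \<le> t"
  shows "fst ` E \<in> sets (F t)"
proof -
  let ?Q = "restr_to_subalg M (F t)"
  have s: "sets ?Q = sets (F t)" by (rule sets_restr_to_subalg[OF subalgebra_F])
  have "fst ` E \<in> sets ?Q"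
  proof (rule measurable_projection)
    show "finite_measure ?Q" by (rule finite_measure_restr_to_subalg[OF subalgebra_F]) (simp add: emeasure_finite less_top)
    show "complete_measure ?Q" by (rule complete_restr[OF t])
    show "E \<in> sets (?Q \<Otimes>\<^sub>M borel)" using E sets_pair_measure_cong[OF s refl[of "sets (borel :: real measure)"]] by simp
    show "E \<subseteq> space ?Q \<times> {a..b}" using sub by (simp add: space_restr_to_subalg)
  qed
  then show ?thesis using s by simp
qed

text \<open>The value \<open>T + 1\<close> on empty sections lies outside the time set, so that
  comparing the debut with \<open>T\<close> decides whether the section is empty.\<close>

definition debut :: "('w \<times> real) set \<Rightarrow> 'w \<Rightarrow> real" where
  "debut E w = (if w \<in> fst ` E then Inf {t. (w, t) \<in> E} else T + 1)"

lemma debut_bounds: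
  assumes "E \<subseteq> space M \<times> {0..T}"
  shows "0 \<le> debut E w" "w \<in> fst ` E \<Longrightarrow> debut E w \<le> T"
    "(w, t) \<in> E \<Longrightarrow> debut E w \<le> t"
proof -
  have bd: "bdd_below {t. (w, t) \<in> E}" using assms by (auto intro!: bdd_belowI[of _ 0])
  show "0 \<le> debut E w" unfolding debut_def using T_pos assms by (auto intro!: cInf_greatest)
  show le: "(w, t) \<in> E \<Longrightarrow> debut E w \<le> t" for t
    unfolding debut_def using bd by (force intro!: cInf_lower)
  show "debut E w \<le> T" if "w \<in> fst ` E"
  proof -
    from that obtain t where "(w, t) \<in> E" by auto
    then show ?thesis using le[of t] assms by auto
  qed
qed

lemma debut_lessD:
  assumes "w \<in> fst ` E" "debut E w < c"
  shows "\<exists>s. (w, s) \<in> E \<and> s < c"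
proof -
  from assms(1) obtain t where "(w, t) \<in> E" by (rule imageE) (metis prod.collapse)
  then have ne: "{t. (w, t) \<in> E} \<noteq> {}" by blast
  have "Inf {t. (w, t) \<in> E} < c" using assms unfolding debut_def by (simp only: if_True)
  from cInf_lessD[OF ne this] show ?thesis by (simp add: Bex_def)
qed

lemma debut_less_iff:
  assumes "E \<subseteq> space M \<times> {0..T}" "t \<le> T"
  shows "debut E w < t \<longleftrightarrow> (\<exists>s<t. (w, s) \<in> E)"
proof
  assume l: "debut E w < t"
  then have m: "w \<in> fst ` E" using assms(2) unfolding debut_def by (auto split: if_splits)
  from debut_lessD[OF m l] show "\<exists>s<t. (w, s) \<in> E" by (simp add: conj_commute)
next
  assume "\<exists>s<t. (w, s) \<in> E"
  then show "debut E w < t" using debut_bounds(3)[OF assms(1)] by (auto intro: order.strict_trans1)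
qed

text \<open>The infimum need not be attained, so the projection theorem describes the event that the
  debut is strictly less than s. Right continuity of the filtration turns this into the event with
  the weak inequality; from \<open>T\<close> on the only further value is
  \<open>T + 1\<close>.\<close>

lemma stopping_time_debut:
  assumes sub: "E \<subseteq> space M \<times> {0..T}"
    and prog: "\<And>t. t \<in> {0..T} \<Longrightarrow> E \<inter> (space M \<times> {0..t}) \<in> sets (F t \<Otimes>\<^sub>M borel)"
  shows "stopping_time F (debut E)"
proof
  fix t
  have less: "{w \<in> space M. debut E w < s} \<in> sets (F s)" if s: "s \<in> {0..T}" for s
  proof -
    have "{w \<in> space M. debut E w < s} = fst ` (E \<inter> (space M \<times> {0..s}) \<inter> (space M \<times> {0..<s}))"
    proof (intro equalityI subsetI)
      fix w assume "w \<in> {w \<in> space M. debut E w < s}"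
      then obtain u where u: "u < s" "(w, u) \<in> E" "w \<in> space M" using debut_less_iff[OF sub, of s] s by auto
      then have "(w, u) \<in> E \<inter> (space M \<times> {0..s}) \<inter> (space M \<times> {0..<s})" using sub by auto
      then show "w \<in> fst ` (E \<inter> (space M \<times> {0..s}) \<inter> (space M \<times> {0..<s}))" by (rule image_eqI[rotated]) simp
    next
      fix w assume "w \<in> fst ` (E \<inter> (space M \<times> {0..s}) \<inter> (space M \<times> {0..<s}))"
      then show "w \<in> {w \<in> space M. debut E w < s}" using debut_less_iff[OF sub, of s] s by auto
    qed
    moreover have "E \<inter> (space M \<times> {0..s}) \<inter> (space M \<times> {0..<s}) \<in> sets (F s \<Otimes>\<^sub>M borel)"
      using sets.top[of "F s"] by (intro sets.Int[OF prog[OF s]] pair_measureI) (auto simp: space_F)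
    ultimately show ?thesis using s by (auto intro!: projection_F[where a=0 and b=s])
  qed
  have "{w \<in> space M. debut E w \<le> t} \<in> sets (F t)"
  proof (cases "t < 0")
    case True
    then have "{w \<in> space M. debut E w \<le> t} = {}" using debut_bounds(1)[OF sub] by (auto simp: not_le intro: order.strict_trans2)
    then show ?thesis by (metis sets.empty_sets)
  next
    case t0: False
    show ?thesis
    proof (cases "t < T")
      case True
      show ?thesis
      proof (rule sets_F_right)
        fix s assume s: "t < s"
        define r where "r n = min s (min T (t + 1 / real (Suc n)))" for n
        have r: "t < r n" "r n \<le> s" "r n \<in> {0..T}" for n using s True t0 by (auto simp: r_def)
        have "{w \<in> space M. debut E w \<le> t} = (\<Inter>n. {w \<in> space M. debut E w < r n})"
        proof (intro equalityI subsetI)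
          fix w assume u: "w \<in> (\<Inter>n. {w \<in> space M. debut E w < r n})"
          have "debut E w \<le> t"
          proof (rule ccontr)
            assume "\<not> debut E w \<le> t"
            then have "0 < debut E w - t" by simp
            then obtain n where n: "1 / real (Suc n) < debut E w - t" using nat_approx_posE by metis
            have "debut E w < r n" using u by blast
            then show False using n unfolding r_def by auto
          qed
          then show "w \<in> {w \<in> space M. debut E w \<le> t}" using u by auto
        qed (use r(1) in \<open>auto intro: order.strict_trans1\<close>)
        moreover have "{w \<in> space M. debut E w < r n} \<in> sets (F s)" for n
          using less[OF r(3)] sets_F_mono[OF r(2)] by blast
        ultimately show "{w \<in> space M. debut E w \<le> t} \<in> sets (F s)"
          by (simp only:) (rule sets.countable_INT', auto)
      qed (use t0 in simp)
    next
      case False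
      show ?thesis
      proof (cases "t < T + 1")
        case True
        have "{w \<in> space M. debut E w \<le> t} = fst ` E"
        proof (intro equalityI subsetI)
          fix w assume "w \<in> {w \<in> space M. debut E w \<le> t}"
          then show "w \<in> fst ` E" using True by (auto simp: debut_def split: if_splits)
        next
          fix w assume "w \<in> fst ` E"
          then show "w \<in> {w \<in> space M. debut E w \<le> t}" using debut_bounds(2)[OF sub] sub False by fastforce
        qed
        moreover have "E \<inter> (space M \<times> {0..T}) = E" using sub by auto
        then have "fst ` E \<in> sets (F T)" using prog[of T] sub T_pos by (intro projection_F[where a=0 and b=T]) auto
        ultimately show ?thesis using sets_F_mono[of T t] False by auto
      next
        case F: False
        have "debut E w \<le> t" for w
        proof (cases "w \<in> fst ` E")
          case True
          then show ?thesis using debut_bounds(2)[OF sub True] F by linarith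
        next
          case False
          then show ?thesis using F by (simp add: debut_def)
        qed
        then show ?thesis using sets.top[of "F t"] by (simp add: space_F)
      qed
    qed
  qed
  then show "Measurable.pred (F t) (\<lambda>x. debut E x \<le> t)" by (simp add: pred_def space_F)
qed

lemma stopping_time_debut_optional:
  assumes "E \<in> sets Opt" shows "stopping_time F (debut E)"
  using sets.sets_into_space[OF assms] optional_progressive[OF assms]
  by (intro stopping_time_debut) (auto simp: space_Opt)

lemma debut_min_stopping_times:
  assumes "E \<in> sets Opt" shows "(\<lambda>w. min (debut E w) T) \<in> stopping_times M F T (\<lambda>_. 0)"
proof -
  have sub: "E \<subseteq> space M \<times> {0..T}" using sets.sets_into_space[OF assms] by (simp add: space_Opt)
  show ?thesis unfolding stopping_times_def
    using stopping_time_min[OF stopping_time_debut_optional[OF assms] stopping_time_const[of F T]]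
      debut_bounds(1)[OF sub] T_pos by (auto simp: less_imp_le)
qed

section \<open>Sets whose sections are closed under limits from the right\<close>

definition right_limit :: "('w \<times> real) set \<Rightarrow> 'w \<Rightarrow> real \<Rightarrow> bool" where
  "right_limit H w t \<longleftrightarrow> (\<forall>d>0. \<exists>s. t < s \<and> s < t + d \<and> (w, s) \<in> H)"

text \<open>Exactly the closure needed for a nonempty section to contain its infimum. Closed
  sections would be too much to ask: closed level sets of right-continuous paths with left limits
  need not be closed from the left.\<close>

definition right_closed :: "('w \<times> real) set \<Rightarrow> bool" where
  "right_closed H \<longleftrightarrow> (\<forall>w t. right_limit H w t \<longrightarrow> (w, t) \<in> H)"

lemma right_limit_empty: "\<not> right_limit {} w t"
  unfolding right_limit_def by (metis empty_iff zero_less_one)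

lemma right_limit_mono: "A \<subseteq> B \<Longrightarrow> right_limit A w t \<Longrightarrow> right_limit B w t"
  unfolding right_limit_def by (meson subsetD)

lemma right_limit_Un:
  assumes "right_limit (A \<union> B) w t" shows "right_limit A w t \<or> right_limit B w t"
proof (rule ccontr)
  assume "\<not> ?thesis"
  then obtain d e where d: "d > 0" "\<And>s. t < s \<Longrightarrow> s < t + d \<Longrightarrow> (w, s) \<notin> A"
    and e: "e > 0" "\<And>s. t < s \<Longrightarrow> s < t + e \<Longrightarrow> (w, s) \<notin> B"
    unfolding right_limit_def by meson
  have "0 < min d e" using d(1) e(1) by simp
  then obtain s where "t < s" "s < t + min d e" "(w, s) \<in> A \<union> B"
    using assms unfolding right_limit_def by meson
  then show False using d(2)[of s] e(2)[of s] by (metis UnE add_le_cancel_left less_le_trans min.cobounded1 min.cobounded2)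
qed

lemma right_closed_empty: "right_closed {}"
  unfolding right_closed_def by (simp add: right_limit_empty)

lemma right_closed_Un: "right_closed A \<Longrightarrow> right_closed B \<Longrightarrow> right_closed (A \<union> B)"
  unfolding right_closed_def using right_limit_Un by (metis UnI1 UnI2)

lemma right_closed_UN: "(\<And>i. i < n \<Longrightarrow> right_closed (A i)) \<Longrightarrow> right_closed (\<Union>i<(n::nat). A i)"
proof (induction n)
  case 0 show ?case by (simp add: right_closed_empty)
next
  case (Suc n)
  then have "right_closed ((\<Union>i<n. A i) \<union> A n)" by (intro right_closed_Un) auto
  then show ?case by (simp add: lessThan_Suc Un_commute)
qed

lemma right_closed_INT:
  assumes "\<And>i. right_closed (A i)" shows "right_closed (\<Inter>i. A i)"
  unfolding right_closed_def
proof (intro allI impI INT_I)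
  fix w t i assume "right_limit (\<Inter>i. A i) w t"
  then have "right_limit (A i) w t" by (rule right_limit_mono[rotated]) (rule INT_lower, rule UNIV_I)
  then show "(w, t) \<in> A i" using assms unfolding right_closed_def by (simp only:)
qed

lemma right_closed_debut:
  assumes "right_closed H" "H \<subseteq> space M \<times> {0..T}" "w \<in> fst ` H"
  shows "(w, debut H w) \<in> H"
proof (rule ccontr)
  assume n: "(w, debut H w) \<notin> H"
  have "right_limit H w (debut H w)" unfolding right_limit_def
  proof (intro allI impI)
    fix d :: real assume "0 < d"
    then have "debut H w < debut H w + d" by simp
    from debut_lessD[OF assms(3) this] obtain s where s: "(w, s) \<in> H" "s < debut H w + d" by (elim exE conjE)
    moreover have "debut H w \<le> s" by (rule debut_bounds(3)[OF assms(2) s(1)])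
    moreover have "debut H w \<noteq> s" using s(1) n by (metis)
    ultimately show "\<exists>s. debut H w < s \<and> s < debut H w + d \<and> (w, s) \<in> H" by (intro exI[of _ s]) simp
  qed
  then show False using assms(1) n unfolding right_closed_def by (simp only: not_True_eq_False)
qed

text \<open>Inner regularity of the finite measure \<open>G \<mapsto> P (w \<in> D, (w, R w) \<in> G)\<close> on the optional
  \<open>\<sigma>\<close>-algebra with respect to the optional sets whose sections are closed under limits from
  the right: such sets contain the graphs of their debuts.\<close>

lemma optional_inner_regular:
  assumes D: "D \<in> sets M" and R: "R \<in> borel_measurable M" and E: "E \<in> sets Opt" and e: "0 < e"
  shows "\<exists>H\<in>sets Opt. right_closed H \<and> H \<subseteq> E \<and> prob {w\<in>D. (w, R w) \<in> E - H} < e"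
proof -
  define m where "m G = prob {w\<in>D. (w, R w) \<in> G}" for G
  have meas: "{w\<in>D. (w, R w) \<in> G} \<in> sets M" if "G \<in> sets Opt" for G
  proof -
    have "G \<inter> (space M \<times> {0..T}) = G" using sets.sets_into_space[OF that] by (auto simp: space_Opt)
    then have "G \<in> sets (F T \<Otimes>\<^sub>M borel)" using optional_progressive[OF that, of T] T_pos by auto
    moreover have "(\<lambda>w. (w, R w)) \<in> M \<rightarrow>\<^sub>M F T \<Otimes>\<^sub>M borel"
      using R subalgebra_F[of T] by (intro measurable_Pair) (auto simp: measurable_def subalgebra_def space_F)
    ultimately have "(\<lambda>w. (w, R w)) -` G \<inter> space M \<in> sets M" by (rule measurable_sets[rotated])
    then have "D \<inter> ((\<lambda>w. (w, R w)) -` G \<inter> space M) \<in> sets M" using D by auto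
    moreover have "D \<inter> ((\<lambda>w. (w, R w)) -` G \<inter> space M) = {w\<in>D. (w, R w) \<in> G}"
      using sets.sets_into_space[OF D] by auto
    ultimately show ?thesis by simp
  qed
  \<comment> \<open>Approximation from inside does not pass to complements. In both inductions below
    every set is therefore treated together with its complement in \<open>?W\<close>.\<close>
  define reg where "reg G \<longleftrightarrow> G \<in> sets Opt \<and> (\<forall>e>0. \<exists>H\<in>sets Opt. right_closed H \<and> H \<subseteq> G \<and> m (G - H) < e)" for G
  have m_mono: "m A \<le> m B" if "A \<subseteq> B" "B \<in> sets Opt" for A B
    unfolding m_def using meas[OF that(2)] that(1) by (intro finite_measure_mono) auto
  have sum_bound: "m (\<Union>i. A i) \<le> e" if A: "\<And>i::nat. A i \<in> sets Opt" "\<And>i. m (A i) < e / 2 ^ Suc i" "0 < e" for A e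
  proof -
    have s: "(\<lambda>i. e * (1 / 2) ^ Suc i) sums (e * 1)" by (intro sums_mult power_half_series)
    have bd: "m (A i) \<le> e * (1 / 2) ^ Suc i" for i using A(2)[of i] by (simp add: power_divide)
    have sm: "summable (\<lambda>i. m (A i))"
      by (rule summable_comparison_test[OF _ sums_summable[OF s]])
        (use bd in \<open>auto simp: m_def intro!: exI[of _ 0]\<close>)
    have "{w\<in>D. (w, R w) \<in> (\<Union>i. A i)} = (\<Union>i. {w\<in>D. (w, R w) \<in> A i})" by auto
    then have "m (\<Union>i. A i) \<le> (\<Sum>i. m (A i))"
      unfolding m_def using meas[OF A(1)] sm unfolding m_def
      by (simp add: finite_measure_subadditive_countably image_subset_iff)
    also have "\<dots> \<le> (\<Sum>i. e * (1 / 2) ^ Suc i)" by (intro suminf_le bd sm sums_summable[OF s])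
    finally show ?thesis using s by (simp add: sums_iff)
  qed
  have reg_closed: "reg H" if "H \<in> sets Opt" "right_closed H" for H
    unfolding reg_def using that by (auto intro!: bexI[of _ H] simp: m_def)
  have reg_INT: "reg (\<Inter>i. G i)" if G: "\<And>i::nat. reg (G i)" for G
    unfolding reg_def
  proof (intro conjI allI impI)
    show GO: "(\<Inter>i. G i) \<in> sets Opt" using G unfolding reg_def by auto
    fix e :: real assume e: "0 < e"
    have "\<exists>H. H \<in> sets Opt \<and> right_closed H \<and> H \<subseteq> G i \<and> m (G i - H) < (e/2) / 2 ^ Suc i" for i
      using G[of i] e unfolding reg_def by (metis divide_pos_pos half_gt_zero zero_less_numeral zero_less_power)
    then obtain H where H: "\<And>i. H i \<in> sets Opt" "\<And>i. right_closed (H i)" "\<And>i. H i \<subseteq> G i"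
      "\<And>i. m (G i - H i) < (e/2) / 2 ^ Suc i" by metis
    have GH: "\<And>i. G i - H i \<in> sets Opt" using G H unfolding reg_def by auto
    have "m ((\<Inter>i. G i) - (\<Inter>i. H i)) \<le> m (\<Union>i. G i - H i)"
      using GH by (intro m_mono) auto
    also have "\<dots> \<le> e / 2" using GH H(4) e by (intro sum_bound) auto
    finally have "m ((\<Inter>i. G i) - (\<Inter>i. H i)) < e" using e by simp
    moreover have "(\<Inter>i. H i) \<subseteq> (\<Inter>i. G i)" using H(3) by blast
    ultimately show "\<exists>H\<in>sets Opt. right_closed H \<and> H \<subseteq> (\<Inter>i. G i) \<and> m ((\<Inter>i. G i) - H) < e"
      using H(1) right_closed_INT[OF H(2)] by (intro bexI[of _ "\<Inter>i. H i"]) auto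
  qed
  have reg_UN: "reg (\<Union>i. G i)" if G: "\<And>i::nat. reg (G i)" for G
    unfolding reg_def
  proof (intro conjI allI impI)
    show GO: "(\<Union>i. G i) \<in> sets Opt" using G unfolding reg_def by auto
    fix e :: real assume e: "0 < e"
    have "\<exists>H. H \<in> sets Opt \<and> right_closed H \<and> H \<subseteq> G i \<and> m (G i - H) < (e/4) / 2 ^ Suc i" for i
      using G[of i] e unfolding reg_def
      by (metis divide_pos_pos zero_less_numeral zero_less_power)
    then obtain H where H: "\<And>i. H i \<in> sets Opt" "\<And>i. right_closed (H i)" "\<And>i. H i \<subseteq> G i"
      "\<And>i. m (G i - H i) < (e/4) / 2 ^ Suc i" by metis
    have GO': "G i \<in> sets Opt" for i using G unfolding reg_def by auto
    have GH: "\<And>i. G i - H i \<in> sets Opt" using GO' H by auto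
    \<comment> \<open>A countable union of right-closed sets need not be right-closed, so the union
      is cut at a finite stage. Its remainder costs less than e/4, and the approximations of the
      single sets cost at most e/4 in total.\<close>
    have "(\<lambda>n. m ((\<Union>i. G i) - (\<Union>i<n. G i))) \<longlonglongrightarrow> prob (\<Inter>n. {w\<in>D. (w, R w) \<in> (\<Union>i. G i) - (\<Union>i<n. G i)})"
      unfolding m_def
    proof (rule finite_Lim_measure_decseq)
      have "(\<Union>i. G i) - (\<Union>i<n. G i) \<in> sets Opt" for n :: nat using GO' by auto
      then show "range (\<lambda>n. {w\<in>D. (w, R w) \<in> (\<Union>i. G i) - (\<Union>i<n. G i)}) \<subseteq> sets M" using meas by blast
      show "decseq (\<lambda>n. {w\<in>D. (w, R w) \<in> (\<Union>i. G i) - (\<Union>i<n. G i)})"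
        unfolding decseq_def by fastforce
    qed
    moreover have "(\<Inter>n. {w\<in>D. (w, R w) \<in> (\<Union>i. G i) - (\<Union>i<n. G i)}) = {}" by fastforce
    ultimately have "(\<lambda>n. m ((\<Union>i. G i) - (\<Union>i<n. G i))) \<longlonglongrightarrow> 0" by simp
    then have "\<forall>\<^sub>F n in sequentially. m ((\<Union>i. G i) - (\<Union>i<n. G i)) < e / 4"
      using e by (intro order_tendstoD) auto
    then obtain n where n: "m ((\<Union>i. G i) - (\<Union>i<n. G i)) < e / 4" unfolding eventually_sequentially by blast
    let ?A = "(\<Union>i. G i) - (\<Union>i<n. G i)" and ?B = "\<Union>i. G i - H i"
    have AB: "?A \<in> sets Opt" "?B \<in> sets Opt" using GO' GH by auto
    have "m ((\<Union>i. G i) - (\<Union>i<n. H i)) \<le> m (?A \<union> ?B)"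
      using AB by (intro m_mono) auto
    also have "\<dots> \<le> m ?A + m ?B"
    proof -
      have "{w\<in>D. (w, R w) \<in> ?A \<union> ?B} = {w\<in>D. (w, R w) \<in> ?A} \<union> {w\<in>D. (w, R w) \<in> ?B}" by blast
      then show ?thesis unfolding m_def using measure_Un_le[OF meas[OF AB(1)] meas[OF AB(2)]] by (simp only:)
    qed
    also have "m ?B \<le> e / 4" using GH H(4) e by (intro sum_bound) auto
    finally have "m ((\<Union>i. G i) - (\<Union>i<n. H i)) < e" using e n by linarith
    moreover have "(\<Union>i<n. H i) \<subseteq> (\<Union>i. G i)" using H(3) by blast
    ultimately show "\<exists>H\<in>sets Opt. right_closed H \<and> H \<subseteq> (\<Union>i. G i) \<and> m ((\<Union>i. G i) - H) < e"
      using H(1) right_closed_UN[OF H(2)] by (intro bexI[of _ "\<Union>i<n. H i"]) auto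
  qed
  let ?W = "space M \<times> {0..T}"
  have empty: "reg {}" by (rule reg_closed[OF sets.empty_sets right_closed_empty])
  \<comment> \<open>Right continuity makes level sets of closed sets right-closed. Closed half lines
    then reach all Borel sets through unions, intersections and complements.\<close>
  have closed_reg: "reg {(w, t) \<in> ?W. X w t \<in> C}"
    if X: "cadlag_adapted (space M) F {0..T} X" and C: "closed C" for X and C :: "real set"
  proof (rule reg_closed)
    show "{(w, t) \<in> ?W. X w t \<in> C} \<in> sets Opt"
      unfolding sets_Opt using X C by (intro sigma_sets.Basic) (auto intro: borel_closed)
    show "right_closed {(w, t) \<in> ?W. X w t \<in> C}"
      unfolding right_closed_def
    proof (intro allI impI)
      fix w t assume "right_limit {(w, t) \<in> ?W. X w t \<in> C} w t"
      then have *: "\<forall>d>0. \<exists>s. t < s \<and> s < t + d \<and> (w, s) \<in> {(w, t) \<in> ?W. X w t \<in> C}"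
        unfolding right_limit_def .
      obtain s where s: "t < s" "(w, s) \<in> ?W" using *[rule_format, of 1] by auto
      have t0: "0 \<le> t"
      proof (rule ccontr)
        assume "\<not> 0 \<le> t"
        then show False using *[rule_format, of "- t"] by auto
      qed
      then have t: "t \<in> {0..T}" "w \<in> space M" using s by auto
      have lim: "(X w \<longlongrightarrow> X w t) (at t within {0..T} \<inter> {t<..})" using X t unfolding cadlag_adapted_def by blast
      have "X w t \<in> C"
      proof (rule ccontr)
        assume "X w t \<notin> C"
        then have "\<forall>\<^sub>F s in at t within {0..T} \<inter> {t<..}. X w s \<in> - C"
          using C by (intro topological_tendstoD[OF lim]) (auto simp: open_Compl)
        then obtain d where d: "d > 0" "\<And>s. s \<in> {0..T} \<inter> {t<..} \<Longrightarrow> s \<noteq> t \<Longrightarrow> dist s t < d \<Longrightarrow> X w s \<in> - C"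
          unfolding eventually_at by blast
        obtain s where "t < s" "s < t + d" "(w, s) \<in> ?W" "X w s \<in> C" using *[rule_format, OF d(1)] by auto
        then show False using d(2)[of s] by (auto simp: dist_real_def)
      qed
      then show "(w, t) \<in> {(w, t) \<in> ?W. X w t \<in> C}" using t by auto
    qed
  qed
  have gen: "reg {(w, t) \<in> ?W. X w t \<in> B} \<and> reg (?W - {(w, t) \<in> ?W. X w t \<in> B})"
    if X: "cadlag_adapted (space M) F {0..T} X" and B: "B \<in> sets borel" for X B
  proof -
    have "B \<in> sigma_sets UNIV (range (\<lambda>x. {..x}))"
      using B unfolding borel_eq_atMost by (simp add: sets_measure_of)
    then show ?thesis
    proof induction
      case (Basic B)
      then obtain a where a: "B = {..a}" by auto
      have "?W - {(w, t) \<in> ?W. X w t \<in> B} = (\<Union>n. {(w, t) \<in> ?W. X w t \<in> {a + 1 / real (Suc n)..}})"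
      proof (intro equalityI subsetI)
        fix p assume p: "p \<in> ?W - {(w, t) \<in> ?W. X w t \<in> B}"
        then have "0 < X (fst p) (snd p) - a" using a by auto
        then obtain n where "1 / real (Suc n) < X (fst p) (snd p) - a" using nat_approx_posE by metis
        then show "p \<in> (\<Union>n. {(w, t) \<in> ?W. X w t \<in> {a + 1 / real (Suc n)..}})"
          using p by (auto intro!: exI[of _ n])
      next
        fix p assume "p \<in> (\<Union>n. {(w, t) \<in> ?W. X w t \<in> {a + 1 / real (Suc n)..}})"
        then obtain n where n: "p \<in> {(w, t) \<in> ?W. X w t \<in> {a + 1 / real (Suc n)..}}" by blast
        define d where "d = 1 / real (Suc n)"
        have "0 < d" "p \<in> {(w, t) \<in> ?W. X w t \<in> {a + d..}}" using n by (simp_all add: d_def)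
        then show "p \<in> ?W - {(w, t) \<in> ?W. X w t \<in> B}" using a by auto
      qed
      moreover have "reg (\<Union>n. {(w, t) \<in> ?W. X w t \<in> {a + 1 / real (Suc n)..}})"
        by (intro reg_UN closed_reg X) simp
      moreover have "reg {(w, t) \<in> ?W. X w t \<in> B}" unfolding a by (intro closed_reg X) simp
      ultimately show ?case by simp
    next
      case Empty
      have "{(w, t) \<in> ?W. X w t \<in> UNIV} = ?W" by auto
      then have "reg ?W" using closed_reg[OF X closed_UNIV] by (simp only:)
      then show ?case using empty by (simp add: case_prod_beta')
    next
      case (Compl B)
      have "{(w, t) \<in> ?W. X w t \<in> UNIV - B} = ?W - {(w, t) \<in> ?W. X w t \<in> B}"
        "?W - {(w, t) \<in> ?W. X w t \<in> UNIV - B} = {(w, t) \<in> ?W. X w t \<in> B}" by auto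
      then show ?case using Compl by (simp only:)
    next
      case (Union B)
      have "{(w, t) \<in> ?W. X w t \<in> (\<Union>i. B i)} = (\<Union>i. {(w, t) \<in> ?W. X w t \<in> B i})"
        "?W - {(w, t) \<in> ?W. X w t \<in> (\<Union>i. B i)} = (\<Inter>i. ?W - {(w, t) \<in> ?W. X w t \<in> B i})" by auto
      moreover have "reg (\<Union>i. {(w, t) \<in> ?W. X w t \<in> B i})" "reg (\<Inter>i. ?W - {(w, t) \<in> ?W. X w t \<in> B i})"
        using Union.IH by (blast intro: reg_UN reg_INT)+
      ultimately show ?case by (simp only:)
    qed
  qed
  have "reg E \<and> reg (?W - E)"
    using E unfolding sets_Opt
  proof induction
    case (Basic E) then show ?case using gen by auto
  next
    case Empty
    have "cadlag_adapted (space M) F {0..T} (\<lambda>_ _. 0)" by (auto simp: cadlag_adapted_def)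
    moreover have "{(w, t) \<in> ?W. (0::real) \<in> UNIV} = ?W" by auto
    ultimately have "reg ?W" using gen[of "\<lambda>_ _. 0" UNIV] by (simp only:) simp
    then show ?case using empty by (simp only: Diff_empty)
  next
    case (Compl E)
    have "?W - (?W - E) = E" using sets.sets_into_space[of E Opt] Compl.hyps by (auto simp: space_Opt sets_Opt)
    then show ?case using Compl.IH by (simp only:)
  next
    case (Union E)
    have "?W - (\<Union>i. E i) = (\<Inter>i. ?W - E i)" by auto
    moreover have "reg (\<Union>i. E i)" "reg (\<Inter>i. ?W - E i)"
      using Union.IH by (blast intro: reg_UN reg_INT)+
    ultimately show ?case by (simp only:)
  qed
  then show ?thesis using e unfolding reg_def m_def by blast
qed

text \<open>If the projection of \<open>E\<close> had positive probability, a measurable selector of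
  \<open>E\<close> would exist on an event \<open>D\<close> of positive probability. It need not be
  a stopping time, so it only serves to measure sets: an optional right-closed subset
  \<open>H\<close> of \<open>E\<close> that catches part of its graph has a debut, which is a
  stopping time with graph inside \<open>H\<close>.\<close>

theorem optional_section:
  assumes E: "E \<in> sets Opt"
    and miss: "\<And>\<tau>. \<tau> \<in> stopping_times M F T (\<lambda>_. 0) \<Longrightarrow> AE w in M. (w, \<tau> w) \<notin> E"
  shows "AE w in M. \<forall>t\<in>{0..T}. (w, t) \<notin> E"
proof -
  have sub: "E \<subseteq> space M \<times> {0..T}" using sets.sets_into_space[OF E] by (simp add: space_Opt)
  have "E \<inter> (space M \<times> {0..T}) = E" using sub by auto
  then have EF: "E \<in> sets (F T \<Otimes>\<^sub>M borel)" using optional_progressive[OF E, of T] T_pos by auto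
  have "sets (F T \<Otimes>\<^sub>M borel) \<subseteq> sets (M \<Otimes>\<^sub>M (borel :: real measure))"
    unfolding sets_pair_measure using sets_F_sub by (simp add: space_F) (intro sigma_sets_mono', blast)
  then have EM: "E \<in> sets (M \<Otimes>\<^sub>M borel)" using EF by auto
  have pr: "fst ` E \<in> sets M" using measurable_projection[OF finite_measure_axioms complete_measure_axioms EM sub] .
  have "emeasure M (fst ` E) = 0"
  proof (rule ccontr)
    assume "emeasure M (fst ` E) \<noteq> 0"
    then have "0 < emeasure M (fst ` E)" by (simp add: zero_less_iff_neq_zero)
    then obtain c where c: "0 < c" "c < emeasure M (fst ` E)" using dense by blast
    from c(2) pr have "c < outer_measure_of M (fst ` E)" by simp
    from measurable_section_approx[OF finite_measure_axioms EM sub this]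
    obtain D R where D: "D \<in> sets M" "c \<le> emeasure M D" "R \<in> borel_measurable M"
      "\<And>w. w \<in> D \<Longrightarrow> (w, R w) \<in> E" by metis
    have "0 < ennreal (prob D)" using less_le_trans[OF c(1) D(2)] by (simp add: emeasure_eq_measure)
    then have "0 < prob D" by simp
    \<comment> \<open>A loss strictly smaller than the probability of \<open>D\<close> leaves a part
      of the selector's graph in \<open>H\<close>, so the projection of \<open>H\<close> is not
      negligible.\<close>
    from optional_inner_regular[OF D(1,3) E this] obtain H where H: "H \<in> sets Opt" "right_closed H" "H \<subseteq> E"
      "prob {w\<in>D. (w, R w) \<in> E - H} < prob D" by blast
    have Hs: "H \<subseteq> space M \<times> {0..T}" using H(3) sub by auto
    let ?\<tau> = "\<lambda>w. min (debut H w) T"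
    have "AE w in M. (w, ?\<tau> w) \<notin> E" by (rule miss[OF debut_min_stopping_times[OF H(1)]])
    moreover have "(w, ?\<tau> w) \<in> E" if "w \<in> fst ` H" for w
      using right_closed_debut[OF H(2) Hs that] debut_bounds(2)[OF Hs that] H(3) by (auto simp: min_absorb1)
    ultimately have "AE w in M. w \<notin> fst ` H" by (auto elim!: eventually_mono)
    then have "AE w in M. w \<in> {w\<in>D. (w, R w) \<in> E - H} \<longleftrightarrow> w \<in> D"
    proof eventually_elim
      case (elim w)
      then show ?case using D(4)[of w] by force
    qed
    then have "{w\<in>D. (w, R w) \<in> E - H} \<in> sets M" "prob {w\<in>D. (w, R w) \<in> E - H} = prob D"
    proof -
      assume ae: "AE w in M. w \<in> {w\<in>D. (w, R w) \<in> E - H} \<longleftrightarrow> w \<in> D"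
      have s: "{w\<in>D. (w, R w) \<in> E - H} \<subseteq> space M" using sets.sets_into_space[OF D(1)] by auto
      show m: "{w\<in>D. (w, R w) \<in> E - H} \<in> sets M"
        by (rule in_sets_AE[OF _ D(1) s]) (use ae in \<open>auto elim: eventually_mono\<close>)
      show "prob {w\<in>D. (w, R w) \<in> E - H} = prob D"
        by (rule finite_measure_eq_AE[OF ae m D(1)])
    qed
    then show False using H(4) by simp
  qed
  then have "fst ` E \<in> null_sets M" using pr by auto
  then have "AE w in M. w \<notin> fst ` E" by (rule AE_not_in)
  then show ?thesis by eventually_elim force
qed

text \<open>In a finite section the infimum is attained, so the debut of \<open>G\<close> runs
  inside \<open>G\<close> and no approximation from inside is needed. What remains is that this
  debut, cut at \<open>T\<close>, is a predictable time.\<close>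

theorem predictable_section_finite:
  assumes E: "E \<in> sets Prd" and fin: "AE w in M. finite {t. (w, t) \<in> E}"
    and miss: "\<And>\<tau>. \<tau> \<in> predictable_stopping_times M F T \<Longrightarrow> AE w in M. (w, \<tau> w) \<notin> E"
  shows "AE w in M. \<forall>t\<in>{0..T}. (w, t) \<notin> E"
proof -
  have sub: "E \<subseteq> space M \<times> {0..T}" using sets.sets_into_space[OF E] by (simp add: space_Prd)
  define N where "N = {w \<in> space M. infinite {t. (w, t) \<in> E}}"
  have N: "N \<in> null_sets M" using fin unfolding N_def AE_iff_null_sets by simp
  define G where "G = E - N \<times> {0..T}"
  have G: "G \<in> sets Prd" unfolding G_def using E Prd_rect[OF null_sets_F[OF N]] by auto
  have Gs: "G \<subseteq> space M \<times> {0..T}" using sub unfolding G_def by auto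
  have GO: "G \<in> sets Opt" by (rule predictable_optional[OF G])
  have fin': "finite {t. (w, t) \<in> G}" for w
  proof (cases "w \<in> N")
    case True
    then have "{t. (w, t) \<in> G} = {}" using sub unfolding G_def by blast
    then show ?thesis by (simp only: finite.emptyI)
  next
    case False
    have "finite {t. (w, t) \<in> E}"
    proof (cases "w \<in> space M")
      case True
      then show ?thesis using False unfolding N_def by blast
    next
      case False
      then have "{t. (w, t) \<in> E} = {}" using sub by blast
      then show ?thesis by (simp only: finite.emptyI)
    qed
    moreover have "{t. (w, t) \<in> G} \<subseteq> {t. (w, t) \<in> E}" unfolding G_def by blast
    ultimately show ?thesis by (rule finite_subset[rotated])
  qed
  have deb: "(w, debut G w) \<in> G" if "w \<in> fst ` G" for w
  proof -
    have "{t. (w, t) \<in> G} \<noteq> {}" using that by auto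
    then have "Inf {t. (w, t) \<in> G} \<in> {t. (w, t) \<in> G}"
      using Min_in[OF fin'[of w]] by (metis cInf_eq_Min fin')
    then show ?thesis using that by (auto simp: debut_def)
  qed
  let ?\<tau> = "\<lambda>w. min (debut G w) T"
  let ?P = "predictable_sigma (space M) F {0..}"
  have st: "?\<tau> \<in> stopping_times M F T (\<lambda>_. 0)" by (rule debut_min_stopping_times[OF GO])
  note st' = stopping_timesD[OF st]
  have "predictable_time M F ?\<tau>"
    unfolding predictable_time_def
  proof (intro conjI ballI st'(2))
    let ?A = "{(w, t) \<in> space M \<times> {0..}. w \<in> space M \<and> ?\<tau> w < t}"
    have A: "?A \<in> sets ?P"
      using st' sets.top[of "pre_sigma ?\<tau>"] by (intro predictable_after_stopping) (auto simp: space_pre_sigma)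
    have TT: "space M \<times> {T} \<in> sets ?P"
    proof -
      have "space M \<times> {T} = (\<Inter>n. space M \<times> {max 0 (T - 1 / real (Suc n))<..T})"
      proof (intro equalityI subsetI)
        fix p assume p: "p \<in> (\<Inter>n. space M \<times> {max 0 (T - 1 / real (Suc n))<..T})"
        have "\<not> snd p < T"
        proof
          assume "snd p < T"
          then have "0 < T - snd p" by simp
          then obtain n where "1 / real (Suc n) < T - snd p" using nat_approx_posE by metis
          moreover have "p \<in> space M \<times> {max 0 (T - 1 / real (Suc n))<..T}" using p by blast
          ultimately show False by auto
        qed
        then show "p \<in> space M \<times> {T}" using p by auto
      qed (use T_pos in auto)
      moreover have "space M \<times> {max 0 (T - 1 / real (Suc n))<..T} \<in> sets ?P" for n
      proof (rule predictable_interval[of "{0..}"])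
        show "space M \<in> sets (F (max 0 (T - 1 / real (Suc n))))" using sets.top[of "F (max 0 (T - 1 / real (Suc n)))"] by (simp add: space_F)
      qed (use T_pos in auto)
      ultimately show ?thesis by (simp only:) (rule sets.countable_INT', auto)
    qed
    \<comment> \<open>Removing from \<open>G\<close> the times strictly after the debut leaves the
      graph of the debut, a predictable set. The last piece accounts for the cut at
      \<open>T\<close>.\<close>
    have "{(w, t) \<in> space M \<times> {0..}. ?\<tau> w \<le> t} = ?A \<union> (G - ?A) \<union> space M \<times> {T}"
    proof (intro equalityI subsetI)
      fix p assume "p \<in> {(w, t) \<in> space M \<times> {0..}. ?\<tau> w \<le> t}"
      then obtain w t where p: "p = (w, t)" "w \<in> space M" "0 \<le> t" "?\<tau> w \<le> t" by auto
      show "p \<in> ?A \<union> (G - ?A) \<union> space M \<times> {T}"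
      proof (cases "?\<tau> w < t \<or> t = T")
        case False
        then have "debut G w = t" "debut G w < T" using p by (auto simp: min_def split: if_splits)
        then have "w \<in> fst ` G" by (auto simp: debut_def split: if_splits)
        from deb[OF this] show ?thesis using \<open>debut G w = t\<close> p False by auto
      qed (use p in auto)
    next
      fix p assume p: "p \<in> ?A \<union> (G - ?A) \<union> space M \<times> {T}"
      then show "p \<in> {(w, t) \<in> space M \<times> {0..}. ?\<tau> w \<le> t}"
      proof (elim UnE)
        assume "p \<in> G - ?A"
        then show ?thesis using debut_bounds(3)[OF Gs] Gs by (auto simp: min_le_iff_disj)
      qed (use T_pos in auto)
    qed
    also have "\<dots> \<in> sets ?P" using A TT Prd_extend[OF G] by auto
    finally show "{(w, t) \<in> space M \<times> {0..}. ?\<tau> w \<le> t} \<in> sets ?P" .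
  qed
  then have "?\<tau> \<in> predictable_stopping_times M F T" using st unfolding predictable_stopping_times_def by simp
  from miss[OF this] AE_not_in[OF N] show ?thesis
  proof eventually_elim
    case (elim w)
    show ?case
    proof (intro ballI notI)
      fix t assume "(w, t) \<in> E"
      then have "(w, t) \<in> G" using elim unfolding G_def by auto
      then have u: "w \<in> fst ` G" by force
      have "(w, ?\<tau> w) \<in> G" using deb[OF u] debut_bounds(2)[OF Gs u] by (simp add: min_absorb1)
      then show False using elim unfolding G_def by auto
    qed
  qed
qed

end

section \<open>Monotone paths\<close>

lemma mono_left_lim:
  fixes x :: "real \<Rightarrow> real"
  assumes m: "mono_on {0..T} x" and t: "0 < t" "t \<le> T"
  shows "(x \<longlongrightarrow> left_lim a x t) (at_left t)" "\<And>s. 0 \<le> s \<Longrightarrow> s < t \<Longrightarrow> x s \<le> left_lim a x t" "left_lim a x t \<le> x t"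
proof -
  define l where "l = Sup (x ` {0..<t})"
  have bd: "bdd_above (x ` {0..<t})" using m t by (auto intro!: bdd_aboveI[of _ "x t"] simp: mono_on_def)
  have ne: "x ` {0..<t} \<noteq> {}" using t by auto
  have up: "x s \<le> l" if "0 \<le> s" "s < t" for s unfolding l_def using that by (intro cSup_upper bd) auto
  have lt: "l \<le> x t" unfolding l_def using m t ne by (intro cSup_least) (auto simp: mono_on_def)
  have lim: "(x \<longlongrightarrow> l) (at_left t)"
  proof (rule order_tendstoI)
    fix y assume "y < l"
    then obtain s where s: "0 \<le> s" "s < t" "y < x s" using ne bd unfolding l_def by (auto simp: less_cSup_iff)
    have "\<forall>\<^sub>F u in at_left t. s < u \<and> u < t" using s by (intro eventually_conj) (auto simp: eventually_at_left_field)
    then show "\<forall>\<^sub>F u in at_left t. y < x u"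
    proof eventually_elim
      case (elim u)
      then have "x s \<le> x u" using m s t by (auto simp: mono_on_def)
      then show ?case using s by simp
    qed
  next
    fix y assume "l < y"
    have "\<forall>\<^sub>F u in at_left t. 0 < u \<and> u < t" using t by (intro eventually_conj) (auto simp: eventually_at_left_field)
    then show "\<forall>\<^sub>F u in at_left t. x u < y"
    proof eventually_elim
      case (elim u)
      then have "x u \<le> l" by (intro up) simp_all
      then show ?case using \<open>l < y\<close> by simp
    qed
  qed
  have "Lim (at_left t) x = l" using tendsto_Lim[OF _ lim] by simp
  then have eq: "left_lim a x t = l" using t unfolding left_lim_def by simp
  show "(x \<longlongrightarrow> left_lim a x t) (at_left t)" "\<And>s. 0 \<le> s \<Longrightarrow> s < t \<Longrightarrow> x s \<le> left_lim a x t" "left_lim a x t \<le> x t"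
    unfolding eq using lim up lt by auto
qed

lemma left_lim_eq: "0 < t \<Longrightarrow> (x \<longlongrightarrow> l) (at_left t) \<Longrightarrow> left_lim a x t = l"
  unfolding left_lim_def using tendsto_Lim[of "at_left t" x l] by simp

lemma left_sequence: "filterlim (\<lambda>n. t - 1 / real (Suc n)) (at_left t) sequentially" for t :: real
  unfolding filterlim_at
proof
  have "(\<lambda>n. t - 1 / real (Suc n)) \<longlonglongrightarrow> t - 0"
    by (intro tendsto_diff tendsto_const LIMSEQ_Suc[OF lim_1_over_n])
  then show "(\<lambda>n. t - 1 / real (Suc n)) \<longlonglongrightarrow> t" by simp
qed (auto intro!: always_eventually)

context
  fixes T :: real and x :: "real \<Rightarrow> real"
  assumes T: "0 < T" and m: "mono_on {0..T} x" and rc: "\<forall>t\<in>{0..<T}. (x \<longlongrightarrow> x t) (at_right t)"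
begin

lemma clamp_mono: "s \<le> t \<Longrightarrow> x (max 0 (min s T)) \<le> x (max 0 (min t T))"
  using m T by (intro mono_onD[OF m]) auto

lemma clamp_right_continuous: "continuous (at_right s) (\<lambda>t. x (max 0 (min t T)))"
proof -
  consider "s < 0" | "0 \<le> s" "s < T" | "T \<le> s" by linarith
  then show ?thesis
  proof cases
    case 1
    have "\<forall>\<^sub>F t in at_right s. x (max 0 (min t T)) = x (max 0 (min s T))"
      unfolding eventually_at_right_field using 1 T by (intro exI[of _ 0]) (auto simp: max_def min_def)
    then show ?thesis unfolding continuous_within by (rule tendsto_eventually)
  next
    case 2
    have "\<forall>\<^sub>F t in at_right s. x t = x (max 0 (min t T))"
      unfolding eventually_at_right_field using 2 by (intro exI[of _ T]) (auto simp: max_def min_def)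
    moreover have "(x \<longlongrightarrow> x (max 0 (min s T))) (at_right s)" using rc 2 by (auto simp: max_def min_def)
    ultimately show ?thesis unfolding continuous_within by (rule Lim_transform_eventually[rotated])
  next
    case 3
    have "\<forall>\<^sub>F t in at_right s. x (max 0 (min t T)) = x (max 0 (min s T))"
      unfolding eventually_at_right_field using 3 T by (intro exI[of _ "s + 1"]) (auto simp: max_def min_def)
    then show ?thesis unfolding continuous_within by (rule tendsto_eventually)
  qed
qed

lemma emeasure_stieltjes_Ioc:
  "s \<le> t \<Longrightarrow> emeasure (stieltjes T x) {s<..t} = ennreal (x (max 0 (min t T)) - x (max 0 (min s T)))"
  unfolding stieltjes_def by (intro emeasure_interval_measure_Ioc clamp_mono clamp_right_continuous)

lemma emeasure_stieltjes_point:
  assumes t: "0 < t" "t \<le> T"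
  shows "emeasure (stieltjes T x) {t} = ennreal (x t - left_lim a x t)"
proof -
  have "(\<lambda>n. emeasure (stieltjes T x) {t - 1 / real (Suc n)<..t}) \<longlonglongrightarrow> emeasure (stieltjes T x) (\<Inter>n. {t - 1 / real (Suc n)<..t})"
  proof (rule Lim_emeasure_decseq)
    show "decseq (\<lambda>n. {t - 1 / real (Suc n)<..t})"
    proof (rule decseq_SucI)
      fix n :: nat
      have "1 / real (Suc (Suc n)) \<le> 1 / real (Suc n)" by (intro divide_left_mono) auto
      then show "{t - 1 / real (Suc (Suc n))<..t} \<subseteq> {t - 1 / real (Suc n)<..t}" by auto
    qed
    show "emeasure (stieltjes T x) {t - 1 / real (Suc n)<..t} \<noteq> \<infinity>" for n
      by (subst emeasure_stieltjes_Ioc) auto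
  qed (auto simp: stieltjes_def)
  moreover have "(\<Inter>n. {t - 1 / real (Suc n)<..t}) = {t}"
  proof (intro equalityI subsetI)
    fix s assume s: "s \<in> (\<Inter>n. {t - 1 / real (Suc n)<..t})"
    have "\<not> s < t"
    proof
      assume "s < t"
      then have "0 < t - s" by simp
      then obtain n where "1 / real (Suc n) < t - s" using nat_approx_posE by metis
      moreover have "s \<in> {t - 1 / real (Suc n)<..t}" using s by blast
      ultimately show False by auto
    qed
    then show "s \<in> {t}" using s by auto
  qed auto
  ultimately have 1: "(\<lambda>n. emeasure (stieltjes T x) {t - 1 / real (Suc n)<..t}) \<longlonglongrightarrow> emeasure (stieltjes T x) {t}" by simp
  have "(\<lambda>n. x (t - 1 / real (Suc n))) \<longlonglongrightarrow> left_lim a x t"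
    by (rule filterlim_compose[OF mono_left_lim(1)[OF m t] left_sequence])
  moreover have "\<forall>\<^sub>F n in sequentially. x (t - 1 / real (Suc n)) = x (max 0 (min (t - 1 / real (Suc n)) T))"
  proof -
    have "(\<lambda>n. t - 1 / real (Suc n)) \<longlonglongrightarrow> t" using left_sequence unfolding filterlim_at by auto
    then have "\<forall>\<^sub>F n in sequentially. 0 < t - 1 / real (Suc n)" using t by (intro order_tendstoD)
    then show ?thesis
    proof eventually_elim
      case (elim n)
      have "0 \<le> 1 / real (Suc n)" by simp
      then have "t - 1 / real (Suc n) \<le> T" using t by linarith
      then show ?case using elim by (simp add: max_def min_def)
    qed
  qed
  ultimately have "(\<lambda>n. x (max 0 (min (t - 1 / real (Suc n)) T))) \<longlonglongrightarrow> left_lim a x t"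
    by (rule Lim_transform_eventually)
  then have "(\<lambda>n. ennreal (x t - x (max 0 (min (t - 1 / real (Suc n)) T)))) \<longlonglongrightarrow> ennreal (x t - left_lim a x t)"
    by (intro tendsto_ennrealI tendsto_intros)
  moreover have "emeasure (stieltjes T x) {t - 1 / real (Suc n)<..t} = ennreal (x t - x (max 0 (min (t - 1 / real (Suc n)) T)))" for n
    using t by (subst emeasure_stieltjes_Ioc) auto
  ultimately have "(\<lambda>n. emeasure (stieltjes T x) {t - 1 / real (Suc n)<..t}) \<longlonglongrightarrow> ennreal (x t - left_lim a x t)" by simp
  then show ?thesis using 1 LIMSEQ_unique by blast
qed

lemma emeasure_stieltjes_le: "emeasure (stieltjes T x) B \<le> ennreal (x T - x 0)"
proof -
  have "emeasure (stieltjes T x) UNIV = (SUP n. emeasure (stieltjes T x) {- real n<..real n})"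
  proof (subst SUP_emeasure_incseq)
    show "incseq (\<lambda>n. {- real n<..real n})" by (auto simp: incseq_def)
    have "(\<Union>n. {- real n<..real n}) = UNIV"
    proof (intro equalityI subsetI UNIV_I)
      fix y :: real
      obtain n :: nat where "\<bar>y\<bar> < real n" using reals_Archimedean2 by blast
      then show "y \<in> (\<Union>n. {- real n<..real n})" by (intro UN_I[of n]) auto
    qed
    then show "emeasure (stieltjes T x) UNIV = emeasure (stieltjes T x) (\<Union>n. {- real n<..real n})" by simp
  qed (auto simp: stieltjes_def)
  also have "\<dots> \<le> ennreal (x T - x 0)"
  proof (rule SUP_least)
    fix n :: nat
    have "x (max 0 (min (real n) T)) \<le> x T" "x 0 \<le> x (max 0 (min (- real n) T))"
      using m T by (auto intro!: mono_onD[OF m])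
    then show "emeasure (stieltjes T x) {- real n<..real n} \<le> ennreal (x T - x 0)"
      by (subst emeasure_stieltjes_Ioc) (auto intro!: ennreal_leI)
  qed
  finally have *: "emeasure (stieltjes T x) UNIV \<le> ennreal (x T - x 0)" .
  have "emeasure (stieltjes T x) B \<le> emeasure (stieltjes T x) (space (stieltjes T x))" by (rule emeasure_space)
  with * show ?thesis by (simp add: stieltjes_def)
qed

end

section \<open>The jump measure and its compensator\<close>

text \<open>Stated for an arbitrary family \<open>G\<close> because it is applied both to
  \<open>F\<close> and to the uncompleted filtration behind
  \<open>natural_filtration\<close>.\<close>

lemma optional_sigma_section:
  assumes sp: "\<And>t. space (G t) = \<Omega>" and E: "E \<in> sets (optional_sigma \<Omega> G I)" and t: "t \<in> I"
  shows "{w \<in> \<Omega>. (w, t) \<in> E} \<in> sets (G t)"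
proof -
  have gen: "{{(w, t) \<in> \<Omega> \<times> I. X w t \<in> B} |X B. cadlag_adapted \<Omega> G I X \<and> B \<in> sets borel} \<subseteq> Pow (\<Omega> \<times> I)" by auto
  have "E \<in> sigma_sets (\<Omega> \<times> I) {{(w, t) \<in> \<Omega> \<times> I. X w t \<in> B} |X B. cadlag_adapted \<Omega> G I X \<and> B \<in> sets borel}"
    using E unfolding optional_sigma_def by (simp only: sets_measure_of[OF gen])
  then show ?thesis
  proof induction
    case (Basic E)
    then obtain X B where X: "E = {(w, t) \<in> \<Omega> \<times> I. X w t \<in> B}" "cadlag_adapted \<Omega> G I X" "B \<in> sets borel" by auto
    have "(\<lambda>w. X w t) \<in> borel_measurable (G t)" using X(2) t unfolding cadlag_adapted_def by auto
    from measurable_sets[OF this X(3)] show ?case using t unfolding X(1) by (simp add: sp vimage_def Int_def conj_commute)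
  next
    case (Compl E)
    have "{w \<in> \<Omega>. (w, t) \<in> \<Omega> \<times> I - E} = space (G t) - {w \<in> \<Omega>. (w, t) \<in> E}" using t by (auto simp: sp)
    also have "\<dots> \<in> sets (G t)" using Compl.IH by (rule sets.compl_sets)
    finally show ?case .
  next
    case (Union E)
    have "{w \<in> \<Omega>. (w, t) \<in> (\<Union>i. E i)} = (\<Union>i. {w \<in> \<Omega>. (w, t) \<in> E i})" by auto
    also have "\<dots> \<in> sets (G t)" using Union.IH by (intro sets.countable_UN) auto
    finally show ?case .
  qed auto
qed

lemma measurable_optional_sigma_section:
  assumes sp: "\<And>t. space (G t) = \<Omega>" and f: "f \<in> measurable (optional_sigma \<Omega> G I) N" and t: "t \<in> I"
  shows "(\<lambda>w. f (w, t)) \<in> measurable (G t) N"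
proof (rule measurableI)
  have s: "space (optional_sigma \<Omega> G I) = \<Omega> \<times> I"
    unfolding optional_sigma_def by (rule space_measure_of) auto
  fix w assume "w \<in> space (G t)"
  then show "f (w, t) \<in> space N" using measurable_space[OF f] t by (simp add: s sp)
next
  have s: "space (optional_sigma \<Omega> G I) = \<Omega> \<times> I"
    unfolding optional_sigma_def by (rule space_measure_of) auto
  fix B assume "B \<in> sets N"
  from optional_sigma_section[OF sp measurable_sets[OF f this] t]
  have "{w \<in> \<Omega>. (w, t) \<in> f -` B \<inter> space (optional_sigma \<Omega> G I)} \<in> sets (G t)" .
  also have "{w \<in> \<Omega>. (w, t) \<in> f -` B \<inter> space (optional_sigma \<Omega> G I)} = (\<lambda>w. f (w, t)) -` B \<inter> space (G t)"
    using t by (auto simp: s sp)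
  finally show "(\<lambda>w. f (w, t)) -` B \<inter> space (G t) \<in> sets (G t)" .
qed

section \<open>The random measure on (0,T] and its compensator\<close>

locale point_process = usual_filtration M F T
  for M :: "'w measure" and F :: "real \<Rightarrow> 'w measure" and T :: real +
  fixes U :: "'u measure" and \<mu> \<nu> :: "'w \<Rightarrow> (real \<times> 'u) measure"
    and K :: "'w \<Rightarrow> real \<Rightarrow> real" and \<phi> :: "'w \<Rightarrow> real \<Rightarrow> 'u measure"
  assumes mpp: "multivariate_point_process M U \<mu>" and discrete: "discrete_random_measure M U \<mu>"
    and natural: "natural_filtration M U \<mu> F"
    and compensator: "predictable_compensator M F T U \<mu> \<nu>"
    and disintegration: "compensator_disintegration M F T U \<nu> K \<phi>"
begin

lemma measurable_Prd_at: "f \<in> measurable Prd N \<Longrightarrow> t \<in> {0..T} \<Longrightarrow> (\<lambda>w. f (w, t)) \<in> measurable (F t) N"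
  by (rule measurable_optional_sigma_section[OF space_F measurable_Prd_Opt])

text \<open>Time is clamped because \<open>W\<close> is measurable only over [0,T], while a function
  on the whole of the product with the real line is wanted. The measures \<open>pm w\<close> and
  \<open>vm w\<close> below are carried by \<open>D\<close>, where the clamp does nothing.\<close>

definition path :: "(('w \<times> real) \<times> 'u \<Rightarrow> 'b) \<Rightarrow> 'w \<Rightarrow> real \<times> 'u \<Rightarrow> 'b" where
  "path W w p = W ((w, max 0 (min T (fst p))), snd p)"

lemma path_eq: "fst p \<in> {0..T} \<Longrightarrow> path W w p = W ((w, fst p), snd p)"
  by (simp add: path_def)

lemma measurable_path:
  assumes W: "W \<in> measurable (Prd \<Otimes>\<^sub>M U) N" and w: "w \<in> space M"
  shows "path W w \<in> measurable (borel \<Otimes>\<^sub>M U) N"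
proof -
  have "(\<lambda>s. (w, max 0 (min T s))) \<in> measurable borel Prd"
    unfolding predictable_sigma_def
  proof (rule measurable_measure_of)
    fix y assume "y \<in> {B \<times> {0} |B. B \<in> sets (F 0)} \<union> {B \<times> {s<..t} |B s t. 0 \<le> s \<and> s \<le> t \<and> t \<in> {0..T} \<and> B \<in> sets (F s)}"
    then obtain B J where y: "y = B \<times> J" "J \<in> sets borel" by auto
    have "(\<lambda>s. max 0 (min T s)) -` J \<inter> space borel \<in> sets (borel :: real measure)"
      using y(2) by (intro measurable_sets[of _ borel borel]) auto
    moreover have "(\<lambda>s. (w, max 0 (min T s))) -` y \<inter> space borel =
      (if w \<in> B then (\<lambda>s. max 0 (min T s)) -` J \<inter> space borel else {})" by (auto simp: y)
    ultimately show "(\<lambda>s. (w, max 0 (min T s))) -` y \<inter> space borel \<in> sets (borel :: real measure)" by simp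
  qed (use predictable_sigma_gen[of "{0..T}" T] T_pos w in auto)
  from measurable_compose[OF measurable_fst this]
  have "(\<lambda>p. ((w, max 0 (min T (fst p))), snd p)) \<in> borel \<Otimes>\<^sub>M U \<rightarrow>\<^sub>M Prd \<Otimes>\<^sub>M U"
    by (intro measurable_Pair) auto
  from measurable_compose[OF this W] show ?thesis unfolding path_def[abs_def] .
qed

text \<open>Compensated integrals run over intervals open on the left, so mass at time 0 never
  enters. Restricted to \<open>D\<close>, both random measures are finite on every path.\<close>

definition D :: "(real \<times> 'u) set" where "D = {0<..T} \<times> space U"
definition pm :: "'w \<Rightarrow> (real \<times> 'u) measure" where "pm w = density (\<mu> w) (indicator D)"
definition vm :: "'w \<Rightarrow> (real \<times> 'u) measure" where "vm w = density (\<nu> w) (indicator D)"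

lemma D_sets: "D \<in> sets (borel \<Otimes>\<^sub>M U)" unfolding D_def by (intro pair_measureI) auto

lemma sets_mu: "w \<in> space M \<Longrightarrow> sets (\<mu> w) = sets (borel \<Otimes>\<^sub>M U)"
  using mpp unfolding multivariate_point_process_def by auto

lemma sets_nu: "w \<in> space M \<Longrightarrow> sets (\<nu> w) = sets (borel \<Otimes>\<^sub>M U)"
  using disintegration unfolding compensator_disintegration_def by auto

lemma sets_pm: "w \<in> space M \<Longrightarrow> sets (pm w) = sets (borel \<Otimes>\<^sub>M U)"
  unfolding pm_def by (simp add: sets_mu)

lemma sets_vm: "w \<in> space M \<Longrightarrow> sets (vm w) = sets (borel \<Otimes>\<^sub>M U)"
  unfolding vm_def by (simp add: sets_nu)

lemma space_pm: "w \<in> space M \<Longrightarrow> space (pm w) = UNIV \<times> space U"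
  using sets_eq_imp_space_eq[OF sets_pm] by (simp add: space_pair_measure)

lemma space_vm: "w \<in> space M \<Longrightarrow> space (vm w) = UNIV \<times> space U"
  using sets_eq_imp_space_eq[OF sets_vm] by (simp add: space_pair_measure)

lemma nn_integral_pm:
  assumes "w \<in> space M" "h \<in> borel_measurable (borel \<Otimes>\<^sub>M U)"
  shows "(\<integral>\<^sup>+p. h p \<partial>pm w) = (\<integral>\<^sup>+p. indicator D p * h p \<partial>\<mu> w)"
  unfolding pm_def using assms D_sets sets_mu[OF assms(1)]
  by (intro nn_integral_density) (auto cong: measurable_cong_sets)

lemma nn_integral_vm:
  assumes "w \<in> space M" "h \<in> borel_measurable (borel \<Otimes>\<^sub>M U)"
  shows "(\<integral>\<^sup>+p. h p \<partial>vm w) = (\<integral>\<^sup>+p. indicator D p * h p \<partial>\<nu> w)"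
  unfolding vm_def using assms D_sets sets_nu[OF assms(1)]
  by (intro nn_integral_density) (auto cong: measurable_cong_sets)

lemma emeasure_pm:
  assumes "w \<in> space M" "B \<in> sets (borel \<Otimes>\<^sub>M U)"
  shows "emeasure (pm w) B = emeasure (\<mu> w) (D \<inter> B)"
proof -
  have "emeasure (pm w) B = (\<integral>\<^sup>+p. indicator B p \<partial>pm w)" using assms sets_pm by simp
  also have "\<dots> = (\<integral>\<^sup>+p. indicator D p * indicator B p \<partial>\<mu> w)" using assms by (intro nn_integral_pm) auto
  also have "\<dots> = emeasure (\<mu> w) (D \<inter> B)"
    using assms D_sets sets_mu by (simp add: indicator_inter_arith[symmetric])
  finally show ?thesis .
qed

lemma emeasure_vm:
  assumes "w \<in> space M" "B \<in> sets (borel \<Otimes>\<^sub>M U)"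
  shows "emeasure (vm w) B = emeasure (\<nu> w) (D \<inter> B)"
proof -
  have "emeasure (vm w) B = (\<integral>\<^sup>+p. indicator B p \<partial>vm w)" using assms sets_vm by simp
  also have "\<dots> = (\<integral>\<^sup>+p. indicator D p * indicator B p \<partial>\<nu> w)" using assms by (intro nn_integral_vm) auto
  also have "\<dots> = emeasure (\<nu> w) (D \<inter> B)"
    using assms D_sets sets_nu by (simp add: indicator_inter_arith[symmetric])
  finally show ?thesis .
qed

text \<open>On every path the jump measure on (0,T] is a finite sum of Dirac measures at distinct
  times. Integrals against \<open>pm w\<close> are therefore finite sums, and integrability is an
  issue for the compensator only.\<close>

lemma pm_points:
  assumes w: "w \<in> space M"
  obtains I :: "nat set" and pt where "finite I" "\<And>n. n \<in> I \<Longrightarrow> pt n \<in> D" "inj_on (\<lambda>n. fst (pt n)) I"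
    "pm w = distr (count_space I) (borel \<Otimes>\<^sub>M U) pt"
    "\<And>t. emeasure (\<mu> w) ({0..t} \<times> space U) < \<infinity>"
proof -
  from mpp obtain S :: "nat \<Rightarrow> 'w \<Rightarrow> ereal" and X where
    X: "\<And>n. X n \<in> M \<rightarrow>\<^sub>M U" and S0: "\<And>n. 0 \<le> S n w"
    and dist: "\<And>m n. m \<noteq> n \<Longrightarrow> S m w \<noteq> \<infinity> \<Longrightarrow> S m w \<noteq> S n w"
    and mu: "\<mu> w = distr (count_space {n. S n w \<noteq> \<infinity>}) (borel \<Otimes>\<^sub>M U) (\<lambda>n. (real_of_ereal (S n w), X n w))"
    using w unfolding multivariate_point_process_def by (elim exE conjE) (metis (no_types, lifting))
  define P where "P = {n. S n w \<noteq> \<infinity>}"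
  define pt where "pt n = (real_of_ereal (S n w), X n w)" for n
  have mu': "\<mu> w = distr (count_space P) (borel \<Otimes>\<^sub>M U) pt" unfolding mu P_def pt_def ..
  have ptm: "pt \<in> count_space P' \<rightarrow>\<^sub>M borel \<Otimes>\<^sub>M U" for P'
    using measurable_space[OF X w] by (auto simp: pt_def space_pair_measure)
  have em: "emeasure (\<mu> w) B = emeasure (count_space P) {n\<in>P. pt n \<in> B}" if "B \<in> sets (borel \<Otimes>\<^sub>M U)" for B
    unfolding mu' using that by (subst emeasure_distr[OF ptm]) (auto intro: arg_cong2[where f=emeasure])
  have inj: "inj_on (\<lambda>n. fst (pt n)) P"
  proof (rule inj_onI, rule ccontr)
    fix m n assume mn: "m \<in> P" "n \<in> P" "fst (pt m) = fst (pt n)" "m \<noteq> n"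
    then have "S m w \<noteq> S n w" using dist by (auto simp: P_def)
    moreover have "\<bar>S m w\<bar> \<noteq> \<infinity>" "\<bar>S n w\<bar> \<noteq> \<infinity>" using mn S0[of m] S0[of n] by (auto simp: P_def)
    ultimately show False using mn(3) by (auto simp: pt_def real_of_ereal.simps elim!: ereal_cases)
  qed
  \<comment> \<open>As the times are distinct, the fibre over the time of a point carries mass
    exactly 1. The points up to time t thus inject into the set that discreteness declares
    finite.\<close>
  have fin: "finite {n\<in>P. fst (pt n) \<le> t}" for t
  proof (rule finite_imageD)
    have "(\<lambda>n. fst (pt n)) ` {n\<in>P. fst (pt n) \<le> t} \<subseteq> {s \<in> {0..t}. emeasure (\<mu> w) ({s} \<times> space U) = 1}"
    proof
      fix s assume "s \<in> (\<lambda>n. fst (pt n)) ` {n\<in>P. fst (pt n) \<le> t}"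
      then obtain n where n: "n \<in> P" "s = fst (pt n)" "s \<le> t" by auto
      have "{m\<in>P. pt m \<in> {s} \<times> space U} = {n}"
      proof (intro equalityI subsetI)
        fix m assume "m \<in> {m\<in>P. pt m \<in> {s} \<times> space U}"
        then show "m \<in> {n}" using n inj_onD[OF inj, of m n] by auto
      next
        fix m assume "m \<in> {n}"
        then show "m \<in> {m\<in>P. pt m \<in> {s} \<times> space U}"
          using n measurable_space[OF X w, of n] by (auto simp: pt_def)
      qed
      then have "emeasure (\<mu> w) ({s} \<times> space U) = 1" using n by (subst em) (auto intro!: pair_measureI)
      moreover have "0 \<le> s" using n S0[of "n"] by (auto simp: pt_def real_of_ereal_pos)
      ultimately show "s \<in> {s \<in> {0..t}. emeasure (\<mu> w) ({s} \<times> space U) = 1}" using n by auto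
    qed
    then show "finite ((\<lambda>n. fst (pt n)) ` {n\<in>P. fst (pt n) \<le> t})"
      using discrete w unfolding discrete_random_measure_def by (blast intro: finite_subset)
    show "inj_on (\<lambda>n. fst (pt n)) {n\<in>P. fst (pt n) \<le> t}" by (rule inj_on_subset[OF inj]) auto
  qed
  define I where "I = {n\<in>P. pt n \<in> D}"
  have "finite I" by (rule finite_subset[OF _ fin[of T]]) (auto simp: I_def D_def)
  have injI: "inj_on (\<lambda>n. fst (pt n)) I" by (rule inj_on_subset[OF inj]) (auto simp: I_def)
  have pm_eq: "pm w = distr (count_space I) (borel \<Otimes>\<^sub>M U) pt"
  proof (rule measure_eqI)
    show "sets (pm w) = sets (distr (count_space I) (borel \<Otimes>\<^sub>M U) pt)" using sets_pm[OF w] by simp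
    fix B assume "B \<in> sets (pm w)"
    then have B: "B \<in> sets (borel \<Otimes>\<^sub>M U)" using sets_pm[OF w] by simp
    have "emeasure (pm w) B = emeasure (count_space P) {n\<in>P. pt n \<in> D \<inter> B}"
      using B D_sets by (simp add: emeasure_pm[OF w] em)
    also have "{n\<in>P. pt n \<in> D \<inter> B} = {n\<in>I. pt n \<in> B}" by (auto simp: I_def)
    also have "emeasure (count_space P) {n\<in>I. pt n \<in> B} = emeasure (count_space I) {n\<in>I. pt n \<in> B}"
    proof -
      have "finite {n\<in>I. pt n \<in> B}" using \<open>finite I\<close> by simp
      moreover have "{n\<in>I. pt n \<in> B} \<subseteq> P" by (auto simp: I_def)
      ultimately show ?thesis by (simp add: emeasure_count_space_finite)
    qed
    also have "\<dots> = emeasure (distr (count_space I) (borel \<Otimes>\<^sub>M U) pt) B"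
      by (subst emeasure_distr[OF ptm B]) (auto intro: arg_cong2[where f=emeasure])
    finally show "emeasure (pm w) B = emeasure (distr (count_space I) (borel \<Otimes>\<^sub>M U) pt) B" .
  qed
  have fin_t: "emeasure (\<mu> w) ({0..t} \<times> space U) < \<infinity>" for t
  proof -
    have "finite {n \<in> P. pt n \<in> {0..t} \<times> space U}" by (rule finite_subset[OF _ fin[of t]]) auto
    then show ?thesis by (subst em) (auto intro!: pair_measureI simp: emeasure_count_space_finite of_nat_less_top)
  qed
  have ID: "pt n \<in> D" if "n \<in> I" for n using that by (simp add: I_def)
  show ?thesis by (rule that[OF \<open>finite I\<close> ID injI pm_eq fin_t])
qed

lemma finite_pm: "w \<in> space M \<Longrightarrow> finite_measure (pm w)"
proof -
  assume w: "w \<in> space M"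
  obtain I :: "nat set" and pt where I: "finite I" "\<And>n. n \<in> I \<Longrightarrow> pt n \<in> D" "pm w = distr (count_space I) (borel \<Otimes>\<^sub>M U) pt"
    using pm_points[OF w] by metis
  have "pt \<in> count_space I \<rightarrow>\<^sub>M borel \<Otimes>\<^sub>M U" using I(2) by (auto simp: D_def space_pair_measure mem_Times_iff)
  then have "finite_measure (distr (count_space I) (borel \<Otimes>\<^sub>M U) pt)"
    using I(1) by (intro finite_measure.finite_measure_distr finite_measure_count_space)
  then show ?thesis using I(3) by simp
qed

lemma K_props:
  assumes "w \<in> space M"
  shows "K w 0 = 0" "mono_on {0..T} (K w)" "\<forall>t\<in>{0..<T}. (K w \<longlongrightarrow> K w t) (at_right t)"
    "\<And>t. t \<in> {0..T} \<Longrightarrow> K w t - left_lim 0 (K w) t \<le> 1"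
  using disintegration assms unfolding compensator_disintegration_def by auto

lemma emeasure_nu_time:
  assumes w: "w \<in> space M" and J: "J \<in> sets borel"
  shows "emeasure (\<nu> w) (J \<times> space U) = emeasure (stieltjes T (K w)) (J \<inter> {0..T})"
proof -
  have ph: "\<phi> w t \<in> space (prob_algebra U)" if "t \<in> {0..T}" for t
  proof -
    have "(\<lambda>(w, t). \<phi> w t) \<in> Prd \<rightarrow>\<^sub>M prob_algebra U"
      using disintegration unfolding compensator_disintegration_def by auto
    from measurable_space[OF this, of "(w, t)"] show ?thesis using w that by (simp add: space_Prd)
  qed
  have "emeasure (\<nu> w) (J \<times> space U) = (\<integral>\<^sup>+t\<in>{0..T}. emeasure (\<phi> w t) (Pair t -` (J \<times> space U)) \<partial>stieltjes T (K w))"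
    using disintegration w J unfolding compensator_disintegration_def by auto
  also have "\<dots> = (\<integral>\<^sup>+t. indicator (J \<inter> {0..T}) t \<partial>stieltjes T (K w))"
  proof (rule nn_integral_cong)
    fix t
    show "emeasure (\<phi> w t) (Pair t -` (J \<times> space U)) * indicator {0..T} t = indicator (J \<inter> {0..T}) t"
    proof (cases "t \<in> {0..T} \<and> t \<in> J")
      case True
      then have "prob_space (\<phi> w t)" "space (\<phi> w t) = space U"
        using ph[of t] sets_eq_imp_space_eq[of "\<phi> w t" U] by (auto simp: space_prob_algebra)
      then have "emeasure (\<phi> w t) (space U) = 1" using prob_space.emeasure_space_1[of "\<phi> w t"] by simp
      moreover have "Pair t -` (J \<times> space U) = space U" using True by auto
      ultimately show ?thesis using True by simp
    next
      case False
      then show ?thesis by (cases "t \<in> J") (auto simp: indicator_def vimage_def)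
    qed
  qed
  also have "\<dots> = emeasure (stieltjes T (K w)) (J \<inter> {0..T})" using J by (simp add: stieltjes_def)
  finally show ?thesis .
qed

lemma emeasure_vm_time:
  assumes w: "w \<in> space M" and J: "J \<in> sets borel"
  shows "emeasure (vm w) (J \<times> space U) = emeasure (stieltjes T (K w)) (J \<inter> {0<..T})"
proof -
  have "emeasure (vm w) (J \<times> space U) = emeasure (\<nu> w) (D \<inter> J \<times> space U)"
    using J by (intro emeasure_vm[OF w] pair_measureI) auto
  also have "D \<inter> J \<times> space U = (J \<inter> {0<..T}) \<times> space U" unfolding D_def by auto
  also have "emeasure (\<nu> w) \<dots> = emeasure (stieltjes T (K w)) (J \<inter> {0<..T} \<inter> {0..T})"
    using J by (intro emeasure_nu_time[OF w]) auto
  also have "J \<inter> {0<..T} \<inter> {0..T} = J \<inter> {0<..T}" by auto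
  finally show ?thesis .
qed

lemma finite_vm: "w \<in> space M \<Longrightarrow> finite_measure (vm w)"
proof
  assume w: "w \<in> space M"
  have "emeasure (vm w) (UNIV \<times> space U) \<le> ennreal (K w T - K w 0)"
    using emeasure_vm_time[OF w, of UNIV] emeasure_stieltjes_le[OF T_pos K_props(2,3)[OF w]] by simp
  then show "emeasure (vm w) (space (vm w)) \<noteq> \<infinity>"
    unfolding space_vm[OF w] using ennreal_less_top le_less_trans by (metis infinity_ennreal_def less_irrefl)
qed

lemma emeasure_vm_point:
  assumes w: "w \<in> space M" and t: "0 < t" "t \<le> T"
  shows "emeasure (vm w) ({t} \<times> space U) = ennreal (K w t - left_lim 0 (K w) t)"
proof -
  have "emeasure (vm w) ({t} \<times> space U) = emeasure (stieltjes T (K w)) ({t} \<inter> {0<..T})"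
    by (rule emeasure_vm_time[OF w]) simp
  also have "{t} \<inter> {0<..T} = {t}" using t by auto
  also have "emeasure (stieltjes T (K w)) {t} = ennreal (K w t - left_lim 0 (K w) t)"
    by (rule emeasure_stieltjes_point[OF T_pos K_props(2,3)[OF w] t])
  finally show ?thesis .
qed

lemma emeasure_vm_point_le: "w \<in> space M \<Longrightarrow> emeasure (vm w) ({t} \<times> space U) \<le> 1"
proof (cases "0 < t \<and> t \<le> T")
  case True
  assume w: "w \<in> space M"
  show ?thesis using True emeasure_vm_point[OF w, of t] K_props(4)[OF w, of t] by (simp add: ennreal_le_1)
next
  case False
  assume w: "w \<in> space M"
  have "{t} \<inter> {0<..T} = {}" using False by auto
  then show ?thesis using emeasure_vm_time[OF w, of "{t}"] by simp
qed

lemma emeasure_pm_point_le: "w \<in> space M \<Longrightarrow> emeasure (pm w) ({t} \<times> space U) \<le> 1"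
proof -
  assume w: "w \<in> space M"
  obtain I :: "nat set" and pt where I: "finite I" "\<And>n. n \<in> I \<Longrightarrow> pt n \<in> D" "inj_on (\<lambda>n. fst (pt n)) I"
    "pm w = distr (count_space I) (borel \<Otimes>\<^sub>M U) pt"
    using pm_points[OF w] by metis
  have ptm: "pt \<in> count_space I \<rightarrow>\<^sub>M borel \<Otimes>\<^sub>M U" using I(2) by (auto simp: D_def space_pair_measure mem_Times_iff)
  have "emeasure (pm w) ({t} \<times> space U) = emeasure (count_space I) (pt -` ({t} \<times> space U) \<inter> space (count_space I))"
    unfolding I(4) by (rule emeasure_distr[OF ptm]) (auto intro!: pair_measureI)
  also have "\<dots> = of_nat (card (pt -` ({t} \<times> space U) \<inter> I))" using I(1) by simp
  also have "card (pt -` ({t} \<times> space U) \<inter> I) \<le> 1"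
  proof -
    have "\<forall>a\<in>pt -` ({t} \<times> space U) \<inter> I. \<forall>b\<in>pt -` ({t} \<times> space U) \<inter> I. a = b"
      using inj_onD[OF I(3)] by (auto simp: mem_Times_iff)
    then show ?thesis by (simp add: card_le_Suc0_iff_eq I(1))
  qed
  then have "(of_nat (card (pt -` ({t} \<times> space U) \<inter> I)) :: ennreal) \<le> of_nat 1" by (rule of_nat_mono)
  finally show ?thesis by simp
qed

text \<open>Optionality of \<open>\<mu>\<close> is given in the filtration \<open>G\<close> before
  completion; the section at time \<open>t\<close> transfers because \<open>F t\<close> contains
  \<open>G t\<close>.\<close>

lemma mu_adapted:
  assumes t: "0 \<le> t" and B: "B \<in> sets U"
  shows "(\<lambda>w. emeasure (\<mu> w) ({0..t} \<times> B)) \<in> borel_measurable (F t)"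
proof -
  from natural obtain G where G: "right_continuous_filtration M G" "optional_random_measure M G U \<mu>"
    "\<forall>t\<ge>0. sets (F t) = sigma_sets (space M) (sets (G t) \<union> null_sets M)"
    unfolding natural_filtration_def by blast
  have spG: "space (G s) = space M" for s
    using G(1) unfolding right_continuous_filtration_def filtration_def by auto
  define W where "W = (\<lambda>p :: ('w \<times> real) \<times> 'u. indicator B (snd p) :: ennreal)"
  have "W \<in> borel_measurable (optional_sigma (space M) G {0..} \<Otimes>\<^sub>M U)"
    unfolding W_def using B by (intro measurable_compose[OF measurable_snd]) simp
  then have "(\<lambda>(w, t). \<integral>\<^sup>+(s, x)\<in>{0..t} \<times> space U. W ((w, s), x) \<partial>\<mu> w) \<in> borel_measurable (optional_sigma (space M) G {0..})"
    using G(2) unfolding optional_random_measure_def by blast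
  from measurable_optional_sigma_section[OF spG this, of t] t
  have 1: "(\<lambda>w. \<integral>\<^sup>+(s, x)\<in>{0..t} \<times> space U. W ((w, s), x) \<partial>\<mu> w) \<in> borel_measurable (G t)" by simp
  have 2: "(\<integral>\<^sup>+(s, x)\<in>{0..t} \<times> space U. W ((w, s), x) \<partial>\<mu> w) = emeasure (\<mu> w) ({0..t} \<times> B)" if "w \<in> space M" for w
  proof -
    have "(\<integral>\<^sup>+(s, x)\<in>{0..t} \<times> space U. W ((w, s), x) \<partial>\<mu> w) = (\<integral>\<^sup>+p. indicator ({0..t} \<times> B) p \<partial>\<mu> w)"
      using sets.sets_into_space[OF B] by (intro nn_integral_cong) (auto simp: W_def split: split_indicator split_indicator_asm)
    also have "\<dots> = emeasure (\<mu> w) ({0..t} \<times> B)"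
      using B sets_mu[OF that] by (intro nn_integral_indicator) auto
    finally show ?thesis .
  qed
  have "(\<lambda>w. emeasure (\<mu> w) ({0..t} \<times> B)) \<in> borel_measurable (G t)"
    using 1 2 by (subst measurable_cong[where g="\<lambda>w. \<integral>\<^sup>+(s, x)\<in>{0..t} \<times> space U. W ((w, s), x) \<partial>\<mu> w"]) (auto simp: spG)
  moreover have "sets (G t) \<subseteq> sets (F t)" using G(3) t by (auto intro: sigma_sets.Basic)
  ultimately show ?thesis unfolding measurable_def by (auto simp: spG space_F)
qed

lemma measurable_time_indicator:
  "J \<in> sets borel \<Longrightarrow> (\<lambda>p. indicator J (fst p) :: ennreal) \<in> borel_measurable (borel \<Otimes>\<^sub>M U)"
  "J \<in> sets borel \<Longrightarrow> (\<lambda>p. indicator J (fst p) :: real) \<in> borel_measurable (borel \<Otimes>\<^sub>M U)"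
  by (auto intro!: measurable_compose[OF measurable_fst] borel_measurable_indicator)

lemma vm_predictable:
  assumes W: "(W :: ('w \<times> real) \<times> 'u \<Rightarrow> ennreal) \<in> borel_measurable (Prd \<Otimes>\<^sub>M U)"
  shows "(\<lambda>(w, t). \<integral>\<^sup>+p. path W w p * indicator {..t} (fst p) \<partial>vm w) \<in> borel_measurable Prd"
proof -
  \<comment> \<open>The clause for the compensator integrates over the closed interval from 0 to t;
    this factor cuts it down to the time range of \<open>vm\<close>.\<close>
  define W' where "W' = (\<lambda>p. W p * indicator {0<..} (snd (fst p)))"
  have "W' \<in> borel_measurable (Prd \<Otimes>\<^sub>M U)"
    unfolding W'_def using W measurable_compose[OF measurable_fst measurable_snd_Prd, of U]
    by (intro borel_measurable_times_ennreal borel_measurable_indicator') (auto simp: pred_def intro!: measurable_sets)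
  then have *: "(\<lambda>(w, t). \<integral>\<^sup>+(s, x)\<in>{0..t} \<times> space U. W' ((w, s), x) \<partial>\<nu> w) \<in> borel_measurable Prd"
    using compensator unfolding predictable_compensator_def by blast
  show ?thesis
  proof (subst measurable_cong)
    show "(\<lambda>(w, t). \<integral>\<^sup>+(s, x)\<in>{0..t} \<times> space U. W' ((w, s), x) \<partial>\<nu> w) \<in> borel_measurable Prd" by (rule *)
    fix p assume "p \<in> space Prd"
    then obtain w t where p: "p = (w, t)" "w \<in> space M" "t \<in> {0..T}" by (auto simp: space_Prd)
    have "(\<integral>\<^sup>+p. path W w p * indicator {..t} (fst p) \<partial>vm w) =
       (\<integral>\<^sup>+p. indicator D p * (path W w p * indicator {..t} (fst p)) \<partial>\<nu> w)"
      using measurable_path[OF W p(2)]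
      by (intro nn_integral_vm[OF p(2)] borel_measurable_times_ennreal measurable_time_indicator) auto
    also have "\<dots> = (\<integral>\<^sup>+(s, x)\<in>{0..t} \<times> space U. W' ((w, s), x) \<partial>\<nu> w)"
      using p(3) by (intro nn_integral_cong) (auto simp: W'_def D_def path_def split: split_indicator split_indicator_asm)
    finally show "(case p of (w, t) \<Rightarrow> \<integral>\<^sup>+p. path W w p * indicator {..t} (fst p) \<partial>vm w) =
      (case p of (w, t) \<Rightarrow> \<integral>\<^sup>+(s, x)\<in>{0..t} \<times> space U. W' ((w, s), x) \<partial>\<nu> w)" using p by simp
  qed
qed

lemma compensation:
  assumes W: "(W :: ('w \<times> real) \<times> 'u \<Rightarrow> ennreal) \<in> borel_measurable (Prd \<Otimes>\<^sub>M U)"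
  shows "(\<integral>\<^sup>+w. (\<integral>\<^sup>+p. path W w p \<partial>pm w) \<partial>M) = (\<integral>\<^sup>+w. (\<integral>\<^sup>+p. path W w p \<partial>vm w) \<partial>M)"
proof -
  define W' where "W' = (\<lambda>p. W p * indicator {0<..} (snd (fst p)))"
  have W': "W' \<in> borel_measurable (Prd \<Otimes>\<^sub>M U)"
    unfolding W'_def using W measurable_compose[OF measurable_fst measurable_snd_Prd, of U]
    by (intro borel_measurable_times_ennreal borel_measurable_indicator') (auto simp: pred_def intro!: measurable_sets)
  have eq: "indicator D p * path W w p = (case p of (s, x) \<Rightarrow> W' ((w, s), x)) * indicator ({0..T} \<times> space U) p" for w p
    by (auto simp: W'_def D_def path_def split: split_indicator split_indicator_asm)
  have 1: "(\<integral>\<^sup>+p. path W w p \<partial>pm w) = (\<integral>\<^sup>+(s, x)\<in>{0..T} \<times> space U. W' ((w, s), x) \<partial>\<mu> w)"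
    "(\<integral>\<^sup>+p. path W w p \<partial>vm w) = (\<integral>\<^sup>+(s, x)\<in>{0..T} \<times> space U. W' ((w, s), x) \<partial>\<nu> w)"
    if "w \<in> space M" for w
    using that measurable_path[OF W that] by (simp_all add: nn_integral_pm nn_integral_vm eq)
  show ?thesis
    using compensator W' unfolding predictable_compensator_def by (simp add: 1 cong: nn_integral_cong)
qed

end

section \<open>Integrals over time intervals\<close>

lemma measurable_time_indicator':
  fixes J :: "real set" and Q :: "(real \<times> 'u) measure"
  assumes "sets Q = sets (borel \<Otimes>\<^sub>M U)" "J \<in> sets borel"
  shows "(\<lambda>p. indicator J (fst p) :: real) \<in> borel_measurable Q"
proof -
  have "fst \<in> Q \<rightarrow>\<^sub>M borel" using measurable_cong_sets[OF assms(1) refl] by auto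
  from measurable_compose[OF this borel_measurable_indicator[OF assms(2)]] show ?thesis .
qed

lemma integrable_time_indicator:
  fixes Q :: "(real \<times> 'u) measure" and h :: "real \<times> 'u \<Rightarrow> real"
  assumes "sets Q = sets (borel \<Otimes>\<^sub>M U)" "J \<in> sets borel" "integrable Q h"
  shows "integrable Q (\<lambda>p. h p * indicator J (fst p))"
proof (rule Bochner_Integration.integrable_bound[OF assms(3)])
  show "(\<lambda>p. h p * indicator J (fst p)) \<in> borel_measurable Q"
    by (intro borel_measurable_times borel_measurable_integrable assms measurable_time_indicator'[OF assms(1)])
qed (auto split: split_indicator)

lemma integral_left_limit:
  fixes Q :: "(real \<times> 'u) measure" and h :: "real \<times> 'u \<Rightarrow> real"
  assumes Q: "sets Q = sets (borel \<Otimes>\<^sub>M U)" and h: "integrable Q h"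
  shows "((\<lambda>t. \<integral>p. h p * indicator {..t} (fst p) \<partial>Q) \<longlongrightarrow> (\<integral>p. h p * indicator {..<t} (fst p) \<partial>Q)) (at_left t)"
proof (rule tendsto_at_left_sequentially[of "t - 1"])
  fix S :: "nat \<Rightarrow> real" assume S: "\<And>n. S n < t" "\<And>n. t - 1 < S n" "incseq S" "S \<longlonglongrightarrow> t"
  show "(\<lambda>n. \<integral>p. h p * indicator {..S n} (fst p) \<partial>Q) \<longlonglongrightarrow> (\<integral>p. h p * indicator {..<t} (fst p) \<partial>Q)"
  proof (rule integral_dominated_convergence[where w="\<lambda>p. \<bar>h p\<bar>"])
    show "AE p in Q. (\<lambda>n. h p * indicator {..S n} (fst p)) \<longlonglongrightarrow> h p * indicator {..<t} (fst p)"
    proof (rule AE_I2)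
      fix p
      have "\<forall>\<^sub>F n in sequentially. h p * indicator {..S n} (fst p) = h p * indicator {..<t} (fst p)"
      proof (cases "fst p < t")
        case True
        have "\<forall>\<^sub>F n in sequentially. fst p < S n" by (rule order_tendstoD(1)[OF S(4) True])
        then show ?thesis by eventually_elim (use True in auto)
      next
        case False
        have "\<not> fst p \<le> S n" for n using False S(1)[of n] by linarith
        then show ?thesis using False by (intro always_eventually allI) simp
      qed
      then show "(\<lambda>n. h p * indicator {..S n} (fst p)) \<longlonglongrightarrow> h p * indicator {..<t} (fst p)" by (rule tendsto_eventually)
    qed
    show "AE p in Q. norm (h p * indicator {..S n} (fst p)) \<le> \<bar>h p\<bar>" for n
      by (intro AE_I2) (auto split: split_indicator)
  qed (auto intro!: h borel_measurable_integrable integrable_time_indicator[OF Q])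
qed simp

lemma integral_right_limit:
  fixes Q :: "(real \<times> 'u) measure" and h :: "real \<times> 'u \<Rightarrow> real"
  assumes Q: "sets Q = sets (borel \<Otimes>\<^sub>M U)" and h: "integrable Q h"
  shows "((\<lambda>t. \<integral>p. h p * indicator {..t} (fst p) \<partial>Q) \<longlongrightarrow> (\<integral>p. h p * indicator {..t} (fst p) \<partial>Q)) (at_right t)"
proof (rule tendsto_at_right_sequentially[of _ "t + 1"])
  fix S :: "nat \<Rightarrow> real" assume S: "\<And>n. t < S n" "\<And>n. S n < t + 1" "decseq S" "S \<longlonglongrightarrow> t"
  show "(\<lambda>n. \<integral>p. h p * indicator {..S n} (fst p) \<partial>Q) \<longlonglongrightarrow> (\<integral>p. h p * indicator {..t} (fst p) \<partial>Q)"
  proof (rule integral_dominated_convergence[where w="\<lambda>p. \<bar>h p\<bar>"])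
    show "AE p in Q. (\<lambda>n. h p * indicator {..S n} (fst p)) \<longlonglongrightarrow> h p * indicator {..t} (fst p)"
    proof (rule AE_I2)
      fix p
      have "\<forall>\<^sub>F n in sequentially. h p * indicator {..S n} (fst p) = h p * indicator {..t} (fst p)"
      proof (cases "fst p \<le> t")
        case True
        then have "fst p \<le> S n" for n using S(1)[of n] by linarith
        then show ?thesis using True by (intro always_eventually allI) simp
      next
        case False
        then have "\<forall>\<^sub>F n in sequentially. S n < fst p" by (intro order_tendstoD(2)[OF S(4)]) simp
        then show ?thesis by eventually_elim (use False in auto)
      qed
      then show "(\<lambda>n. h p * indicator {..S n} (fst p)) \<longlonglongrightarrow> h p * indicator {..t} (fst p)" by (rule tendsto_eventually)
    qed
    show "AE p in Q. norm (h p * indicator {..S n} (fst p)) \<le> \<bar>h p\<bar>" for n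
      by (intro AE_I2) (auto split: split_indicator)
  qed (auto intro!: h borel_measurable_integrable integrable_time_indicator[OF Q])
qed simp

text \<open>Here \<open>\<theta>\<close> is the supremum of the times with mass at most
  \<open>c\<close> strictly before them. Continuity from below keeps the mass before
  \<open>\<theta>\<close> at most \<open>c\<close>, and the atom at \<open>\<theta>\<close> adds at
  most 1. The second alternative covers the case of no such time.\<close>

lemma early_mass:
  fixes Q :: "(real \<times> 'u) measure"
  assumes fin: "finite_measure Q" and Q: "sets Q = sets (borel \<Otimes>\<^sub>M U)"
    and atoms: "\<And>t. measure Q ({t} \<times> space U) \<le> 1" and c: "0 \<le> c"
  shows "\<exists>\<theta>. (\<forall>s. 0 < s \<and> s \<le> T \<and> measure Q ({..<s} \<times> space U) \<le> c \<longrightarrow> s \<le> \<theta>) \<and> measure Q ({..\<theta>} \<times> space U) \<le> c + 1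
    \<or> (\<forall>s. \<not> (0 < s \<and> s \<le> T \<and> measure Q ({..<s} \<times> space U) \<le> c))"
proof -
  interpret finite_measure Q by fact
  define A where "A = {s. 0 < s \<and> s \<le> T \<and> measure Q ({..<s} \<times> space U) \<le> c}"
  have mm: "J \<times> space U \<in> sets Q" if "J \<in> sets borel" for J :: "real set" using that unfolding Q by auto
  show ?thesis
  proof (cases "A = {}")
    case True then show ?thesis unfolding A_def by blast
  next
    case False
    define \<theta> where "\<theta> = Sup A"
    have bd: "bdd_above A" by (auto simp: A_def intro!: bdd_aboveI[of _ T])
    have le: "s \<le> \<theta>" if "s \<in> A" for s unfolding \<theta>_def using that bd by (rule cSup_upper)
    have lim: "(\<lambda>n. measure Q ({..<\<theta> - 1 / real (Suc n)} \<times> space U)) \<longlonglongrightarrow> measure Q (\<Union>n. {..<\<theta> - 1 / real (Suc n)} \<times> space U)"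
    proof (rule finite_Lim_measure_incseq)
      show "incseq (\<lambda>n. {..<\<theta> - 1 / real (Suc n)} \<times> space U)"
      proof (rule incseq_SucI)
        fix n :: nat
        have "1 / real (Suc (Suc n)) \<le> 1 / real (Suc n)" by (intro divide_left_mono) auto
        then show "{..<\<theta> - 1 / real (Suc n)} \<times> space U \<subseteq> {..<\<theta> - 1 / real (Suc (Suc n))} \<times> space U" by auto
      qed
    qed (auto intro!: mm)
    have "(\<Union>n. {..<\<theta> - 1 / real (Suc n)} \<times> space U) = {..<\<theta>} \<times> space U"
    proof (intro equalityI subsetI)
      fix p assume p: "p \<in> {..<\<theta>} \<times> space U"
      then have "0 < \<theta> - fst p" by auto
      then obtain n where "1 / real (Suc n) < \<theta> - fst p" using nat_approx_posE by metis
      then show "p \<in> (\<Union>n. {..<\<theta> - 1 / real (Suc n)} \<times> space U)" using p by (intro UN_I[of n]) auto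
    next
      fix p assume "p \<in> (\<Union>n. {..<\<theta> - 1 / real (Suc n)} \<times> space U)"
      then obtain n where n: "p \<in> {..<\<theta> - 1 / real (Suc n)} \<times> space U" by blast
      define d where "d = 1 / real (Suc n)"
      have "0 < d" "p \<in> {..<\<theta> - d} \<times> space U" using n by (simp_all add: d_def)
      then show "p \<in> {..<\<theta>} \<times> space U" by auto
    qed
    with lim have "(\<lambda>n. measure Q ({..<\<theta> - 1 / real (Suc n)} \<times> space U)) \<longlonglongrightarrow> measure Q ({..<\<theta>} \<times> space U)" by simp
    moreover have "measure Q ({..<\<theta> - 1 / real (Suc n)} \<times> space U) \<le> c" for n
    proof -
      have "\<theta> - 1 / real (Suc n) < Sup A" unfolding \<theta>_def by simp
      then obtain a where a: "a \<in> A" "\<theta> - 1 / real (Suc n) < a" using less_cSup_iff[OF False bd] by blast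
      have "measure Q ({..<\<theta> - 1 / real (Suc n)} \<times> space U) \<le> measure Q ({..<a} \<times> space U)"
        using a(2) by (intro finite_measure_mono mm) auto
      then show ?thesis using a(1) unfolding A_def by auto
    qed
    ultimately have "measure Q ({..<\<theta>} \<times> space U) \<le> c" by (intro LIMSEQ_le_const2) auto
    moreover have "measure Q ({..\<theta>} \<times> space U) = measure Q ({..<\<theta>} \<times> space U) + measure Q ({\<theta>} \<times> space U)"
    proof -
      have "{..\<theta>} \<times> space U = {..<\<theta>} \<times> space U \<union> {\<theta>} \<times> space U" by auto
      then show ?thesis by (simp only:) (intro finite_measure_Union mm, auto)
    qed
    ultimately have "measure Q ({..\<theta>} \<times> space U) \<le> c + 1" using atoms[of \<theta>] by linarith
    then show ?thesis using le unfolding A_def by blast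
  qed
qed

section \<open>Products of integrals, ordered by time\<close>

context
  fixes P Q :: "(real \<times> 'u) measure" and U :: "'u measure" and v u :: "real \<times> 'u \<Rightarrow> real" and c d :: real
  assumes P: "finite_measure P" "sets P = sets (borel \<Otimes>\<^sub>M U)" and Q: "finite_measure Q" "sets Q = sets (borel \<Otimes>\<^sub>M U)"
    and v: "v \<in> borel_measurable (borel \<Otimes>\<^sub>M U)" "\<And>p. snd p \<in> space U \<Longrightarrow> \<bar>v p\<bar> \<le> c"
    and u: "u \<in> borel_measurable (borel \<Otimes>\<^sub>M U)" "\<And>p. snd p \<in> space U \<Longrightarrow> \<bar>u p\<bar> \<le> d"
begin

lemma time_order_integrable:
  assumes R: "{z. R (fst z) (snd z)} \<in> sets (borel :: (real \<times> real) measure)"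
  shows "integrable (P \<Otimes>\<^sub>M Q) (\<lambda>(p, q). v p * (u q * of_bool (R (fst p) (fst q))))"
    "(\<lambda>p. \<integral>q. u q * of_bool (R (fst p) (fst q)) \<partial>Q) \<in> borel_measurable (borel \<Otimes>\<^sub>M U)"
    "integrable P (\<lambda>p. v p * (\<integral>q. u q * of_bool (R (fst p) (fst q)) \<partial>Q))"
proof -
  interpret P: finite_measure P by fact
  interpret Q: finite_measure Q by fact
  interpret PQ: finite_measure "P \<Otimes>\<^sub>M Q" by (rule finite_measure_pair_measure[OF Q(1) P(1)])
  note [measurable_cong] = P(2) Q(2)
  note [measurable] = v(1) u(1)
  have spP: "space P = UNIV \<times> space U" using sets_eq_imp_space_eq[OF P(2)] by (simp add: space_pair_measure)
  have spQ: "space Q = UNIV \<times> space U" using sets_eq_imp_space_eq[OF Q(2)] by (simp add: space_pair_measure)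
  have fs: "(\<lambda>z. (fst (fst z), fst (snd z))) \<in> P \<Otimes>\<^sub>M Q \<rightarrow>\<^sub>M (borel :: (real \<times> real) measure)"
    unfolding borel_prod[symmetric] by measurable
  have Rm: "(\<lambda>z. of_bool (R (fst (fst z)) (fst (snd z))) :: real) \<in> borel_measurable (P \<Otimes>\<^sub>M Q)"
  proof -
    have "(\<lambda>z. indicator {z. R (fst z) (snd z)} z :: real) \<in> borel_measurable borel" using R by simp
    from measurable_compose[OF fs this] show ?thesis by (simp add: indicator_def)
  qed
  have m: "(\<lambda>(p, q). u q * of_bool (R (fst p) (fst q))) \<in> borel_measurable (P \<Otimes>\<^sub>M Q)"
    using Rm by (simp add: split_beta')
  have m2: "(\<lambda>(p, q). v p * (u q * of_bool (R (fst p) (fst q)))) \<in> borel_measurable (P \<Otimes>\<^sub>M Q)"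
    using Rm by (simp add: split_beta')
  have cd: "\<bar>v p * (u q * of_bool b)\<bar> \<le> c * d" if "snd p \<in> space U" "snd q \<in> space U" for p q b
  proof -
    have "0 \<le> d" using u(2)[OF that(2)] by linarith
    then have "\<bar>v p\<bar> * \<bar>u q * of_bool b\<bar> \<le> c * d" using v(2)[OF that(1)] u(2)[OF that(2)]
      by (intro mult_mono) (auto simp: abs_mult)
    then show ?thesis by (simp add: abs_mult)
  qed
  show "integrable (P \<Otimes>\<^sub>M Q) (\<lambda>(p, q). v p * (u q * of_bool (R (fst p) (fst q))))"
    by (rule PQ.integrable_const_bound[of _ "c * d"])
      (use m2 cd in \<open>auto intro!: AE_I2 simp: space_pair_measure spP spQ\<close>)
  have "(\<lambda>p. \<integral>q. u q * of_bool (R (fst p) (fst q)) \<partial>Q) \<in> borel_measurable P"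
    by (rule Q.borel_measurable_lebesgue_integral) (use m in simp)
  then show m3: "(\<lambda>p. \<integral>q. u q * of_bool (R (fst p) (fst q)) \<partial>Q) \<in> borel_measurable (borel \<Otimes>\<^sub>M U)"
    using measurable_cong_sets[OF P(2) refl] by blast
  interpret PS: pair_sigma_finite Q P ..
  have "integrable P (\<lambda>p. \<integral>q. v p * (u q * of_bool (R (fst p) (fst q))) \<partial>Q)"
  proof -
    interpret PS: pair_sigma_finite P Q ..
    show ?thesis using PS.integrable_fst'[OF \<open>integrable (P \<Otimes>\<^sub>M Q) (\<lambda>(p, q). v p * (u q * of_bool (R (fst p) (fst q))))\<close>] by simp
  qed
  then show "integrable P (\<lambda>p. v p * (\<integral>q. u q * of_bool (R (fst p) (fst q)) \<partial>Q))" by simp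
qed

lemma time_order_swap:
  assumes R: "{z. R (fst z) (snd z)} \<in> sets (borel :: (real \<times> real) measure)"
  shows "(\<integral>p. v p * (\<integral>q. u q * of_bool (R (fst p) (fst q)) \<partial>Q) \<partial>P) = (\<integral>q. u q * (\<integral>p. v p * of_bool (R (fst p) (fst q)) \<partial>P) \<partial>Q)"
proof -
  interpret P: finite_measure P by fact
  interpret Q: finite_measure Q by fact
  interpret PS: pair_sigma_finite P Q ..
  have "(\<integral>q. (\<integral>p. v p * (u q * of_bool (R (fst p) (fst q))) \<partial>P) \<partial>Q) = (\<integral>p. (\<integral>q. v p * (u q * of_bool (R (fst p) (fst q))) \<partial>Q) \<partial>P)"
    by (rule PS.Fubini_integral[OF time_order_integrable(1)[of R, OF R]])
  moreover have "(\<integral>p. v p * (u q * of_bool (R (fst p) (fst q))) \<partial>P) = u q * (\<integral>p. v p * of_bool (R (fst p) (fst q)) \<partial>P)" for q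
    by (simp add: mult.left_commute[of _ "u q"])
  ultimately show ?thesis by simp
qed

end

lemma sets_time_less: "{z. snd z < fst z} \<in> sets (borel :: (real \<times> real) measure)"
  "{z. fst z < snd z} \<in> sets (borel :: (real \<times> real) measure)"
  "{z. snd z = fst z} \<in> sets (borel :: (real \<times> real) measure)"
proof -
  show "{z. snd z < fst z} \<in> sets (borel :: (real \<times> real) measure)"
    by (intro borel_open open_Collect_less continuous_intros)
  show "{z. fst z < snd z} \<in> sets (borel :: (real \<times> real) measure)"
    by (intro borel_open open_Collect_less continuous_intros)
  show "{z. snd z = fst z} \<in> sets (borel :: (real \<times> real) measure)"
    by (intro borel_closed closed_Collect_eq continuous_intros)
qed

text \<open>The plane is cut into earlier, equal and later times, and Fubini turns the last part
  around. In both strict parts the inner integral then runs over the strict past of the outer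
  variable, which is what makes it predictable later on.\<close>

lemma time_split:
  fixes P Q :: "(real \<times> 'u) measure" and u :: "real \<times> 'u \<Rightarrow> real"
  assumes P: "finite_measure P" "sets P = sets (borel \<Otimes>\<^sub>M U)" and Q: "finite_measure Q" "sets Q = sets (borel \<Otimes>\<^sub>M U)"
    and u: "u \<in> borel_measurable (borel \<Otimes>\<^sub>M U)" "\<And>p. snd p \<in> space U \<Longrightarrow> \<bar>u p\<bar> \<le> c"
  shows "(\<integral>p. u p \<partial>P) * (\<integral>q. u q \<partial>Q) =
    (\<integral>p. u p * (\<integral>q. u q * of_bool (fst q < fst p) \<partial>Q) \<partial>P) + (\<integral>p. u p * (\<integral>q. u q * of_bool (fst q = fst p) \<partial>Q) \<partial>P) +
    (\<integral>q. u q * (\<integral>p. u p * of_bool (fst p < fst q) \<partial>P) \<partial>Q)"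
proof -
  interpret Q: finite_measure Q by fact
  have spQ: "space Q = UNIV \<times> space U" using sets_eq_imp_space_eq[OF Q(2)] by (simp add: space_pair_measure)
  have wQ: "u \<in> borel_measurable Q" using u(1) measurable_cong_sets[OF Q(2) refl] by blast
  have iQ: "integrable Q u" by (rule Q.integrable_const_bound[of _ c]) (use u(2) wQ spQ in \<open>auto intro!: AE_I2\<close>)
  have ind: "integrable Q (\<lambda>q. u q * of_bool (fst q \<in> J))" if "J \<in> sets borel" for J :: "real set"
    using integrable_time_indicator[OF Q(2) that iQ] by (simp add: indicator_def)
  have split: "(\<integral>q. u q \<partial>Q) = (\<integral>q. u q * of_bool (fst q < t) \<partial>Q) + (\<integral>q. u q * of_bool (fst q = t) \<partial>Q) + (\<integral>q. u q * of_bool (t < fst q) \<partial>Q)" for t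
  proof -
    have "(\<integral>q. u q \<partial>Q) = (\<integral>q. (u q * of_bool (fst q \<in> {..<t}) + u q * of_bool (fst q \<in> {t})) + u q * of_bool (fst q \<in> {t<..}) \<partial>Q)"
      by (intro Bochner_Integration.integral_cong) auto
    also have "\<dots> = (\<integral>q. u q * of_bool (fst q \<in> {..<t}) \<partial>Q) + (\<integral>q. u q * of_bool (fst q \<in> {t}) \<partial>Q) + (\<integral>q. u q * of_bool (fst q \<in> {t<..}) \<partial>Q)"
      by (subst Bochner_Integration.integral_add Bochner_Integration.integrable_add, (intro Bochner_Integration.integrable_add ind; simp)+)+ simp
    finally show ?thesis by simp
  qed
  note I = time_order_integrable(3)[OF P Q u u]
  have I1: "integrable P (\<lambda>p. u p * (\<integral>q. u q * of_bool (fst q < fst p) \<partial>Q))" by (rule I, assumption, assumption, rule sets_time_less)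
  have I2: "integrable P (\<lambda>p. u p * (\<integral>q. u q * of_bool (fst q = fst p) \<partial>Q))" by (rule I, assumption, assumption, rule sets_time_less)
  have I3: "integrable P (\<lambda>p. u p * (\<integral>q. u q * of_bool (fst p < fst q) \<partial>Q))" by (rule I, assumption, assumption, rule sets_time_less)
  have "(\<integral>p. u p \<partial>P) * (\<integral>q. u q \<partial>Q) = (\<integral>p. u p * (\<integral>q. u q \<partial>Q) \<partial>P)" by simp
  also have "\<dots> = (\<integral>p. (u p * (\<integral>q. u q * of_bool (fst q < fst p) \<partial>Q) + u p * (\<integral>q. u q * of_bool (fst q = fst p) \<partial>Q)) + u p * (\<integral>q. u q * of_bool (fst p < fst q) \<partial>Q) \<partial>P)"
    by (intro Bochner_Integration.integral_cong refl) (subst split, simp add: algebra_simps)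
  also have "\<dots> = (\<integral>p. u p * (\<integral>q. u q * of_bool (fst q < fst p) \<partial>Q) \<partial>P) + (\<integral>p. u p * (\<integral>q. u q * of_bool (fst q = fst p) \<partial>Q) \<partial>P) + (\<integral>p. u p * (\<integral>q. u q * of_bool (fst p < fst q) \<partial>Q) \<partial>P)"
    using I1 I2 I3 by simp
  also have "(\<integral>p. u p * (\<integral>q. u q * of_bool (fst p < fst q) \<partial>Q) \<partial>P) = (\<integral>q. u q * (\<integral>p. u p * of_bool (fst p < fst q) \<partial>P) \<partial>Q)"
    by (rule time_order_swap[OF P Q u u, of "\<lambda>s t. s < t"], assumption, assumption, rule sets_time_less)
  finally show ?thesis .
qed

lemma same_time_sym:
  fixes P Q :: "(real \<times> 'u) measure" and v u :: "real \<times> 'u \<Rightarrow> real"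
  assumes P: "finite_measure P" "sets P = sets (borel \<Otimes>\<^sub>M U)" and Q: "finite_measure Q" "sets Q = sets (borel \<Otimes>\<^sub>M U)"
    and v: "v \<in> borel_measurable (borel \<Otimes>\<^sub>M U)" "\<And>p. snd p \<in> space U \<Longrightarrow> \<bar>v p\<bar> \<le> c"
    and u: "u \<in> borel_measurable (borel \<Otimes>\<^sub>M U)" "\<And>p. snd p \<in> space U \<Longrightarrow> \<bar>u p\<bar> \<le> d"
  shows "(\<integral>p. v p * (\<integral>q. u q * of_bool (fst q = fst p) \<partial>Q) \<partial>P) = (\<integral>q. u q * (\<integral>p. v p * of_bool (fst p = fst q) \<partial>P) \<partial>Q)"
  using time_order_swap[OF P Q v u, of "\<lambda>s t. t = s"] sets_time_less by (simp add: eq_commute)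

text \<open>The pathwise form of the formula \<open>N\<^sub>T\<^sup>2 = 2 \<integral> N\<^bsub>s-\<^esub> dN\<^sub>s + [N]\<^sub>T\<close>.\<close>

lemma square_of_difference:
  fixes P Q :: "(real \<times> 'u) measure" and u :: "real \<times> 'u \<Rightarrow> real"
  assumes P: "finite_measure P" "sets P = sets (borel \<Otimes>\<^sub>M U)" and Q: "finite_measure Q" "sets Q = sets (borel \<Otimes>\<^sub>M U)"
    and u: "u \<in> borel_measurable (borel \<Otimes>\<^sub>M U)" "\<And>p. snd p \<in> space U \<Longrightarrow> \<bar>u p\<bar> \<le> c"
    and N: "\<And>p. snd p \<in> space U \<Longrightarrow> N p = (\<integral>q. u q * of_bool (fst q < fst p) \<partial>P) - (\<integral>q. u q * of_bool (fst q < fst p) \<partial>Q)"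
  shows "((\<integral>p. u p \<partial>P) - (\<integral>p. u p \<partial>Q))\<^sup>2 = 2 * ((\<integral>p. u p * N p \<partial>P) - (\<integral>p. u p * N p \<partial>Q)) +
    (\<integral>p. u p * (\<integral>q. u q * of_bool (fst q = fst p) \<partial>P) \<partial>P) - 2 * (\<integral>p. u p * (\<integral>q. u q * of_bool (fst q = fst p) \<partial>Q) \<partial>P)
    + (\<integral>p. u p * (\<integral>q. u q * of_bool (fst q = fst p) \<partial>Q) \<partial>Q)"
proof -
  let ?L = "\<lambda>P Q. \<integral>p. u p * (\<integral>q. u q * of_bool (fst q < fst p) \<partial>Q) \<partial>P"
  let ?E = "\<lambda>P Q. \<integral>p. u p * (\<integral>q. u q * of_bool (fst q = fst p) \<partial>Q) \<partial>P"
  have i1: "integrable P (\<lambda>p. u p * (\<integral>q. u q * of_bool (fst q < fst p) \<partial>P))"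
    by (rule time_order_integrable(3)[OF P P u u], assumption, assumption, rule sets_time_less)
  have i2: "integrable P (\<lambda>p. u p * (\<integral>q. u q * of_bool (fst q < fst p) \<partial>Q))"
    by (rule time_order_integrable(3)[OF P Q u u], assumption, assumption, rule sets_time_less)
  have i3: "integrable Q (\<lambda>p. u p * (\<integral>q. u q * of_bool (fst q < fst p) \<partial>P))"
    by (rule time_order_integrable(3)[OF Q P u u], assumption, assumption, rule sets_time_less)
  have i4: "integrable Q (\<lambda>p. u p * (\<integral>q. u q * of_bool (fst q < fst p) \<partial>Q))"
    by (rule time_order_integrable(3)[OF Q Q u u], assumption, assumption, rule sets_time_less)
  note i = i1 i2 i3 i4
  have spP: "space P = UNIV \<times> space U" using sets_eq_imp_space_eq[OF P(2)] by (simp add: space_pair_measure)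
  have spQ: "space Q = UNIV \<times> space U" using sets_eq_imp_space_eq[OF Q(2)] by (simp add: space_pair_measure)
  have NP: "(\<integral>p. u p * N p \<partial>P) = ?L P P - ?L P Q"
  proof -
    have "(\<integral>p. u p * N p \<partial>P) = (\<integral>p. u p * (\<integral>q. u q * of_bool (fst q < fst p) \<partial>P) - u p * (\<integral>q. u q * of_bool (fst q < fst p) \<partial>Q) \<partial>P)"
      by (intro Bochner_Integration.integral_cong refl) (auto simp: spP N right_diff_distrib)
    then show ?thesis using i by simp
  qed
  have NQ: "(\<integral>p. u p * N p \<partial>Q) = ?L Q P - ?L Q Q"
  proof -
    have "(\<integral>p. u p * N p \<partial>Q) = (\<integral>p. u p * (\<integral>q. u q * of_bool (fst q < fst p) \<partial>P) - u p * (\<integral>q. u q * of_bool (fst q < fst p) \<partial>Q) \<partial>Q)"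
      by (intro Bochner_Integration.integral_cong refl) (auto simp: spQ N right_diff_distrib)
    then show ?thesis using i by simp
  qed
  let ?A = "\<integral>p. u p \<partial>P" and ?B = "\<integral>p. u p \<partial>Q"
  have "?A * ?A = ?L P P + ?E P P + ?L P P" by (rule time_split[OF P P u])
  moreover have "?A * ?B = ?L P Q + ?E P Q + ?L Q P" by (rule time_split[OF P Q u])
  moreover have "?B * ?B = ?L Q Q + ?E Q Q + ?L Q Q" by (rule time_split[OF Q Q u])
  moreover have "(?A - ?B)\<^sup>2 = ?A * ?A - 2 * (?A * ?B) + ?B * ?B" by (simp add: power2_eq_square algebra_simps)
  ultimately show ?thesis unfolding NP NQ by simp
qed

section \<open>Adaptedness of integrals against the jump measure\<close>

context point_process
begin

lemma predictable_gen_Int_stable: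
  "Int_stable ({B \<times> {0} |B. B \<in> sets (F 0)} \<union> {B \<times> {s<..t} |B s t. 0 \<le> s \<and> s \<le> t \<and> t \<in> {0..T} \<and> B \<in> sets (F s)})" (is "Int_stable ?G")
proof (rule Int_stableI)
  have emp: "{} \<in> ?G" by auto
  fix a b assume ab: "a \<in> ?G" "b \<in> ?G"
  then consider (zz) B B' where "a = B \<times> {0}" "B \<in> sets (F 0)" "b = B' \<times> {0}" "B' \<in> sets (F 0)"
    | (no) "a \<inter> b = {}"
    | (ii) B s t B' s' t' where "a = B \<times> {s<..t}" "b = B' \<times> {s'<..t'}" "0 \<le> s" "s \<le> t" "t \<in> {0..T}" "B \<in> sets (F s)"
        "0 \<le> s'" "s' \<le> t'" "t' \<in> {0..T}" "B' \<in> sets (F s')"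
    by fastforce
  then show "a \<inter> b \<in> ?G"
  proof cases
    case zz
    then have "a \<inter> b = (B \<inter> B') \<times> {0}" by auto
    then show ?thesis using zz by (intro UnI1) (auto intro!: exI[of _ "B \<inter> B'"])
  next
    case no then show ?thesis using emp by simp
  next
    case ii
    have eq: "a \<inter> b = (B \<inter> B') \<times> {max s s'<..min t t'}" using ii by auto
    show ?thesis
    proof (cases "max s s' \<le> min t t'")
      case True
      have "B \<in> sets (F (max s s'))" "B' \<in> sets (F (max s s'))"
        using ii sets_F_mono[of s "max s s'"] sets_F_mono[of s' "max s s'"] by auto
      then show ?thesis unfolding eq using True ii by (intro UnI2 CollectI exI[of _ "B \<inter> B'"] exI[of _ "max s s'"] exI[of _ "min t t'"]) auto
    next
      case False
      then have "a \<inter> b = {}" unfolding eq by auto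
      then show ?thesis using emp by simp
    qed
  qed
qed

lemma sets_Prd_pair:
  "sets (Prd \<Otimes>\<^sub>M U) = sigma_sets ((space M \<times> {0..T}) \<times> space U)
    {A \<times> B |A B. A \<in> {B \<times> {0} |B. B \<in> sets (F 0)} \<union> {B \<times> {s<..t} |B s t. 0 \<le> s \<and> s \<le> t \<and> t \<in> {0..T} \<and> B \<in> sets (F s)} \<and> B \<in> sets U}"
proof -
  let ?G = "{B \<times> {0} |B. B \<in> sets (F 0)} \<union> {B \<times> {s<..t} |B s t. 0 \<le> s \<and> s \<le> t \<and> t \<in> {0..T} \<and> B \<in> sets (F s)}"
  have Gs: "?G \<subseteq> Pow (space M \<times> {0..T})" using predictable_sigma_gen[of "{0..T}" T] T_pos by auto
  have z: "space M \<in> sets (F 0)" using sets.top[of "F 0"] by (simp add: space_F)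
  have "sets (Prd \<Otimes>\<^sub>M U) = sets (sigma (space Prd \<times> space U) {A \<times> B |A B. A \<in> ?G \<and> B \<in> sets U})"
  proof (rule sets_pair_eq)
    show "?G \<subseteq> Pow (space Prd)" using Gs by (simp add: space_Prd)
    show "sets Prd = sigma_sets (space Prd) ?G" by (simp add: sets_Prd space_Prd)
    have "space M \<times> {0} \<in> ?G" using z by (intro UnI1 CollectI exI[of _ "space M"] conjI refl)
    moreover have "space M \<times> {0<..T} \<in> ?G"
      using z T_pos by (intro UnI2 CollectI exI[of _ "space M"] exI[of _ 0] exI[of _ T] conjI refl) simp_all
    ultimately show "{space M \<times> {0}, space M \<times> {0<..T}} \<subseteq> ?G" by (intro insert_subsetI empty_subsetI)
    show "\<Union> {space M \<times> {0}, space M \<times> {0<..T}} = space Prd" using T_pos by (auto simp: space_Prd)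
    show "sets U \<subseteq> Pow (space U)" by (rule sets.space_closed)
    show "sets U = sigma_sets (space U) (sets U)" by (simp add: sets.sigma_sets_eq)
    show "countable {space U}" "{space U} \<subseteq> sets U" "\<Union> {space U} = space U" by auto
  qed simp
  also have "\<dots> = sigma_sets (space Prd \<times> space U) {A \<times> B |A B. A \<in> ?G \<and> B \<in> sets U}"
  proof (rule sets_measure_of, rule subsetI, rule PowI)
    fix X assume "X \<in> {A \<times> B |A B. A \<in> ?G \<and> B \<in> sets U}"
    then obtain A B where X: "X = A \<times> B" "A \<in> ?G" "B \<in> sets U" by (elim CollectE exE conjE)
    have "A \<subseteq> space Prd" using subsetD[OF Gs X(2)] by (simp only: space_Prd PowD)
    then show "X \<subseteq> space Prd \<times> space U" using sets.sets_into_space[OF X(3)] unfolding X(1) by (rule Sigma_mono)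
  qed
  finally show ?thesis by (simp add: space_Prd)
qed

lemma space_Prd_pair: "space (Prd \<Otimes>\<^sub>M U) = (space M \<times> {0..T}) \<times> space U"
  by (simp add: space_pair_measure space_Prd)

lemma path_space: "w \<in> space M \<Longrightarrow> snd p \<in> space U \<Longrightarrow> ((w, max 0 (min T (fst p))), snd p) \<in> space (Prd \<Otimes>\<^sub>M U)"
  using T_pos by (auto simp: space_Prd_pair)

text \<open>The integrand is predictable for \<open>F\<close>, whereas optionality of
  \<open>\<mu>\<close> is known for the uncompleted filtration. Adaptedness is therefore rebuilt
  from products of predictable generators and sets of marks by a Dynkin induction. The complement
  step subtracts, which is why the finiteness of the total mass is established at the start.\<close>

lemma pm_adapted_indicator:
  assumes G: "G \<in> sets (Prd \<Otimes>\<^sub>M U)" and t: "t \<in> {0..T}"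
  shows "(\<lambda>w. \<integral>\<^sup>+p. path (indicator G) w p * indicator {..t} (fst p) \<partial>pm w) \<in> borel_measurable (F t)"
proof -
  define g where "g G w = (\<integral>\<^sup>+p. path (indicator G) w p * indicator {..t} (fst p) \<partial>pm w)" for G w
  let ?S = "(space M \<times> {0..T}) \<times> space U"
  let ?G = "{B \<times> {0} |B. B \<in> sets (F 0)} \<union> {B \<times> {s<..t} |B s t. 0 \<le> s \<and> s \<le> t \<and> t \<in> {0..T} \<and> B \<in> sets (F s)}"
  let ?E = "{A \<times> B |A B. A \<in> ?G \<and> B \<in> sets U}"
  have meas: "(\<lambda>p. path (indicator G) w p * indicator {..t} (fst p) :: ennreal) \<in> borel_measurable (borel \<Otimes>\<^sub>M U)"
    if "G \<in> sets (Prd \<Otimes>\<^sub>M U)" "w \<in> space M" for G w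
    using that by (intro borel_measurable_times_ennreal measurable_path measurable_time_indicator) auto
  have meas': "(\<lambda>p. path (indicator G) w p * indicator {..t} (fst p) :: ennreal) \<in> borel_measurable (pm w)"
    if "G \<in> sets (Prd \<Otimes>\<^sub>M U)" "w \<in> space M" for G w
    using meas[OF that] measurable_cong_sets[OF sets_pm[OF that(2)] refl] by blast
  have top: "g ?S \<in> borel_measurable (F t)" and fin: "\<And>w. w \<in> space M \<Longrightarrow> g ?S w < \<infinity>"
  proof -
    have eq: "g ?S w = emeasure (\<mu> w) ({0..t} \<times> space U) - emeasure (\<mu> w) ({0..0} \<times> space U)"
      and fin: "g ?S w < \<infinity>" if w: "w \<in> space M" for w
    proof -
      obtain I :: "nat set" and pt where f: "\<And>t. emeasure (\<mu> w) ({0..t} \<times> space U) < \<infinity>"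
        using pm_points[OF w] by metis
      have "g ?S w = (\<integral>\<^sup>+p. indicator ({0<..t} \<times> space U) p \<partial>\<mu> w)"
      proof -
        have "?S \<in> sets (Prd \<Otimes>\<^sub>M U)" using sets.top[of "Prd \<Otimes>\<^sub>M U"] by (simp add: space_Prd_pair)
        then have "g ?S w = (\<integral>\<^sup>+p. indicator D p * (path (indicator ?S) w p * indicator {..t} (fst p)) \<partial>\<mu> w)"
          unfolding g_def by (intro nn_integral_pm w meas)
        also have "\<dots> = (\<integral>\<^sup>+p. indicator ({0<..t} \<times> space U) p \<partial>\<mu> w)"
          using t w T_pos by (intro nn_integral_cong) (auto simp: D_def path_def split: split_indicator split_indicator_asm)
        finally show ?thesis .
      qed
      also have "\<dots> = emeasure (\<mu> w) ({0<..t} \<times> space U)" using sets_mu[OF w] by (intro nn_integral_indicator) auto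
      finally have 1: "g ?S w = emeasure (\<mu> w) ({0<..t} \<times> space U)" .
      have "{0<..t} \<times> space U = {0..t} \<times> space U - {0..0} \<times> space U" by auto
      then have "emeasure (\<mu> w) ({0<..t} \<times> space U) = emeasure (\<mu> w) ({0..t} \<times> space U) - emeasure (\<mu> w) ({0..0} \<times> space U)"
        using sets_mu[OF w] f[of 0] t by (simp only:) (intro emeasure_Diff, auto)
      then show "g ?S w = emeasure (\<mu> w) ({0..t} \<times> space U) - emeasure (\<mu> w) ({0..0} \<times> space U)" using 1 by simp
      have "emeasure (\<mu> w) ({0<..t} \<times> space U) \<le> emeasure (\<mu> w) ({0..t} \<times> space U)"
        using sets_mu[OF w] by (intro emeasure_mono) auto
      then show "g ?S w < \<infinity>" using 1 f[of t] by (simp add: le_less_trans)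
    qed
    show "\<And>w. w \<in> space M \<Longrightarrow> g ?S w < \<infinity>" by (rule fin)
    have "(\<lambda>w. emeasure (\<mu> w) ({0..t} \<times> space U) - emeasure (\<mu> w) ({0..0} \<times> space U)) \<in> borel_measurable (F t)"
      using mu_adapted[of t "space U"] measurable_F_mono[OF mu_adapted[of 0 "space U"], of t] t
      by (intro borel_measurable_minus_ennreal) auto
    then show "g ?S \<in> borel_measurable (F t)" by (subst measurable_cong[OF eq]) (auto simp: space_F)
  qed
  have GS: "G \<in> sigma_sets ?S ?E" using G by (simp only: sets_Prd_pair)
  have IS: "Int_stable ?E"
  proof (rule Int_stableI)
    fix a b assume "a \<in> ?E" "b \<in> ?E"
    then obtain A B A' B' where ab: "a = A \<times> B" "A \<in> ?G" "B \<in> sets U" "b = A' \<times> B'" "A' \<in> ?G" "B' \<in> sets U"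
      by (elim CollectE exE conjE)
    have "A \<inter> A' \<in> ?G" by (rule Int_stableD[OF predictable_gen_Int_stable ab(2,5)])
    moreover have "a \<inter> b = (A \<inter> A') \<times> (B \<inter> B')" unfolding ab(1,4) by (rule Times_Int_Times)
    ultimately show "a \<inter> b \<in> ?E" using sets.Int[OF ab(3,6)]
      by (intro CollectI exI[of _ "A \<inter> A'"] exI[of _ "B \<inter> B'"] conjI)
  qed
  have ES: "?E \<subseteq> Pow ?S"
  proof (rule subsetI, rule PowI)
    have Gs: "?G \<subseteq> Pow (space M \<times> {0..T})" using predictable_sigma_gen[of "{0..T}" T] T_pos by auto
    fix X assume "X \<in> ?E"
    then obtain A B where X: "X = A \<times> B" "A \<in> ?G" "B \<in> sets U" by (elim CollectE exE conjE)
    have "A \<subseteq> space M \<times> {0..T}" using subsetD[OF Gs X(2)] by (simp only: PowD)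
    then show "X \<subseteq> ?S" using sets.sets_into_space[OF X(3)] unfolding X(1) by (rule Sigma_mono)
  qed
  from IS ES GS have "g G \<in> borel_measurable (F t)"
  proof (induction rule: sigma_sets_induct_disjoint)
    case (basic E)
    then obtain A B where E: "E = A \<times> B" "A \<in> ?G" "B \<in> sets U" by (elim CollectE exE conjE)
    have ES: "E \<in> sets (Prd \<Otimes>\<^sub>M U)" unfolding sets_Prd_pair using basic by (rule sigma_sets.Basic)
    have gE: "g E w = (\<integral>\<^sup>+p. indicator D p * (path (indicator E) w p * indicator {..t} (fst p)) \<partial>\<mu> w)" if "w \<in> space M" for w
      unfolding g_def by (intro nn_integral_pm that meas ES)
    from E(2) show ?case
    proof
      assume "A \<in> {B \<times> {0} |B. B \<in> sets (F 0)}"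
      then have "indicator D p * (path (indicator E) w p * indicator {..t} (fst p)) = (0 :: ennreal)" for w p
        by (auto simp: E(1) D_def path_def split: split_indicator)
      then have "g E w = 0" if "w \<in> space M" for w unfolding gE[OF that] by (simp only: nn_integral_const mult_zero_left)
      then show ?thesis by (subst measurable_cong[where g="\<lambda>_. 0"]) (auto simp: space_F)
    next
      assume "A \<in> {B \<times> {s<..t} |B s t. 0 \<le> s \<and> s \<le> t \<and> t \<in> {0..T} \<and> B \<in> sets (F s)}"
      then obtain C u v where A: "A = C \<times> {u<..v}" "0 \<le> u" "u \<le> v" "v \<le> T" "C \<in> sets (F u)" by auto
      show ?thesis
      proof (cases "u \<le> t")
        case False
        then have "indicator D p * (path (indicator E) w p * indicator {..t} (fst p)) = (0 :: ennreal)" for w p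
          using A by (auto simp: E(1) D_def path_def split: split_indicator)
        then have "g E w = 0" if "w \<in> space M" for w unfolding gE[OF that] by (simp only: nn_integral_const mult_zero_left)
        then show ?thesis by (subst measurable_cong[where g="\<lambda>_. 0"]) (auto simp: space_F)
      next
        case True
        let ?v = "min v t"
        have "g E w = indicator C w * (emeasure (\<mu> w) ({0..?v} \<times> B) - emeasure (\<mu> w) ({0..u} \<times> B))" if w: "w \<in> space M" for w
        proof -
          obtain I :: "nat set" and pt where f: "\<And>t. emeasure (\<mu> w) ({0..t} \<times> space U) < \<infinity>"
            using pm_points[OF w] by metis
          have "g E w = (\<integral>\<^sup>+p. indicator C w * indicator ({u<..?v} \<times> B) p \<partial>\<mu> w)"
            unfolding gE[OF w] using A E(3) sets.sets_into_space[OF E(3)] t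
            by (intro nn_integral_cong) (auto simp: E(1) D_def path_def split: split_indicator split_indicator_asm)
          also have "\<dots> = indicator C w * emeasure (\<mu> w) ({u<..?v} \<times> B)"
            using sets_mu[OF w] E(3) by (intro nn_integral_cmult_indicator) auto
          also have "emeasure (\<mu> w) ({u<..?v} \<times> B) = emeasure (\<mu> w) ({0..?v} \<times> B) - emeasure (\<mu> w) ({0..u} \<times> B)"
          proof -
            have "{u<..?v} \<times> B = {0..?v} \<times> B - {0..u} \<times> B" using A(2) by auto
            moreover have "emeasure (\<mu> w) ({0..u} \<times> B) \<noteq> \<infinity>"
            proof -
              have "emeasure (\<mu> w) ({0..u} \<times> B) \<le> emeasure (\<mu> w) ({0..u} \<times> space U)"
                using sets_mu[OF w] E(3) sets.sets_into_space[OF E(3)] by (intro emeasure_mono) auto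
              then show ?thesis using f[of u] by auto
            qed
            ultimately show ?thesis
              using sets_mu[OF w] E(3) A True by (simp only:) (intro emeasure_Diff, auto)
          qed
          finally show ?thesis .
        qed
        note eq = this
        have "C \<in> sets (F t)" using A(5) sets_F_mono[OF True] by blast
        then have "(\<lambda>w. indicator C w * (emeasure (\<mu> w) ({0..?v} \<times> B) - emeasure (\<mu> w) ({0..u} \<times> B))) \<in> borel_measurable (F t)"
          using measurable_F_mono[OF mu_adapted[of ?v B], of t] measurable_F_mono[OF mu_adapted[of u B], of t] E(3) A True t
          by (intro borel_measurable_times_ennreal borel_measurable_minus_ennreal borel_measurable_indicator) auto
        then show ?thesis by (subst measurable_cong[OF eq]) (auto simp: space_F)
      qed
    qed
  next
    case empty
    have "g {} = (\<lambda>_. 0)" by (auto simp: g_def path_def)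
    then show ?case by simp
  next
    case (compl E)
    then have E: "E \<in> sets (Prd \<Otimes>\<^sub>M U)" by (simp add: sets_Prd_pair)
    have S: "?S \<in> sets (Prd \<Otimes>\<^sub>M U)" "?S - E \<in> sets (Prd \<Otimes>\<^sub>M U)"
      using sets.top[of "Prd \<Otimes>\<^sub>M U"] E by (auto simp: space_Prd_pair[symmetric])
    have eq: "g (?S - E) w = g ?S w - g E w" if w: "w \<in> space M" for w
    proof -
      have "g ?S w = g (?S - E) w + g E w"
      proof -
        have "g ?S w = (\<integral>\<^sup>+p. path (indicator (?S - E)) w p * indicator {..t} (fst p) + path (indicator E) w p * indicator {..t} (fst p) \<partial>pm w)"
          unfolding g_def using path_space[OF w] sets.sets_into_space[OF E]
          by (intro nn_integral_cong) (auto simp: path_def space_Prd_pair split: split_indicator)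
        also have "\<dots> = g (?S - E) w + g E w" unfolding g_def by (intro nn_integral_add meas' S E w)
        finally show ?thesis .
      qed
      moreover from this have "g E w \<noteq> \<infinity>" using fin[OF w] by auto
      ultimately show ?thesis by simp
    qed
    have "(\<lambda>w. g ?S w - g E w) \<in> borel_measurable (F t)"
      using top compl by (intro borel_measurable_minus_ennreal) auto
    then show ?case by (subst measurable_cong[OF eq]) (auto simp: space_F)
  next
    case (union E)
    then have E: "E i \<in> sets (Prd \<Otimes>\<^sub>M U)" for i by (auto simp: sets_Prd_pair)
    have eq: "g (\<Union>i. E i) w = (\<Sum>i. g (E i) w)" if w: "w \<in> space M" for w
    proof -
      have "g (\<Union>i. E i) w = (\<integral>\<^sup>+p. (\<Sum>i. path (indicator (E i)) w p * indicator {..t} (fst p)) \<partial>pm w)"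
        unfolding g_def
        by (intro nn_integral_cong) (auto simp: path_def suminf_indicator[OF union(1)] ennreal_suminf_multc)
      also have "\<dots> = (\<Sum>i. g (E i) w)" unfolding g_def by (intro nn_integral_suminf meas' E w)
      finally show ?thesis .
    qed
    have "(\<lambda>w. \<Sum>i. g (E i) w) \<in> borel_measurable (F t)" using union by (intro borel_measurable_suminf_order) auto
    then show ?case by (subst measurable_cong[OF eq]) (auto simp: space_F)
  qed
  then show ?thesis unfolding g_def .
qed

lemma pm_adapted:
  assumes W: "(W :: ('w \<times> real) \<times> 'u \<Rightarrow> ennreal) \<in> borel_measurable (Prd \<Otimes>\<^sub>M U)" and t: "t \<in> {0..T}"
  shows "(\<lambda>w. \<integral>\<^sup>+p. path W w p * indicator {..t} (fst p) \<partial>pm w) \<in> borel_measurable (F t)"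
proof -
  have meas: "(\<lambda>p. path W w p * indicator {..t} (fst p) :: ennreal) \<in> borel_measurable (pm w)"
    if "(W :: ('w \<times> real) \<times> 'u \<Rightarrow> ennreal) \<in> borel_measurable (Prd \<Otimes>\<^sub>M U)" "w \<in> space M" for W w
  proof -
    have "(\<lambda>p. path W w p * indicator {..t} (fst p) :: ennreal) \<in> borel_measurable (borel \<Otimes>\<^sub>M U)"
      using that by (intro borel_measurable_times_ennreal measurable_path measurable_time_indicator) auto
    then show ?thesis using measurable_cong_sets[OF sets_pm[OF that(2)] refl] by blast
  qed
  show ?thesis using W
  proof (induction rule: borel_measurable_induct)
    case (cong f g)
    have "(\<integral>\<^sup>+p. path g w p * indicator {..t} (fst p) \<partial>pm w) = (\<integral>\<^sup>+p. path f w p * indicator {..t} (fst p) \<partial>pm w)" if w: "w \<in> space M" for w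
      using path_space[OF w] cong(3) by (intro nn_integral_cong) (auto simp: path_def space_pm[OF w])
    then show ?case using cong(4) by (subst measurable_cong) (auto simp: space_F)
  next
    case (set A)
    then show ?case by (rule pm_adapted_indicator[OF _ t])
  next
    case (mult u c)
    have eq: "(\<integral>\<^sup>+p. path (\<lambda>x. c * u x) w p * indicator {..t} (fst p) \<partial>pm w) = c * (\<integral>\<^sup>+p. path u w p * indicator {..t} (fst p) \<partial>pm w)" if w: "w \<in> space M" for w
      using nn_integral_cmult[OF meas[OF mult(2) w], of c] by (simp add: path_def mult.assoc)
    then show ?case using mult by (subst measurable_cong[OF eq]) (auto simp: space_F)
  next
    case (add u v)
    have eq: "(\<integral>\<^sup>+p. path (\<lambda>x. v x + u x) w p * indicator {..t} (fst p) \<partial>pm w) =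
      (\<integral>\<^sup>+p. path v w p * indicator {..t} (fst p) \<partial>pm w) + (\<integral>\<^sup>+p. path u w p * indicator {..t} (fst p) \<partial>pm w)" if w: "w \<in> space M" for w
      using nn_integral_add[OF meas[OF add(3) w] meas[OF add(1) w]] by (simp add: path_def distrib_right)
    then show ?case using add by (subst measurable_cong[OF eq]) (auto simp: space_F)
  next
    case (seq V)
    have eq: "(\<integral>\<^sup>+p. path (SUP i. V i) w p * indicator {..t} (fst p) \<partial>pm w) =
      (SUP i. \<integral>\<^sup>+p. path (V i) w p * indicator {..t} (fst p) \<partial>pm w)" if w: "w \<in> space M" for w
    proof -
      have "(\<integral>\<^sup>+p. path (SUP i. V i) w p * indicator {..t} (fst p) \<partial>pm w) = (\<integral>\<^sup>+p. (SUP i. path (V i) w p * indicator {..t} (fst p)) \<partial>pm w)"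
        by (intro nn_integral_cong) (auto simp: path_def SUP_mult_right_ennreal image_comp)
      also have "\<dots> = (SUP i. \<integral>\<^sup>+p. path (V i) w p * indicator {..t} (fst p) \<partial>pm w)"
      proof (rule nn_integral_monotone_convergence_SUP)
        show "incseq (\<lambda>i p. path (V i) w p * indicator {..t} (fst p))"
          using seq(3) by (auto simp: incseq_def le_fun_def path_def intro!: mult_right_mono)
        show "(\<lambda>p. path (V i) w p * indicator {..t} (fst p)) \<in> borel_measurable (pm w)" for i
          by (intro meas seq w)
      qed
      finally show ?thesis .
    qed
    then show ?case using seq by (subst measurable_cong[OF eq]) (auto simp: space_F)
  qed
qed

end

section \<open>Square integrability of compensated integrals\<close>

context point_process
begin

definition J :: "(('w \<times> real) \<times> 'u \<Rightarrow> real) \<Rightarrow> 'w \<Rightarrow> real" where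
  "J W w = (\<integral>p. path W w p \<partial>pm w) - (\<integral>p. path W w p \<partial>vm w)"

lemma measurable_pm: "w \<in> space M \<Longrightarrow> h \<in> measurable (borel \<Otimes>\<^sub>M U) N \<Longrightarrow> h \<in> measurable (pm w) N"
  using measurable_cong_sets[OF sets_pm refl] by blast

lemma measurable_vm: "w \<in> space M \<Longrightarrow> h \<in> measurable (borel \<Otimes>\<^sub>M U) N \<Longrightarrow> h \<in> measurable (vm w) N"
  using measurable_cong_sets[OF sets_vm refl] by blast

lemma pm_sum:
  assumes w: "w \<in> space M"
  obtains I :: "nat set" and pt where "finite I" "\<And>n. n \<in> I \<Longrightarrow> pt n \<in> D" "inj_on (\<lambda>n. fst (pt n)) I"
    "\<And>h :: _ \<Rightarrow> real. h \<in> borel_measurable (borel \<Otimes>\<^sub>M U) \<Longrightarrow> (\<integral>p. h p \<partial>pm w) = (\<Sum>i\<in>I. h (pt i))"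
    "\<And>h :: _ \<Rightarrow> real. h \<in> borel_measurable (borel \<Otimes>\<^sub>M U) \<Longrightarrow> integrable (pm w) h"
proof -
  obtain I :: "nat set" and pt where I: "finite I" "\<And>n. n \<in> I \<Longrightarrow> pt n \<in> D" "inj_on (\<lambda>n. fst (pt n)) I"
    "pm w = distr (count_space I) (borel \<Otimes>\<^sub>M U) pt"
    using pm_points[OF w] by metis
  have ptm: "pt \<in> count_space I \<rightarrow>\<^sub>M borel \<Otimes>\<^sub>M U" using I(2) by (auto simp: D_def space_pair_measure mem_Times_iff)
  have 1: "(\<integral>p. h p \<partial>pm w) = (\<Sum>i\<in>I. h (pt i))" if "h \<in> borel_measurable (borel \<Otimes>\<^sub>M U)" for h :: "_ \<Rightarrow> real"
    unfolding I(4) using integral_distr[OF ptm that] I(1) by (simp add: lebesgue_integral_count_space_finite)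
  have 2: "integrable (pm w) h" if "h \<in> borel_measurable (borel \<Otimes>\<^sub>M U)" for h :: "_ \<Rightarrow> real"
    unfolding I(4) using integrable_distr_eq[OF ptm that] integrable_count_space[OF I(1)] by blast
  show ?thesis by (rule that[OF I(1-3) 1 2])
qed

lemma integrable_pm:
  fixes h :: "real \<times> 'u \<Rightarrow> real"
  shows "w \<in> space M \<Longrightarrow> h \<in> borel_measurable (borel \<Otimes>\<^sub>M U) \<Longrightarrow> integrable (pm w) h"
  using pm_sum by metis

lemma AE_pm: "w \<in> space M \<Longrightarrow> AE p in pm w. p \<in> D"
  unfolding pm_def using D_sets sets_mu by (subst AE_density) (auto split: split_indicator intro!: borel_measurable_indicator)

lemma AE_vm: "w \<in> space M \<Longrightarrow> AE p in vm w. p \<in> D"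
  unfolding vm_def using D_sets sets_nu by (subst AE_density) (auto split: split_indicator intro!: borel_measurable_indicator)

lemma integrable_vm_bounded:
  fixes h :: "real \<times> 'u \<Rightarrow> real"
  assumes w: "w \<in> space M" and h: "h \<in> borel_measurable (borel \<Otimes>\<^sub>M U)" "\<And>p. snd p \<in> space U \<Longrightarrow> \<bar>h p\<bar> \<le> c"
  shows "integrable (vm w) h"
  by (rule finite_measure.integrable_const_bound[OF finite_vm[OF w], of _ c])
    (use h measurable_vm[OF w h(1)] in \<open>auto intro!: AE_I2 simp: space_vm[OF w]\<close>)

lemma path_bound:
  assumes "\<And>q. q \<in> space (Prd \<Otimes>\<^sub>M U) \<Longrightarrow> \<bar>W q\<bar> \<le> c" "w \<in> space M" "snd p \<in> space U"
  shows "\<bar>path W w p\<bar> \<le> c"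
  unfolding path_def by (rule assms(1)[OF path_space[OF assms(2,3)]])

lemma path_mult: "path (\<lambda>q. V q * W q) w p = path V w p * path W w p" by (simp add: path_def)

lemma vm_predictable_real:
  assumes W: "W \<in> borel_measurable (Prd \<Otimes>\<^sub>M U)" "\<And>q. q \<in> space (Prd \<Otimes>\<^sub>M U) \<Longrightarrow> \<bar>W q\<bar> \<le> (c :: real)"
  shows "(\<lambda>(w, t). \<integral>p. path W w p * indicator {..t} (fst p) \<partial>vm w) \<in> borel_measurable Prd"
proof -
  let ?g = "\<lambda>W (w, t). \<integral>\<^sup>+p. path W w p * indicator {..t} (fst p) \<partial>vm w"
  have "(\<lambda>x. enn2real (?g (\<lambda>q. ennreal (W q)) x) - enn2real (?g (\<lambda>q. ennreal (- W q)) x)) \<in> borel_measurable Prd"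
    using W(1) by (intro borel_measurable_diff borel_measurable_enn2real vm_predictable) auto
  also have "?this \<longleftrightarrow> ?thesis"
  proof (rule measurable_cong)
    fix x assume "x \<in> space Prd"
    then obtain w t where x: "x = (w, t)" "w \<in> space M" by (auto simp: space_Prd)
    have i: "integrable (vm w) (\<lambda>p. path W w p * indicator {..t} (fst p))"
      by (rule integrable_time_indicator[OF sets_vm[OF x(2)] _ integrable_vm_bounded[OF x(2) measurable_path[OF W(1) x(2)] path_bound[OF W(2) x(2)]]]) auto
    have e: "ennreal (path W w p * indicator {..t} (fst p)) = path (\<lambda>q. ennreal (W q)) w p * indicator {..t} (fst p)"
      "ennreal (- (path W w p * indicator {..t} (fst p))) = path (\<lambda>q. ennreal (- W q)) w p * indicator {..t} (fst p)" for p
      by (auto simp: path_def split: split_indicator)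
    show "enn2real (?g (\<lambda>q. ennreal (W q)) x) - enn2real (?g (\<lambda>q. ennreal (- W q)) x) =
      (case x of (w, t) \<Rightarrow> \<integral>p. path W w p * indicator {..t} (fst p) \<partial>vm w)"
      unfolding x(1) prod.case real_lebesgue_integral_def[OF i] e ..
  qed
  finally show ?thesis .
qed

lemma vm_adapted_real:
  assumes W: "W \<in> borel_measurable (Prd \<Otimes>\<^sub>M U)" "\<And>q. q \<in> space (Prd \<Otimes>\<^sub>M U) \<Longrightarrow> \<bar>W q\<bar> \<le> (c :: real)" and t: "t \<in> {0..T}"
  shows "(\<lambda>w. \<integral>p. path W w p * indicator {..t} (fst p) \<partial>vm w) \<in> borel_measurable (F t)"
  using measurable_Prd_at[OF vm_predictable_real[OF W] t] by simp

lemma pm_adapted_real: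
  assumes W: "(W :: _ \<Rightarrow> real) \<in> borel_measurable (Prd \<Otimes>\<^sub>M U)" and t: "t \<in> {0..T}"
  shows "(\<lambda>w. \<integral>p. path W w p * indicator {..t} (fst p) \<partial>pm w) \<in> borel_measurable (F t)"
proof -
  let ?g = "\<lambda>W w. \<integral>\<^sup>+p. path W w p * indicator {..t} (fst p) \<partial>pm w"
  have "(\<lambda>w. enn2real (?g (\<lambda>q. ennreal (W q)) w) - enn2real (?g (\<lambda>q. ennreal (- W q)) w)) \<in> borel_measurable (F t)"
    using W by (intro borel_measurable_diff borel_measurable_enn2real pm_adapted t) auto
  also have "?this \<longleftrightarrow> ?thesis"
  proof (rule measurable_cong)
    fix w assume "w \<in> space (F t)"
    then have w: "w \<in> space M" by (simp add: space_F)
    have i: "integrable (pm w) (\<lambda>p. path W w p * indicator {..t} (fst p))"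
      by (rule integrable_time_indicator[OF sets_pm[OF w] _ integrable_pm[OF w measurable_path[OF W w]]]) auto
    have e: "ennreal (path W w p * indicator {..t} (fst p)) = path (\<lambda>q. ennreal (W q)) w p * indicator {..t} (fst p)"
      "ennreal (- (path W w p * indicator {..t} (fst p))) = path (\<lambda>q. ennreal (- W q)) w p * indicator {..t} (fst p)" for p
      by (auto simp: path_def split: split_indicator)
    show "enn2real (?g (\<lambda>q. ennreal (W q)) w) - enn2real (?g (\<lambda>q. ennreal (- W q)) w) =
      (\<integral>p. path W w p * indicator {..t} (fst p) \<partial>pm w)"
      unfolding real_lebesgue_integral_def[OF i] e ..
  qed
  finally show ?thesis .
qed

lemma integral_pm_cut:
  fixes h :: "real \<times> 'u \<Rightarrow> real"
  assumes "w \<in> space M" "h \<in> borel_measurable (borel \<Otimes>\<^sub>M U)"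
  shows "(\<integral>p. h p \<partial>pm w) = (\<integral>p. h p * indicator {..T} (fst p) \<partial>pm w)"
  by (intro integral_cong_AE measurable_pm assms borel_measurable_times measurable_time_indicator)
    (use AE_pm[OF assms(1)] in \<open>auto elim!: eventually_mono simp: D_def\<close>)

lemma integral_vm_cut:
  fixes h :: "real \<times> 'u \<Rightarrow> real"
  assumes "w \<in> space M" "h \<in> borel_measurable (borel \<Otimes>\<^sub>M U)"
  shows "(\<integral>p. h p \<partial>vm w) = (\<integral>p. h p * indicator {..T} (fst p) \<partial>vm w)"
  by (intro integral_cong_AE measurable_vm assms borel_measurable_times measurable_time_indicator)
    (use AE_vm[OF assms(1)] in \<open>auto elim!: eventually_mono simp: D_def\<close>)

lemma T_in: "T \<in> {0..T}" using T_pos by simp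

lemma pm_integral_measurable:
  assumes W: "(W :: _ \<Rightarrow> real) \<in> borel_measurable (Prd \<Otimes>\<^sub>M U)"
  shows "(\<lambda>w. \<integral>p. path W w p \<partial>pm w) \<in> borel_measurable M"
  by (subst measurable_cong[OF integral_pm_cut[OF _ measurable_path[OF W]]])
    (auto intro: measurable_F_sub[OF pm_adapted_real[OF W T_in]])

lemma vm_integral_measurable:
  assumes W: "W \<in> borel_measurable (Prd \<Otimes>\<^sub>M U)" "\<And>q. q \<in> space (Prd \<Otimes>\<^sub>M U) \<Longrightarrow> \<bar>W q\<bar> \<le> (c :: real)"
  shows "(\<lambda>w. \<integral>p. path W w p \<partial>vm w) \<in> borel_measurable M"
  by (subst measurable_cong[OF integral_vm_cut[OF _ measurable_path[OF W(1)]]])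
    (auto intro: measurable_F_sub[OF vm_adapted_real[OF W T_in]])

section \<open>Localisation by the mass accumulated in the strict past\<close>

definition mass :: "'w \<Rightarrow> real \<Rightarrow> real" where
  "mass w s = measure (pm w) ({..<s} \<times> space U) + measure (vm w) ({..<s} \<times> space U)"

lemma integral_time_measure:
  assumes "w \<in> space M" "S \<in> sets borel"
  shows "(\<integral>p. indicator S (fst p) \<partial>pm w) = measure (pm w) (S \<times> space U)"
    "(\<integral>p. indicator S (fst p) \<partial>vm w) = measure (vm w) (S \<times> space U)"
proof -
  have SU: "S \<times> space U \<inter> UNIV \<times> space U = S \<times> space U" by auto
  have "(\<integral>p. indicator S (fst p) \<partial>pm w) = (\<integral>p. (indicator (S \<times> space U) p :: real) \<partial>pm w)"
    by (intro Bochner_Integration.integral_cong) (auto simp: space_pm[OF assms(1)] split: split_indicator)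
  then show "(\<integral>p. indicator S (fst p) \<partial>pm w) = measure (pm w) (S \<times> space U)"
    by (simp add: space_pm[OF assms(1)] SU)
  have "(\<integral>p. indicator S (fst p) \<partial>vm w) = (\<integral>p. (indicator (S \<times> space U) p :: real) \<partial>vm w)"
    by (intro Bochner_Integration.integral_cong) (auto simp: space_vm[OF assms(1)] split: split_indicator)
  then show "(\<integral>p. indicator S (fst p) \<partial>vm w) = measure (vm w) (S \<times> space U)"
    by (simp add: space_vm[OF assms(1)] SU)
qed

lemma mass_predictable:
  obtains X' where "predictable_process M F T X'" "\<And>w t. w \<in> space M \<Longrightarrow> 0 < t \<Longrightarrow> X' w t = mass w t"
proof -
  define X :: "'w \<Rightarrow> real \<Rightarrow> real" where
    "X w t = (\<integral>p. indicator {..t} (fst p) \<partial>pm w) + (\<integral>p. indicator {..t} (fst p) \<partial>vm w)" for w t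
  have "(\<lambda>w. X w t) \<in> borel_measurable (F t)" if "t \<in> {0..T}" for t
    using pm_adapted_real[of "\<lambda>_. 1" t] vm_adapted_real[of "\<lambda>_. 1" 1 t] that by (simp add: X_def path_def)
  then obtain X' where X': "predictable_process M F T X'" "\<And>w t l. 0 < t \<Longrightarrow> (X w \<longlongrightarrow> l) (at_left t) \<Longrightarrow> X' w t = l"
    by (rule left_limit_predictable[of X]) (assumption, rule that)
  have "X' w t = mass w t" if w: "w \<in> space M" and t: "0 < t" for w t
  proof (rule X'(2)[OF t])
    have 1: "integrable (vm w) (\<lambda>_. 1 :: real)" by (rule integrable_vm_bounded[OF w, of _ 1]) auto
    have 2: "integrable (pm w) (\<lambda>_. 1 :: real)" by (rule integrable_pm[OF w]) auto
    have "((\<lambda>t. X w t) \<longlongrightarrow> (\<integral>p. indicator {..<t} (fst p) \<partial>pm w) + (\<integral>p. indicator {..<t} (fst p) \<partial>vm w)) (at_left t)"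
      unfolding X_def using integral_left_limit[OF sets_pm[OF w] 2, of t] integral_left_limit[OF sets_vm[OF w] 1, of t]
      by (intro tendsto_add) simp_all
    then show "(X w \<longlongrightarrow> mass w t) (at_left t)" unfolding mass_def by (simp add: integral_time_measure[OF w])
  qed
  then show ?thesis using that X'(1) by blast
qed

text \<open>Since \<open>mass\<close> at t counts only what lies strictly before t, it is a left
  limit of an adapted process and this set is predictable. It takes the place of a localising
  sequence of stopping times.\<close>

definition Loc :: "nat \<Rightarrow> (('w \<times> real) \<times> 'u) set" where
  "Loc n = {q \<in> space (Prd \<Otimes>\<^sub>M U). 0 < snd (fst q) \<and> mass (fst (fst q)) (snd (fst q)) \<le> real n}"

lemma Loc_sets: "Loc n \<in> sets (Prd \<Otimes>\<^sub>M U)"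
proof -
  obtain X' where X': "predictable_process M F T X'" "\<And>w t. w \<in> space M \<Longrightarrow> 0 < t \<Longrightarrow> X' w t = mass w t"
    by (rule mass_predictable) blast
  have m1: "(\<lambda>q. (\<lambda>(w, t). X' w t) (fst q)) \<in> borel_measurable (Prd \<Otimes>\<^sub>M U)"
    using X'(1) unfolding predictable_process_def by (rule measurable_compose[OF measurable_fst])
  have m2: "(\<lambda>q. snd (fst q)) \<in> borel_measurable (Prd \<Otimes>\<^sub>M U)"
    by (rule measurable_compose[OF measurable_fst measurable_snd_Prd])
  have "{q \<in> space (Prd \<Otimes>\<^sub>M U). 0 < snd (fst q)} \<inter> {q \<in> space (Prd \<Otimes>\<^sub>M U). (\<lambda>(w, t). X' w t) (fst q) \<le> real n} \<in> sets (Prd \<Otimes>\<^sub>M U)"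
    using borel_measurable_less[OF borel_measurable_const m2, of 0] borel_measurable_le[OF m1 borel_measurable_const, of "real n"]
    by (intro sets.Int) auto
  also have "{q \<in> space (Prd \<Otimes>\<^sub>M U). 0 < snd (fst q)} \<inter> {q \<in> space (Prd \<Otimes>\<^sub>M U). (\<lambda>(w, t). X' w t) (fst q) \<le> real n} = Loc n"
    using X'(2) by (auto simp: Loc_def space_Prd_pair)
  finally show ?thesis .
qed

text \<open>The elementary integrands: for them the integrals against \<open>pm w\<close> and
  \<open>vm w\<close> are bounded by a constant that does not depend on \<open>w\<close>, so all
  expectations below exist.\<close>

definition loc :: "real \<Rightarrow> nat \<Rightarrow> (('w \<times> real) \<times> 'u \<Rightarrow> real) \<Rightarrow> bool" where
  "loc c n V \<longleftrightarrow> 0 \<le> c \<and> V \<in> borel_measurable (Prd \<Otimes>\<^sub>M U) \<and> (\<forall>q\<in>space (Prd \<Otimes>\<^sub>M U). \<bar>V q\<bar> \<le> c \<and> (q \<notin> Loc n \<longrightarrow> V q = 0))"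

lemma locD:
  assumes "loc c n V"
  shows "0 \<le> c" "V \<in> borel_measurable (Prd \<Otimes>\<^sub>M U)" "\<And>q. q \<in> space (Prd \<Otimes>\<^sub>M U) \<Longrightarrow> \<bar>V q\<bar> \<le> c"
    "\<And>q. q \<in> space (Prd \<Otimes>\<^sub>M U) \<Longrightarrow> q \<notin> Loc n \<Longrightarrow> V q = 0"
  using assms unfolding loc_def by auto

text \<open>By \<open>early_mass\<close> at level \<open>n\<close>, on a given path \<open>V\<close>
  vanishes after some time \<open>\<theta>\<close>, and the mass up to and including
  \<open>\<theta>\<close> is at most n + 1; the extra unit is the atom at
  \<open>\<theta>\<close>.\<close>

lemma loc_nn_bound_aux:
  assumes V: "loc c n V" and w: "w \<in> space M"
    and Q: "finite_measure Q" "sets Q = sets (borel \<Otimes>\<^sub>M U)" "AE p in Q. p \<in> D"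
    and at: "\<And>t. emeasure Q ({t} \<times> space U) \<le> 1"
    and le: "\<And>s. measure Q ({..<s} \<times> space U) \<le> mass w s"
  shows "(\<integral>\<^sup>+p. ennreal \<bar>path V w p\<bar> \<partial>Q) \<le> ennreal (c * (real n + 1))"
proof -
  interpret finite_measure Q by fact
  note V' = locD[OF V]
  have at': "measure Q ({t} \<times> space U) \<le> 1" for t using at[of t] by (simp add: emeasure_eq_measure ennreal_le_1)
  have spQ: "space Q = UNIV \<times> space U" using sets_eq_imp_space_eq[OF Q(2)] by (simp add: space_pair_measure)
  have key: "0 < fst p \<and> fst p \<le> T \<and> measure Q ({..<fst p} \<times> space U) \<le> real n" if "p \<in> D" "path V w p \<noteq> 0" for p
  proof -
    have p: "0 < fst p" "fst p \<le> T" "snd p \<in> space U" using that(1) by (auto simp: D_def)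
    then have "path V w p = V ((w, fst p), snd p)" by (intro path_eq) auto
    moreover have "((w, fst p), snd p) \<in> space (Prd \<Otimes>\<^sub>M U)" using p w by (auto simp: space_Prd_pair)
    ultimately have "((w, fst p), snd p) \<in> Loc n" using V'(4) that(2) by metis
    then have "mass w (fst p) \<le> real n" by (simp add: Loc_def)
    then show ?thesis using le[of "fst p"] p by linarith
  qed
  from early_mass[OF Q(1,2) at', of "real n" T]
  consider (a) \<theta> where "\<And>s. 0 < s \<Longrightarrow> s \<le> T \<Longrightarrow> measure Q ({..<s} \<times> space U) \<le> real n \<Longrightarrow> s \<le> \<theta>" "measure Q ({..\<theta>} \<times> space U) \<le> real n + 1"
    | (b) "\<And>s. \<not> (0 < s \<and> s \<le> T \<and> measure Q ({..<s} \<times> space U) \<le> real n)" by auto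
  then show ?thesis
  proof cases
    case a
    have "(\<integral>\<^sup>+p. ennreal \<bar>path V w p\<bar> \<partial>Q) \<le> (\<integral>\<^sup>+p. ennreal c * indicator ({..\<theta>} \<times> space U) p \<partial>Q)"
    proof (rule nn_integral_mono_AE)
      show "AE p in Q. ennreal \<bar>path V w p\<bar> \<le> ennreal c * indicator ({..\<theta>} \<times> space U) p"
        using Q(3)
      proof eventually_elim
        case (elim p)
        then have pU: "snd p \<in> space U" by (auto simp: D_def)
        show ?case
        proof (cases "path V w p = 0")
          case False
          from key[OF elim False] a(1) have "fst p \<le> \<theta>" by blast
          then have "p \<in> {..\<theta>} \<times> space U" using pU by (cases p) auto
          then show ?thesis using path_bound[OF V'(3) w pU] by (simp add: ennreal_leI)
        qed simp
      qed
    qed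
    also have "\<dots> = ennreal c * emeasure Q ({..\<theta>} \<times> space U)"
      using Q(2) by (intro nn_integral_cmult_indicator) auto
    also have "\<dots> \<le> ennreal c * ennreal (real n + 1)"
      unfolding emeasure_eq_measure by (intro mult_left_mono ennreal_leI a(2)) simp
    also have "\<dots> = ennreal (c * (real n + 1))" using V'(1) by (simp add: ennreal_mult)
    finally show ?thesis .
  next
    case b
    have "(\<integral>\<^sup>+p. ennreal \<bar>path V w p\<bar> \<partial>Q) = (\<integral>\<^sup>+p. 0 \<partial>Q)"
      by (rule nn_integral_cong_AE) (use Q(3) key b in \<open>auto elim!: eventually_mono\<close>)
    then show ?thesis by simp
  qed
qed

lemma loc_nn_bound:
  assumes "loc c n V" "w \<in> space M"
  shows "(\<integral>\<^sup>+p. ennreal \<bar>path V w p\<bar> \<partial>pm w) \<le> ennreal (c * (real n + 1))"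
    "(\<integral>\<^sup>+p. ennreal \<bar>path V w p\<bar> \<partial>vm w) \<le> ennreal (c * (real n + 1))"
  using loc_nn_bound_aux[OF assms finite_pm sets_pm AE_pm emeasure_pm_point_le, OF assms(2,2,2,2)]
    loc_nn_bound_aux[OF assms finite_vm sets_vm AE_vm emeasure_vm_point_le, OF assms(2,2,2,2)]
  by (simp_all add: mass_def)

lemma loc_integrable:
  assumes "loc c n V" "w \<in> space M"
  shows "integrable (pm w) (path V w)" "integrable (vm w) (path V w)"
  using integrable_pm[OF assms(2) measurable_path[OF locD(2)[OF assms(1)] assms(2)]]
    integrable_vm_bounded[OF assms(2) measurable_path[OF locD(2)[OF assms(1)] assms(2)] path_bound[OF locD(3)[OF assms(1)] assms(2)]]
  by auto

lemma loc_bound: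
  assumes "loc c n V" "w \<in> space M"
  shows "\<bar>\<integral>p. path V w p \<partial>pm w\<bar> \<le> c * (real n + 1)" "\<bar>\<integral>p. path V w p \<partial>vm w\<bar> \<le> c * (real n + 1)"
proof -
  have c: "0 \<le> c * (real n + 1)" using locD(1)[OF assms(1)] by simp
  have "ennreal \<bar>\<integral>p. path V w p \<partial>Q\<bar> \<le> ennreal (c * (real n + 1))"
    if "integrable Q (path V w)" "(\<integral>\<^sup>+p. ennreal \<bar>path V w p\<bar> \<partial>Q) \<le> ennreal (c * (real n + 1))" for Q
  proof -
    have "ennreal \<bar>\<integral>p. path V w p \<partial>Q\<bar> \<le> (\<integral>\<^sup>+p. ennreal \<bar>path V w p\<bar> \<partial>Q)"
      using integral_norm_bound_ennreal[OF that(1)] by (simp only: real_norm_def)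
    also have "\<dots> \<le> ennreal (c * (real n + 1))" by (rule that(2))
    finally show ?thesis .
  qed
  then show "\<bar>\<integral>p. path V w p \<partial>pm w\<bar> \<le> c * (real n + 1)" "\<bar>\<integral>p. path V w p \<partial>vm w\<bar> \<le> c * (real n + 1)"
    using loc_integrable[OF assms] loc_nn_bound[OF assms] c by (simp_all add: ennreal_le_iff)
qed

lemma loc_M_integrable:
  assumes "loc c n V"
  shows "integrable M (\<lambda>w. \<integral>p. path V w p \<partial>pm w)" "integrable M (\<lambda>w. \<integral>p. path V w p \<partial>vm w)"
  using loc_bound[OF assms] pm_integral_measurable[OF locD(2)[OF assms]] vm_integral_measurable[OF locD(2,3)[OF assms]]
  by (auto intro!: integrable_const_bound[of _ "c * (real n + 1)"] AE_I2)

text \<open>The compensation formula is an identity between possibly infinite integrals. The uniform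
  bounds turn it into one between real numbers, so that positive and negative parts may be
  subtracted.\<close>

lemma loc_expectation:
  assumes V: "loc c n V"
  shows "(\<integral>w. (\<integral>p. path V w p \<partial>pm w) \<partial>M) = (\<integral>w. (\<integral>p. path V w p \<partial>vm w) \<partial>M)"
proof -
  have pos: "(\<integral>w. (\<integral>p. path V w p \<partial>pm w) \<partial>M) = (\<integral>w. (\<integral>p. path V w p \<partial>vm w) \<partial>M)"
    if V: "loc c n V" and p: "\<And>q. 0 \<le> V q" for V
  proof -
    have e: "(\<integral>\<^sup>+p. path (\<lambda>q. ennreal (V q)) w p \<partial>pm w) = ennreal (\<integral>p. path V w p \<partial>pm w)"
      "(\<integral>\<^sup>+p. path (\<lambda>q. ennreal (V q)) w p \<partial>vm w) = ennreal (\<integral>p. path V w p \<partial>vm w)" if "w \<in> space M" for w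
    proof -
      have *: "path (\<lambda>q. ennreal (V q)) w = (\<lambda>p. ennreal (path V w p))" by (auto simp: path_def)
      have p0: "0 \<le> path V w p" for p using p by (simp add: path_def)
      show "(\<integral>\<^sup>+p. path (\<lambda>q. ennreal (V q)) w p \<partial>pm w) = ennreal (\<integral>p. path V w p \<partial>pm w)"
        unfolding * by (intro nn_integral_eq_integral loc_integrable[OF V that] AE_I2 p0)
      show "(\<integral>\<^sup>+p. path (\<lambda>q. ennreal (V q)) w p \<partial>vm w) = ennreal (\<integral>p. path V w p \<partial>vm w)"
        unfolding * by (intro nn_integral_eq_integral loc_integrable[OF V that] AE_I2 p0)
    qed
    have nn: "0 \<le> (\<integral>p. path V w p \<partial>Q)" for Q w using p by (intro integral_nonneg_AE AE_I2) (simp add: path_def)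
    have "(\<integral>\<^sup>+w. ennreal (\<integral>p. path V w p \<partial>pm w) \<partial>M) = (\<integral>\<^sup>+w. ennreal (\<integral>p. path V w p \<partial>vm w) \<partial>M)"
      using compensation[of "\<lambda>q. ennreal (V q)"] locD(2)[OF V] by (simp add: e cong: nn_integral_cong)
    then have "ennreal (\<integral>w. (\<integral>p. path V w p \<partial>pm w) \<partial>M) = ennreal (\<integral>w. (\<integral>p. path V w p \<partial>vm w) \<partial>M)"
      using nn_integral_eq_integral[OF loc_M_integrable(1)[OF V]] nn_integral_eq_integral[OF loc_M_integrable(2)[OF V]] nn by simp
    then show ?thesis using nn by (simp add: integral_nonneg_AE)
  qed
  let ?P = "\<lambda>q. max (V q) 0" and ?N = "\<lambda>q. max (- V q) 0"
  have l: "loc c n ?P" "loc c n ?N" using V unfolding loc_def by (auto simp: max_def abs_le_iff)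
  have d: "(\<integral>p. path V w p \<partial>pm w) = (\<integral>p. path ?P w p \<partial>pm w) - (\<integral>p. path ?N w p \<partial>pm w)"
    "(\<integral>p. path V w p \<partial>vm w) = (\<integral>p. path ?P w p \<partial>vm w) - (\<integral>p. path ?N w p \<partial>vm w)" if "w \<in> space M" for w
  proof -
    have *: "path V w p = path ?P w p - path ?N w p" for p by (simp add: path_def max_def)
    show "(\<integral>p. path V w p \<partial>pm w) = (\<integral>p. path ?P w p \<partial>pm w) - (\<integral>p. path ?N w p \<partial>pm w)"
      unfolding * using loc_integrable[OF l(1) that] loc_integrable[OF l(2) that] by (intro Bochner_Integration.integral_diff)
    show "(\<integral>p. path V w p \<partial>vm w) = (\<integral>p. path ?P w p \<partial>vm w) - (\<integral>p. path ?N w p \<partial>vm w)"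
      unfolding * using loc_integrable[OF l(1) that] loc_integrable[OF l(2) that] by (intro Bochner_Integration.integral_diff)
  qed
  show ?thesis
    using loc_M_integrable[OF l(1)] loc_M_integrable[OF l(2)] pos[OF l(1)] pos[OF l(2)]
    by (simp add: d cong: Bochner_Integration.integral_cong)
qed

text \<open>At t > 0 the integral over a single time is the jump of the compensator integral: a
  predictable process minus its left limit.\<close>

lemma same_time_predictable:
  assumes V: "V \<in> borel_measurable (Prd \<Otimes>\<^sub>M U)" "\<And>q. q \<in> space (Prd \<Otimes>\<^sub>M U) \<Longrightarrow> \<bar>V q\<bar> \<le> (c :: real)"
  obtains B where "(\<lambda>(w, t). B w t) \<in> borel_measurable Prd"
    "\<And>w t. w \<in> space M \<Longrightarrow> 0 < t \<Longrightarrow> B w t = (\<integral>p. path V w p * of_bool (fst p = t) \<partial>vm w)"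
proof -
  define L where "L w t = (\<integral>p. path V w p * indicator {..t} (fst p) \<partial>vm w)" for w t
  obtain X' where X': "predictable_process M F T X'" "\<And>w t l. 0 < t \<Longrightarrow> (L w \<longlongrightarrow> l) (at_left t) \<Longrightarrow> X' w t = l"
    using left_limit_predictable[of L] vm_adapted_real[OF V] unfolding L_def by blast
  have "(\<lambda>(w, t). L w t - X' w t) \<in> borel_measurable Prd"
    using borel_measurable_diff[OF vm_predictable_real[OF V] X'(1)[unfolded predictable_process_def]]
    by (simp add: L_def split_beta')
  moreover have "L w t - X' w t = (\<integral>p. path V w p * of_bool (fst p = t) \<partial>vm w)" if w: "w \<in> space M" and t: "0 < t" for w t
  proof -
    have i: "integrable (vm w) (path V w)"
      by (rule integrable_vm_bounded[OF w measurable_path[OF V(1) w] path_bound[OF V(2) w]])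
    note j = integrable_time_indicator[OF sets_vm[OF w] _ i]
    have "(L w \<longlongrightarrow> (\<integral>p. path V w p * indicator {..<t} (fst p) \<partial>vm w)) (at_left t)"
      unfolding L_def[abs_def] by (rule integral_left_limit[OF sets_vm[OF w] i])
    then have "X' w t = (\<integral>p. path V w p * indicator {..<t} (fst p) \<partial>vm w)" by (rule X'(2)[OF t])
    then have "L w t - X' w t = (\<integral>p. path V w p * indicator {..t} (fst p) - path V w p * indicator {..<t} (fst p) \<partial>vm w)"
      unfolding L_def using j[of "{..t}"] j[of "{..<t}"] by simp
    also have "\<dots> = (\<integral>p. path V w p * of_bool (fst p = t) \<partial>vm w)"
      by (intro Bochner_Integration.integral_cong) (auto split: split_indicator)
    finally show ?thesis .
  qed
  ultimately show ?thesis using that[of "\<lambda>w t. L w t - X' w t"] by blast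
qed

lemma path_time: "fst p \<in> {0..T} \<Longrightarrow> path (\<lambda>q. g (fst q)) w p = g (w, fst p)"
  by (simp add: path_def)

lemma loc_times:
  assumes V: "loc c n V" and g: "g \<in> borel_measurable Prd"
    and b: "\<And>w t x. ((w, t), x) \<in> Loc n \<Longrightarrow> \<bar>g (w, t)\<bar> \<le> d" and d: "0 \<le> d"
  shows "loc (c * d) n (\<lambda>q. V q * g (fst q))"
  unfolding loc_def
proof (intro conjI ballI impI)
  note V' = locD[OF V]
  show "0 \<le> c * d" using V'(1) d by simp
  show "(\<lambda>q. V q * g (fst q)) \<in> borel_measurable (Prd \<Otimes>\<^sub>M U)"
    using V'(2) measurable_compose[OF measurable_fst g] by (intro borel_measurable_times)
  fix q assume q: "q \<in> space (Prd \<Otimes>\<^sub>M U)"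
  show "\<bar>V q * g (fst q)\<bar> \<le> c * d"
  proof (cases "q \<in> Loc n")
    case True
    then have "\<bar>g (fst q)\<bar> \<le> d" using b by (metis prod.collapse)
    then show ?thesis using V'(3)[OF q] d V'(1) by (simp add: abs_mult mult_mono)
  next
    case False
    then show ?thesis using V'(4)[OF q] V'(1) d by simp
  qed
  show "V q * g (fst q) = 0" if "q \<notin> Loc n" using V'(4)[OF q that] by simp
qed

lemma integral_path_same_time:
  assumes V: "loc c n V" and B: "(\<lambda>(w, t). B w t) \<in> borel_measurable Prd"
    "\<And>w t. w \<in> space M \<Longrightarrow> 0 < t \<Longrightarrow> B w t = (\<integral>p. path V w p * of_bool (fst p = t) \<partial>vm w)"
    and w: "w \<in> space M" and Q: "AE p in Q. p \<in> D" "sets Q = sets (borel \<Otimes>\<^sub>M U)"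
  shows "(\<integral>p. path V w p * (\<integral>q. path V w q * of_bool (fst q = fst p) \<partial>vm w) \<partial>Q) =
    (\<integral>p. path (\<lambda>q. V q * (\<lambda>(w, t). B w t) (fst q)) w p \<partial>Q)"
proof (rule integral_cong_AE)
  let ?VB = "\<lambda>q. V q * (\<lambda>(w, t). B w t) (fst q)" and ?u = "path V w"
  have u: "?u \<in> borel_measurable (borel \<Otimes>\<^sub>M U)" by (rule measurable_path[OF locD(2)[OF V] w])
  have wb: "\<bar>?u p\<bar> \<le> c" if "snd p \<in> space U" for p by (rule path_bound[OF locD(3)[OF V] w that])
  have "?VB \<in> borel_measurable (Prd \<Otimes>\<^sub>M U)"
    using locD(2)[OF V] measurable_compose[OF measurable_fst B(1)] by (intro borel_measurable_times)
  then have "path ?VB w \<in> borel_measurable (borel \<Otimes>\<^sub>M U)" by (rule measurable_path[OF _ w])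
  then show "path ?VB w \<in> borel_measurable Q" unfolding measurable_cong_sets[OF Q(2) refl] .
  have "(\<lambda>p. \<integral>q. ?u q * of_bool (fst q = fst p) \<partial>vm w) \<in> borel_measurable (borel \<Otimes>\<^sub>M U)"
    by (rule time_order_integrable(2)[OF finite_pm[OF w] sets_pm[OF w] finite_vm[OF w] sets_vm[OF w] u wb u wb], assumption, assumption, rule sets_time_less)
  from borel_measurable_times[OF u this]
  show "(\<lambda>p. ?u p * (\<integral>q. ?u q * of_bool (fst q = fst p) \<partial>vm w)) \<in> borel_measurable Q"
    unfolding measurable_cong_sets[OF Q(2) refl] .
  show "AE p in Q. ?u p * (\<integral>q. ?u q * of_bool (fst q = fst p) \<partial>vm w) = path ?VB w p"
    using Q(1)
  proof eventually_elim
    case (elim p)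
    then have "fst p \<in> {0<..T}" by (auto simp: D_def)
    then show ?case using B(2)[OF w, of "fst p"] by (simp add: path_mult path_time[of p "\<lambda>(w, t). B w t"])
  qed
qed

text \<open>Take expectations in the pathwise formula for the square. The first bracket has the
  predictable integrand V times the strict past, so it has mean zero. The term with
  \<open>pm w\<close> twice is the integral of the square of \<open>V\<close>. The mixed term has
  the predictable integrand V times B, hence the same mean as the term with \<open>vm w\<close>
  twice, and the coefficients -2 and 1 leave a single negative term.\<close>

lemma isometry:
  assumes V: "loc c n V" and B: "(\<lambda>(w, t). B w t) \<in> borel_measurable Prd"
    "\<And>w t. w \<in> space M \<Longrightarrow> 0 < t \<Longrightarrow> B w t = (\<integral>p. path V w p * of_bool (fst p = t) \<partial>vm w)"
  shows "integrable M (\<lambda>w. (J V w)\<^sup>2)" "loc (c * c) n (\<lambda>q. V q * V q)" "loc (c * c) n (\<lambda>q. V q * (\<lambda>(w, t). B w t) (fst q))"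
    "(\<integral>w. (J V w)\<^sup>2 \<partial>M) = (\<integral>w. (\<integral>p. path (\<lambda>q. V q * V q) w p \<partial>vm w) \<partial>M)
      - (\<integral>w. (\<integral>p. path (\<lambda>q. V q * (\<lambda>(w, t). B w t) (fst q)) w p \<partial>vm w) \<partial>M)"
proof -
  note V' = locD[OF V]
  let ?VB = "\<lambda>q. V q * (\<lambda>(w, t). B w t) (fst q)"
  define N where "N w t = (\<integral>q. path V w q * of_bool (fst q < t) \<partial>pm w) - (\<integral>q. path V w q * of_bool (fst q < t) \<partial>vm w)" for w t
  have wm: "path V w \<in> borel_measurable (borel \<Otimes>\<^sub>M U)" if "w \<in> space M" for w by (rule measurable_path[OF V'(2) that])
  have wb: "\<bar>path V w p\<bar> \<le> c" if "w \<in> space M" "snd p \<in> space U" for w p by (rule path_bound[OF V'(3) that])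
  have cut_bound: "\<bar>\<integral>q. path V w q * indicator S (fst q) \<partial>Q\<bar> \<le> c * measure Q (S \<times> space U)"
    if w: "w \<in> space M" and Q: "finite_measure Q" "sets Q = sets (borel \<Otimes>\<^sub>M U)" and S: "S \<in> sets borel" for w Q S
  proof -
    interpret Q: finite_measure Q by fact
    have spQ: "space Q = UNIV \<times> space U" using sets_eq_imp_space_eq[OF Q(2)] by (simp add: space_pair_measure)
    have SU: "S \<times> space U \<in> sets Q" using S Q(2) by auto
    have "\<bar>\<integral>q. path V w q * indicator S (fst q) \<partial>Q\<bar> \<le> (\<integral>q. \<bar>path V w q * indicator S (fst q)\<bar> \<partial>Q)"
      using integral_norm_bound[of Q "\<lambda>q. path V w q * indicator S (fst q)"] by simp
    also have "\<dots> \<le> (\<integral>q. c * indicator (S \<times> space U) q \<partial>Q)"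
    proof (rule integral_mono_AE')
      show "integrable Q (\<lambda>q. c * indicator (S \<times> space U) q)" using SU by (simp add: Q.emeasure_finite less_top[symmetric])
      show "AE q in Q. \<bar>path V w q * indicator S (fst q)\<bar> \<le> c * indicator (S \<times> space U) q"
        using wb[OF w] by (intro AE_I2) (auto simp: spQ split: split_indicator)
    qed (use V'(1) in \<open>auto intro!: AE_I2\<close>)
    also have "\<dots> = c * measure Q (S \<times> space U)" using SU by simp
    finally show ?thesis .
  qed
  \<comment> \<open>At time t the process \<open>N\<close> sees only points strictly before t, so it
    is the left limit of an adapted process.\<close>
  obtain N' where N': "predictable_process M F T N'" "\<And>w t. w \<in> space M \<Longrightarrow> 0 < t \<Longrightarrow> N' w t = N w t"
  proof -
    define X where "X w t = (\<integral>p. path V w p * indicator {..t} (fst p) \<partial>pm w) - (\<integral>p. path V w p * indicator {..t} (fst p) \<partial>vm w)" for w t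
    have "(\<lambda>w. X w t) \<in> borel_measurable (F t)" if "t \<in> {0..T}" for t
      unfolding X_def using pm_adapted_real[OF V'(2) that] vm_adapted_real[OF V'(2,3) that] by (intro borel_measurable_diff)
    then obtain X' where X': "predictable_process M F T X'" "\<And>w t l. 0 < t \<Longrightarrow> (X w \<longlongrightarrow> l) (at_left t) \<Longrightarrow> X' w t = l"
      by (rule left_limit_predictable[of X]) (assumption, rule that)
    have "X' w t = N w t" if w: "w \<in> space M" and t: "0 < t" for w t
    proof (rule X'(2)[OF t])
      have "(\<integral>q. path V w q * of_bool (fst q < t) \<partial>Q) = (\<integral>q. path V w q * indicator {..<t} (fst q) \<partial>Q)" for Q
        by (intro Bochner_Integration.integral_cong) (auto split: split_indicator)
      then show "(X w \<longlongrightarrow> N w t) (at_left t)" unfolding X_def N_def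
        using integral_left_limit[OF sets_pm[OF w] loc_integrable(1)[OF V w]] integral_left_limit[OF sets_vm[OF w] loc_integrable(2)[OF V w]]
        by (simp add: tendsto_diff)
    qed
    then show ?thesis using that X'(1) by blast
  qed
  let ?VN = "\<lambda>q. V q * (\<lambda>(w, t). N' w t) (fst q)"
  \<comment> \<open>On \<open>Loc n\<close> the strict past carries total mass at most n, so
    \<open>N\<close> is bounded there by c times n; another factor c comes from
    \<open>V\<close>.\<close>
  have VN: "loc (c * (c * real n)) n ?VN"
  proof (rule loc_times[OF V])
    show "(\<lambda>(w, t). N' w t) \<in> borel_measurable Prd" using N'(1) unfolding predictable_process_def .
    fix w t x assume "((w, t), x) \<in> Loc n"
    then have t: "w \<in> space M" "0 < t" "mass w t \<le> real n" by (auto simp: Loc_def space_Prd_pair)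
    have "(\<integral>q. path V w q * of_bool (fst q < t) \<partial>Q) = (\<integral>q. path V w q * indicator {..<t} (fst q) \<partial>Q)" for Q
      by (intro Bochner_Integration.integral_cong) (auto split: split_indicator)
    then have "\<bar>N w t\<bar> \<le> c * measure (pm w) ({..<t} \<times> space U) + c * measure (vm w) ({..<t} \<times> space U)"
      unfolding N_def using cut_bound[OF t(1) finite_pm[OF t(1)] sets_pm[OF t(1)], of "{..<t}"]
        cut_bound[OF t(1) finite_vm[OF t(1)] sets_vm[OF t(1)], of "{..<t}"] by simp
    also have "\<dots> = c * mass w t" by (simp add: mass_def distrib_left)
    also have "\<dots> \<le> c * real n" using t(3) V'(1) by (intro mult_left_mono)
    finally show "\<bar>(\<lambda>(w, t). N' w t) (w, t)\<bar> \<le> c * real n" using N'(2)[OF t(1,2)] by simp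
  qed (use V'(1) in simp)
  show VV: "loc (c * c) n (\<lambda>q. V q * V q)"
    unfolding loc_def
  proof (intro conjI ballI impI)
    show "0 \<le> c * c" using V'(1) by simp
    show "(\<lambda>q. V q * V q) \<in> borel_measurable (Prd \<Otimes>\<^sub>M U)" by (rule borel_measurable_times[OF V'(2) V'(2)])
    fix q assume q: "q \<in> space (Prd \<Otimes>\<^sub>M U)"
    show "\<bar>V q * V q\<bar> \<le> c * c" unfolding abs_mult by (rule mult_mono[OF V'(3)[OF q] V'(3)[OF q] V'(1) abs_ge_zero])
    show "V q * V q = 0" if "q \<notin> Loc n" using V'(4)[OF q that] by simp
  qed
  show VB: "loc (c * c) n ?VB"
  proof (rule loc_times[OF V B(1)])
    fix w t x assume "((w, t), x) \<in> Loc n"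
    then have t: "w \<in> space M" "0 < t" by (auto simp: Loc_def space_Prd_pair)
    have "B w t = (\<integral>q. path V w q * indicator {t} (fst q) \<partial>vm w)"
      unfolding B(2)[OF t] by (intro Bochner_Integration.integral_cong) (auto split: split_indicator)
    then have "\<bar>B w t\<bar> \<le> c * measure (vm w) ({t} \<times> space U)"
      using cut_bound[OF t(1) finite_vm[OF t(1)] sets_vm[OF t(1)], of "{t}"] by simp
    also have "\<dots> \<le> c * 1"
    proof (rule mult_left_mono[OF _ V'(1)])
      interpret vm: finite_measure "vm w" by (rule finite_vm[OF t(1)])
      show "measure (vm w) ({t} \<times> space U) \<le> 1" using emeasure_vm_point_le[OF t(1), of t] by (simp add: vm.emeasure_eq_measure ennreal_le_1)
    qed
    finally show "\<bar>(\<lambda>(w, t). B w t) (w, t)\<bar> \<le> c" by simp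
  qed (rule V'(1))
  have sq: "(J V w)\<^sup>2 = 2 * ((\<integral>p. path ?VN w p \<partial>pm w) - (\<integral>p. path ?VN w p \<partial>vm w)) + (\<integral>p. path (\<lambda>q. V q * V q) w p \<partial>pm w)
    - 2 * (\<integral>p. path ?VB w p \<partial>pm w) + (\<integral>p. path ?VB w p \<partial>vm w)" if w: "w \<in> space M" for w
  proof -
    let ?u = "path V w"
    have 1: "(\<integral>p. ?u p * N w (fst p) \<partial>Q) = (\<integral>p. path ?VN w p \<partial>Q)" if "AE p in Q. p \<in> D" "sets Q = sets (borel \<Otimes>\<^sub>M U)" for Q
    proof (rule integral_cong_AE)
      have "(\<lambda>p. path ?VN w p) \<in> borel_measurable (borel \<Otimes>\<^sub>M U)" by (rule measurable_path[OF locD(2)[OF VN] w])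
      then show "path ?VN w \<in> borel_measurable Q" unfolding measurable_cong_sets[OF that(2) refl] .
      have nm: "(\<lambda>p. \<integral>q. ?u q * of_bool (fst q < fst p) \<partial>Q') \<in> borel_measurable (borel \<Otimes>\<^sub>M U)"
        if "finite_measure Q'" "sets Q' = sets (borel \<Otimes>\<^sub>M U)" for Q'
        by (rule time_order_integrable(2)[OF that that wm[OF w] wb[OF w] wm[OF w] wb[OF w]], assumption, assumption, rule sets_time_less)
      have "(\<lambda>p. N w (fst p)) \<in> borel_measurable (borel \<Otimes>\<^sub>M U)"
        unfolding N_def
        by (rule borel_measurable_diff[OF nm[OF finite_pm[OF w] sets_pm[OF w]] nm[OF finite_vm[OF w] sets_vm[OF w]]])
      from borel_measurable_times[OF wm[OF w] this]
      show "(\<lambda>p. ?u p * N w (fst p)) \<in> borel_measurable Q"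
        unfolding measurable_cong_sets[OF that(2) refl] .
      show "AE p in Q. ?u p * N w (fst p) = path ?VN w p"
        using that(1)
      proof eventually_elim
        case (elim p)
        then have "fst p \<in> {0<..T}" by (auto simp: D_def)
        then show ?case using N'(2)[OF w, of "fst p"] by (simp add: path_mult path_time[of p "\<lambda>(w, t). N' w t"])
      qed
    qed
    have 2: "(\<integral>p. ?u p * (\<integral>q. ?u q * of_bool (fst q = fst p) \<partial>vm w) \<partial>Q) = (\<integral>p. path ?VB w p \<partial>Q)"
      if "AE p in Q. p \<in> D" "sets Q = sets (borel \<Otimes>\<^sub>M U)" for Q
      by (rule integral_path_same_time[OF V B(1) _ w that]) (rule B(2))
    \<comment> \<open>Distinct points of the jump measure have distinct times, so only the diagonal
      survives.\<close>
    have 3: "(\<integral>p. ?u p * (\<integral>q. ?u q * of_bool (fst q = fst p) \<partial>pm w) \<partial>pm w) = (\<integral>p. path (\<lambda>q. V q * V q) w p \<partial>pm w)"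
    proof -
      obtain I :: "nat set" and pt where I: "finite I" "inj_on (\<lambda>n. fst (pt n)) I"
        "\<And>h :: _ \<Rightarrow> real. h \<in> borel_measurable (borel \<Otimes>\<^sub>M U) \<Longrightarrow> (\<integral>p. h p \<partial>pm w) = (\<Sum>i\<in>I. h (pt i))"
        using pm_sum[OF w] by metis
      have in1: "(\<lambda>p. \<integral>q. ?u q * of_bool (fst q = fst p) \<partial>pm w) \<in> borel_measurable (borel \<Otimes>\<^sub>M U)"
        by (rule time_order_integrable(2)[OF finite_pm[OF w] sets_pm[OF w] finite_pm[OF w] sets_pm[OF w] wm[OF w] wb[OF w] wm[OF w] wb[OF w]], assumption, assumption, rule sets_time_less)
      have in2: "(\<integral>q. ?u q * of_bool (fst q = fst (pt i)) \<partial>pm w) = ?u (pt i)" if "i \<in> I" for i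
      proof -
        have "(\<lambda>q. ?u q * indicator {fst (pt i)} (fst q)) \<in> borel_measurable (borel \<Otimes>\<^sub>M U)"
          using wm[OF w] by (intro borel_measurable_times measurable_time_indicator) auto
        then have "(\<lambda>q. ?u q * of_bool (fst q = fst (pt i))) \<in> borel_measurable (borel \<Otimes>\<^sub>M U)"
          by (simp add: indicator_def)
        then have "(\<integral>q. ?u q * of_bool (fst q = fst (pt i)) \<partial>pm w) = (\<Sum>j\<in>I. ?u (pt j) * of_bool (fst (pt j) = fst (pt i)))"
          by (rule I(3))
        also have "\<dots> = (\<Sum>j\<in>I. if j = i then ?u (pt j) else 0)"
          using inj_onD[OF I(2)] that by (intro sum.cong) auto
        also have "\<dots> = ?u (pt i)" using that I(1) by simp
        finally show ?thesis .
      qed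
      show ?thesis
        using I(3)[OF borel_measurable_times[OF wm[OF w] in1]] I(3)[OF measurable_path[OF locD(2)[OF VV] w]] in2
        by (simp add: path_mult)
    qed
    show ?thesis
      unfolding J_def
      using square_of_difference[OF finite_pm[OF w] sets_pm[OF w] finite_vm[OF w] sets_vm[OF w] wm[OF w] wb[OF w], of "\<lambda>p. N w (fst p)"]
      by (simp add: N_def 1[OF AE_pm[OF w] sets_pm[OF w], unfolded N_def] 1[OF AE_vm[OF w] sets_vm[OF w], unfolded N_def]
        2[OF AE_pm[OF w] sets_pm[OF w]] 2[OF AE_vm[OF w] sets_vm[OF w]] 3)
  qed
  note ints = loc_M_integrable[OF VN] loc_M_integrable[OF VV] loc_M_integrable[OF VB]
  show "integrable M (\<lambda>w. (J V w)\<^sup>2)"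
    by (subst Bochner_Integration.integrable_cong[OF refl sq])
      (assumption, intro Bochner_Integration.integrable_add Bochner_Integration.integrable_diff integrable_mult_right ints)
  have "(\<integral>w. (J V w)\<^sup>2 \<partial>M) = (\<integral>w. 2 * ((\<integral>p. path ?VN w p \<partial>pm w) - (\<integral>p. path ?VN w p \<partial>vm w)) + (\<integral>p. path (\<lambda>q. V q * V q) w p \<partial>pm w)
    - 2 * (\<integral>p. path ?VB w p \<partial>pm w) + (\<integral>p. path ?VB w p \<partial>vm w) \<partial>M)"
    by (intro Bochner_Integration.integral_cong refl sq)
  also have "\<dots> = (\<integral>w. (\<integral>p. path (\<lambda>q. V q * V q) w p \<partial>vm w) \<partial>M) - (\<integral>w. (\<integral>p. path ?VB w p \<partial>vm w) \<partial>M)"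
    using ints by (simp add: loc_expectation[OF VN] loc_expectation[OF VV] loc_expectation[OF VB])
  finally show "(\<integral>w. (J V w)\<^sup>2 \<partial>M) = (\<integral>w. (\<integral>p. path (\<lambda>q. V q * V q) w p \<partial>vm w) \<partial>M) - (\<integral>w. (\<integral>p. path ?VB w p \<partial>vm w) \<partial>M)" .
qed

end

lemma abs_le_one_plus_square: "\<bar>x\<bar> \<le> 1 + x * x" for x :: real
proof (cases "\<bar>x\<bar> \<le> 1")
  case True
  then show ?thesis using zero_le_square[of x] by linarith
next
  case False
  then have "\<bar>x\<bar> * 1 \<le> \<bar>x\<bar> * \<bar>x\<bar>" by (intro mult_left_mono) auto
  then show ?thesis by simp
qed

section \<open>Bounds from the isometry and passage to the limit\<close>

context point_process
begin

text \<open>Integrate the square of \<open>u p + u q\<close> over pairs with equal times: this is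
  twice the integral of \<open>u p * u p * A p\<close>, with \<open>A p\<close> at most 1 the mass
  of the atom, plus twice the double integral. That double integral is a sum of squares over the
  atoms; the cruder bound avoids decomposing into atoms and costs only a factor 2 in the
  isometry.\<close>

lemma vm_same_time_lower:
  assumes w: "w \<in> space M" and u: "u \<in> borel_measurable (borel \<Otimes>\<^sub>M U)" "\<And>p. snd p \<in> space U \<Longrightarrow> \<bar>u p\<bar> \<le> (c :: real)"
  shows "- (\<integral>p. u p * u p \<partial>vm w) \<le> (\<integral>p. u p * (\<integral>q. u q * of_bool (fst q = fst p) \<partial>vm w) \<partial>vm w)"
proof -
  let ?Q = "vm w"
  note Q = finite_vm[OF w] sets_vm[OF w]
  interpret finite_measure ?Q by (rule Q(1))
  define A where "A p = (\<integral>q. (1 :: real) * of_bool (fst q = fst p) \<partial>?Q)" for p :: "real \<times> 'u"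
  define W1 where "W1 p = (\<integral>q. u q * of_bool (fst q = fst p) \<partial>?Q)" for p :: "real \<times> 'u"
  define W2 where "W2 p = (\<integral>q. (u q * u q) * of_bool (fst q = fst p) \<partial>?Q)" for p :: "real \<times> 'u"
  have w2: "(\<lambda>p. u p * u p) \<in> borel_measurable (borel \<Otimes>\<^sub>M U)" using u(1) by simp
  have w2b: "\<bar>u p * u p\<bar> \<le> c * c" if "snd p \<in> space U" for p
    unfolding abs_mult by (rule mult_mono[OF u(2)[OF that] u(2)[OF that] _ abs_ge_zero]) (use u(2)[OF that] in linarith)
  have one: "(\<lambda>p :: real \<times> 'u. 1 :: real) \<in> borel_measurable (borel \<Otimes>\<^sub>M U)" "\<And>p :: real \<times> 'u. snd p \<in> space U \<Longrightarrow> \<bar>1 :: real\<bar> \<le> 1" by auto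
  have iA: "integrable ?Q (\<lambda>p. (u p * u p) * A p)" unfolding A_def
    by (rule time_order_integrable(3)[OF Q Q w2 w2b one], assumption, assumption, rule sets_time_less)
  have i1: "integrable ?Q (\<lambda>p. u p * W1 p)" unfolding W1_def
    by (rule time_order_integrable(3)[OF Q Q u u], assumption, assumption, rule sets_time_less)
  have i2: "integrable ?Q (\<lambda>p. 1 * W2 p)" unfolding W2_def
    by (rule time_order_integrable(3)[OF Q Q one w2 w2b], assumption, assumption, rule sets_time_less)
  have iw: "integrable ?Q u" by (rule integrable_vm_bounded[OF w u])
  have iw2: "integrable ?Q (\<lambda>p. u p * u p)" by (rule integrable_vm_bounded[OF w w2 w2b])
  have pos: "0 \<le> (u p * u p) * A p + 2 * (u p * W1 p) + 1 * W2 p" for p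
  proof -
    have j: "integrable ?Q (\<lambda>q. h q * of_bool (fst q = fst p))" if "integrable ?Q h" for h :: "real \<times> 'u \<Rightarrow> real"
      using integrable_time_indicator[OF Q(2) _ that, of "{fst p}"] by (simp add: indicator_def)
    have j1: "integrable ?Q (\<lambda>q. (1 :: real) * of_bool (fst q = fst p))" using j[of "\<lambda>_. 1"] by simp
    note j2 = j[OF iw] and j3 = j[OF iw2]
    have "0 \<le> (\<integral>q. (u p + u q)\<^sup>2 * of_bool (fst q = fst p) \<partial>?Q)" by (intro integral_nonneg_AE AE_I2) simp
    also have "\<dots> = (\<integral>q. (u p * u p) * (1 * of_bool (fst q = fst p)) + (2 * u p) * (u q * of_bool (fst q = fst p)) + (u q * u q) * of_bool (fst q = fst p) \<partial>?Q)"
      by (intro Bochner_Integration.integral_cong) (auto simp: power2_eq_square algebra_simps)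
    also have "\<dots> = (u p * u p) * A p + (2 * u p) * W1 p + W2 p"
      using j1 j2 j3 unfolding A_def W1_def W2_def by simp
    finally show ?thesis by simp
  qed
  have "0 \<le> (\<integral>p. (u p * u p) * A p + 2 * (u p * W1 p) + 1 * W2 p \<partial>?Q)" by (intro integral_nonneg_AE AE_I2 pos)
  also have "\<dots> = (\<integral>p. (u p * u p) * A p \<partial>?Q) + 2 * (\<integral>p. u p * W1 p \<partial>?Q) + (\<integral>p. 1 * W2 p \<partial>?Q)"
    using iA i1 i2 by simp
  also have "(\<integral>p. 1 * W2 p \<partial>?Q) = (\<integral>p. (u p * u p) * A p \<partial>?Q)"
    unfolding W2_def A_def using same_time_sym[OF Q Q one w2 w2b] by simp
  finally have 1: "0 \<le> (\<integral>p. (u p * u p) * A p \<partial>?Q) + (\<integral>p. u p * W1 p \<partial>?Q)" by simp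
  have "(\<integral>p. (u p * u p) * A p \<partial>?Q) \<le> (\<integral>p. u p * u p \<partial>?Q)"
  proof (rule integral_mono[OF iA iw2])
    fix p
    have "A p = (\<integral>q. indicator {fst p} (fst q) \<partial>?Q)" unfolding A_def
      by (intro Bochner_Integration.integral_cong) (auto split: split_indicator)
    also have "\<dots> = measure ?Q ({fst p} \<times> space U)" by (rule integral_time_measure(2)[OF w]) simp
    also have "\<dots> \<le> 1" using emeasure_vm_point_le[OF w, of "fst p"] by (simp add: emeasure_eq_measure ennreal_le_1)
    finally show "(u p * u p) * A p \<le> u p * u p" by (intro mult_left_le) simp_all
  qed
  with 1 show ?thesis unfolding W1_def by linarith
qed

text \<open>The isometry subtracts a term that is at least minus the integral of the square; hence
  the factor 2.\<close>

lemma isometry_bound: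
  assumes V: "loc c n V"
  shows "integrable M (\<lambda>w. (J V w)\<^sup>2)" "(\<integral>w. (J V w)\<^sup>2 \<partial>M) \<le> (\<integral>w. (\<integral>p. path (\<lambda>q. V q * V q * 2) w p \<partial>vm w) \<partial>M)"
proof -
  obtain B where B: "(\<lambda>(w, t). B w t) \<in> borel_measurable Prd"
    "\<And>w t. w \<in> space M \<Longrightarrow> 0 < t \<Longrightarrow> B w t = (\<integral>p. path V w p * of_bool (fst p = t) \<partial>vm w)"
    by (rule same_time_predictable[OF locD(2,3)[OF V]]) (assumption, rule that)
  have iso: "integrable M (\<lambda>w. (J V w)\<^sup>2)" "loc (c * c) n (\<lambda>q. V q * V q)" "loc (c * c) n (\<lambda>q. V q * (\<lambda>(w, t). B w t) (fst q))"
    "(\<integral>w. (J V w)\<^sup>2 \<partial>M) = (\<integral>w. (\<integral>p. path (\<lambda>q. V q * V q) w p \<partial>vm w) \<partial>M)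
      - (\<integral>w. (\<integral>p. path (\<lambda>q. V q * (\<lambda>(w, t). B w t) (fst q)) w p \<partial>vm w) \<partial>M)"
    by (rule isometry[OF V B(1)], rule B(2), assumption, assumption)+
  show "integrable M (\<lambda>w. (J V w)\<^sup>2)" by (rule iso(1))
  let ?VB = "\<lambda>q. V q * (\<lambda>(w, t). B w t) (fst q)"
  have "(\<integral>w. - (\<integral>p. path (\<lambda>q. V q * V q) w p \<partial>vm w) \<partial>M) \<le> (\<integral>w. (\<integral>p. path ?VB w p \<partial>vm w) \<partial>M)"
  proof (rule integral_mono)
    fix w assume w: "w \<in> space M"
    have "path (\<lambda>q. V q * V q) w = (\<lambda>p. path V w p * path V w p)" by (auto simp: path_mult)
    then show "- (\<integral>p. path (\<lambda>q. V q * V q) w p \<partial>vm w) \<le> (\<integral>p. path ?VB w p \<partial>vm w)"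
      using vm_same_time_lower[OF w measurable_path[OF locD(2)[OF V] w] path_bound[OF locD(3)[OF V] w]]
        integral_path_same_time[OF V B(1) _ w AE_vm[OF w] sets_vm[OF w]] B(2) by simp
  qed (use loc_M_integrable[OF iso(2)] loc_M_integrable[OF iso(3)] in auto)
  moreover have "(\<integral>w. (\<integral>p. path (\<lambda>q. V q * V q * 2) w p \<partial>vm w) \<partial>M) = 2 * (\<integral>w. (\<integral>p. path (\<lambda>q. V q * V q) w p \<partial>vm w) \<partial>M)"
    by (simp add: path_def mult.commute[of _ 2])
  ultimately show "(\<integral>w. (J V w)\<^sup>2 \<partial>M) \<le> (\<integral>w. (\<integral>p. path (\<lambda>q. V q * V q * 2) w p \<partial>vm w) \<partial>M)"
    unfolding iso(4) by simp
qed

lemma atom_predictable: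
  obtains a where "(\<lambda>(w, t). a w t) \<in> borel_measurable Prd"
    "\<And>w t. w \<in> space M \<Longrightarrow> 0 < t \<Longrightarrow> a w t = measure (vm w) ({t} \<times> space U)"
proof -
  obtain B where B: "(\<lambda>(w, t). B w t) \<in> borel_measurable Prd"
    "\<And>w t. w \<in> space M \<Longrightarrow> 0 < t \<Longrightarrow> B w t = (\<integral>p. path (\<lambda>_. 1 :: real) w p * of_bool (fst p = t) \<partial>vm w)"
    by (rule same_time_predictable[of "\<lambda>_. 1" 1]) (simp, simp, rule that)
  have "B w t = measure (vm w) ({t} \<times> space U)" if "w \<in> space M" "0 < t" for w t
  proof -
    have "B w t = (\<integral>p. indicator {t} (fst p) \<partial>vm w)" unfolding B(2)[OF that]
      by (intro Bochner_Integration.integral_cong) (auto simp: path_def split: split_indicator)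
    then show ?thesis using integral_time_measure(2)[OF that(1), of "{t}"] by simp
  qed
  then show ?thesis using that B(1) by blast
qed

text \<open>If \<open>V\<close> does not depend on the mark, its integral over one time is
  \<open>V\<close> times the mass of the atom. The isometry then produces the weight one minus that
  mass, which matches the second term of the norm of \<open>H20\<close>.\<close>

lemma isometry_time:
  assumes V: "loc c n V" and ind: "\<And>w t x y. x \<in> space U \<Longrightarrow> y \<in> space U \<Longrightarrow> V ((w, t), x) = V ((w, t), y)"
    and a: "(\<lambda>(w, t). a w t) \<in> borel_measurable Prd"
      "\<And>w t. w \<in> space M \<Longrightarrow> 0 < t \<Longrightarrow> a w t = measure (vm w) ({t} \<times> space U)"
  shows "integrable M (\<lambda>w. (J V w)\<^sup>2)"
    "(\<integral>w. (J V w)\<^sup>2 \<partial>M) = (\<integral>w. (\<integral>p. path (\<lambda>q. V q * V q * (1 - (\<lambda>(w, t). a w t) (fst q))) w p \<partial>vm w) \<partial>M)"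
proof -
  obtain B where B: "(\<lambda>(w, t). B w t) \<in> borel_measurable Prd"
    "\<And>w t. w \<in> space M \<Longrightarrow> 0 < t \<Longrightarrow> B w t = (\<integral>p. path V w p * of_bool (fst p = t) \<partial>vm w)"
    by (rule same_time_predictable[OF locD(2,3)[OF V]]) (assumption, rule that)
  have iso: "integrable M (\<lambda>w. (J V w)\<^sup>2)" "loc (c * c) n (\<lambda>q. V q * V q)" "loc (c * c) n (\<lambda>q. V q * (\<lambda>(w, t). B w t) (fst q))"
    "(\<integral>w. (J V w)\<^sup>2 \<partial>M) = (\<integral>w. (\<integral>p. path (\<lambda>q. V q * V q) w p \<partial>vm w) \<partial>M)
      - (\<integral>w. (\<integral>p. path (\<lambda>q. V q * (\<lambda>(w, t). B w t) (fst q)) w p \<partial>vm w) \<partial>M)"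
    by (rule isometry[OF V B(1)], rule B(2), assumption, assumption)+
  show "integrable M (\<lambda>w. (J V w)\<^sup>2)" by (rule iso(1))
  let ?VB = "\<lambda>q. V q * (\<lambda>(w, t). B w t) (fst q)"
  let ?Va = "\<lambda>q. V q * V q * (1 - (\<lambda>(w, t). a w t) (fst q))"
  have eq: "(\<integral>p. path ?Va w p \<partial>vm w) = (\<integral>p. path (\<lambda>q. V q * V q) w p \<partial>vm w) - (\<integral>p. path ?VB w p \<partial>vm w)" if w: "w \<in> space M" for w
  proof -
    have "(\<integral>p. path ?Va w p \<partial>vm w) = (\<integral>p. path (\<lambda>q. V q * V q) w p - path ?VB w p \<partial>vm w)"
    proof (rule integral_cong_AE)
      have "?Va \<in> borel_measurable (Prd \<Otimes>\<^sub>M U)"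
        using locD(2)[OF V] measurable_compose[OF measurable_fst a(1)] by (intro borel_measurable_times borel_measurable_diff) auto
      then show "path ?Va w \<in> borel_measurable (vm w)" by (intro measurable_vm[OF w] measurable_path[OF _ w])
      show "(\<lambda>p. path (\<lambda>q. V q * V q) w p - path ?VB w p) \<in> borel_measurable (vm w)"
        using loc_integrable[OF iso(2) w] loc_integrable[OF iso(3) w] by (intro borel_measurable_diff borel_measurable_integrable)
      show "AE p in vm w. path ?Va w p = path (\<lambda>q. V q * V q) w p - path ?VB w p"
        using AE_vm[OF w]
      proof eventually_elim
        case (elim p)
        then have p: "0 < fst p" "fst p \<le> T" "snd p \<in> space U" by (auto simp: D_def)
        have "B w (fst p) = (\<integral>q. path V w p * indicator {fst p} (fst q) \<partial>vm w)" unfolding B(2)[OF w p(1)]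
        proof (intro Bochner_Integration.integral_cong refl)
          fix q assume "q \<in> space (vm w)"
          then have "snd q \<in> space U" by (auto simp: space_vm[OF w])
          then show "path V w q * of_bool (fst q = fst p) = path V w p * indicator {fst p} (fst q)"
            using ind[of "snd q" "snd p"] p(3) by (auto simp: path_def split: split_indicator)
        qed
        also have "\<dots> = path V w p * a w (fst p)"
          using integral_time_measure(2)[OF w, of "{fst p}"] a(2)[OF w p(1)] by simp
        finally show ?case using p path_time[of p "\<lambda>(w, t). a w t" w] path_time[of p "\<lambda>(w, t). B w t" w]
          by (simp add: path_def algebra_simps)
      qed
    qed
    also have "\<dots> = (\<integral>p. path (\<lambda>q. V q * V q) w p \<partial>vm w) - (\<integral>p. path ?VB w p \<partial>vm w)"
      using loc_integrable[OF iso(2) w] loc_integrable[OF iso(3) w] by simp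
    finally show ?thesis .
  qed
  show "(\<integral>w. (J V w)\<^sup>2 \<partial>M) = (\<integral>w. (\<integral>p. path ?Va w p \<partial>vm w) \<partial>M)"
    unfolding iso(4) using loc_M_integrable[OF iso(2)] loc_M_integrable[OF iso(3)]
    by (simp add: eq cong: Bochner_Integration.integral_cong)
qed

lemma vm_nn_measurable:
  assumes W: "(W :: ('w \<times> real) \<times> 'u \<Rightarrow> ennreal) \<in> borel_measurable (Prd \<Otimes>\<^sub>M U)"
  shows "(\<lambda>w. \<integral>\<^sup>+p. path W w p \<partial>vm w) \<in> borel_measurable M"
proof -
  have eq: "(\<integral>\<^sup>+p. path W w p \<partial>vm w) = (\<integral>\<^sup>+p. path W w p * indicator {..T} (fst p) \<partial>vm w)" if "w \<in> space M" for w
    by (rule nn_integral_cong_AE) (use AE_vm[OF that] in \<open>auto elim!: eventually_mono simp: D_def\<close>)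
  have "(\<lambda>w. \<integral>\<^sup>+p. path W w p * indicator {..T} (fst p) \<partial>vm w) \<in> borel_measurable M"
    using measurable_F_sub[OF measurable_Prd_at[OF vm_predictable[OF W] T_in]] by simp
  then show ?thesis by (subst measurable_cong[OF eq])
qed

text \<open>The truncations \<open>J (V k)\<close> converge to \<open>J W\<close> almost surely and, by the isometry, in \<open>L\<^sup>2\<close>.\<close>

lemma J_limit:
  fixes W v :: "('w \<times> real) \<times> 'u \<Rightarrow> real"
  assumes W: "W \<in> borel_measurable (Prd \<Otimes>\<^sub>M U)" and v: "v \<in> borel_measurable (Prd \<Otimes>\<^sub>M U)" "\<And>q. 0 \<le> v q" "\<And>q. v q \<le> 2"
    and int: "AE w in M. integrable (vm w) (path W w)"
    and fin: "(\<integral>\<^sup>+w. (\<integral>\<^sup>+p. path (\<lambda>q. ennreal (W q * W q * v q)) w p \<partial>vm w) \<partial>M) < \<infinity>"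
  defines "R \<equiv> \<lambda>k :: nat. {q \<in> space (Prd \<Otimes>\<^sub>M U). \<bar>W q\<bar> \<le> real k} \<inter> Loc k"
  assumes iso: "\<And>j k. loc (real k) k (\<lambda>q. W q * indicator (R k - R j) q) \<Longrightarrow>
      integrable M (\<lambda>w. (J (\<lambda>q. W q * indicator (R k - R j) q) w)\<^sup>2) \<and>
      (\<integral>w. (J (\<lambda>q. W q * indicator (R k - R j) q) w)\<^sup>2 \<partial>M) \<le>
      (\<integral>w. (\<integral>p. path (\<lambda>q. (W q * indicator (R k - R j) q) * (W q * indicator (R k - R j) q) * v q) w p \<partial>vm w) \<partial>M)"
  shows "integrable M (J W)" "(\<integral>w. J W w \<partial>M) = 0"
proof -
  \<comment> \<open>The weight \<open>v\<close> will be the constant 2 for a general integrand, and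
    one minus the mass of the atom for an integrand that does not depend on the mark.\<close>
  have R: "R k \<in> sets (Prd \<Otimes>\<^sub>M U)" for k
    unfolding R_def using W by (intro sets.Int Loc_sets borel_measurable_le) auto
  have Rmono: "R j \<subseteq> R k" if "j \<le> k" for j k using that unfolding R_def Loc_def by auto
  define V where "V k = (\<lambda>q. W q * indicator (R k) q)" for k
  define Vd where "Vd j k = (\<lambda>q. W q * indicator (R k - R j) q)" for j k
  have loc_ind: "loc (real k) k (\<lambda>q. W q * indicator (R k - S) q)" if "S \<in> sets (Prd \<Otimes>\<^sub>M U)" for k S
    unfolding loc_def using W R that
    by (auto simp: R_def intro!: borel_measurable_times borel_measurable_indicator split: split_indicator)
  have locV: "loc (real k) k (V k)" for k using loc_ind[of "{}" k] by (simp add: V_def)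
  have locVd: "loc (real k) k (Vd j k)" for j k unfolding Vd_def by (rule loc_ind[OF R])
  have JV: "integrable M (J (V k))" "(\<integral>w. J (V k) w \<partial>M) = 0" for k
    unfolding J_def using loc_M_integrable[OF locV[of k]] loc_expectation[OF locV[of k]] by simp_all
  have J_diff: "J (V k) w - J (V j) w = J (Vd j k) w" if "j \<le> k" "w \<in> space M" for j k w
  proof -
    have "path (Vd j k) w = (\<lambda>p. path (V k) w p - path (V j) w p)"
      using Rmono[OF that(1)] by (intro ext) (auto simp: path_def V_def Vd_def split: split_indicator)
    then show ?thesis unfolding J_def
      using loc_integrable[OF locV[of k] that(2)] loc_integrable[OF locV[of j] that(2)] by simp
  qed
  let ?u = "\<lambda>q. ennreal (W q * W q * v q)"
  have wm: "?u \<in> borel_measurable (Prd \<Otimes>\<^sub>M U)" using W v(1) by simp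
  have wS: "(\<lambda>q. ?u q * indicator S q) \<in> borel_measurable (Prd \<Otimes>\<^sub>M U)" if "S \<in> sets (Prd \<Otimes>\<^sub>M U)" for S
    using wm that by (intro borel_measurable_times_ennreal) auto
  define s where "s S = (\<integral>\<^sup>+w. (\<integral>\<^sup>+p. path (\<lambda>q. ?u q * indicator S q) w p \<partial>vm w) \<partial>M)" for S
  let ?C = "\<integral>\<^sup>+w. (\<integral>\<^sup>+p. path ?u w p \<partial>vm w) \<partial>M"
  have s_add: "s (R j) + s (R k - R j) = s (R k)" if "j \<le> k" for j k
  proof -
    have sets: "R j \<in> sets (Prd \<Otimes>\<^sub>M U)" "R k - R j \<in> sets (Prd \<Otimes>\<^sub>M U)" using R by auto
    have "s (R j) + s (R k - R j) = (\<integral>\<^sup>+w. (\<integral>\<^sup>+p. path (\<lambda>q. ?u q * indicator (R j) q) w p \<partial>vm w) + (\<integral>\<^sup>+p. path (\<lambda>q. ?u q * indicator (R k - R j) q) w p \<partial>vm w) \<partial>M)"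
      unfolding s_def by (intro nn_integral_add[symmetric] vm_nn_measurable wS sets)
    also have "\<dots> = s (R k)" unfolding s_def
    proof (intro nn_integral_cong)
      fix w assume w: "w \<in> space M"
      have "(\<integral>\<^sup>+p. path (\<lambda>q. ?u q * indicator (R j) q) w p \<partial>vm w) + (\<integral>\<^sup>+p. path (\<lambda>q. ?u q * indicator (R k - R j) q) w p \<partial>vm w) =
        (\<integral>\<^sup>+p. path (\<lambda>q. ?u q * indicator (R j) q) w p + path (\<lambda>q. ?u q * indicator (R k - R j) q) w p \<partial>vm w)"
        by (intro nn_integral_add[symmetric] measurable_vm[OF w] measurable_path[OF _ w] wS sets)
      also have "\<dots> = (\<integral>\<^sup>+p. path (\<lambda>q. ?u q * indicator (R k) q) w p \<partial>vm w)"
        using Rmono[OF that] by (intro nn_integral_cong) (auto simp: path_def split: split_indicator)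
      finally show "(\<integral>\<^sup>+p. path (\<lambda>q. ?u q * indicator (R j) q) w p \<partial>vm w) + (\<integral>\<^sup>+p. path (\<lambda>q. ?u q * indicator (R k - R j) q) w p \<partial>vm w) =
        (\<integral>\<^sup>+p. path (\<lambda>q. ?u q * indicator (R k) q) w p \<partial>vm w)" .
    qed
    finally show ?thesis .
  qed
  have s_le: "s S \<le> ?C" for S
    unfolding s_def by (intro nn_integral_mono) (auto simp: path_def split: split_indicator)
  \<comment> \<open>At a fixed point both the size of \<open>W\<close> and the mass of the strict
    past are finite numbers, so every point of \<open>D\<close> belongs to the truncation sets from
    some index on.\<close>
  have in_R: "\<exists>k0. \<forall>k\<ge>k0. ((w, fst p), snd p) \<in> R k" if "w \<in> space M" "p \<in> D" for w p
  proof -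
    obtain k0 :: nat where k0: "max \<bar>W ((w, fst p), snd p)\<bar> (mass w (fst p)) \<le> real k0" using real_arch_simple by blast
    have "((w, fst p), snd p) \<in> R k" if "k0 \<le> k" for k
    proof -
      have "real k0 \<le> real k" using that by simp
      then show ?thesis using k0 \<open>w \<in> space M\<close> \<open>p \<in> D\<close> by (auto simp: R_def Loc_def D_def space_Prd_pair)
    qed
    then show ?thesis by blast
  qed
  have s_SUP: "(SUP k. s (R k)) = ?C"
  proof -
    have "?C = (\<integral>\<^sup>+w. (SUP k. \<integral>\<^sup>+p. path (\<lambda>q. ?u q * indicator (R k) q) w p \<partial>vm w) \<partial>M)"
    proof (intro nn_integral_cong)
      fix w assume w: "w \<in> space M"
      have "(\<integral>\<^sup>+p. path ?u w p \<partial>vm w) = (\<integral>\<^sup>+p. (SUP k. path (\<lambda>q. ?u q * indicator (R k) q) w p) \<partial>vm w)"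
      proof (rule nn_integral_cong_AE)
        show "AE p in vm w. path ?u w p = (SUP k. path (\<lambda>q. ?u q * indicator (R k) q) w p)"
          using AE_vm[OF w]
        proof eventually_elim
          case (elim p)
          then obtain k0 where k0: "\<forall>k\<ge>k0. ((w, fst p), snd p) \<in> R k" using in_R[OF w] by blast
          have pe: "path g w p = g ((w, fst p), snd p)" for g :: "_ \<Rightarrow> ennreal" using elim by (intro path_eq) (auto simp: D_def)
          show ?case unfolding pe
          proof (rule antisym)
            show "?u ((w, fst p), snd p) \<le> (SUP k. ?u ((w, fst p), snd p) * indicator (R k) ((w, fst p), snd p))"
              using k0 by (intro SUP_upper2[of k0]) auto
            show "(SUP k. ?u ((w, fst p), snd p) * indicator (R k) ((w, fst p), snd p)) \<le> ?u ((w, fst p), snd p)"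
              by (intro SUP_least) (auto split: split_indicator)
          qed
        qed
      qed
      also have "\<dots> = (SUP k. \<integral>\<^sup>+p. path (\<lambda>q. ?u q * indicator (R k) q) w p \<partial>vm w)"
      proof (rule nn_integral_monotone_convergence_SUP)
        show "incseq (\<lambda>k p. path (\<lambda>q. ?u q * indicator (R k) q) w p)"
          by (auto simp: incseq_def le_fun_def path_def dest: subsetD[OF Rmono] split: split_indicator)
        show "path (\<lambda>q. ?u q * indicator (R k) q) w \<in> borel_measurable (vm w)" for k
          by (intro measurable_vm[OF w] measurable_path[OF _ w] wS R)
      qed
      finally show "(\<integral>\<^sup>+p. path ?u w p \<partial>vm w) = (SUP k. \<integral>\<^sup>+p. path (\<lambda>q. ?u q * indicator (R k) q) w p \<partial>vm w)" .
    qed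
    also have "\<dots> = (SUP k. s (R k))" unfolding s_def
    proof (rule nn_integral_monotone_convergence_SUP)
      show "incseq (\<lambda>k w. \<integral>\<^sup>+p. path (\<lambda>q. ?u q * indicator (R k) q) w p \<partial>vm w)"
        by (auto simp: incseq_def le_fun_def path_def dest: subsetD[OF Rmono] intro!: nn_integral_mono split: split_indicator)
    qed (intro vm_nn_measurable wS R)
    finally show ?thesis by simp
  qed
  have conv: "AE w in M. (\<lambda>k. J (V k) w) \<longlonglongrightarrow> J W w"
    using int AE_space
  proof eventually_elim
    case (elim w)
    have l: "(\<lambda>k. \<integral>p. path (V k) w p \<partial>Q) \<longlonglongrightarrow> (\<integral>p. path W w p \<partial>Q)"
      if Q: "integrable Q (path W w)" "sets Q = sets (borel \<Otimes>\<^sub>M U)" "AE p in Q. p \<in> D" for Q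
    proof (rule integral_dominated_convergence[where w="\<lambda>p. \<bar>path W w p\<bar>"])
      have m: "h \<in> borel_measurable Q" if "h \<in> borel_measurable (borel \<Otimes>\<^sub>M U)" for h :: "_ \<Rightarrow> real"
        using that unfolding measurable_cong_sets[OF Q(2) refl] .
      show "path W w \<in> borel_measurable Q" "path (V k) w \<in> borel_measurable Q" for k
        using elim by (auto intro!: m measurable_path W locD(2)[OF locV])
      show "integrable Q (\<lambda>p. \<bar>path W w p\<bar>)" using Q(1) by simp
      show "AE p in Q. (\<lambda>k. path (V k) w p) \<longlonglongrightarrow> path W w p"
        using Q(3)
      proof eventually_elim
        case (elim p)
        then obtain k0 where k0: "\<forall>k\<ge>k0. ((w, fst p), snd p) \<in> R k" using in_R[OF \<open>w \<in> space M\<close>] by blast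
        have pe: "path g w p = g ((w, fst p), snd p)" for g :: "_ \<Rightarrow> real" using elim by (intro path_eq) (auto simp: D_def)
        have "\<forall>\<^sub>F k in sequentially. path (V k) w p = path W w p"
          unfolding pe eventually_sequentially V_def using k0 by (intro exI[of _ k0]) auto
        then show ?case by (rule tendsto_eventually)
      qed
      show "AE p in Q. norm (path (V k) w p) \<le> \<bar>path W w p\<bar>" for k
        by (intro AE_I2) (auto simp: path_def V_def split: split_indicator)
    qed
    show ?case unfolding J_def
      using l[OF elim(1) sets_vm AE_vm, OF elim(2,2)] l[OF integrable_pm sets_pm AE_pm, OF elim(2) measurable_path[OF W elim(2)] elim(2,2)]
      by (intro tendsto_diff)
  qed
  have JWm: "J W \<in> borel_measurable M"
  proof (rule measurable_AE)
    show "(\<lambda>w. lim (\<lambda>k. J (V k) w)) \<in> borel_measurable M"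
      using JV(1) by (intro borel_measurable_lim_metric borel_measurable_integrable)
    show "AE w in M. J W w = lim (\<lambda>k. J (V k) w)" using conv by eventually_elim (simp add: limI)
  qed
  \<comment> \<open>Here \<open>s\<close> is the weighted energy of \<open>W\<close> on a set. Once
    the energy outside \<open>R j\<close> is at most e, the isometry bounds J (V k) - J (V j) in
    mean square by e for all k at least j, and Fatou's lemma lets k tend to infinity.\<close>
  have close: "\<exists>j. (\<integral>\<^sup>+w. ennreal ((J W w - J (V j) w)\<^sup>2) \<partial>M) \<le> ennreal e" if e: "0 < e" for e :: real
  proof -
    have "?C \<noteq> \<infinity>" using fin by auto
    have "\<exists>j. ?C \<le> s (R j) + ennreal e"
    proof (cases "?C = 0")
      case False
      have "?C - ennreal e < ?C" using False \<open>?C \<noteq> \<infinity>\<close> e by (intro ennreal_between) (auto simp: less_top[symmetric] zero_less_iff_neq_zero)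
      then have "?C - ennreal e < (SUP k. s (R k))" by (simp only: s_SUP)
      then obtain j where "?C - ennreal e < s (R j)" by (auto simp: less_SUP_iff)
      then have "?C - ennreal e \<le> s (R j)" by (rule less_imp_le)
      then have "?C \<le> s (R j) + ennreal e" unfolding ennreal_minus_le_iff by (simp only: add.commute)
      then show ?thesis by blast
    qed simp
    then obtain j where j: "?C \<le> s (R j) + ennreal e" by blast
    have sj: "s (R j) \<noteq> \<infinity>" using s_le[of "R j"] \<open>?C \<noteq> \<infinity>\<close> by (auto simp: top_unique)
    have bound: "(\<integral>\<^sup>+w. ennreal ((J (V k) w - J (V j) w)\<^sup>2) \<partial>M) \<le> ennreal e" if k: "j \<le> k" for k
    proof -
      have "s (R j) + s (R k - R j) \<le> s (R j) + ennreal e" using s_add[OF k] s_le[of "R k"] j by simp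
      then have sd: "s (R k - R j) \<le> ennreal e" using sj by (simp add: ennreal_add_left_cancel_le)
      have l2: "loc (real k * real k * 2) k (\<lambda>q. Vd j k q * Vd j k q * v q)"
        unfolding loc_def
      proof (intro conjI ballI impI)
        show "(\<lambda>q. Vd j k q * Vd j k q * v q) \<in> borel_measurable (Prd \<Otimes>\<^sub>M U)" using locD(2)[OF locVd] v(1) by simp
        fix q assume q: "q \<in> space (Prd \<Otimes>\<^sub>M U)"
        have "\<bar>Vd j k q\<bar> * \<bar>Vd j k q\<bar> * \<bar>v q\<bar> \<le> real k * real k * 2"
          using locD(3)[OF locVd q] v(2,3)[of q] by (intro mult_mono) auto
        then show "\<bar>Vd j k q * Vd j k q * v q\<bar> \<le> real k * real k * 2" by (simp add: abs_mult)
        show "Vd j k q * Vd j k q * v q = 0" if "q \<notin> Loc k" using locD(4)[OF locVd q that] by simp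
      qed simp
      have sq: "(\<integral>w. (\<integral>p. path (\<lambda>q. Vd j k q * Vd j k q * v q) w p \<partial>vm w) \<partial>M) \<le> e"
      proof -
        have nn: "0 \<le> Vd j k q * Vd j k q * v q" for q using v(2) by simp
        have e1: "ennreal (\<integral>p. path (\<lambda>q. Vd j k q * Vd j k q * v q) w p \<partial>vm w) = (\<integral>\<^sup>+p. path (\<lambda>q. ?u q * indicator (R k - R j) q) w p \<partial>vm w)"
          if w: "w \<in> space M" for w
        proof -
          have "(\<integral>\<^sup>+p. ennreal (path (\<lambda>q. Vd j k q * Vd j k q * v q) w p) \<partial>vm w) = ennreal (\<integral>p. path (\<lambda>q. Vd j k q * Vd j k q * v q) w p \<partial>vm w)"
            using nn by (intro nn_integral_eq_integral loc_integrable[OF l2 w] AE_I2) (simp add: path_def)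
          moreover have "ennreal (path (\<lambda>q. Vd j k q * Vd j k q * v q) w p) = path (\<lambda>q. ?u q * indicator (R k - R j) q) w p" for p
            by (auto simp: path_def Vd_def split: split_indicator)
          ultimately show ?thesis by simp
        qed
        have "ennreal (\<integral>w. (\<integral>p. path (\<lambda>q. Vd j k q * Vd j k q * v q) w p \<partial>vm w) \<partial>M) = (\<integral>\<^sup>+w. ennreal (\<integral>p. path (\<lambda>q. Vd j k q * Vd j k q * v q) w p \<partial>vm w) \<partial>M)"
          using nn by (intro nn_integral_eq_integral[symmetric] loc_M_integrable[OF l2] AE_I2 integral_nonneg_AE) (simp add: path_def)
        also have "\<dots> = s (R k - R j)" unfolding s_def by (intro nn_integral_cong e1)
        also have "\<dots> \<le> ennreal e" by (rule sd)
        finally show ?thesis using e by (simp add: ennreal_le_iff)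
      qed
      have isq: "integrable M (\<lambda>w. (J (Vd j k) w)\<^sup>2) \<and> (\<integral>w. (J (Vd j k) w)\<^sup>2 \<partial>M) \<le>
          (\<integral>w. (\<integral>p. path (\<lambda>q. Vd j k q * Vd j k q * v q) w p \<partial>vm w) \<partial>M)"
        unfolding Vd_def by (rule iso[OF locVd[of k j, unfolded Vd_def]])
      have "(\<integral>\<^sup>+w. ennreal ((J (V k) w - J (V j) w)\<^sup>2) \<partial>M) = (\<integral>\<^sup>+w. ennreal ((J (Vd j k) w)\<^sup>2) \<partial>M)"
        by (intro nn_integral_cong) (simp add: J_diff[OF k])
      also have "\<dots> = ennreal (\<integral>w. (J (Vd j k) w)\<^sup>2 \<partial>M)" using isq by (intro nn_integral_eq_integral) auto
      also have "\<dots> \<le> ennreal e" using isq sq by (intro ennreal_leI) linarith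
      finally show ?thesis .
    qed
    have "(\<integral>\<^sup>+w. ennreal ((J W w - J (V j) w)\<^sup>2) \<partial>M) = (\<integral>\<^sup>+w. liminf (\<lambda>k. ennreal ((J (V (k + j)) w - J (V j) w)\<^sup>2)) \<partial>M)"
    proof (rule nn_integral_cong_AE)
      show "AE w in M. ennreal ((J W w - J (V j) w)\<^sup>2) = liminf (\<lambda>k. ennreal ((J (V (k + j)) w - J (V j) w)\<^sup>2))"
        using conv
      proof eventually_elim
        case (elim w)
        have "(\<lambda>k. ennreal ((J (V (k + j)) w - J (V j) w)\<^sup>2)) \<longlonglongrightarrow> ennreal ((J W w - J (V j) w)\<^sup>2)"
          by (intro tendsto_ennrealI tendsto_power tendsto_diff tendsto_const LIMSEQ_ignore_initial_segment[OF elim])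
        then show ?case using lim_imp_Liminf[OF sequentially_bot] by metis
      qed
    qed
    also have "\<dots> \<le> liminf (\<lambda>k. \<integral>\<^sup>+w. ennreal ((J (V (k + j)) w - J (V j) w)\<^sup>2) \<partial>M)"
      using JV(1) by (intro nn_integral_liminf) (auto intro!: borel_measurable_power borel_measurable_diff borel_measurable_integrable)
    also have "\<dots> \<le> liminf (\<lambda>k :: nat. ennreal e)"
      by (intro Liminf_mono always_eventually allI bound) simp
    also have "\<dots> = ennreal e" by (simp add: Liminf_const)
    finally show ?thesis by blast
  qed
  have near: "\<exists>j. integrable M (\<lambda>w. J W w - J (V j) w) \<and> (\<integral>w. \<bar>J W w - J (V j) w\<bar> \<partial>M) \<le> d" if d: "0 < d" for d :: real
  proof -
    obtain j where j: "(\<integral>\<^sup>+w. ennreal ((J W w - J (V j) w)\<^sup>2) \<partial>M) \<le> ennreal (d * d)" using close[of "d * d"] d by auto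
    let ?X = "\<lambda>w. J W w - J (V j) w"
    have Xm: "?X \<in> borel_measurable M" by (intro borel_measurable_diff JWm borel_measurable_integrable[OF JV(1)])
    have X2: "integrable M (\<lambda>w. (?X w)\<^sup>2)"
      using Xm j by (intro integrableI_bounded) (auto intro: le_less_trans)
    have "ennreal (\<integral>w. (?X w)\<^sup>2 \<partial>M) \<le> ennreal (d * d)"
      using j nn_integral_eq_integral[OF X2] by simp
    then have X2d: "(\<integral>w. (?X w)\<^sup>2 \<partial>M) \<le> d * d" using d by (simp add: ennreal_le_iff)
    \<comment> \<open>Young's inequality with the parameter tuned so that a second moment of at most
      d squared gives a first moment of at most d.\<close>
    have le: "\<bar>?X w\<bar> \<le> d / 2 + (?X w)\<^sup>2 / (2 * d)" for w
    proof -
      have "2 * d * \<bar>y\<bar> \<le> d * d + y\<^sup>2" for y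
        using zero_le_power2[of "d - \<bar>y\<bar>"] by (simp add: power2_diff power2_eq_square algebra_simps)
      then have "2 * d * \<bar>?X w\<bar> \<le> d * d + (?X w)\<^sup>2" .
      then have "\<bar>?X w\<bar> \<le> (d * d + (?X w)\<^sup>2) / (2 * d)" using d by (simp add: pos_le_divide_eq mult.commute)
      then show ?thesis using d by (simp add: add_divide_distrib)
    qed
    have ib: "integrable M (\<lambda>w. d / 2 + (?X w)\<^sup>2 / (2 * d))" using X2 by simp
    have iX: "integrable M ?X"
    proof (rule Bochner_Integration.integrable_bound[OF ib Xm], rule AE_I2)
      fix w
      show "norm (?X w) \<le> norm (d / 2 + (?X w)\<^sup>2 / (2 * d))" using le[of w] by (simp add: abs_of_nonneg d less_imp_le)
    qed
    have "(\<integral>w. \<bar>?X w\<bar> \<partial>M) \<le> (\<integral>w. d / 2 + (?X w)\<^sup>2 / (2 * d) \<partial>M)" by (intro integral_mono integrable_abs iX ib le)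
    also have "\<dots> = d / 2 + (\<integral>w. (?X w)\<^sup>2 \<partial>M) / (2 * d)" using X2 by (simp add: prob_space)
    also have "\<dots> \<le> d / 2 + (d * d) / (2 * d)" using X2d d by (intro add_left_mono divide_right_mono) auto
    also have "\<dots> = d" using d by simp
    finally show ?thesis using iX by blast
  qed
  show int_JW: "integrable M (J W)"
  proof -
    obtain j where "integrable M (\<lambda>w. J W w - J (V j) w)" using near[of 1] by auto
    from Bochner_Integration.integrable_add[OF this JV(1)[of j]] show ?thesis by simp
  qed
  have le: "\<bar>\<integral>w. J W w \<partial>M\<bar> \<le> d" if d: "0 < d" for d :: real
  proof -
    obtain j where j: "(\<integral>w. \<bar>J W w - J (V j) w\<bar> \<partial>M) \<le> d" using near[OF d] by auto
    have "(\<integral>w. J W w \<partial>M) = (\<integral>w. J W w - J (V j) w \<partial>M)" using int_JW JV by simp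
    then have "\<bar>\<integral>w. J W w \<partial>M\<bar> \<le> (\<integral>w. \<bar>J W w - J (V j) w\<bar> \<partial>M)" using integral_abs_bound[of M "\<lambda>w. J W w - J (V j) w"] by simp
    then show ?thesis using j by simp
  qed
  have "\<bar>\<integral>w. J W w \<partial>M\<bar> \<le> 0" by (rule dense_ge, rule le)
  then show "(\<integral>w. J W w \<partial>M) = 0" by simp
qed

end

section \<open>Integrands in the space of the solution\<close>

context point_process
begin

definition unc :: "('w \<Rightarrow> real \<Rightarrow> 'u \<Rightarrow> real) \<Rightarrow> ('w \<times> real) \<times> 'u \<Rightarrow> real" where
  "unc Z q = Z (fst (fst q)) (snd (fst q)) (snd q)"

lemma predictable_function_unc: "predictable_function M F T U Z \<longleftrightarrow> unc Z \<in> borel_measurable (Prd \<Otimes>\<^sub>M U)"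
  unfolding predictable_function_def unc_def[abs_def] by (simp add: split_beta')

lemma integral_pm_density:
  fixes h :: "real \<times> 'u \<Rightarrow> real"
  assumes "w \<in> space M" "h \<in> borel_measurable (borel \<Otimes>\<^sub>M U)"
  shows "(\<integral>p. h p \<partial>pm w) = (\<integral>p. indicator D p * h p \<partial>\<mu> w)"
proof -
  have "(\<integral>p. h p \<partial>density (\<mu> w) (\<lambda>p. ennreal (indicator D p))) = (\<integral>p. indicator D p *\<^sub>R h p \<partial>\<mu> w)"
    using assms D_sets sets_mu[OF assms(1)] measurable_cong_sets[OF sets_mu[OF assms(1)] refl]
    by (intro integral_density) (blast, auto intro!: borel_measurable_indicator AE_I2)
  then show ?thesis by (simp add: pm_def ennreal_indicator)
qed

lemma integral_vm_density:
  fixes h :: "real \<times> 'u \<Rightarrow> real"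
  assumes "w \<in> space M" "h \<in> borel_measurable (borel \<Otimes>\<^sub>M U)"
  shows "(\<integral>p. h p \<partial>vm w) = (\<integral>p. indicator D p * h p \<partial>\<nu> w)"
proof -
  have "(\<integral>p. h p \<partial>density (\<nu> w) (\<lambda>p. ennreal (indicator D p))) = (\<integral>p. indicator D p *\<^sub>R h p \<partial>\<nu> w)"
    using assms D_sets sets_nu[OF assms(1)] measurable_cong_sets[OF sets_nu[OF assms(1)] refl]
    by (intro integral_density) (blast, auto intro!: borel_measurable_indicator AE_I2)
  then show ?thesis by (simp add: vm_def ennreal_indicator)
qed

lemma compensated_integral_eq:
  assumes Z: "unc Z \<in> borel_measurable (Prd \<Otimes>\<^sub>M U)" and w: "w \<in> space M" and ab: "0 \<le> a" "b \<le> T"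
  shows "compensated_integral U \<mu> \<nu> Z w a b =
    (\<integral>p. path (unc Z) w p * indicator {a<..b} (fst p) \<partial>pm w) - (\<integral>p. path (unc Z) w p * indicator {a<..b} (fst p) \<partial>vm w)"
proof -
  have m: "(\<lambda>p. path (unc Z) w p * indicator {a<..b} (fst p)) \<in> borel_measurable (borel \<Otimes>\<^sub>M U)"
    by (intro borel_measurable_times measurable_path Z w measurable_time_indicator) auto
  have e: "indicator D p * (path (unc Z) w p * indicator {a<..b} (fst p)) = indicator ({a<..b} \<times> space U) p *\<^sub>R Z w (fst p) (snd p)" for p
    using ab by (auto simp: D_def path_def unc_def split: split_indicator)
  show ?thesis
    unfolding compensated_integral_def set_lebesgue_integral_def integral_pm_density[OF w m] integral_vm_density[OF w m] e ..
qed

lemma Zbar_eq: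
  assumes Z: "unc Z \<in> borel_measurable (Prd \<Otimes>\<^sub>M U)" and w: "w \<in> space M" and t: "0 < t" "t \<le> T"
  shows "Zbar U \<nu> Z w t = (\<integral>p. path (unc Z) w p * indicator {t} (fst p) \<partial>vm w)"
proof -
  have m: "(\<lambda>p. path (unc Z) w p * indicator {t} (fst p)) \<in> borel_measurable (borel \<Otimes>\<^sub>M U)"
    by (intro borel_measurable_times measurable_path Z w measurable_time_indicator) auto
  have e: "indicator D p * (path (unc Z) w p * indicator {t} (fst p)) = indicator ({t} \<times> space U) p *\<^sub>R Z w t (snd p)" for p
    using t by (auto simp: D_def path_def unc_def split: split_indicator)
  show ?thesis unfolding Zbar_def set_lebesgue_integral_def integral_vm_density[OF w m] e ..
qed

text \<open>\<open>Zbar\<close> is an integral that is 0 by convention where the integrand is not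
  integrable, and its predictable version has to reproduce that default. The integrals
  \<open>C k\<close> of the truncated absolute values detect integrability; where it holds, the
  truncated integrals \<open>B k\<close> converge by domination.\<close>

lemma Zbar_predictable:
  assumes Z: "unc Z \<in> borel_measurable (Prd \<Otimes>\<^sub>M U)"
  obtains Zt where "(\<lambda>(w, t). Zt w t) \<in> borel_measurable Prd"
    "\<And>w t. w \<in> space M \<Longrightarrow> 0 < t \<Longrightarrow> t \<le> T \<Longrightarrow> Zt w t = Zbar U \<nu> Z w t"
proof -
  let ?W = "unc Z"
  let ?V = "\<lambda>k::nat. \<lambda>q. max (- real k) (min (real k) (?W q))" and ?A = "\<lambda>k::nat. \<lambda>q. min (real k) \<bar>?W q\<bar>"
  have Vm: "?V k \<in> borel_measurable (Prd \<Otimes>\<^sub>M U)" and Am: "?A k \<in> borel_measurable (Prd \<Otimes>\<^sub>M U)" for k using Z by simp_all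
  have Vb: "\<bar>?V k q\<bar> \<le> real k" for k q by (rule abs_leI) simp_all
  have Ab: "\<bar>?A k q\<bar> \<le> real k" for k q by (simp add: abs_of_nonneg)
  define P where "P h B \<longleftrightarrow> (\<lambda>(w, t). B w t) \<in> borel_measurable Prd \<and>
    (\<forall>w t. w \<in> space M \<longrightarrow> 0 < t \<longrightarrow> B w t = (\<integral>p. path h w p * of_bool (fst p = t) \<partial>vm w))" for h :: "_ \<Rightarrow> real" and B
  have "\<exists>B. P h B" if h: "h \<in> borel_measurable (Prd \<Otimes>\<^sub>M U)" "\<And>q. \<bar>h q\<bar> \<le> c" for h c
  proof -
    obtain B where "(\<lambda>(w, t). B w t) \<in> borel_measurable Prd"
      "\<And>w t. w \<in> space M \<Longrightarrow> 0 < t \<Longrightarrow> B w t = (\<integral>p. path h w p * of_bool (fst p = t) \<partial>vm w)"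
      by (rule same_time_predictable[OF h]) (rule that)
    then have "P h B" unfolding P_def by (intro conjI allI impI)
    then show ?thesis by (rule exI[of _ B])
  qed
  note ex = this
  have exV: "\<forall>k. \<exists>B. P (?V k) B" by (rule allI, rule ex[OF Vm Vb])
  have exA: "\<forall>k. \<exists>B. P (?A k) B" by (rule allI, rule ex[OF Am Ab])
  from choice[OF exV] choice[OF exA] obtain B C where BC: "\<forall>k. P (?V k) (B k)" "\<forall>k. P (?A k) (C k)" by (elim exE) (rule that)
  have B: "\<And>k. (\<lambda>(w, t). B k w t) \<in> borel_measurable Prd"
    "\<And>k w t. w \<in> space M \<Longrightarrow> 0 < t \<Longrightarrow> B k w t = (\<integral>p. path (?V k) w p * of_bool (fst p = t) \<partial>vm w)"
    using BC(1) unfolding P_def by simp_all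
  have C: "\<And>k. (\<lambda>(w, t). C k w t) \<in> borel_measurable Prd"
    "\<And>k w t. w \<in> space M \<Longrightarrow> 0 < t \<Longrightarrow> C k w t = (\<integral>p. path (?A k) w p * of_bool (fst p = t) \<partial>vm w)"
    using BC(2) unfolding P_def by simp_all
  define Zt where "Zt w t = (if (SUP k. ennreal (C k w t)) < \<infinity> then lim (\<lambda>k. B k w t) else 0)" for w t
  have Zm0: "(\<lambda>x. if (SUP k. ennreal ((\<lambda>(w, t). C k w t) x)) < \<infinity> then lim (\<lambda>k. (\<lambda>(w, t). B k w t) x) else 0) \<in> borel_measurable Prd"
  proof (intro measurable_If borel_measurable_const)
    show "(\<lambda>x. lim (\<lambda>k. (\<lambda>(w, t). B k w t) x)) \<in> borel_measurable Prd" by (intro borel_measurable_lim_metric B)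
    have "(\<lambda>x. SUP k. ennreal ((\<lambda>(w, t). C k w t) x)) \<in> borel_measurable Prd"
      using C(1) by (intro borel_measurable_SUP) auto
    then show "{x \<in> space Prd. (SUP k. ennreal ((\<lambda>(w, t). C k w t) x)) < \<infinity>} \<in> sets Prd"
      by (intro borel_measurable_less) auto
  qed
  have Zt_eq: "(\<lambda>(w, t). Zt w t) = (\<lambda>x. if (SUP k. ennreal ((\<lambda>(w, t). C k w t) x)) < \<infinity> then lim (\<lambda>k. (\<lambda>(w, t). B k w t) x) else 0)"
    by (auto simp: Zt_def fun_eq_iff)
  have Ztm: "(\<lambda>(w, t). Zt w t) \<in> borel_measurable Prd" unfolding Zt_eq by (rule Zm0)
  have "Zt w t = Zbar U \<nu> Z w t" if w: "w \<in> space M" and t: "0 < t" "t \<le> T" for w t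
  proof -
    let ?u = "path ?W w"
    have wm: "?u \<in> borel_measurable (borel \<Otimes>\<^sub>M U)" by (rule measurable_path[OF Z w])
    have ob: "of_bool (fst p = t) = (indicator {t} (fst p) :: real)" for p :: "real \<times> 'u" by (simp add: indicator_def)
    have tm: "(\<lambda>p. h p * indicator {t} (fst p)) \<in> borel_measurable (vm w)" if "h \<in> borel_measurable (borel \<Otimes>\<^sub>M U)" for h :: "_ \<Rightarrow> real"
      by (intro measurable_vm[OF w] borel_measurable_times that measurable_time_indicator) auto
    have Ai: "integrable (vm w) (\<lambda>p. path (?A k) w p * indicator {t} (fst p))" for k
      by (rule integrable_time_indicator[OF sets_vm[OF w] _ integrable_vm_bounded[OF w measurable_path[OF Am w] path_bound[OF Ab w]]]) auto
    have "(\<integral>\<^sup>+p. ennreal \<bar>?u p * indicator {t} (fst p)\<bar> \<partial>vm w) = (\<integral>\<^sup>+p. (SUP k. ennreal (path (?A k) w p * indicator {t} (fst p))) \<partial>vm w)"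
    proof (intro nn_integral_cong)
      fix p
      show "ennreal \<bar>?u p * indicator {t} (fst p)\<bar> = (SUP k. ennreal (path (?A k) w p * indicator {t} (fst p)))"
      proof (rule antisym)
        obtain k :: nat where "\<bar>?u p\<bar> \<le> real k" using real_arch_simple by blast
        then show "ennreal \<bar>?u p * indicator {t} (fst p)\<bar> \<le> (SUP k. ennreal (path (?A k) w p * indicator {t} (fst p)))"
          by (intro SUP_upper2[of k]) (auto simp: path_def abs_mult intro!: ennreal_leI mult_right_mono)
        show "(SUP k. ennreal (path (?A k) w p * indicator {t} (fst p))) \<le> ennreal \<bar>?u p * indicator {t} (fst p)\<bar>"
          by (intro SUP_least ennreal_leI) (auto simp: path_def abs_mult intro!: mult_right_mono)
      qed
    qed
    also have "\<dots> = (SUP k. \<integral>\<^sup>+p. ennreal (path (?A k) w p * indicator {t} (fst p)) \<partial>vm w)"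
    proof (rule nn_integral_monotone_convergence_SUP)
      show "incseq (\<lambda>k p. ennreal (path (?A k) w p * indicator {t} (fst p)))"
        by (auto simp: incseq_def le_fun_def path_def intro!: ennreal_leI mult_right_mono min.mono)
    qed (use tm[OF measurable_path[OF Am w]] in auto)
    also have "\<dots> = (SUP k. ennreal (C k w t))"
    proof (intro SUP_cong refl)
      fix k
      show "(\<integral>\<^sup>+p. ennreal (path (?A k) w p * indicator {t} (fst p)) \<partial>vm w) = ennreal (C k w t)"
        unfolding C(2)[OF w t(1)] ob by (intro nn_integral_eq_integral Ai AE_I2) (simp add: path_def)
    qed
    finally have nn: "(\<integral>\<^sup>+p. ennreal \<bar>?u p * indicator {t} (fst p)\<bar> \<partial>vm w) = (SUP k. ennreal (C k w t))" .
    show ?thesis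
    proof (cases "(SUP k. ennreal (C k w t)) < \<infinity>")
      case True
      then have i: "integrable (vm w) (\<lambda>p. ?u p * indicator {t} (fst p))"
        using tm[OF wm] nn by (intro integrableI_bounded) (simp_all only: real_norm_def)
      have "(\<lambda>k. \<integral>p. path (?V k) w p * indicator {t} (fst p) \<partial>vm w) \<longlonglongrightarrow> (\<integral>p. ?u p * indicator {t} (fst p) \<partial>vm w)"
      proof (rule integral_dominated_convergence[where w="\<lambda>p. \<bar>?u p * indicator {t} (fst p)\<bar>"])
        show "AE p in vm w. (\<lambda>k. path (?V k) w p * indicator {t} (fst p)) \<longlonglongrightarrow> ?u p * indicator {t} (fst p)"
        proof (rule AE_I2, rule tendsto_mult, rule tendsto_eventually)
          fix p
          obtain k0 :: nat where k0: "\<bar>?u p\<bar> \<le> real k0" using real_arch_simple by blast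
          have "path (?V k) w p = ?u p" if "k0 \<le> k" for k
          proof -
            have "real k0 \<le> real k" using that by simp
            then show ?thesis using k0 by (auto simp: path_def min_def max_def)
          qed
          then show "\<forall>\<^sub>F k in sequentially. path (?V k) w p = ?u p" unfolding eventually_sequentially by blast
        qed simp
        show "AE p in vm w. norm (path (?V k) w p * indicator {t} (fst p)) \<le> \<bar>?u p * indicator {t} (fst p)\<bar>" for k
          by (intro AE_I2) (auto simp: path_def abs_mult min_def max_def split: split_indicator)
      qed (use i tm[OF wm] tm[OF measurable_path[OF Vm w]] in auto)
      then have "(\<lambda>k. B k w t) \<longlonglongrightarrow> Zbar U \<nu> Z w t"
        unfolding Zbar_eq[OF Z w t] B(2)[OF w t(1)] ob .
      then show ?thesis using True by (simp add: Zt_def limI)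
    next
      case False
      have "\<not> integrable (vm w) (\<lambda>p. ?u p * indicator {t} (fst p))"
      proof
        assume "integrable (vm w) (\<lambda>p. ?u p * indicator {t} (fst p))"
        then have "(\<integral>\<^sup>+p. ennreal (norm (?u p * indicator {t} (fst p))) \<partial>vm w) < \<infinity>" unfolding integrable_iff_bounded by blast
        then show False using False nn by (simp only: real_norm_def)
      qed
      then show ?thesis using False unfolding Zbar_eq[OF Z w t] Zt_def by (simp add: not_integrable_integral_eq)
    qed
  qed
  then show ?thesis using that Ztm by blast
qed

lemma finite_atoms:
  assumes w: "w \<in> space M" and c: "0 < c"
  shows "finite {t. c < measure (vm w) ({t} \<times> space U)}"
proof -
  interpret vm: finite_measure "vm w" by (rule finite_vm[OF w])
  let ?m = "measure (vm w) (space (vm w))"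
  have "card G \<le> nat \<lfloor>?m / c\<rfloor>" if G: "G \<subseteq> {t. c < measure (vm w) ({t} \<times> space U)}" "finite G" for G
  proof -
    have s: "{t} \<times> space U \<in> sets (vm w)" for t using sets_vm[OF w] by auto
    have "c * real (card G) = (\<Sum>t\<in>G. c)" by simp
    also have "\<dots> \<le> (\<Sum>t\<in>G. measure (vm w) ({t} \<times> space U))" using G(1) by (intro sum_mono) (auto simp: less_imp_le)
    also have "\<dots> = measure (vm w) (\<Union>t\<in>G. {t} \<times> space U)"
      using G(2) s by (intro vm.finite_measure_finite_Union[symmetric]) (auto simp: disjoint_family_on_def)
    also have "\<dots> \<le> ?m" by (rule vm.bounded_measure)
    finally have "real (card G) \<le> ?m / c" using c by (simp add: pos_le_divide_eq mult.commute)
    then show ?thesis by linarith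
  qed
  then show ?thesis using finite_if_finite_subsets_card_bdd by blast
qed

text \<open>The norm of \<open>H20\<close> sums over times without weighting each time by its atom.
  As atoms have mass at most 1, this sum dominates the integral of a function that vanishes off the
  atoms. The finite sets \<open>Dn n\<close> exhaust the atoms.\<close>

lemma atom_sum_le:
  fixes g :: "'w \<times> real \<Rightarrow> ennreal"
  assumes w: "w \<in> space M" and g: "g \<in> borel_measurable Prd"
    and z: "\<And>t. 0 < t \<Longrightarrow> t \<le> T \<Longrightarrow> measure (vm w) ({t} \<times> space U) = 0 \<Longrightarrow> g (w, t) = 0"
  shows "(\<integral>\<^sup>+p. path (\<lambda>q. g (fst q)) w p \<partial>vm w) \<le> (\<Sum>\<^sub>\<infinity>t\<in>{0<..T}. g (w, t))"
proof -
  define Dn where "Dn n = {t\<in>{0<..T}. 1 / real (Suc n) < measure (vm w) ({t} \<times> space U)}" for n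
  have fin: "finite (Dn n)" for n by (rule finite_subset[OF _ finite_atoms[OF w, of "1 / real (Suc n)"]]) (auto simp: Dn_def)
  have gm: "path (\<lambda>q. g (fst q)) w \<in> borel_measurable (borel \<Otimes>\<^sub>M U)"
    by (rule measurable_path[OF measurable_compose[OF measurable_fst g] w])
  have Dmono: "Dn m \<subseteq> Dn n" if "m \<le> n" for m n
  proof
    fix t assume "t \<in> Dn m"
    moreover have "1 / real (Suc n) \<le> 1 / real (Suc m)" using that by (intro divide_left_mono) auto
    ultimately show "t \<in> Dn n" unfolding Dn_def by (auto simp del: of_nat_Suc)
  qed
  have meas: "(\<lambda>p. path (\<lambda>q. g (fst q)) w p * indicator (Dn n) (fst p)) \<in> borel_measurable (vm w)" for n
    using fin[of n] by (intro measurable_vm[OF w] borel_measurable_times_ennreal gm measurable_time_indicator borel_closed finite_imp_closed)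
  have "(\<integral>\<^sup>+p. path (\<lambda>q. g (fst q)) w p \<partial>vm w) = (\<integral>\<^sup>+p. (SUP n. path (\<lambda>q. g (fst q)) w p * indicator (Dn n) (fst p)) \<partial>vm w)"
  proof (rule nn_integral_cong_AE)
    show "AE p in vm w. path (\<lambda>q. g (fst q)) w p = (SUP n. path (\<lambda>q. g (fst q)) w p * indicator (Dn n) (fst p))"
      using AE_vm[OF w]
    proof eventually_elim
      case (elim p)
      then have p: "0 < fst p" "fst p \<le> T" by (auto simp: D_def)
      have pe: "path (\<lambda>q. g (fst q)) w p = g (w, fst p)" using p by (simp add: path_def)
      show ?case
      proof (rule antisym)
        show "path (\<lambda>q. g (fst q)) w p \<le> (SUP n. path (\<lambda>q. g (fst q)) w p * indicator (Dn n) (fst p))"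
        proof (cases "measure (vm w) ({fst p} \<times> space U) = 0")
          case True
          then show ?thesis using z[OF p] pe by simp
        next
          case False
          then have "0 < measure (vm w) ({fst p} \<times> space U)" by (simp add: zero_less_measure_iff)
          then obtain n where "1 / real (Suc n) < measure (vm w) ({fst p} \<times> space U)" using nat_approx_posE by metis
          then have "fst p \<in> Dn n" using p by (simp add: Dn_def)
          then show ?thesis by (intro SUP_upper2[of n]) auto
        qed
        show "(SUP n. path (\<lambda>q. g (fst q)) w p * indicator (Dn n) (fst p)) \<le> path (\<lambda>q. g (fst q)) w p"
          by (intro SUP_least) (auto split: split_indicator)
      qed
    qed
  qed
  also have "\<dots> = (SUP n. \<integral>\<^sup>+p. path (\<lambda>q. g (fst q)) w p * indicator (Dn n) (fst p) \<partial>vm w)"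
  proof (rule nn_integral_monotone_convergence_SUP[OF _ meas])
    show "incseq (\<lambda>n p. path (\<lambda>q. g (fst q)) w p * indicator (Dn n) (fst p))"
      using Dmono by (auto simp: incseq_def le_fun_def split: split_indicator)
  qed
  also have "\<dots> \<le> (\<Sum>\<^sub>\<infinity>t\<in>{0<..T}. g (w, t))"
  proof (rule SUP_least)
    fix n
    have "(\<integral>\<^sup>+p. path (\<lambda>q. g (fst q)) w p * indicator (Dn n) (fst p) \<partial>vm w) = (\<integral>\<^sup>+p. (\<Sum>t\<in>Dn n. g (w, t) * indicator ({t} \<times> space U) p) \<partial>vm w)"
    proof (rule nn_integral_cong)
      fix p assume "p \<in> space (vm w)"
      then have pU: "snd p \<in> space U" by (auto simp: space_vm[OF w])
      show "path (\<lambda>q. g (fst q)) w p * indicator (Dn n) (fst p) = (\<Sum>t\<in>Dn n. g (w, t) * indicator ({t} \<times> space U) p)"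
      proof (cases "fst p \<in> Dn n")
        case True
        then have "path (\<lambda>q. g (fst q)) w p = g (w, fst p)" by (simp add: path_def Dn_def)
        moreover have "(\<Sum>t\<in>Dn n. g (w, t) * indicator ({t} \<times> space U) p) = (\<Sum>t\<in>Dn n. if t = fst p then g (w, t) else 0)"
          using pU by (intro sum.cong) (auto simp: indicator_def mem_Times_iff)
        ultimately show ?thesis using True fin by simp
      next
        case False
        then have "(\<Sum>t\<in>Dn n. g (w, t) * indicator ({t} \<times> space U) p) = (\<Sum>t\<in>Dn n. 0)"
          by (intro sum.cong) (auto simp: indicator_def mem_Times_iff)
        then show ?thesis using False by simp
      qed
    qed
    also have "\<dots> = (\<Sum>t\<in>Dn n. \<integral>\<^sup>+p. g (w, t) * indicator ({t} \<times> space U) p \<partial>vm w)"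
      using sets_vm[OF w] by (intro nn_integral_sum) auto
    also have "\<dots> = (\<Sum>t\<in>Dn n. g (w, t) * emeasure (vm w) ({t} \<times> space U))"
      using sets_vm[OF w] by (intro sum.cong refl nn_integral_cmult_indicator) auto
    also have "\<dots> \<le> (\<Sum>t\<in>Dn n. g (w, t))"
      using mult_left_mono[OF emeasure_vm_point_le[OF w], of "g (w, _)"] by (intro sum_mono) simp
    also have "\<dots> = (\<Sum>\<^sub>\<infinity>t\<in>Dn n. g (w, t))" by (rule infsum_finite[OF fin, symmetric])
    also have "\<dots> \<le> (\<Sum>\<^sub>\<infinity>t\<in>{0<..T}. g (w, t))"
      by (rule infsum_mono_neutral) (auto simp: Dn_def intro: nonneg_summable_on_complete)
    finally show "(\<integral>\<^sup>+p. path (\<lambda>q. g (fst q)) w p * indicator (Dn n) (fst p) \<partial>vm w) \<le> (\<Sum>\<^sub>\<infinity>t\<in>{0<..T}. g (w, t))" .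
  qed
  finally show ?thesis .
qed

lemma J_add:
  assumes "w \<in> space M" "V \<in> borel_measurable (Prd \<Otimes>\<^sub>M U)" "W \<in> borel_measurable (Prd \<Otimes>\<^sub>M U)"
    "integrable (vm w) (path V w)" "integrable (vm w) (path W w)"
  shows "J (\<lambda>q. V q + W q) w = J V w + J W w"
proof -
  have "path (\<lambda>q. V q + W q) w = (\<lambda>p. path V w p + path W w p)" by (auto simp: path_def)
  then show ?thesis unfolding J_def
    using integrable_pm[OF assms(1) measurable_path[OF assms(2,1)]] integrable_pm[OF assms(1) measurable_path[OF assms(3,1)]] assms(4,5)
    by simp
qed

text \<open>The decomposition \<open>Z = (Z - Zbar) + Zbar\<close> splits the norm of \<open>\<H>\<^bsup>2,0\<^esup>\<close> into its two terms. The
  first summand is controlled by its second moment, the second one does not depend on the mark.\<close>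

theorem compensated_mean_zero:
  assumes Z: "Z \<in> H20 M F T U \<nu> K"
  shows "AE w in M. integrable (vm w) (path (unc Z) w)"
    "\<And>E. E \<in> sets Prd \<Longrightarrow> integrable M (J (\<lambda>q. unc Z q * indicator E (fst q)))"
    "\<And>E. E \<in> sets Prd \<Longrightarrow> (\<integral>w. J (\<lambda>q. unc Z q * indicator E (fst q)) w \<partial>M) = 0"
proof -
  have Zm: "unc Z \<in> borel_measurable (Prd \<Otimes>\<^sub>M U)"
    using Z unfolding H20_def predictable_function_unc by blast
  obtain Zt where Zt: "(\<lambda>(w, t). Zt w t) \<in> borel_measurable Prd"
    "\<And>w t. w \<in> space M \<Longrightarrow> 0 < t \<Longrightarrow> t \<le> T \<Longrightarrow> Zt w t = Zbar U \<nu> Z w t"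
    by (rule Zbar_predictable[OF Zm]) (rule that)
  obtain a where a: "(\<lambda>(w, t). a w t) \<in> borel_measurable Prd"
    "\<And>w t. w \<in> space M \<Longrightarrow> 0 < t \<Longrightarrow> a w t = measure (vm w) ({t} \<times> space U)"
    by (rule atom_predictable) (rule that)
  have a1: "0 \<le> a w t" "a w t \<le> 1" if "w \<in> space M" "0 < t" for w t
  proof -
    interpret vm: finite_measure "vm w" by (rule finite_vm[OF that(1)])
    show "0 \<le> a w t" "a w t \<le> 1" unfolding a(2)[OF that]
      using emeasure_vm_point_le[OF that(1), of t] by (simp_all add: vm.emeasure_eq_measure ennreal_le_1)
  qed
  have aK: "a w t = K w t - left_lim 0 (K w) t" if "w \<in> space M" "0 < t" "t \<le> T" for w t
  proof -
    have "left_lim 0 (K w) t \<le> K w t" by (rule mono_left_lim(3)[OF K_props(2)[OF that(1)] that(2,3)])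
    then show ?thesis unfolding a(2)[OF that(1,2)] measure_def emeasure_vm_point[OF that] by simp
  qed
  \<comment> \<open>The predictable version \<open>a\<close> of the atom mass is controlled at
    positive times only. Clamping makes the weight lie between 0 and 1 at every point, as
    \<open>J_limit\<close> requires.\<close>
  define r where "r q = max 0 (min 1 (1 - (\<lambda>(w, t). a w t) (fst q)))" for q :: "('w \<times> real) \<times> 'u"
  define W1 where "W1 q = unc Z q - (\<lambda>(w, t). Zt w t) (fst q)" for q
  define W2 where "W2 q = (\<lambda>(w, t). Zt w t) (fst q)" for q :: "('w \<times> real) \<times> 'u"
  have W2m: "W2 \<in> borel_measurable (Prd \<Otimes>\<^sub>M U)" unfolding W2_def[abs_def] by (rule measurable_compose[OF measurable_fst Zt(1)])
  have W1m: "W1 \<in> borel_measurable (Prd \<Otimes>\<^sub>M U)" unfolding W1_def[abs_def]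
    using Zm W2m by (intro borel_measurable_diff) (simp_all add: W2_def[abs_def])
  have rm: "r \<in> borel_measurable (Prd \<Otimes>\<^sub>M U)" unfolding r_def[abs_def]
    using measurable_compose[OF measurable_fst a(1), of U] by simp
  have r_eq: "r ((w, t), x) = 1 - a w t" if "w \<in> space M" "0 < t" for w t x
    using a1[OF that] by (simp add: r_def)
  define h1 where "h1 w = (\<integral>\<^sup>+p. path (\<lambda>q. ennreal (W1 q * W1 q)) w p \<partial>vm w)" for w
  define h2 where "h2 w = (\<integral>\<^sup>+p. path (\<lambda>q. ennreal (W2 q * W2 q * r q)) w p \<partial>vm w)" for w
  have h1m: "h1 \<in> borel_measurable M" unfolding h1_def[abs_def] using W1m by (intro vm_nn_measurable) simp
  have h2m: "h2 \<in> borel_measurable M" unfolding h2_def[abs_def] using W2m rm by (intro vm_nn_measurable) simp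
  have h1_le: "h1 w \<le> (\<integral>\<^sup>+(t, x)\<in>{0..T} \<times> space U. ennreal (\<bar>Z w t x - Zbar U \<nu> Z w t\<bar>\<^sup>2) \<partial>\<nu> w)" if w: "w \<in> space M" for w
  proof -
    have "h1 w = (\<integral>\<^sup>+p. indicator D p * path (\<lambda>q. ennreal (W1 q * W1 q)) w p \<partial>\<nu> w)"
      unfolding h1_def using W1m by (intro nn_integral_vm[OF w] measurable_path[OF _ w]) simp
    also have "\<dots> \<le> (\<integral>\<^sup>+(t, x)\<in>{0..T} \<times> space U. ennreal (\<bar>Z w t x - Zbar U \<nu> Z w t\<bar>\<^sup>2) \<partial>\<nu> w)"
      using Zt(2)[OF w] by (intro nn_integral_mono) (auto simp: D_def path_def W1_def unc_def power2_eq_square split: split_indicator)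
    finally show ?thesis .
  qed
  have h2_le: "h2 w \<le> (\<Sum>\<^sub>\<infinity>t\<in>{0<..T}. ennreal (\<bar>Zbar U \<nu> Z w t\<bar>\<^sup>2 * (1 - (K w t - left_lim 0 (K w) t))))" if w: "w \<in> space M" for w
  proof -
    let ?g = "\<lambda>(w, t). ennreal (Zt w t * Zt w t * max 0 (min 1 (1 - a w t)))"
    have gm: "?g \<in> borel_measurable Prd" using Zt(1) a(1) by (simp add: split_beta')
    have "h2 w = (\<integral>\<^sup>+p. path (\<lambda>q. ?g (fst q)) w p \<partial>vm w)"
      unfolding h2_def by (rule nn_integral_cong) (simp add: path_def W2_def r_def split_beta')
    also have "\<dots> \<le> (\<Sum>\<^sub>\<infinity>t\<in>{0<..T}. ?g (w, t))"
    proof (rule atom_sum_le[OF w gm])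
      fix t assume t: "0 < t" "t \<le> T" "measure (vm w) ({t} \<times> space U) = 0"
      interpret vm: finite_measure "vm w" by (rule finite_vm[OF w])
      have "{t} \<times> space U \<in> null_sets (vm w)" using t(3) sets_vm[OF w] by (auto simp: null_sets_def vm.emeasure_eq_measure)
      from AE_not_in[OF this] AE_vm[OF w]
      have "AE p in vm w. path (unc Z) w p * indicator {t} (fst p) = 0"
        by eventually_elim (auto simp: D_def split: split_indicator)
      then have "Zbar U \<nu> Z w t = 0" unfolding Zbar_eq[OF Zm w t(1,2)] by (rule integral_eq_zero_AE)
      then show "?g (w, t) = 0" using Zt(2)[OF w t(1,2)] by simp
    qed
    also have "\<dots> = (\<Sum>\<^sub>\<infinity>t\<in>{0<..T}. ennreal (\<bar>Zbar U \<nu> Z w t\<bar>\<^sup>2 * (1 - (K w t - left_lim 0 (K w) t))))"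
    proof (rule infsum_cong)
      fix t assume "t \<in> {0<..T}"
      then have t: "0 < t" "t \<le> T" by auto
      then show "?g (w, t) = ennreal (\<bar>Zbar U \<nu> Z w t\<bar>\<^sup>2 * (1 - (K w t - left_lim 0 (K w) t)))"
        using Zt(2)[OF w t] aK[OF w t] a1[OF w t(1)] by (simp add: power2_eq_square)
    qed
    finally show ?thesis .
  qed
  have "(\<integral>\<^sup>+w. h1 w + h2 w \<partial>M) \<le> (\<integral>\<^sup>+w. (\<integral>\<^sup>+(t, x)\<in>{0..T} \<times> space U. ennreal (\<bar>Z w t x - Zbar U \<nu> Z w t\<bar>\<^sup>2) \<partial>\<nu> w) +
        (\<Sum>\<^sub>\<infinity>t\<in>{0<..T}. ennreal (\<bar>Zbar U \<nu> Z w t\<bar>\<^sup>2 * (1 - (K w t - left_lim 0 (K w) t)))) \<partial>M)"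
    using h1_le h2_le by (intro nn_integral_mono add_mono)
  also have "\<dots> < \<infinity>" using Z unfolding H20_def by blast
  finally have "(\<integral>\<^sup>+w. h1 w \<partial>M) + (\<integral>\<^sup>+w. h2 w \<partial>M) < \<infinity>" using h1m h2m by (simp add: nn_integral_add)
  then have Eh: "(\<integral>\<^sup>+w. h1 w \<partial>M) < \<infinity>" "(\<integral>\<^sup>+w. h2 w \<partial>M) < \<infinity>" by (auto simp: less_top[symmetric])
  have AEh: "AE w in M. h1 w \<noteq> \<infinity>" "AE w in M. h2 w \<noteq> \<infinity>"
    using nn_integral_PInf_AE[OF h1m] nn_integral_PInf_AE[OF h2m] Eh by simp_all
  have int1: "AE w in M. integrable (vm w) (path W1 w)"
    using AEh(1) AE_space
  proof eventually_elim
    case (elim w)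
    note w = elim(2)
    interpret vm: finite_measure "vm w" by (rule finite_vm[OF w])
    have m: "path W1 w \<in> borel_measurable (vm w)" by (intro measurable_vm[OF w] measurable_path[OF W1m w])
    have "integrable (vm w) (\<lambda>p. path W1 w p * path W1 w p)"
      using elim(1) by (intro integrableI_bounded borel_measurable_times m) (simp add: h1_def path_def less_top[symmetric])
    then have "integrable (vm w) (\<lambda>p. 1 + path W1 w p * path W1 w p)" by simp
    then show ?case
      by (rule Bochner_Integration.integrable_bound[OF _ m]) (use abs_le_one_plus_square in \<open>auto intro!: AE_I2 simp: abs_of_nonneg\<close>)
  qed
  have int2: "AE w in M. integrable (vm w) (path W2 w)"
    using AEh(2) AE_space
  proof eventually_elim
    case (elim w)
    note w = elim(2)
    interpret vm: finite_measure "vm w" by (rule finite_vm[OF w])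
    have m: "path W2 w \<in> borel_measurable (vm w)" by (intro measurable_vm[OF w] measurable_path[OF W2m w])
    have m2: "path (\<lambda>q. W2 q * W2 q * r q) w \<in> borel_measurable (vm w)"
      using W2m rm by (intro measurable_vm[OF w] measurable_path[OF _ w]) simp
    have r0: "0 \<le> r q" for q by (simp add: r_def)
    have i2: "integrable (vm w) (path (\<lambda>q. W2 q * W2 q * r q) w)"
      using elim(1) m2 r0 by (intro integrableI_bounded) (simp_all add: h2_def path_def less_top[symmetric])
    \<comment> \<open>The weight \<open>1 - a\<close> may be arbitrarily small only on the finite
      set \<open>G\<close>, where \<open>b\<close> bounds the mean. Off \<open>G\<close> it is at
      least 1/2, so z squared is at most twice the weighted square.\<close>
    define G where "G = {t. 1/2 < measure (vm w) ({t} \<times> space U)}"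
    define b where "b = Max ((\<lambda>t. \<bar>Zt w t\<bar>) ` insert 0 G)"
    have finG: "finite G" unfolding G_def by (rule finite_atoms[OF w]) simp
    have b: "\<bar>Zt w t\<bar> \<le> b" if "t \<in> G" for t unfolding b_def using finG that by (intro Max_ge) auto
    have b0: "0 \<le> b" unfolding b_def using finG by (intro order.trans[OF abs_ge_zero Max_ge]) auto
    have "integrable (vm w) (\<lambda>p. (1 + b) + 2 * path (\<lambda>q. W2 q * W2 q * r q) w p)" using i2 by simp
    then show ?case
    proof (rule Bochner_Integration.integrable_bound[OF _ m])
      show "AE p in vm w. norm (path W2 w p) \<le> norm ((1 + b) + 2 * path (\<lambda>q. W2 q * W2 q * r q) w p)"
        using AE_vm[OF w]
      proof eventually_elim
        case (elim p)
        then have p: "0 < fst p" "fst p \<le> T" "fst p \<in> {0..T}" by (auto simp: D_def)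
        let ?z = "Zt w (fst p)"
        have e: "path W2 w p = ?z" "path (\<lambda>q. W2 q * W2 q * r q) w p = ?z * ?z * (1 - a w (fst p))"
          unfolding path_eq[OF p(3)] using r_eq[OF w p(1)] by (simp_all add: W2_def)
        have nn: "0 \<le> ?z * ?z * (1 - a w (fst p))" using a1[OF w p(1)] by simp
        have "\<bar>?z\<bar> \<le> (1 + b) + 2 * (?z * ?z * (1 - a w (fst p)))"
        proof (cases "fst p \<in> G")
          case True
          then show ?thesis using b[OF True] nn by linarith
        next
          case False
          then have "a w (fst p) \<le> 1/2" unfolding G_def using a(2)[OF w p(1)] by simp
          then have "?z * ?z * (1/2) \<le> ?z * ?z * (1 - a w (fst p))" by (intro mult_left_mono) auto
          then show ?thesis using abs_le_one_plus_square[of ?z] b0 by linarith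
        qed
        then show ?case unfolding e using nn b0 by simp
      qed
    qed
  qed
  have dec: "path (unc Z) w p = path W1 w p + path W2 w p" for w p by (simp add: path_def W1_def W2_def)
  show "AE w in M. integrable (vm w) (path (unc Z) w)"
    using int1 int2
  proof eventually_elim
    case (elim w)
    then have "integrable (vm w) (\<lambda>p. path W1 w p + path W2 w p)" by (rule Bochner_Integration.integrable_add)
    moreover have "path (unc Z) w = (\<lambda>p. path W1 w p + path W2 w p)" by (rule ext, rule dec)
    ultimately show ?case by (simp only:)
  qed
  \<comment> \<open>An arbitrary predictable \<open>E\<close> is carried along because it will be
    specialised to stochastic intervals over events of the past of \<open>S\<close>, and to the set
    of large jumps of \<open>A\<close>.\<close>
  fix E assume E: "E \<in> sets Prd"
  have Em: "(\<lambda>q. indicator E (fst q) :: real) \<in> borel_measurable (Prd \<Otimes>\<^sub>M U)"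
    using E by (intro measurable_compose[OF measurable_fst borel_measurable_indicator])
  have intE: "integrable (vm w) (path (\<lambda>q. W q * indicator E (fst q)) w)"
    if "integrable (vm w) (path W w)" "w \<in> space M" "W \<in> borel_measurable (Prd \<Otimes>\<^sub>M U)" for W :: "('w \<times> real) \<times> 'u \<Rightarrow> real" and w
  proof (rule Bochner_Integration.integrable_bound[OF that(1)])
    show "path (\<lambda>q. W q * indicator E (fst q)) w \<in> borel_measurable (vm w)"
      by (intro measurable_vm[OF that(2)] measurable_path[OF _ that(2)] borel_measurable_times that(3) Em)
  qed (auto intro!: AE_I2 simp: path_def split: split_indicator)
  let ?W1 = "\<lambda>q. W1 q * indicator E (fst q)" and ?W2 = "\<lambda>q. W2 q * indicator E (fst q)"
  have W1E: "?W1 \<in> borel_measurable (Prd \<Otimes>\<^sub>M U)" using W1m Em by (intro borel_measurable_times)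
  have W2E: "?W2 \<in> borel_measurable (Prd \<Otimes>\<^sub>M U)" using W2m Em by (intro borel_measurable_times)
  have A1: "AE w in M. integrable (vm w) (path ?W1 w)" using int1 AE_space by eventually_elim (rule intE[OF _ _ W1m])
  have A2: "AE w in M. integrable (vm w) (path ?W2 w)" using int2 AE_space by eventually_elim (rule intE[OF _ _ W2m])
  have F1: "(\<integral>\<^sup>+w. (\<integral>\<^sup>+p. path (\<lambda>q. ennreal (?W1 q * ?W1 q * 2)) w p \<partial>vm w) \<partial>M) < \<infinity>"
  proof -
    have "(\<integral>\<^sup>+w. (\<integral>\<^sup>+p. path (\<lambda>q. ennreal (?W1 q * ?W1 q * 2)) w p \<partial>vm w) \<partial>M) \<le> (\<integral>\<^sup>+w. 2 * h1 w \<partial>M)"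
    proof (intro nn_integral_mono)
      fix w assume w: "w \<in> space M"
      have "(\<integral>\<^sup>+p. path (\<lambda>q. ennreal (?W1 q * ?W1 q * 2)) w p \<partial>vm w) \<le> (\<integral>\<^sup>+p. 2 * path (\<lambda>q. ennreal (W1 q * W1 q)) w p \<partial>vm w)"
      proof (intro nn_integral_mono)
        fix p
        have "ennreal (x * x * 2) = 2 * ennreal (x * x)" for x :: real
          by (subst mult.commute) (simp add: ennreal_mult'')
        then show "path (\<lambda>q. ennreal (?W1 q * ?W1 q * 2)) w p \<le> 2 * path (\<lambda>q. ennreal (W1 q * W1 q)) w p"
          by (auto simp: path_def split: split_indicator)
      qed
      also have "\<dots> = 2 * h1 w" unfolding h1_def
        using W1m by (intro nn_integral_cmult measurable_vm[OF w] measurable_path[OF _ w]) simp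
      finally show "(\<integral>\<^sup>+p. path (\<lambda>q. ennreal (?W1 q * ?W1 q * 2)) w p \<partial>vm w) \<le> 2 * h1 w" .
    qed
    also have "\<dots> = 2 * (\<integral>\<^sup>+w. h1 w \<partial>M)" using h1m by (rule nn_integral_cmult)
    also have "\<dots> < \<infinity>" using Eh(1) by (simp add: ennreal_mult_less_top)
    finally show ?thesis .
  qed
  have F2: "(\<integral>\<^sup>+w. (\<integral>\<^sup>+p. path (\<lambda>q. ennreal (?W2 q * ?W2 q * r q)) w p \<partial>vm w) \<partial>M) < \<infinity>"
  proof -
    have "(\<integral>\<^sup>+w. (\<integral>\<^sup>+p. path (\<lambda>q. ennreal (?W2 q * ?W2 q * r q)) w p \<partial>vm w) \<partial>M) \<le> (\<integral>\<^sup>+w. h2 w \<partial>M)"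
      unfolding h2_def by (intro nn_integral_mono) (auto simp: path_def split: split_indicator)
    then show ?thesis using Eh(2) by (rule le_less_trans)
  qed
  have L1: "integrable M (J ?W1)" "(\<integral>w. J ?W1 w \<partial>M) = 0"
    by (rule J_limit[OF W1E borel_measurable_const[of 2] _ _ A1 F1], simp, simp, intro conjI isometry_bound, assumption+)+
  have L2: "integrable M (J ?W2)" "(\<integral>w. J ?W2 w \<partial>M) = 0"
  proof -
    let ?R = "\<lambda>k :: nat. {q \<in> space (Prd \<Otimes>\<^sub>M U). \<bar>?W2 q\<bar> \<le> real k} \<inter> Loc k"
    have iso: "integrable M (\<lambda>w. (J (\<lambda>q. ?W2 q * indicator (?R k - ?R j) q) w)\<^sup>2) \<and>
      (\<integral>w. (J (\<lambda>q. ?W2 q * indicator (?R k - ?R j) q) w)\<^sup>2 \<partial>M) \<le>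
      (\<integral>w. (\<integral>p. path (\<lambda>q. (?W2 q * indicator (?R k - ?R j) q) * (?W2 q * indicator (?R k - ?R j) q) * r q) w p \<partial>vm w) \<partial>M)"
      if l: "loc (real k) k (\<lambda>q. ?W2 q * indicator (?R k - ?R j) q)" for j k
    proof -
      let ?V = "\<lambda>q. ?W2 q * indicator (?R k - ?R j) q"
      \<comment> \<open>The truncation sets see the mark only through membership in
        \<open>space U\<close>, so truncating keeps the integrand independent of the mark.\<close>
      have ind: "?V ((w, t), x) = ?V ((w, t), y)" if "x \<in> space U" "y \<in> space U" for w t x y
        using that by (simp add: W2_def Loc_def space_Prd_pair indicator_def)
      have "path (\<lambda>q. ?V q * ?V q * (1 - (\<lambda>(w, t). a w t) (fst q))) w p = path (\<lambda>q. ?V q * ?V q * r q) w p" for w p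
      proof (cases "((w, max 0 (min T (fst p))), snd p) \<in> Loc k")
        case True
        then have "w \<in> space M" "0 < max 0 (min T (fst p))" by (auto simp: Loc_def space_Prd_pair)
        from r_eq[OF this] show ?thesis by (simp add: path_def)
      next
        case False
        then show ?thesis by (simp add: path_def)
      qed
      then show ?thesis using isometry_time[OF l ind a] by simp
    qed
    show "integrable M (J ?W2)" "(\<integral>w. J ?W2 w \<partial>M) = 0"
      by (rule J_limit[OF W2E rm _ _ A2 F2], simp add: r_def, simp add: r_def, rule iso, assumption)+
  qed
  have eq: "AE w in M. J (\<lambda>q. unc Z q * indicator E (fst q)) w = J ?W1 w + J ?W2 w"
    using A1 A2 AE_space
  proof eventually_elim
    case (elim w)
    have "(\<lambda>q. unc Z q * indicator E (fst q)) = (\<lambda>q. ?W1 q + ?W2 q)" by (auto simp: W1_def W2_def algebra_simps)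
    then show ?case using J_add[OF elim(3) W1E W2E elim(1,2)] by simp
  qed
  have sm: "(\<lambda>w. J ?W1 w + J ?W2 w) \<in> borel_measurable M" using L1(1) L2(1) by (intro borel_measurable_add borel_measurable_integrable)
  have m: "J (\<lambda>q. unc Z q * indicator E (fst q)) \<in> borel_measurable M" by (rule measurable_AE[OF sm eq])
  show "integrable M (J (\<lambda>q. unc Z q * indicator E (fst q)))"
    by (rule integrable_cong_AE_imp[OF Bochner_Integration.integrable_add[OF L1(1) L2(1)] m]) (use eq in \<open>auto elim: eventually_mono\<close>)
  show "(\<integral>w. J (\<lambda>q. unc Z q * indicator E (fst q)) w \<partial>M) = 0"
    using integral_cong_AE[OF m sm eq] L1 L2 by simp
qed

end

section \<open>Essential suprema\<close>

text \<open>Exhaustion: a maximising sequence of countable subfamilies has a countable union, which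
  attains the supremum of the probabilities. A set sticking out of it by positive probability would
  exceed that supremum.\<close>

lemma (in prob_space) essential_union:
  assumes S: "\<And>i. i \<in> I \<Longrightarrow> S i \<in> sets M"
  obtains C where "countable C" "C \<subseteq> I" "\<And>i. i \<in> I \<Longrightarrow> AE w in M. w \<in> S i \<longrightarrow> w \<in> (\<Union>j\<in>C. S j)"
proof -
  let ?c = "\<lambda>C. emeasure M (\<Union>j\<in>C. S j)"
  let ?A = "?c ` {C. countable C \<and> C \<subseteq> I}"
  have "{} \<in> {C. countable C \<and> C \<subseteq> I}" by simp
  then have ne: "?A \<noteq> {}" by blast
  obtain f :: "nat \<Rightarrow> ennreal" where f: "range f \<subseteq> ?A" "Sup ?A = (SUP i. f i)"
    using ennreal_Sup_countable_SUP[OF ne] by metis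
  have "\<exists>C. countable C \<and> C \<subseteq> I \<and> f n = ?c C" for n
  proof -
    have "f n \<in> ?A" using f(1) by (rule subsetD) simp
    then show ?thesis by blast
  qed
  then obtain D where D: "\<And>n. countable (D n)" "\<And>n. D n \<subseteq> I" "\<And>n. f n = ?c (D n)" by metis
  define C where "C = (\<Union>n. D n)"
  have C: "countable C" "C \<subseteq> I" using D unfolding C_def by auto
  have sets: "(\<Union>j\<in>C'. S j) \<in> sets M" if "countable C'" "C' \<subseteq> I" for C'
    using that S by (intro sets.countable_UN') auto
  have top: "?c C' \<le> ?c C" if "countable C'" "C' \<subseteq> I" for C'
  proof -
    have "?c C' \<le> Sup ?A" using that by (intro Sup_upper) blast
    also have "\<dots> = (SUP i. f i)" by (rule f(2))
    also have "\<dots> \<le> ?c C"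
    proof (rule SUP_least)
      fix n show "f n \<le> ?c C" unfolding D(3) by (rule emeasure_mono[OF _ sets[OF C]]) (auto simp: C_def)
    qed
    finally show ?thesis .
  qed
  show thesis
  proof (rule that[OF C])
    fix i assume i: "i \<in> I"
    let ?U = "\<Union>j\<in>C. S j"
    have m: "?U \<in> sets M" "S i - ?U \<in> sets M" using sets[OF C] S[OF i] by auto
    have "?c (insert i C) \<le> emeasure M ?U" using i C by (intro top) auto
    then have "prob (S i \<union> ?U) \<le> prob ?U" by (simp add: emeasure_eq_measure)
    moreover have "?U \<union> (S i - ?U) = S i \<union> ?U" by blast
    with finite_measure_Union[OF m] have "prob (S i \<union> ?U) = prob ?U + prob (S i - ?U)" by simp
    ultimately have "prob (S i - ?U) = 0" using measure_nonneg[of M "S i - ?U"] by linarith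
    then have "AE w in M. w \<notin> S i - ?U" using prob_eq_0[OF m(2)] by simp
    then show "AE w in M. w \<in> S i \<longrightarrow> w \<in> ?U" by eventually_elim simp
  qed
qed

text \<open>\<open>ess_sup\<close> chooses some version, so nothing can be drawn from it before a
  version is known to exist. One is found by reducing the superlevel sets at each rational level to
  a countable subfamily and taking the supremum over all these subfamilies.\<close>

lemma (in prob_space) is_ess_sup_ess_sup:
  fixes XS :: "('a \<Rightarrow> ennreal) set"
  assumes m: "\<And>X. X \<in> XS \<Longrightarrow> X \<in> borel_measurable M"
  shows "is_ess_sup M XS (ess_sup M XS)"
proof -
  define S where "S q X = {w \<in> space M. ennreal (real_of_rat q) < X w}" for q X
  have "\<exists>C. countable C \<and> C \<subseteq> XS \<and> (\<forall>X\<in>XS. AE w in M. w \<in> S q X \<longrightarrow> w \<in> (\<Union>Y\<in>C. S q Y))" for q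
  proof -
    have "S q X \<in> sets M" if "X \<in> XS" for X unfolding S_def using m[OF that] by measurable
    then obtain C where "countable C" "C \<subseteq> XS" "\<And>X. X \<in> XS \<Longrightarrow> AE w in M. w \<in> S q X \<longrightarrow> w \<in> (\<Union>Y\<in>C. S q Y)"
      by (rule essential_union) (assumption, rule that)
    then show ?thesis by (intro exI[of _ C] conjI ballI)
  qed
  then obtain C where C: "\<And>q. countable (C q)" "\<And>q. C q \<subseteq> XS"
    "\<And>q X. X \<in> XS \<Longrightarrow> AE w in M. w \<in> S q X \<longrightarrow> w \<in> (\<Union>Y\<in>C q. S q Y)" by metis
  define V where "V w = (SUP Y\<in>(\<Union>q. C q). Y w)" for w
  have cU: "countable (\<Union>q. C q)" using C(1) by simp
  have "is_ess_sup M XS V"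
    unfolding is_ess_sup_def
  proof (intro conjI ballI impI)
    show "V \<in> borel_measurable M" unfolding V_def[abs_def] using C(2) m by (intro borel_measurable_SUP[OF cU]) blast
    fix X assume X: "X \<in> XS"
    have "AE w in M. \<forall>q. w \<in> S q X \<longrightarrow> w \<in> (\<Union>Y\<in>C q. S q Y)" using C(3)[OF X] by (simp add: AE_all_countable)
    then show "AE w in M. X w \<le> V w"
      using AE_space
    proof eventually_elim
      case (elim w)
      show ?case
      proof (rule ccontr)
        assume "\<not> X w \<le> V w"
        then have "V w < X w" by simp
        from ennreal_rat_dense[OF this] obtain q where q: "V w < ennreal (real_of_rat q)" "ennreal (real_of_rat q) < X w" by blast
        then have "w \<in> S q X" using elim(2) by (simp add: S_def)
        then obtain Y where Y: "Y \<in> C q" "ennreal (real_of_rat q) < Y w" using elim(1) by (auto simp: S_def)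
        have "Y w \<le> V w" unfolding V_def using Y(1) by (intro SUP_upper) blast
        then show False using q(1) Y(2) by simp
      qed
    qed
  next
    fix W assume W: "W \<in> borel_measurable M" "\<forall>X\<in>XS. AE w in M. X w \<le> W w"
    have "AE w in M. \<forall>Y\<in>(\<Union>q. C q). Y w \<le> W w" using W(2) C(2) by (subst AE_ball_countable[OF cU]) blast
    then show "AE w in M. V w \<le> W w" by eventually_elim (auto simp: V_def intro!: SUP_least)
  qed
  then show ?thesis unfolding ess_sup_def by (rule someI[of "is_ess_sup M XS"])
qed

lemma ess_sup_eq:
  assumes V: "is_ess_sup M XS V"
  shows "AE w in M. ess_sup M XS w = V w"
proof -
  have E: "is_ess_sup M XS (ess_sup M XS)" unfolding ess_sup_def using V by (rule someI[of "is_ess_sup M XS"])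
  have "AE w in M. ess_sup M XS w \<le> V w" using E V unfolding is_ess_sup_def by blast
  moreover have "AE w in M. V w \<le> ess_sup M XS w" using E V unfolding is_ess_sup_def by blast
  ultimately show ?thesis by eventually_elim (rule antisym)
qed

lemma (in usual_filtration) S20_integrable:
  assumes X: "X \<in> S20 M F T" and \<tau>: "\<tau> \<in> stopping_times M F T S"
  shows "integrable M (\<lambda>w. X w (\<tau> w))"
proof -
  let ?XS = "{\<lambda>w. ennreal (\<bar>X w (\<tau> w)\<bar>\<^sup>2) |\<tau>. \<tau> \<in> stopping_times M F T (\<lambda>_. 0)}"
  have op: "optional_process M F T X" and fin: "(\<integral>\<^sup>+w. ess_sup M ?XS w \<partial>M) < \<infinity>"
    using X unfolding S20_def by simp_all
  have "is_ess_sup M ?XS (ess_sup M ?XS)"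
  proof (rule is_ess_sup_ess_sup)
    fix W assume "W \<in> ?XS"
    then obtain \<tau>' where "W = (\<lambda>w. ennreal (\<bar>X w (\<tau>' w)\<bar>\<^sup>2))" "\<tau>' \<in> stopping_times M F T (\<lambda>_. 0)" by blast
    then show "W \<in> borel_measurable M" using optional_at_stopping_time_M[OF op] by simp
  qed
  then have u: "\<forall>W\<in>?XS. AE w in M. W w \<le> ess_sup M ?XS w" unfolding is_ess_sup_def by (elim conjE)
  have mem: "(\<lambda>w. ennreal (\<bar>X w (\<tau> w)\<bar>\<^sup>2)) \<in> ?XS" using stopping_times_0[OF \<tau>] by blast
  have m: "(\<lambda>w. X w (\<tau> w)) \<in> borel_measurable M" by (rule optional_at_stopping_time_M[OF op \<tau>])
  have "(\<integral>\<^sup>+w. ennreal (\<bar>X w (\<tau> w)\<bar>\<^sup>2) \<partial>M) \<le> (\<integral>\<^sup>+w. ess_sup M ?XS w \<partial>M)"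
    by (rule nn_integral_mono_AE[OF bspec[OF u mem]])
  then have fin2: "(\<integral>\<^sup>+w. ennreal (\<bar>X w (\<tau> w)\<bar>\<^sup>2) \<partial>M) < \<infinity>" using fin by (rule le_less_trans)
  have "integrable M (\<lambda>w. (X w (\<tau> w))\<^sup>2)"
  proof (rule integrableI_bounded)
    show "(\<lambda>w. (X w (\<tau> w))\<^sup>2) \<in> borel_measurable M" using m by simp
    show "(\<integral>\<^sup>+w. ennreal (norm ((X w (\<tau> w))\<^sup>2)) \<partial>M) < \<infinity>" using fin2 by simp
  qed
  then have "integrable M (\<lambda>w. 1 + (X w (\<tau> w))\<^sup>2)" by simp
  then show ?thesis
    by (rule Bochner_Integration.integrable_bound[OF _ m])
      (use abs_le_one_plus_square in \<open>auto intro!: AE_I2 simp: power2_eq_square abs_of_nonneg\<close>)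
qed

section \<open>Jumps of monotone paths\<close>

context
  fixes T :: real and x :: "real \<Rightarrow> real"
  assumes T: "0 < T" and m: "mono_on {0..T} x" and rc: "\<forall>t\<in>{0..<T}. (x \<longlongrightarrow> x t) (at_right t)"
    and x0: "0 \<le> x 0"
begin

abbreviation "jump s \<equiv> x s - left_lim 0 x s"

lemma jump_nonneg: "s \<in> {0..T} \<Longrightarrow> 0 \<le> jump s"
  using mono_left_lim(3)[OF m, of s 0] x0 by (cases "s = 0") (auto simp: left_lim_def)

lemma sum_jumps_le:
  assumes G: "finite G" "G \<subseteq> {a<..b}" and ab: "0 \<le> a" "a \<le> b" "b \<le> T"
  shows "sum jump G \<le> x b - x a"
proof -
  have G': "s \<in> G \<Longrightarrow> 0 < s \<and> s \<le> T" for s using G(2) ab by auto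
  have sets: "B \<in> sets (stieltjes T x)" if "B \<in> sets borel" for B using that by (simp add: stieltjes_def)
  have "ennreal (sum jump G) = (\<Sum>s\<in>G. ennreal (jump s))"
    using G' jump_nonneg by (intro sum_ennreal[symmetric]) force
  also have "\<dots> = (\<Sum>s\<in>G. emeasure (stieltjes T x) {s})"
    using G' by (intro sum.cong refl emeasure_stieltjes_point[OF T m rc, symmetric]) auto
  also have "\<dots> = emeasure (stieltjes T x) G"
    using G(1) by (intro emeasure_eq_sum_singleton[symmetric] sets) auto
  also have "\<dots> \<le> emeasure (stieltjes T x) {a<..b}" by (rule emeasure_mono[OF G(2)]) (rule sets, simp)
  also have "\<dots> = ennreal (x b - x a)" using emeasure_stieltjes_Ioc[OF T m rc ab(2)] ab by simp
  finally show ?thesis using mono_onD[OF m, of a b] ab by (simp add: ennreal_le_iff)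
qed

lemma jumps_summable:
  assumes B: "B \<subseteq> {0..T}" shows "jump summable_on B"
proof (rule nonneg_bdd_above_summable_on)
  show "0 \<le> jump s" if "s \<in> B" for s using jump_nonneg B that by blast
  show "bdd_above (sum jump ` {G. G \<subseteq> B \<and> finite G})"
  proof (rule bdd_aboveI2)
    fix G assume "G \<in> {G. G \<subseteq> B \<and> finite G}"
    then have G: "G \<subseteq> {0..T}" "finite G" using B by auto
    have pos: "G - {0} \<subseteq> {0<..T}" using G by force
    have "sum jump G \<le> sum jump (insert 0 (G - {0}))"
      using G jump_nonneg T by (intro sum_mono2) auto
    also have "\<dots> = jump 0 + sum jump (G - {0})" using G(2) by (intro sum.insert) auto
    also have "\<dots> \<le> x 0 + (x T - x 0)"
      using G T pos by (intro add_mono sum_jumps_le) (auto simp: left_lim_def)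
    finally show "sum jump G \<le> x T" by simp
  qed
qed

lemma disc_part_split:
  assumes "0 \<le> a" "a \<le> b" "b \<le> T"
  shows "disc_part x b = disc_part x a + infsum jump {a<..b}"
proof -
  have "{0..b} = {0..a} \<union> {a<..b}" using assms by auto
  then show ?thesis unfolding disc_part_def
    using infsum_Un_disjoint[OF jumps_summable[of "{0..a}"] jumps_summable[of "{a<..b}"]] assms by force
qed

lemma infsum_jumps:
  assumes "0 \<le> a" "a \<le> b" "b \<le> T"
  shows "0 \<le> infsum jump {a<..b}" "infsum jump {a<..b} \<le> x b - x a"
proof -
  show "0 \<le> infsum jump {a<..b}" using assms by (intro infsum_nonneg jump_nonneg) auto
  show "infsum jump {a<..b} \<le> x b - x a"
    using assms by (intro infsum_le_finite_sums jumps_summable sum_jumps_le) auto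
qed

text \<open>The jumps strictly between s and t add up to at most the increment from x(s) to the left
  limit at t, which vanishes as s increases to t.\<close>

lemma disc_part_left:
  assumes t: "0 < t" "t \<le> T"
  shows "(disc_part x \<longlongrightarrow> disc_part x t - jump t) (at_left t)"
proof (rule tendsto_sandwich)
  have "\<forall>\<^sub>F s in at_left t. 0 < s \<and> s < t" using eventually_at_left_real[OF t(1)] by eventually_elim auto
  then have ev: "\<forall>\<^sub>F s in at_left t. disc_part x t - jump t - (left_lim 0 x t - x s) \<le> disc_part x s \<and> disc_part x s \<le> disc_part x t - jump t"
  proof eventually_elim
    case (elim s)
    have "{s<..t} = {s<..<t} \<union> {t}" using elim by auto
    then have "infsum jump {s<..t} = infsum jump {s<..<t} + jump t"
      using infsum_Un_disjoint[OF jumps_summable[of "{s<..<t}"] jumps_summable[of "{t}"]] elim t by force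
    moreover have "infsum jump {s<..<t} \<le> left_lim 0 x t - x s"
    proof (rule infsum_le_finite_sums[OF jumps_summable])
      show "{s<..<t} \<subseteq> {0..T}" using elim t by auto
      fix G assume G: "finite G" "G \<subseteq> {s<..<t}"
      show "sum jump G \<le> left_lim 0 x t - x s"
      proof (cases "G = {}")
        case True
        then show ?thesis using mono_left_lim(2)[OF m t, of s 0] elim by simp
      next
        case False
        have M: "Max G \<in> G" by (rule Max_in[OF G(1) False])
        then have M': "s < Max G" "Max G < t" using G(2) by auto
        have sub: "G \<subseteq> {s<..Max G}" using G by auto
        have "sum jump G \<le> x (Max G) - x s" by (rule sum_jumps_le[OF G(1) sub]) (use M' elim t in auto)
        also have "x (Max G) \<le> left_lim 0 x t" using mono_left_lim(2)[OF m t, of "Max G" 0] M' elim by simp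
        finally show ?thesis by simp
      qed
    qed
    moreover have "0 \<le> infsum jump {s<..<t}" using elim t by (intro infsum_nonneg jump_nonneg) auto
    ultimately show ?case using disc_part_split[of s t] elim t by simp
  qed
  show "\<forall>\<^sub>F s in at_left t. disc_part x t - jump t - (left_lim 0 x t - x s) \<le> disc_part x s"
    using ev by eventually_elim simp
  show "\<forall>\<^sub>F s in at_left t. disc_part x s \<le> disc_part x t - jump t" using ev by eventually_elim simp
  have "((\<lambda>s. disc_part x t - jump t - (left_lim 0 x t - x s)) \<longlongrightarrow> disc_part x t - jump t - (left_lim 0 x t - left_lim 0 x t)) (at_left t)"
    by (intro tendsto_diff tendsto_const mono_left_lim(1)[OF m t])
  then show "((\<lambda>s. disc_part x t - jump t - (left_lim 0 x t - x s)) \<longlongrightarrow> disc_part x t - jump t) (at_left t)" by simp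
qed (rule tendsto_const)

lemma disc_part_jump:
  assumes "t \<in> {0..T}" shows "disc_part x t - left_lim 0 (disc_part x) t = jump t"
proof (cases "t = 0")
  case True
  then show ?thesis by (simp add: left_lim_def disc_part_def)
next
  case False
  then have "left_lim 0 (disc_part x) t = disc_part x t - jump t"
    using assms by (intro left_lim_eq disc_part_left) auto
  then show ?thesis by simp
qed

lemma cont_part_left:
  assumes t: "0 < t" "t \<le> T" shows "(cont_part x \<longlongrightarrow> cont_part x t) (at_left t)"
proof -
  have "((\<lambda>s. x s - disc_part x s) \<longlongrightarrow> left_lim 0 x t - (disc_part x t - jump t)) (at_left t)"
    by (intro tendsto_diff mono_left_lim(1)[OF m t] disc_part_left t)
  then show ?thesis by (simp add: cont_part_def[abs_def])
qed

lemma cont_part_mono: "mono_on {0..T} (cont_part x)"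
proof (rule mono_onI)
  fix a b assume ab: "a \<in> {0..T}" "b \<in> {0..T}" "a \<le> b"
  then show "cont_part x a \<le> cont_part x b"
    using disc_part_split[of a b] infsum_jumps(2)[of a b] by (simp add: cont_part_def)
qed

lemma cont_part_right:
  assumes t: "t \<in> {0..<T}" shows "(cont_part x \<longlongrightarrow> cont_part x t) (at_right t)"
proof -
  have d: "(disc_part x \<longlongrightarrow> disc_part x t) (at_right t)"
  proof (rule tendsto_sandwich)
    have "\<forall>\<^sub>F s in at_right t. t < s \<and> s < T" using eventually_at_right_real[of t T] t by auto
    then have ev: "\<forall>\<^sub>F s in at_right t. disc_part x t \<le> disc_part x s \<and> disc_part x s \<le> disc_part x t + (x s - x t)"
    proof eventually_elim
      case (elim s)
      then show ?case using disc_part_split[of t s] infsum_jumps[of t s] t by simp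
    qed
    show "\<forall>\<^sub>F s in at_right t. disc_part x t \<le> disc_part x s" using ev by eventually_elim simp
    show "\<forall>\<^sub>F s in at_right t. disc_part x s \<le> disc_part x t + (x s - x t)" using ev by eventually_elim simp
    have "((\<lambda>s. disc_part x t + (x s - x t)) \<longlongrightarrow> disc_part x t + (x t - x t)) (at_right t)"
      using rc t by (intro tendsto_intros) auto
    then show "((\<lambda>s. disc_part x t + (x s - x t)) \<longlongrightarrow> disc_part x t) (at_right t)" by simp
  qed (rule tendsto_const)
  have r: "(x \<longlongrightarrow> x t) (at_right t)" using rc t by blast
  show ?thesis using tendsto_diff[OF r d] by (simp add: cont_part_def[abs_def])
qed

lemma finite_large_jumps:
  assumes d: "0 < d" shows "finite {t \<in> {0<..T}. d < jump t}"
proof -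
  have "card G \<le> nat \<lceil>(x T - x 0) / d\<rceil>" if G: "G \<subseteq> {t \<in> {0<..T}. d < jump t}" "finite G" for G
  proof -
    have "real (card G) * d = (\<Sum>t\<in>G. d)" by simp
    also have "\<dots> \<le> sum jump G" using G(1) by (intro sum_mono) (auto intro: less_imp_le)
    also have "\<dots> \<le> x T - x 0" using G T by (intro sum_jumps_le) auto
    finally have "real (card G) \<le> (x T - x 0) / d" using d by (simp add: pos_le_divide_eq)
    then show ?thesis by linarith
  qed
  from finite_if_finite_subsets_card_bdd[OF this] show ?thesis by blast
qed

text \<open>The Skorokhod condition for the continuous part is available only strictly before a
  contact time. Left continuity of that part extends constancy from the open interval to the
  endpoint \<open>b\<close>.\<close>

lemma mono_flat:
  assumes ab: "0 \<le> a" "a < b" "b \<le> T" and nj: "\<And>t. a < t \<Longrightarrow> t \<le> b \<Longrightarrow> jump t = 0"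
    and B: "(\<integral>\<^sup>+t. indicator B t \<partial>stieltjes T (cont_part x)) = 0" "{a<..<b} \<subseteq> B"
  shows "x b = x a"
proof -
  have c: "cont_part x s = cont_part x a" if s: "a < s" "s < b" for s
  proof -
    have "emeasure (stieltjes T (cont_part x)) {a<..s} = (\<integral>\<^sup>+t. indicator {a<..s} t \<partial>stieltjes T (cont_part x))"
      by (rule nn_integral_indicator[symmetric]) (simp add: stieltjes_def)
    also have "\<dots> \<le> (\<integral>\<^sup>+t. indicator B t \<partial>stieltjes T (cont_part x))"
      using B(2) s by (intro nn_integral_mono) (auto split: split_indicator)
    finally have "emeasure (stieltjes T (cont_part x)) {a<..s} = 0" using B(1) by simp
    moreover have "emeasure (stieltjes T (cont_part x)) {a<..s} = ennreal (cont_part x s - cont_part x a)"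
      using emeasure_stieltjes_Ioc[OF T cont_part_mono, of a s] cont_part_right s ab by auto
    ultimately have "cont_part x s \<le> cont_part x a" by (simp add: ennreal_eq_0_iff)
    moreover have "cont_part x a \<le> cont_part x s" using mono_onD[OF cont_part_mono, of a s] s ab by simp
    ultimately show ?thesis by simp
  qed
  have "\<forall>\<^sub>F s in at_left b. cont_part x s = cont_part x a"
    using eventually_at_left_real[OF ab(2)] by eventually_elim (auto intro: c)
  then have "(cont_part x \<longlongrightarrow> cont_part x a) (at_left b)" by (rule tendsto_eventually)
  moreover have "(cont_part x \<longlongrightarrow> cont_part x b) (at_left b)" using ab by (intro cont_part_left) auto
  ultimately have "cont_part x b = cont_part x a" using tendsto_unique[OF trivial_limit_at_left_real] by blast
  moreover have "infsum jump {a<..b} = 0" by (rule infsum_0) (use nj in auto)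
  then have "disc_part x b = disc_part x a" using disc_part_split[of a b] ab by simp
  ultimately show ?thesis by (simp add: cont_part_def)
qed

text \<open>A difference of left limits counts the jump at \<open>a\<close> and omits the one at
  \<open>b\<close>. This fits the use for \<open>C\<close>, which may jump at the contact time
  \<open>b\<close>.\<close>

lemma pure_jump_flat:
  assumes d: "\<forall>t\<in>{0..T}. x t = disc_part x t" and ab: "0 \<le> a" "a \<le> b" "b \<le> T"
    and nj: "\<And>t. a \<le> t \<Longrightarrow> t < b \<Longrightarrow> jump t = 0"
  shows "left_lim 0 x b = left_lim 0 x a"
proof (cases "a = b")
  case False
  then have lt: "a < b" using ab by simp
  have "x s = x a" if "a < s" "s < b" for s
  proof -
    have "infsum jump {a<..s} = 0" by (rule infsum_0) (use nj that in auto)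
    then show ?thesis using disc_part_split[of a s] d that ab by simp
  qed
  then have "\<forall>\<^sub>F s in at_left b. x s = x a" using eventually_at_left_real[OF lt] by (auto elim: eventually_mono)
  then have "left_lim 0 x b = x a" using lt ab by (intro left_lim_eq tendsto_eventually) auto
  then show ?thesis using nj[of a] lt by simp
qed simp

lemma left_lim_mono:
  assumes "0 \<le> s" "s \<le> t" "t \<le> T"
  shows "left_lim 0 x s \<le> left_lim 0 x t"
proof (cases "s = t")
  case False
  then have "left_lim 0 x s \<le> x s" "x s \<le> left_lim 0 x t"
    using jump_nonneg[of s] mono_left_lim(2)[OF m, of t s 0] assms by auto
  then show ?thesis by simp
qed simp

lemma left_lim_nonneg: "0 \<le> t \<Longrightarrow> t \<le> T \<Longrightarrow> 0 \<le> left_lim 0 x t"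
  using left_lim_mono[of 0 t] by (simp add: left_lim_def)

lemma left_lim_at_right:
  assumes t: "t \<in> {0..<T}" shows "(left_lim 0 x \<longlongrightarrow> x t) (at_right t)"
proof (rule tendsto_sandwich)
  have "\<forall>\<^sub>F s in at_right t. t < s \<and> s < T" using eventually_at_right_real[of t T] t by auto
  then have ev: "\<forall>\<^sub>F s in at_right t. x t \<le> left_lim 0 x s \<and> left_lim 0 x s \<le> x s"
  proof eventually_elim
    case (elim s)
    then show ?case using mono_left_lim(2,3)[OF m, of s] t by auto
  qed
  show "\<forall>\<^sub>F s in at_right t. x t \<le> left_lim 0 x s" using ev by eventually_elim simp
  show "\<forall>\<^sub>F s in at_right t. left_lim 0 x s \<le> x s" using ev by eventually_elim simp
  show "(x \<longlongrightarrow> x t) (at_right t)" using rc t by blast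
qed (rule tendsto_const)

lemma left_lim_at_left:
  assumes t: "0 < t" "t \<le> T" shows "(left_lim 0 x \<longlongrightarrow> left_lim 0 x t) (at_left t)"
proof (rule order_tendstoI)
  fix y assume "y < left_lim 0 x t"
  then have "\<forall>\<^sub>F s in at_left t. y < x s" using order_tendstoD(1)[OF mono_left_lim(1)[OF m t]] by blast
  then obtain b where b: "b < t" "\<And>s. b < s \<Longrightarrow> s < t \<Longrightarrow> y < x s" unfolding eventually_at_left_field by blast
  have "max b 0 < t" using b(1) t by simp
  from eventually_at_left_real[OF this] show "\<forall>\<^sub>F s in at_left t. y < left_lim 0 x s"
  proof eventually_elim
    case (elim s)
    define r where "r = (max b 0 + s) / 2"
    have r: "max b 0 < r" "r < s" unfolding r_def using elim by auto
    then have "y < x r" using b(2)[of r] elim by simp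
    also have "x r \<le> left_lim 0 x s" using mono_left_lim(2)[OF m, of s r 0] r elim t by simp
    finally show ?case .
  qed
next
  fix y assume y: "left_lim 0 x t < y"
  from eventually_at_left_real[OF t(1)] show "\<forall>\<^sub>F s in at_left t. left_lim 0 x s < y"
  proof eventually_elim
    case (elim s)
    then show ?case using left_lim_mono[of s t] t y by simp
  qed
qed

end

section \<open>Paths of the solution\<close>

lemma (in usual_filtration) predictable_left_limit:
  assumes X: "\<And>t. t \<in> {0..T} \<Longrightarrow> (\<lambda>w. X w t) \<in> borel_measurable (F t)"
    and l: "AE w in M. \<forall>t\<in>{0<..T}. \<exists>l. (X w \<longlongrightarrow> l) (at_left t)"
  obtains X' where "predictable_process M F T X'" "\<And>w. X' w 0 = 0"
    "AE w in M. \<forall>t\<in>{0<..T}. (X w \<longlongrightarrow> X' w t) (at_left t)"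
proof -
  obtain X0 where X0: "predictable_process M F T X0" "\<And>w t l. 0 < t \<Longrightarrow> (X w \<longlongrightarrow> l) (at_left t) \<Longrightarrow> X0 w t = l"
    by (rule left_limit_predictable[of X, OF X]) (assumption, rule that)
  define X' where "X' w t = X0 w t * indicator {0<..} t" for w t
  have "(\<lambda>x. (\<lambda>(w, t). X0 w t) x * indicator {0<..} (snd x)) \<in> borel_measurable Prd"
    using X0(1) unfolding predictable_process_def
    by (intro borel_measurable_times measurable_compose[OF measurable_snd_Prd] borel_measurable_indicator) auto
  moreover have "(\<lambda>x. (\<lambda>(w, t). X0 w t) x * indicator {0<..} (snd x)) = (\<lambda>(w, t). X' w t)" by (auto simp: X'_def fun_eq_iff)
  ultimately have "predictable_process M F T X'" unfolding predictable_process_def by (simp only:)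
  moreover have "X' w 0 = 0" for w by (simp add: X'_def)
  moreover have "AE w in M. \<forall>t\<in>{0<..T}. (X w \<longlongrightarrow> X' w t) (at_left t)"
    using l
  proof eventually_elim
    case (elim w)
    show ?case
    proof
      fix t assume t: "t \<in> {0<..T}"
      then obtain l where l: "(X w \<longlongrightarrow> l) (at_left t)" using elim by blast
      then show "(X w \<longlongrightarrow> X' w t) (at_left t)" using X0(2)[OF _ l] t by (simp add: X'_def)
    qed
  qed
  ultimately show ?thesis by (rule that)
qed

section \<open>The reflected equation on single paths\<close>

locale rbsde = point_process M F T U \<mu> \<nu> K \<phi>
  for M :: "'w measure" and F :: "real \<Rightarrow> 'w measure" and T :: real and U :: "'u measure"
    and \<mu> \<nu> :: "'w \<Rightarrow> (real \<times> 'u) measure" and K :: "'w \<Rightarrow> real \<Rightarrow> real" and \<phi> :: "'w \<Rightarrow> real \<Rightarrow> 'u measure" +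
  fixes f :: "'w \<Rightarrow> real \<Rightarrow> real \<Rightarrow> ('u \<Rightarrow> real) \<Rightarrow> real" and \<xi> Y A C :: "'w \<Rightarrow> real \<Rightarrow> real"
    and Z :: "'w \<Rightarrow> real \<Rightarrow> 'u \<Rightarrow> real"
  assumes xi: "\<xi> \<in> S20 M F T" "left_limited M T \<xi>" "right_usc M T \<xi>"
    and sol: "rbsde_solution M F T U \<mu> \<nu> K f \<xi> Y Z A C"
begin

definition g :: "'w \<Rightarrow> real \<Rightarrow> real" where "g w s = f w s (Y w s) (Z w s)"

definition I :: "'w \<Rightarrow> real \<Rightarrow> real" where "I w t = (LINT s:{t..T}|lborel. g w s)"

text \<open>A set function of time rather than a process: half lines, intervals and single times are
  all needed, and additivity relates them without a discussion of endpoints.\<close>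

definition N :: "'w \<Rightarrow> real set \<Rightarrow> real" where
  "N w H = (\<integral>p. path (unc Z) w p * indicator H (fst p) \<partial>pm w) - (\<integral>p. path (unc Z) w p * indicator H (fst p) \<partial>vm w)"

definition CL :: "'w \<Rightarrow> real \<Rightarrow> real" where "CL w = left_lim 0 (C w)"

text \<open>Every term of the equation except minus the left limit of \<open>C\<close> at t. All
  these terms are right-continuous in t, so \<open>R\<close> isolates the right-continuous part of
  \<open>Y\<close>.\<close>

definition R :: "'w \<Rightarrow> real \<Rightarrow> real" where
  "R w t = \<xi> w T + I w t - N w {t<..T} + A w T - A w t + CL w T"

lemma solD:
  shows "Y \<in> S20 M F T" "Z \<in> H20 M F T U \<nu> K" "A \<in> S20 M F T" "C \<in> S20 M F T"
    "AE w in M. set_integrable lborel {0..T} (\<lambda>s. f w s (Y w s) (Z w s))"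
    "\<forall>\<tau>\<in>stopping_times M F T (\<lambda>_. 0). AE w in M.
        Y w (\<tau> w) = \<xi> w T + (LINT s : {\<tau> w..T} | lborel. f w s (Y w s) (Z w s))
          - compensated_integral U \<mu> \<nu> Z w (\<tau> w) T
          + A w T - A w (\<tau> w) + left_lim 0 (C w) T - left_lim 0 (C w) (\<tau> w)"
    "AE w in M. \<forall>t\<in>{0..T}. \<xi> w t \<le> Y w t"
    "nondecreasing_right_continuous M T A" "predictable_process M F T A" "AE w in M. A w 0 = 0"
    "AE w in M. (\<integral>\<^sup>+t. indicator {t \<in> {0..T}. Y w t > \<xi> w t} t \<partial>stieltjes T (cont_part (A w))) = 0"
    "\<forall>\<tau>\<in>predictable_stopping_times M F T. AE w in M.
        (left_lim (Y w 0) (Y w) (\<tau> w) - left_lim (\<xi> w 0) (\<xi> w) (\<tau> w)) *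
        (disc_part (A w) (\<tau> w) - left_lim 0 (disc_part (A w)) (\<tau> w)) = 0"
    "nondecreasing_right_continuous M T C" "\<forall>t\<in>{0..T}. (\<lambda>w. C w t) \<in> borel_measurable (F t)"
    "AE w in M. 0 \<le> C w 0 \<and> (\<forall>t\<in>{0..T}. C w t = disc_part (C w) t)"
    "\<forall>\<tau>\<in>stopping_times M F T (\<lambda>_. 0). AE w in M.
        (Y w (\<tau> w) - \<xi> w (\<tau> w)) * (C w (\<tau> w) - left_lim 0 (C w) (\<tau> w)) = 0"
  using sol unfolding rbsde_solution_def by - ((elim conjE, assumption)+)

lemma unc_Z: "unc Z \<in> borel_measurable (Prd \<Otimes>\<^sub>M U)"
  using solD(2) unfolding H20_def predictable_function_unc[symmetric] by simp

lemma optional: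
  "optional_process M F T Y" "optional_process M F T \<xi>" "optional_process M F T A" "optional_process M F T C"
  using solD(1,3,4) xi(1) unfolding S20_def by simp_all

text \<open>Collects the almost sure facts that can be read off a whole path at once, so that later
  arguments work on one fixed path.\<close>

definition pathwise :: "'w \<Rightarrow> bool" where
  "pathwise w \<longleftrightarrow> w \<in> space M \<and> set_integrable lborel {0..T} (g w) \<and> integrable (vm w) (path (unc Z) w) \<and>
    mono_on {0..T} (A w) \<and> (\<forall>t\<in>{0..<T}. (A w \<longlongrightarrow> A w t) (at_right t)) \<and> A w 0 = 0 \<and>
    mono_on {0..T} (C w) \<and> (\<forall>t\<in>{0..<T}. (C w \<longlongrightarrow> C w t) (at_right t)) \<and> 0 \<le> C w 0 \<and>
    (\<forall>t\<in>{0..T}. C w t = disc_part (C w) t) \<and> (\<forall>t\<in>{0..T}. \<xi> w t \<le> Y w t) \<and>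
    (\<integral>\<^sup>+t. indicator {t \<in> {0..T}. Y w t > \<xi> w t} t \<partial>stieltjes T (cont_part (A w))) = 0 \<and>
    (\<forall>t\<in>{0<..T}. \<exists>l. (\<xi> w \<longlongrightarrow> l) (at_left t)) \<and>
    (\<forall>t\<in>{0..<T}. Limsup (at_right t) (\<lambda>s. ereal (\<xi> w s)) \<le> ereal (\<xi> w t))"

lemma pathwiseD:
  assumes "pathwise w"
  shows "w \<in> space M" "set_integrable lborel {0..T} (g w)" "integrable (vm w) (path (unc Z) w)"
    "mono_on {0..T} (A w)" "\<forall>t\<in>{0..<T}. (A w \<longlongrightarrow> A w t) (at_right t)" "A w 0 = 0"
    "mono_on {0..T} (C w)" "\<forall>t\<in>{0..<T}. (C w \<longlongrightarrow> C w t) (at_right t)" "0 \<le> C w 0"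
    "\<forall>t\<in>{0..T}. C w t = disc_part (C w) t" "\<forall>t\<in>{0..T}. \<xi> w t \<le> Y w t"
    "(\<integral>\<^sup>+t. indicator {t \<in> {0..T}. Y w t > \<xi> w t} t \<partial>stieltjes T (cont_part (A w))) = 0"
    "\<forall>t\<in>{0<..T}. \<exists>l. (\<xi> w \<longlongrightarrow> l) (at_left t)"
    "\<forall>t\<in>{0..<T}. Limsup (at_right t) (\<lambda>s. ereal (\<xi> w s)) \<le> ereal (\<xi> w t)"
  using assms unfolding pathwise_def by - ((elim conjE, assumption)+)

lemma AE_pathwise: "AE w in M. pathwise w"
  using AE_space solD(5)[folded g_def] compensated_mean_zero(1)[OF solD(2)] solD(8)[unfolded nondecreasing_right_continuous_def]
    solD(10) solD(13)[unfolded nondecreasing_right_continuous_def] solD(15) solD(7) solD(11)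
    xi(2)[unfolded left_limited_def] xi(3)[unfolded right_usc_def]
  by eventually_elim (unfold pathwise_def, elim conjE, intro conjI; assumption)

lemma A_ge: "pathwise w \<Longrightarrow> 0 \<le> A w 0"
  by (simp add: pathwiseD(6))

lemmas A_path = T_pos pathwiseD(4,5) A_ge
lemmas C_path = T_pos pathwiseD(7,8,9)

lemma I_diff:
  assumes w: "pathwise w" and ab: "0 \<le> a" "a \<le> b" "b \<le> T"
  shows "(LINT s:{a..b}|lborel. g w s) = I w a - I w b"
proof -
  have i: "set_integrable lborel {c..d} (g w)" if "0 \<le> c" "d \<le> T" for c d
    using that by (intro set_integrable_subset[OF pathwiseD(2)[OF w]]) auto
  have "g w integrable_on {a..T}"
    by (rule set_borel_integral_eq_integral(1)[OF i]) (use ab in auto)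
  then have "integral {a..b} (g w) + integral {b..T} (g w) = integral {a..T} (g w)"
    by (rule Henstock_Kurzweil_Integration.integral_combine[OF ab(2,3)])
  then show ?thesis unfolding I_def using ab by (simp add: set_borel_integral_eq_integral(2)[OF i])
qed

lemma I_continuous:
  assumes w: "pathwise w" shows "continuous_on {0..T} (I w)"
proof -
  have "continuous_on {0..T} (\<lambda>t. integral {t..T} (g w))"
    by (rule indefinite_integral_continuous_1'[OF set_borel_integral_eq_integral(1)[OF pathwiseD(2)[OF w]]])
  moreover have "integral {t..T} (g w) = I w t" if "t \<in> {0..T}" for t
    unfolding I_def using that
    by (intro set_borel_integral_eq_integral(2)[symmetric] set_integrable_subset[OF pathwiseD(2)[OF w]]) auto
  ultimately show ?thesis by (rule continuous_on_eq)
qed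

lemma I_left: "pathwise w \<Longrightarrow> 0 < t \<Longrightarrow> t \<le> T \<Longrightarrow> (I w \<longlongrightarrow> I w t) (at_left t)"
  using continuous_on_Icc_at_leftD[OF continuous_on_subset[OF I_continuous], of w 0 t] by auto

lemma I_right: "pathwise w \<Longrightarrow> 0 \<le> t \<Longrightarrow> t < T \<Longrightarrow> (I w \<longlongrightarrow> I w t) (at_right t)"
  using continuous_on_Icc_at_rightD[OF continuous_on_subset[OF I_continuous], of w t T] by auto

lemma path_integrable:
  assumes "pathwise w"
  shows "integrable (pm w) (path (unc Z) w)" "integrable (vm w) (path (unc Z) w)"
  using integrable_pm[OF pathwiseD(1)[OF assms] measurable_path[OF unc_Z pathwiseD(1)[OF assms]]] pathwiseD(3)[OF assms] by auto

lemma N_Un: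
  assumes w: "pathwise w" and H: "H \<in> sets borel" "H' \<in> sets borel" "H \<inter> H' = {}"
  shows "N w (H \<union> H') = N w H + N w H'"
proof -
  note sp = pathwiseD(1)[OF w] and i = path_integrable[OF w]
  have e: "path (unc Z) w p * indicator (H \<union> H') (fst p) = path (unc Z) w p * indicator H (fst p) + path (unc Z) w p * indicator H' (fst p)" for p
    using H(3) by (auto split: split_indicator)
  show ?thesis unfolding N_def e
    using integrable_time_indicator[OF sets_pm[OF sp] H(1) i(1)] integrable_time_indicator[OF sets_pm[OF sp] H(2) i(1)]
      integrable_time_indicator[OF sets_vm[OF sp] H(1) i(2)] integrable_time_indicator[OF sets_vm[OF sp] H(2) i(2)]
    by simp
qed

lemma N_Ioc: "pathwise w \<Longrightarrow> a \<le> b \<Longrightarrow> N w {a<..b} = N w {..b} - N w {..a}"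
  using N_Un[of w "{..a}" "{a<..b}"] by (simp add: ivl_disj_un ivl_disj_int)

lemma N_point: "pathwise w \<Longrightarrow> N w {t} = N w {..t} - N w {..<t}"
  using N_Un[of w "{..<t}" "{t}"] by (simp add: ivl_disj_un_singleton del: Un_insert_right)

lemma N_left: "pathwise w \<Longrightarrow> ((\<lambda>s. N w {..s}) \<longlongrightarrow> N w {..<t}) (at_left t)"
  unfolding N_def by (intro tendsto_diff integral_left_limit[OF sets_pm] integral_left_limit[OF sets_vm] path_integrable pathwiseD(1))

lemma N_right: "pathwise w \<Longrightarrow> ((\<lambda>s. N w {..s}) \<longlongrightarrow> N w {..t}) (at_right t)"
  unfolding N_def by (intro tendsto_diff integral_right_limit[OF sets_pm] integral_right_limit[OF sets_vm] path_integrable pathwiseD(1))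

lemma R_eq: "pathwise w \<Longrightarrow> t \<le> T \<Longrightarrow> R w t = \<xi> w T + I w t - (N w {..T} - N w {..t}) + A w T - A w t + CL w T"
  by (simp add: R_def N_Ioc)

lemma R_right:
  assumes w: "pathwise w" and t: "t \<in> {0..<T}" shows "(R w \<longlongrightarrow> R w t) (at_right t)"
proof -
  have "((\<lambda>t. \<xi> w T + I w t - (N w {..T} - N w {..t}) + A w T - A w t + CL w T) \<longlongrightarrow> R w t) (at_right t)"
    using R_eq[OF w, of t] pathwiseD(5)[OF w] t I_right[OF w] N_right[OF w] by (simp add: tendsto_intros)
  moreover have "\<forall>\<^sub>F s in at_right t. \<xi> w T + I w s - (N w {..T} - N w {..s}) + A w T - A w s + CL w T = R w s"
    using eventually_at_right_real[of t T] t by (auto elim!: eventually_mono simp: R_eq[OF w])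
  ultimately show ?thesis by (rule Lim_transform_eventually)
qed

definition RL :: "'w \<Rightarrow> real \<Rightarrow> real" where
  "RL w t = \<xi> w T + I w t - (N w {..T} - N w {..<t}) + A w T - left_lim 0 (A w) t + CL w T"

lemma R_left:
  assumes w: "pathwise w" and t: "0 < t" "t \<le> T" shows "(R w \<longlongrightarrow> RL w t) (at_left t)"
proof -
  have "((\<lambda>t. \<xi> w T + I w t - (N w {..T} - N w {..t}) + A w T - A w t + CL w T) \<longlongrightarrow> RL w t) (at_left t)"
    unfolding RL_def using mono_left_lim(1)[OF pathwiseD(4)[OF w] t] I_left[OF w t] N_left[OF w] by (intro tendsto_intros)
  moreover have "\<forall>\<^sub>F s in at_left t. \<xi> w T + I w s - (N w {..T} - N w {..s}) + A w T - A w s + CL w T = R w s"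
    using eventually_at_left_real[of 0 t] t by (auto elim!: eventually_mono simp: R_eq[OF w])
  ultimately show ?thesis by (rule Lim_transform_eventually)
qed

lemma solution_at:
  assumes \<tau>: "\<tau> \<in> stopping_times M F T S"
  shows "AE w in M. Y w (\<tau> w) = R w (\<tau> w) - CL w (\<tau> w)"
  using bspec[OF solD(6) stopping_times_0[OF \<tau>]] stopping_timesD(3)[OF \<tau>] AE_space
proof eventually_elim
  case (elim w)
  have "compensated_integral U \<mu> \<nu> Z w (\<tau> w) T = N w {\<tau> w<..T}"
    unfolding N_def using elim by (intro compensated_integral_eq unc_Z) auto
  then show ?case using elim(1) by (simp add: R_def I_def g_def CL_def)
qed

text \<open>The equation contains \<open>C\<close> through left limits only. Unlike
  \<open>CL\<close>, the version \<open>C'\<close> is measurable on the product, as the section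
  theorem requires; its value 0 at time 0 encodes the convention that C vanishes before 0.\<close>

lemma C_left_version:
  obtains C' where "predictable_process M F T C'" "AE w in M. \<forall>t\<in>{0..T}. C' w t = CL w t"
proof -
  have l: "AE w in M. \<forall>t\<in>{0<..T}. \<exists>l. (C w \<longlongrightarrow> l) (at_left t)"
    using AE_pathwise
  proof eventually_elim
    case (elim w)
    show ?case using mono_left_lim(1)[OF pathwiseD(7)[OF elim]] by force
  qed
  have ad: "(\<lambda>w. C w t) \<in> borel_measurable (F t)" if "t \<in> {0..T}" for t using solD(14) that by blast
  obtain C' where C': "predictable_process M F T C'" "\<And>w. C' w 0 = 0"
    "AE w in M. \<forall>t\<in>{0<..T}. (C w \<longlongrightarrow> C' w t) (at_left t)"
    by (rule predictable_left_limit[OF ad l]) (assumption, rule that)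
  have "AE w in M. \<forall>t\<in>{0..T}. C' w t = CL w t"
    using C'(3)
  proof eventually_elim
    case (elim w)
    show ?case
    proof
      fix t assume t: "t \<in> {0..T}"
      show "C' w t = CL w t"
      proof (cases "t = 0")
        case True
        then show ?thesis by (simp add: C'(2) CL_def left_lim_def)
      next
        case False
        then have "0 < t" "(C w \<longlongrightarrow> C' w t) (at_left t)" using elim t by auto
        then show ?thesis unfolding CL_def by (rule left_lim_eq[symmetric])
      qed
    qed
  qed
  then show ?thesis by (rule that[OF C'(1)])
qed

lemma optional_measurable: "optional_process M F T X \<Longrightarrow> (\<lambda>(w, t). X w t) \<in> borel_measurable Opt"
  unfolding optional_process_def .

text \<open>The optional set where the equation fails is missed by every stopping time, so its
  sections are almost surely empty. For this set to be optional, \<open>R\<close> needs an optional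
  version: at each fixed time it agrees almost surely with the adapted sum of \<open>Y\<close> and
  \<open>C'\<close>, and its paths are regular.\<close>

lemma solution_paths: "AE w in M. \<forall>t\<in>{0..T}. Y w t = R w t - CL w t"
proof -
  obtain C' where C': "predictable_process M F T C'" "AE w in M. \<forall>t\<in>{0..T}. C' w t = CL w t" by (rule C_left_version)
  note C'o = predictable_process_optional[OF C'(1)]
  have ad: "(\<lambda>w. R w t) \<in> borel_measurable (F t)" if t: "t \<in> {0..T}" for t
  proof (rule measurable_F_AE)
    show "0 \<le> t" using t by simp
    show "(\<lambda>w. Y w t + C' w t) \<in> borel_measurable (F t)"
      by (intro borel_measurable_add optional_adapted optional C'o t)
    have "(\<lambda>_. t) \<in> stopping_times M F T (\<lambda>_. 0)" using t by (intro stopping_times_const) auto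
    from solution_at[OF this] C'(2) show "AE w in M. R w t = Y w t + C' w t"
      by eventually_elim (use t in simp)
  qed
  have r: "AE w in M. \<forall>t\<in>{0..<T}. (R w \<longlongrightarrow> R w t) (at_right t)"
    using AE_pathwise by eventually_elim (auto intro: R_right)
  have l: "AE w in M. \<forall>t\<in>{0<..T}. \<exists>l. (R w \<longlongrightarrow> l) (at_left t)"
    using AE_pathwise
  proof eventually_elim
    case (elim w)
    show ?case using R_left[OF elim] by force
  qed
  obtain R' where R': "cadlag_adapted (space M) F {0..T} R'" "AE w in M. R' w = R w"
    by (rule cadlag_modification[OF ad r l]) (assumption, rule that)
  define E where "E = {p \<in> space Opt. (\<lambda>(w, t). Y w t) p \<noteq> (\<lambda>(w, t). R' w t) p - (\<lambda>(w, t). C' w t) p}"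
  have E: "E \<in> sets Opt" unfolding E_def
    by (intro borel_measurable_neq borel_measurable_diff optional_measurable optional optional_cadlag[OF R'(1)] C'o)
  have "AE w in M. \<forall>t\<in>{0..T}. (w, t) \<notin> E"
  proof (rule optional_section[OF E])
    fix \<tau> assume \<tau>: "\<tau> \<in> stopping_times M F T (\<lambda>_. 0)"
    show "AE w in M. (w, \<tau> w) \<notin> E"
      using solution_at[OF \<tau>] R'(2) C'(2) stopping_timesD(3)[OF \<tau>]
      by eventually_elim (simp add: E_def)
  qed
  with R'(2) C'(2) AE_space show ?thesis
  proof eventually_elim
    case (elim w)
    then show ?case by (auto simp: E_def space_Opt)
  qed
qed

lemma obstacle_jump: "AE w in M. \<forall>t\<in>{0..T}. (Y w t - \<xi> w t) * (C w t - CL w t) = 0"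
proof -
  obtain C' where C': "predictable_process M F T C'" "AE w in M. \<forall>t\<in>{0..T}. C' w t = CL w t" by (rule C_left_version)
  note C'o = predictable_process_optional[OF C'(1)]
  define E where "E = {p \<in> space Opt. ((\<lambda>(w, t). Y w t) p - (\<lambda>(w, t). \<xi> w t) p) * ((\<lambda>(w, t). C w t) p - (\<lambda>(w, t). C' w t) p) \<noteq> 0}"
  have E: "E \<in> sets Opt" unfolding E_def
    by (intro borel_measurable_neq borel_measurable_times borel_measurable_diff borel_measurable_const optional_measurable optional C'o)
  have "AE w in M. \<forall>t\<in>{0..T}. (w, t) \<notin> E"
  proof (rule optional_section[OF E])
    fix \<tau> assume \<tau>: "\<tau> \<in> stopping_times M F T (\<lambda>_. 0)"
    show "AE w in M. (w, \<tau> w) \<notin> E"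
      using bspec[OF solD(16) \<tau>] C'(2) stopping_timesD(3)[OF \<tau>]
      by eventually_elim (simp add: E_def CL_def)
  qed
  with C'(2) AE_space show ?thesis
  proof eventually_elim
    case (elim w)
    show ?case
    proof
      fix t assume t: "t \<in> {0..T}"
      then have "(w, t) \<notin> E" "C' w t = CL w t" using elim by auto
      then show "(Y w t - \<xi> w t) * (C w t - CL w t) = 0" using elim(2) t by (simp add: E_def space_Opt)
    qed
  qed
qed

lemma Y_left:
  assumes w: "pathwise w" "\<forall>t\<in>{0..T}. Y w t = R w t - CL w t" and t: "0 < t" "t \<le> T"
  shows "(Y w \<longlongrightarrow> RL w t - CL w t) (at_left t)"
proof -
  have "((\<lambda>s. R w s - CL w s) \<longlongrightarrow> RL w t - CL w t) (at_left t)"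
    unfolding CL_def by (intro tendsto_diff R_left[OF w(1) t] left_lim_at_left[OF C_path(1) C_path(2-4)[OF w(1)] t])
  moreover have "\<forall>\<^sub>F s in at_left t. R w s - CL w s = Y w s"
    using eventually_at_left_real[OF t(1)] by eventually_elim (use w(2) t in auto)
  ultimately show ?thesis by (rule Lim_transform_eventually)
qed

lemma Y_right:
  assumes w: "pathwise w" "\<forall>t\<in>{0..T}. Y w t = R w t - CL w t" and t: "0 \<le> t" "t < T"
  shows "(Y w \<longlongrightarrow> R w t - C w t) (at_right t)"
proof -
  have t': "t \<in> {0..<T}" using t by simp
  have "((\<lambda>s. R w s - CL w s) \<longlongrightarrow> R w t - C w t) (at_right t)"
    unfolding CL_def by (intro tendsto_diff R_right[OF w(1) t'] left_lim_at_right[OF C_path(1) C_path(2-4)[OF w(1)] t'])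
  moreover have "\<forall>\<^sub>F s in at_right t. R w s - CL w s = Y w s"
    using eventually_at_right_real[OF t(2)] by eventually_elim (use w(2) t in auto)
  ultimately show ?thesis by (rule Lim_transform_eventually)
qed

lemma A_left_version:
  obtains A' where "predictable_process M F T A'" "AE w in M. \<forall>t\<in>{0<..T}. A' w t = left_lim 0 (A w) t"
proof -
  have l: "AE w in M. \<forall>t\<in>{0<..T}. \<exists>l. (A w \<longlongrightarrow> l) (at_left t)"
    using AE_pathwise
  proof eventually_elim
    case (elim w)
    show ?case using mono_left_lim(1)[OF pathwiseD(4)[OF elim]] by force
  qed
  obtain A' where A': "predictable_process M F T A'" "\<And>w. A' w 0 = 0"
    "AE w in M. \<forall>t\<in>{0<..T}. (A w \<longlongrightarrow> A' w t) (at_left t)"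
    by (rule predictable_left_limit[OF optional_adapted[OF optional(3)] l]) (assumption, rule that)
  from A'(3) have "AE w in M. \<forall>t\<in>{0<..T}. A' w t = left_lim 0 (A w) t"
    by eventually_elim (auto intro!: left_lim_eq[symmetric])
  then show ?thesis by (rule that[OF A'(1)])
qed

lemma large_jumps_predictable:
  assumes A': "predictable_process M F T A'"
  shows "{p \<in> space Prd. 0 < snd p \<and> d < (\<lambda>(w, t). A w t) p - (\<lambda>(w, t). A' w t) p} \<in> sets Prd"
proof -
  have "{p \<in> space Prd. 0 < snd p} \<in> sets Prd" by (intro borel_measurable_less measurable_snd_Prd borel_measurable_const)
  moreover have "{p \<in> space Prd. d < (\<lambda>(w, t). A w t) p - (\<lambda>(w, t). A' w t) p} \<in> sets Prd"
    using solD(9) A' unfolding predictable_process_def by (intro borel_measurable_less borel_measurable_diff borel_measurable_const)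
  ultimately have "{p \<in> space Prd. 0 < snd p} \<inter> {p \<in> space Prd. d < (\<lambda>(w, t). A w t) p - (\<lambda>(w, t). A' w t) p} \<in> sets Prd" by (rule sets.Int)
  moreover have "{p \<in> space Prd. 0 < snd p} \<inter> {p \<in> space Prd. d < (\<lambda>(w, t). A w t) p - (\<lambda>(w, t). A' w t) p} =
    {p \<in> space Prd. 0 < snd p \<and> d < (\<lambda>(w, t). A w t) p - (\<lambda>(w, t). A' w t) p}" by blast
  ultimately show ?thesis by (simp only:)
qed

text \<open>For d > 0, the set of times where \<open>A\<close> jumps by more than d while the left
  limits of \<open>Y\<close> and \<open>\<xi>\<close> differ is predictable with finite sections,
  and the Skorokhod condition says that predictable times miss it. Letting d run through the numbers
  1/(k+1) covers all jumps.\<close>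

lemma predictable_jump: "AE w in M. \<forall>t\<in>{0<..T}. \<forall>y x. (Y w \<longlongrightarrow> y) (at_left t) \<longrightarrow> (\<xi> w \<longlongrightarrow> x) (at_left t) \<longrightarrow>
  A w t - left_lim 0 (A w) t = 0 \<or> y = x"
proof -
  obtain A' where A': "predictable_process M F T A'" "AE w in M. \<forall>t\<in>{0<..T}. A' w t = left_lim 0 (A w) t" by (rule A_left_version)
  have lY: "AE w in M. \<forall>t\<in>{0<..T}. \<exists>l. (Y w \<longlongrightarrow> l) (at_left t)"
    using AE_pathwise solution_paths
  proof eventually_elim
    case (elim w)
    show ?case using Y_left[OF elim] by force
  qed
  obtain Y' where Y': "predictable_process M F T Y'" "\<And>w. Y' w 0 = 0"
    "AE w in M. \<forall>t\<in>{0<..T}. (Y w \<longlongrightarrow> Y' w t) (at_left t)"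
    by (rule predictable_left_limit[OF optional_adapted[OF optional(1)] lY]) (assumption, rule that)
  obtain X' where X': "predictable_process M F T X'" "\<And>w. X' w 0 = 0"
    "AE w in M. \<forall>t\<in>{0<..T}. (\<xi> w \<longlongrightarrow> X' w t) (at_left t)"
    by (rule predictable_left_limit[OF optional_adapted[OF optional(2)] xi(2)[unfolded left_limited_def]]) (assumption, rule that)
  define E where "E d = {p \<in> space Prd. 0 < snd p \<and> d < (\<lambda>(w, t). A w t) p - (\<lambda>(w, t). A' w t) p} \<inter>
    {p \<in> space Prd. (\<lambda>(w, t). Y' w t) p \<noteq> (\<lambda>(w, t). X' w t) p}" for d
  have mem: "(w, t) \<in> E d \<longleftrightarrow> w \<in> space M \<and> 0 < t \<and> t \<le> T \<and> d < A w t - A' w t \<and> Y' w t \<noteq> X' w t" for w t d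
    by (auto simp: E_def space_Prd)
  have E: "E d \<in> sets Prd" for d unfolding E_def
    using Y'(1) X'(1) unfolding predictable_process_def
    by (intro sets.Int large_jumps_predictable[OF A'(1)] borel_measurable_neq)
  have sec: "AE w in M. \<forall>t\<in>{0..T}. (w, t) \<notin> E d" if d: "0 < d" for d
  proof (rule predictable_section_finite[OF E])
    show "AE w in M. finite {t. (w, t) \<in> E d}"
      using AE_pathwise A'(2)
    proof eventually_elim
      case (elim w)
      show ?case
        by (rule finite_subset[OF _ finite_large_jumps[OF A_path(1) A_path(2-4)[OF elim(1)] d]]) (use elim(2) in \<open>auto simp: mem\<close>)
    qed
    fix \<tau> assume \<tau>: "\<tau> \<in> predictable_stopping_times M F T"
    then have \<tau>': "\<tau> \<in> stopping_times M F T (\<lambda>_. 0)" by (simp add: predictable_stopping_times_def)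
    show "AE w in M. (w, \<tau> w) \<notin> E d"
      using bspec[OF solD(12) \<tau>] AE_pathwise A'(2) Y'(3) X'(3) stopping_timesD(3)[OF \<tau>']
    proof eventually_elim
      case (elim w)
      show ?case
      proof
        assume "(w, \<tau> w) \<in> E d"
        then have *: "0 < \<tau> w" "\<tau> w \<le> T" "d < A w (\<tau> w) - A' w (\<tau> w)" "Y' w (\<tau> w) \<noteq> X' w (\<tau> w)" by (simp_all add: mem)
        then have "left_lim (Y w 0) (Y w) (\<tau> w) = Y' w (\<tau> w)" "left_lim (\<xi> w 0) (\<xi> w) (\<tau> w) = X' w (\<tau> w)"
          using elim(4,5) by (auto intro!: left_lim_eq)
        moreover have "disc_part (A w) (\<tau> w) - left_lim 0 (disc_part (A w)) (\<tau> w) = A w (\<tau> w) - A' w (\<tau> w)"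
          using disc_part_jump[OF A_path(1) A_path(2-4)[OF elim(2)], of "\<tau> w"] elim(3) * by simp
        ultimately show False using elim(1) * d by simp
      qed
    qed
  qed
  have "AE w in M. \<forall>k :: nat. \<forall>t\<in>{0..T}. (w, t) \<notin> E (inverse (real (Suc k)))"
    unfolding AE_all_countable by (intro allI sec) simp
  with AE_pathwise A'(2) Y'(3) X'(3) show ?thesis
  proof eventually_elim
    case (elim w)
    show ?case
    proof (intro ballI allI impI)
      fix t y x assume t: "t \<in> {0<..T}" and y: "(Y w \<longlongrightarrow> y) (at_left t)" and x: "(\<xi> w \<longlongrightarrow> x) (at_left t)"
      have eq: "y = Y' w t" "x = X' w t"
        using tendsto_unique[OF trivial_limit_at_left_real y] tendsto_unique[OF trivial_limit_at_left_real x] elim(3,4) t by auto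
      have nn: "0 \<le> A w t - left_lim 0 (A w) t"
        using jump_nonneg[OF A_path(1) A_path(2-4)[OF elim(1)], of t] t by simp
      show "A w t - left_lim 0 (A w) t = 0 \<or> y = x"
      proof (rule ccontr)
        assume n: "\<not> (A w t - left_lim 0 (A w) t = 0 \<or> y = x)"
        then have "0 < A w t - left_lim 0 (A w) t" using nn by simp
        then obtain k where "inverse (real (Suc k)) < A w t - left_lim 0 (A w) t" using reals_Archimedean by blast
        then have "(w, t) \<in> E (inverse (real (Suc k)))" using n eq t elim(2) pathwiseD(1)[OF elim(1)] by (simp add: mem)
        then show False using elim(5) t by auto
      qed
    qed
  qed
qed

text \<open>Adds to \<open>pathwise\<close> the three statements that hold at all times
  simultaneously only thanks to the section theorems.\<close>

definition regular :: "'w \<Rightarrow> bool" where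
  "regular w \<longleftrightarrow> pathwise w \<and> (\<forall>t\<in>{0..T}. Y w t = R w t - CL w t) \<and>
    (\<forall>t\<in>{0..T}. (Y w t - \<xi> w t) * (C w t - CL w t) = 0) \<and>
    (\<forall>t\<in>{0<..T}. \<forall>y x. (Y w \<longlongrightarrow> y) (at_left t) \<longrightarrow> (\<xi> w \<longlongrightarrow> x) (at_left t) \<longrightarrow>
      A w t - left_lim 0 (A w) t = 0 \<or> y = x)"

lemma AE_regular: "AE w in M. regular w"
  using AE_pathwise solution_paths obstacle_jump predictable_jump
  by eventually_elim (unfold regular_def, intro conjI; assumption)

end

section \<open>Optimal stopping\<close>

text \<open>The indicator of the times from \<open>S\<close> on is right-continuous with left limits
  and adapted. It restricts the contact set to times after \<open>S\<close> inside the optional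
  \<sigma>-algebra.\<close>

lemma (in usual_filtration) optional_after:
  assumes S: "stopping_time F S"
  shows "{(w, t) \<in> space M \<times> {0..T}. S w \<le> t} \<in> sets Opt"
proof -
  define X :: "'w \<Rightarrow> real \<Rightarrow> real" where "X w t = (if S w \<le> t then 1 else 0)" for w t
  have "cadlag_adapted (space M) F {0..T} X"
    unfolding cadlag_adapted_def
  proof (intro conjI ballI impI)
    fix t assume t: "t \<in> {0..T}"
    have "{w \<in> space (F t). S w \<le> t} \<in> sets (F t)" using stopping_timeD[OF S, of t] by (simp add: pred_def)
    then show "(\<lambda>w. X w t) \<in> borel_measurable (F t)" unfolding X_def by (intro measurable_If borel_measurable_const)
    fix w
    have "\<forall>\<^sub>F s in at t within {0..T} \<inter> {t<..}. X w s = X w t"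
      unfolding eventually_at X_def
      by (intro exI[of _ "if S w \<le> t then 1 else S w - t"]) (auto simp: dist_real_def)
    then show "(X w \<longlongrightarrow> X w t) (at t within {0..T} \<inter> {t<..})" by (rule tendsto_eventually)
    assume "0 < t"
    show "\<exists>l. (X w \<longlongrightarrow> l) (at_left t)"
    proof (cases "S w < t")
      case True
      have "\<forall>\<^sub>F s in at_left t. X w s = 1"
        using eventually_at_left_real[OF True] by eventually_elim (simp add: X_def)
      then show ?thesis by (intro exI) (rule tendsto_eventually)
    next
      case False
      have "\<forall>\<^sub>F s in at_left t. X w s = 0"
        using eventually_at_left_real[OF \<open>0 < t\<close>] by eventually_elim (use False in \<open>simp add: X_def\<close>)
      then show ?thesis by (intro exI) (rule tendsto_eventually)
    qed
  qed
  then have "(\<lambda>(w, t). X w t) \<in> borel_measurable Opt" using optional_cadlag unfolding optional_process_def by blast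
  then have "{p \<in> space Opt. (\<lambda>(w, t). X w t) p = 1} \<in> sets Opt" by (intro borel_measurable_eq borel_measurable_const)
  moreover have "{p \<in> space Opt. (\<lambda>(w, t). X w t) p = 1} = {(w, t) \<in> space M \<times> {0..T}. S w \<le> t}"
    by (auto simp: space_Opt X_def split: if_splits)
  ultimately show ?thesis by simp
qed

section \<open>Payoffs, gaps and contact times\<close>

context rbsde
begin

lemma regularD:
  assumes "regular w"
  shows "pathwise w" "\<forall>t\<in>{0..T}. Y w t = R w t - CL w t" "\<forall>t\<in>{0..T}. (Y w t - \<xi> w t) * (C w t - CL w t) = 0"
    "\<forall>t\<in>{0<..T}. \<forall>y x. (Y w \<longlongrightarrow> y) (at_left t) \<longrightarrow> (\<xi> w \<longlongrightarrow> x) (at_left t) \<longrightarrow>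
      A w t - left_lim 0 (A w) t = 0 \<or> y = x"
  using assms unfolding regular_def by - ((elim conjE, assumption)+)

lemma N_empty: "N w {} = 0"
  by (simp add: N_def)

lemma J_section:
  assumes w: "w \<in> space M" and E: "E \<in> sets Prd" and H: "{t. (w, t) \<in> E} = H" "H \<in> sets borel"
  shows "J (\<lambda>q. unc Z q * indicator E (fst q)) w = N w H"
proof -
  let ?W = "\<lambda>q. unc Z q * indicator E (fst q)"
  have W: "?W \<in> borel_measurable (Prd \<Otimes>\<^sub>M U)"
    using E by (intro borel_measurable_times unc_Z measurable_compose[OF measurable_fst borel_measurable_indicator])
  have eq: "(\<integral>p. path ?W w p \<partial>Q) = (\<integral>p. path (unc Z) w p * indicator H (fst p) \<partial>Q)"
    if Q: "AE p in Q. p \<in> D" "sets Q = sets (borel \<Otimes>\<^sub>M U)" for Q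
  proof (rule integral_cong_AE)
    show "path ?W w \<in> borel_measurable Q"
      unfolding measurable_cong_sets[OF Q(2) refl] by (rule measurable_path[OF W w])
    show "(\<lambda>p. path (unc Z) w p * indicator H (fst p)) \<in> borel_measurable Q"
      unfolding measurable_cong_sets[OF Q(2) refl]
      by (intro borel_measurable_times measurable_path[OF unc_Z w] measurable_time_indicator H)
    show "AE p in Q. path ?W w p = path (unc Z) w p * indicator H (fst p)"
      using Q(1)
    proof eventually_elim
      case (elim p)
      then have "fst p \<in> {0..T}" by (auto simp: D_def)
      then show ?case unfolding H(1)[symmetric] by (simp add: path_eq indicator_def)
    qed
  qed
  show ?thesis unfolding J_def N_def eq[OF AE_pm[OF w] sets_pm[OF w]] eq[OF AE_vm[OF w] sets_vm[OF w]] ..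
qed

text \<open>Conditional mean zero is tested on events \<open>B\<close> of the past of
  \<open>S\<close>. On \<open>B\<close> the increment is the full integral of \<open>Z\<close> over
  the predictable set \<open>E B\<close>, the part over \<open>B\<close> of the stochastic interval
  from \<open>S\<close>, excluded, to \<open>\<tau>\<close>, included; off \<open>B\<close> the
  section of \<open>E B\<close> is empty.\<close>

lemma martingale:
  assumes S: "S \<in> stopping_times M F T (\<lambda>_. 0)" and \<tau>: "\<tau> \<in> stopping_times M F T S"
  shows "integrable M (\<lambda>w. N w {S w<..\<tau> w})"
    "AE w in M. real_cond_exp M (pre_sigma S) (\<lambda>w. N w {S w<..\<tau> w}) w = 0"
proof -
  note S' = stopping_timesD[OF S] and \<tau>' = stopping_timesD[OF \<tau>]
  have I: "{0..T} = {0..T} \<and> 0 \<le> T \<or> {0..T} = {0..}" using T_pos by simp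
  define E where "E B = {(w, t) \<in> space M \<times> {0..T}. w \<in> B \<and> S w < t} - {(w, t) \<in> space M \<times> {0..T}. w \<in> space M \<and> \<tau> w < t}" for B
  have top: "space M \<in> sets (pre_sigma \<sigma>)" if "stopping_time F \<sigma>" for \<sigma>
    using subalgebra_pre_sigma[OF that] unfolding subalgebra_def by (metis sets.top)
  have E: "E B \<in> sets Prd" if "B \<in> sets (pre_sigma S)" for B
    unfolding E_def by (intro sets.Diff predictable_after_stopping[OF I] S' \<tau>' that top)
  define h where "h B = J (\<lambda>q. unc Z q * indicator (E B) (fst q))" for B
  have h: "integrable M (h B)" "(\<integral>w. h B w \<partial>M) = 0" if "B \<in> sets (pre_sigma S)" for B
    unfolding h_def using compensated_mean_zero(2,3)[OF solD(2) E[OF that]] by simp_all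
  have eq: "AE w in M. indicator B w * N w {S w<..\<tau> w} = h B w" if B: "B \<in> sets (pre_sigma S)" for B
    using \<tau>'(3) S'(3) AE_space
  proof eventually_elim
    case (elim w)
    have sec: "{t. (w, t) \<in> E B} = (if w \<in> B then {S w<..\<tau> w} else {})"
      unfolding E_def using elim by auto
    have "h B w = N w (if w \<in> B then {S w<..\<tau> w} else {})"
      unfolding h_def by (rule J_section[OF elim(3) E[OF B] sec]) simp
    then show ?case by (simp add: N_empty)
  qed
  have eq1: "AE w in M. N w {S w<..\<tau> w} = h (space M) w"
    using eq[OF top[OF S'(1)]] AE_space by eventually_elim simp
  have m: "(\<lambda>w. N w {S w<..\<tau> w}) \<in> borel_measurable M"
    by (rule measurable_AE[OF borel_measurable_integrable[OF h(1)[OF top[OF S'(1)]]] eq1])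
  show int: "integrable M (\<lambda>w. N w {S w<..\<tau> w})"
    by (rule integrable_cong_AE_imp[OF h(1)[OF top[OF S'(1)]] m]) (use eq1 in \<open>auto elim: eventually_mono\<close>)
  interpret S: finite_measure_subalgebra M "pre_sigma S"
    by unfold_locales (rule subalgebra_pre_sigma[OF S'(1)])
  show "AE w in M. real_cond_exp M (pre_sigma S) (\<lambda>w. N w {S w<..\<tau> w}) w = 0"
  proof (rule S.real_cond_exp_charact[OF _ int])
    fix B assume B: "B \<in> sets (pre_sigma S)"
    have BM: "B \<in> sets M" using subalgebra_pre_sigma[OF S'(1)] B unfolding subalgebra_def by blast
    have "(\<integral>w. indicator B w * N w {S w<..\<tau> w} \<partial>M) = (\<integral>w. h B w \<partial>M)"
      using BM m h(1)[OF B] by (intro integral_cong_AE eq[OF B] borel_measurable_times borel_measurable_indicator) auto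
    then show "(LINT w:B|M. N w {S w<..\<tau> w}) = (LINT w:B|M. 0)"
      using h(2)[OF B] by (simp add: set_lebesgue_integral_def)
  qed simp_all
qed

definition gap :: "('w \<Rightarrow> real) \<Rightarrow> ('w \<Rightarrow> real) \<Rightarrow> 'w \<Rightarrow> real" where
  "gap S \<tau> w = (Y w (\<tau> w) - \<xi> w (\<tau> w)) + (A w (\<tau> w) - A w (S w)) + (CL w (\<tau> w) - CL w (S w))"

lemma payoff_eq:
  assumes S: "S \<in> stopping_times M F T (\<lambda>_. 0)" and \<tau>: "\<tau> \<in> stopping_times M F T S"
  shows "AE w in M. \<xi> w (\<tau> w) + (LINT t : {S w..\<tau> w} | lborel. f w t (Y w t) (Z w t)) =
    Y w (S w) + N w {S w<..\<tau> w} - gap S \<tau> w"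
  using stopping_timesD(3)[OF S] stopping_timesD(3)[OF \<tau>] AE_regular
proof eventually_elim
  case (elim w)
  note r = regularD[OF elim(3)]
  have t: "S w \<in> {0..T}" "\<tau> w \<in> {0..T}" "S w \<le> \<tau> w" using elim by auto
  have "(LINT t : {S w..\<tau> w} | lborel. f w t (Y w t) (Z w t)) = I w (S w) - I w (\<tau> w)"
    using I_diff[OF r(1), of "S w" "\<tau> w"] t by (simp add: g_def)
  then show ?case
    using bspec[OF r(2) t(1)] bspec[OF r(2) t(2)] R_eq[OF r(1), of "S w"] R_eq[OF r(1), of "\<tau> w"] t
    by (simp add: gap_def N_Ioc[OF r(1)])
qed

lemma gap_nonneg:
  assumes S: "S \<in> stopping_times M F T (\<lambda>_. 0)" and \<tau>: "\<tau> \<in> stopping_times M F T S"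
  shows "AE w in M. \<xi> w (\<tau> w) \<le> Y w (\<tau> w) \<and> Y w (\<tau> w) - \<xi> w (\<tau> w) \<le> gap S \<tau> w"
  using stopping_timesD(3)[OF S] stopping_timesD(3)[OF \<tau>] AE_pathwise
proof eventually_elim
  case (elim w)
  have t: "S w \<in> {0..T}" "\<tau> w \<in> {0..T}" "S w \<le> \<tau> w" using elim by auto
  have "A w (S w) \<le> A w (\<tau> w)" by (rule mono_onD[OF pathwiseD(4)[OF elim(3)] t])
  moreover have "CL w (S w) \<le> CL w (\<tau> w)"
    unfolding CL_def using t by (intro left_lim_mono[OF C_path(1) C_path(2-4)[OF elim(3)]]) auto
  moreover have "\<xi> w (\<tau> w) \<le> Y w (\<tau> w)" using pathwiseD(11)[OF elim(3)] t by blast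
  ultimately show ?case by (simp add: gap_def)
qed

lemma CL_integrable:
  assumes \<tau>: "\<tau> \<in> stopping_times M F T S"
  shows "integrable M (\<lambda>w. CL w (\<tau> w))"
proof -
  obtain C' where C': "predictable_process M F T C'" "AE w in M. \<forall>t\<in>{0..T}. C' w t = CL w t" by (rule C_left_version)
  have "AE w in M. CL w (\<tau> w) = C' w (\<tau> w)"
    using C'(2) stopping_timesD(3)[OF \<tau>] by eventually_elim simp
  then have m: "(\<lambda>w. CL w (\<tau> w)) \<in> borel_measurable M"
    by (rule measurable_AE[OF optional_at_stopping_time_M[OF predictable_process_optional[OF C'(1)] \<tau>]])
  show ?thesis
  proof (rule Bochner_Integration.integrable_bound[OF S20_integrable[OF solD(4) \<tau>] m])
    show "AE w in M. norm (CL w (\<tau> w)) \<le> norm (C w (\<tau> w))"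
      using stopping_timesD(3)[OF \<tau>] AE_pathwise
    proof eventually_elim
      case (elim w)
      have "0 \<le> CL w (\<tau> w)" unfolding CL_def
        using elim by (intro left_lim_nonneg[OF C_path(1) C_path(2-4)[OF elim(2)]]) auto
      moreover have "CL w (\<tau> w) \<le> C w (\<tau> w)" unfolding CL_def
        using jump_nonneg[OF C_path(1) C_path(2-4)[OF elim(2)], of "\<tau> w"] elim by simp
      ultimately show ?case by simp
    qed
  qed
qed

lemma gap_integrable:
  assumes S: "S \<in> stopping_times M F T (\<lambda>_. 0)" and \<tau>: "\<tau> \<in> stopping_times M F T S"
  shows "integrable M (gap S \<tau>)"
  unfolding gap_def[abs_def]
  by (intro Bochner_Integration.integrable_add Bochner_Integration.integrable_diff CL_integrable[OF S] CL_integrable[OF \<tau>]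
      S20_integrable[OF solD(1) \<tau>] S20_integrable[OF xi(1) \<tau>] S20_integrable[OF solD(3) \<tau>] S20_integrable[OF solD(3) S])

lemma reward_eq:
  assumes S: "S \<in> stopping_times M F T (\<lambda>_. 0)" and \<tau>: "\<tau> \<in> stopping_times M F T S"
  shows "AE w in M. reward M F f \<xi> Y Z S \<tau> w = Y w (S w) - real_cond_exp M (pre_sigma S) (gap S \<tau>) w"
proof -
  interpret S: finite_measure_subalgebra M "pre_sigma S"
    by unfold_locales (rule subalgebra_pre_sigma[OF stopping_timesD(1)[OF S]])
  note iY = S20_integrable[OF solD(1) S] and iN = martingale(1)[OF S \<tau>] and iG = gap_integrable[OF S \<tau>]
  have mY: "(\<lambda>w. Y w (S w)) \<in> borel_measurable (pre_sigma S)" by (rule optional_at_stopping_time[OF optional(1) S])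
  have mH: "(\<lambda>w. Y w (S w) + N w {S w<..\<tau> w} - gap S \<tau> w) \<in> borel_measurable M"
    using iY iN iG by (intro borel_measurable_diff borel_measurable_add borel_measurable_integrable)
  have "AE w in M. reward M F f \<xi> Y Z S \<tau> w = real_cond_exp M (pre_sigma S) (\<lambda>w. Y w (S w) + N w {S w<..\<tau> w} - gap S \<tau> w) w"
    unfolding reward_def by (rule S.real_cond_exp_cong[OF payoff_eq[OF S \<tau>] measurable_AE[OF mH payoff_eq[OF S \<tau>]] mH])
  moreover have "AE w in M. real_cond_exp M (pre_sigma S) (\<lambda>w. Y w (S w) + N w {S w<..\<tau> w} - gap S \<tau> w) w =
      real_cond_exp M (pre_sigma S) (\<lambda>w. Y w (S w) + N w {S w<..\<tau> w}) w - real_cond_exp M (pre_sigma S) (gap S \<tau>) w"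
    by (rule S.real_cond_exp_diff[OF Bochner_Integration.integrable_add[OF iY iN] iG])
  moreover note S.real_cond_exp_add[OF iY iN] S.real_cond_exp_F_meas[OF iY mY] martingale(2)[OF S \<tau>]
  ultimately show ?thesis by eventually_elim simp
qed

lemma reward_le:
  assumes S: "S \<in> stopping_times M F T (\<lambda>_. 0)" and \<tau>: "\<tau> \<in> stopping_times M F T S"
  shows "AE w in M. reward M F f \<xi> Y Z S \<tau> w \<le> Y w (S w)"
proof -
  interpret S: finite_measure_subalgebra M "pre_sigma S"
    by unfold_locales (rule subalgebra_pre_sigma[OF stopping_timesD(1)[OF S]])
  have "AE w in M. 0 \<le> gap S \<tau> w" using gap_nonneg[OF S \<tau>] by eventually_elim simp
  from S.real_cond_exp_pos[OF this borel_measurable_integrable[OF gap_integrable[OF S \<tau>]]] reward_eq[OF S \<tau>]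
  show ?thesis by eventually_elim simp
qed

lemma reward_ge:
  assumes S: "S \<in> stopping_times M F T (\<lambda>_. 0)" and \<tau>: "\<tau> \<in> stopping_times M F T S"
    and le: "AE w in M. gap S \<tau> w \<le> e"
  shows "AE w in M. Y w (S w) \<le> reward M F f \<xi> Y Z S \<tau> w + e"
proof -
  interpret S: finite_measure_subalgebra M "pre_sigma S"
    by unfold_locales (rule subalgebra_pre_sigma[OF stopping_timesD(1)[OF S]])
  have c: "integrable M (\<lambda>_. e)" by simp
  have "AE w in M. real_cond_exp M (pre_sigma S) (\<lambda>_. e) w = e" by (rule S.real_cond_exp_F_meas[OF c]) simp
  with S.real_cond_exp_mono[OF le gap_integrable[OF S \<tau>] c] reward_eq[OF S \<tau>]
  show ?thesis by eventually_elim simp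
qed

text \<open>The case e = 0 covers \<open>tau_star\<close> as well: since Y dominates \<xi>, the
  inequality is then an equality.\<close>

definition contact :: "real \<Rightarrow> ('w \<Rightarrow> real) \<Rightarrow> 'w \<Rightarrow> real set" where
  "contact e S w = {t. S w \<le> t \<and> t \<le> T \<and> Y w t \<le> \<xi> w t + e}"

lemma terminal_value:
  assumes w: "regular w" shows "Y w T = \<xi> w T"
proof -
  note r = regularD[OF w]
  have "I w T = 0" using I_diff[OF r(1), of T T] T_pos by (simp add: I_def)
  then show ?thesis using r(2) T_pos by (simp add: R_def N_empty)
qed

text \<open>Let t be the infimum and suppose Y > \<xi> + e at t. Then Y > \<xi> there, so
  \<open>C\<close> does not jump at t and \<open>Y\<close> is right-continuous at t. Right upper
  semicontinuity of \<open>\<xi>\<close> then keeps Y above \<xi> + e on an interval to the right of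
  t, which contradicts the choice of t.\<close>

lemma contact_min:
  assumes w: "regular w" and S: "0 \<le> S w" "S w \<le> T" and e: "0 \<le> e"
  obtains t where "t \<in> contact e S w" "\<forall>s\<in>contact e S w. t \<le> s"
proof -
  note r = regularD[OF w] and p = pathwiseD[OF regularD(1)[OF w]]
  let ?E = "contact e S w"
  define t where "t = Inf ?E"
  have TE: "T \<in> ?E" using terminal_value[OF w] S e by (simp add: contact_def)
  have bdd: "bdd_below ?E" by (rule bdd_belowI[of _ "S w"]) (simp add: contact_def)
  have lower: "t \<le> s" if "s \<in> ?E" for s unfolding t_def using that bdd by (rule cInf_lower)
  have St: "S w \<le> t" unfolding t_def using TE by (intro cInf_greatest) (auto simp: contact_def)
  have tT: "t \<le> T" by (rule lower[OF TE])
  have "Y w t \<le> \<xi> w t + e"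
  proof (rule ccontr)
    assume n: "\<not> Y w t \<le> \<xi> w t + e"
    then have "t \<noteq> T" using terminal_value[OF w] e by auto
    then have t: "0 \<le> t" "t < T" "t \<in> {0..T}" "t \<in> {0..<T}" using St S tT by auto
    have "C w t - CL w t = 0" using bspec[OF r(3) t(3)] n e by auto
    then have "R w t - C w t = Y w t" using bspec[OF r(2) t(3)] by simp
    then have Yr: "(Y w \<longlongrightarrow> Y w t) (at_right t)" using Y_right[OF r(1,2) t(1,2)] by simp
    \<comment> \<open>The midpoint between the values at t of \<xi> and of Y - e: near t from the
      right, \<open>\<xi>\<close> stays below it and Y - e above it.\<close>
    define c where "c = (\<xi> w t + (Y w t - e)) / 2"
    have c: "\<xi> w t < c" "c + e < Y w t" using n unfolding c_def by (auto simp: field_simps)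
    have "Limsup (at_right t) (\<lambda>s. ereal (\<xi> w s)) < ereal c"
      using bspec[OF p(14) t(4)] c(1) by (meson ereal_less_le le_less_trans less_ereal.simps(1))
    then have "\<forall>\<^sub>F s in at_right t. ereal (\<xi> w s) < ereal c" by (rule Limsup_lessD)
    with order_tendstoD(1)[OF Yr c(2)] have "\<forall>\<^sub>F s in at_right t. \<not> Y w s \<le> \<xi> w s + e"
      by eventually_elim simp
    then obtain b where b: "t < b" "\<And>s. t < s \<Longrightarrow> s < b \<Longrightarrow> \<not> Y w s \<le> \<xi> w s + e"
      unfolding eventually_at_right_field by blast
    have "b \<le> Inf ?E"
    proof (rule cInf_greatest)
      show "?E \<noteq> {}" using TE by blast
      fix s assume s: "s \<in> ?E"
      then have "t \<le> s" "Y w s \<le> \<xi> w s + e" using lower by (auto simp: contact_def)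
      then show "b \<le> s" using b(2)[of s] n by (cases "s = t") force+
    qed
    then show False using b(1) by (simp add: t_def)
  qed
  then have "t \<in> ?E" using St tT by (simp add: contact_def)
  then show ?thesis using lower by (intro that ballI)
qed

lemma INF_ereal_min:
  assumes "t \<in> B" "\<forall>s\<in>B. t \<le> s" shows "(INF s\<in>B. ereal s) = ereal t"
  by (rule antisym) (use assms in \<open>auto intro: INF_lower INF_greatest\<close>)

lemma tau_eps_min:
  assumes "t \<in> contact e S w" "\<forall>s\<in>contact e S w. t \<le> s" shows "tau_eps T \<xi> Y e S w = t"
  unfolding tau_eps_def contact_def[symmetric] INF_ereal_min[OF assms] by simp

lemma tau_star_eq:
  assumes w: "regular w" and S: "0 \<le> S w" "S w \<le> T"
  shows "tau_star T \<xi> Y S w = tau_eps T \<xi> Y 0 S w"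
proof -
  obtain t where t: "t \<in> contact 0 S w" "\<forall>s\<in>contact 0 S w. t \<le> s"
    by (rule contact_min[where S=S, OF w S order_refl]) (rule that)
  have "Y w t = \<xi> w t \<longleftrightarrow> Y w t \<le> \<xi> w t + 0" if "S w \<le> t" "t \<le> T" for t
    using bspec[OF pathwiseD(11)[OF regularD(1)[OF w]], of t] S that by auto
  then have "{t. S w \<le> t \<and> t \<le> T \<and> Y w t = \<xi> w t} = contact 0 S w" unfolding contact_def by blast
  then have "tau_star T \<xi> Y S w = real_of_ereal (min (ereal t) (ereal T))"
    unfolding tau_star_def by (simp only: INF_ereal_min[OF t])
  then show ?thesis using tau_eps_min[OF t] t(1) by (simp add: contact_def min_def)
qed

text \<open>Almost surely the infimum is the debut of an optional set. The exceptional paths, where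
  the definition may give other values, are absorbed by completeness.\<close>

lemma tau_eps_stopping:
  assumes S: "S \<in> stopping_times M F T (\<lambda>_. 0)" and e: "0 \<le> e"
  shows "tau_eps T \<xi> Y e S \<in> stopping_times M F T S"
proof -
  note S' = stopping_timesD[OF S]
  define E where "E = {(w, t) \<in> space M \<times> {0..T}. S w \<le> t} \<inter> {p \<in> space Opt. (\<lambda>(w, t). Y w t) p \<le> (\<lambda>(w, t). \<xi> w t) p + e}"
  have E: "E \<in> sets Opt" unfolding E_def
    by (intro sets.Int optional_after S' borel_measurable_le borel_measurable_add borel_measurable_const optional_measurable optional)
  have eq: "AE w in M. tau_eps T \<xi> Y e S w = min (debut E w) T \<and> S w \<le> tau_eps T \<xi> Y e S w \<and> tau_eps T \<xi> Y e S w \<le> T"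
    using AE_regular S'(3)
  proof eventually_elim
    case (elim w)
    obtain t where t: "t \<in> contact e S w" "\<forall>s\<in>contact e S w. t \<le> s"
      by (rule contact_min[where S=S, OF elim(1) _ _ e]) (use elim in simp, use elim in simp, rule that)
    have sec: "{t. (w, t) \<in> E} = contact e S w"
      using elim pathwiseD(1)[OF regularD(1)[OF elim(1)]] by (auto simp: E_def contact_def space_Opt)
    then have "(w, t) \<in> E" using t(1) by blast
    then have "w \<in> fst ` E" by force
    then have "debut E w = t" unfolding debut_def sec using cInf_eq_minimum[OF t(1)] t(2) by simp
    then show ?case using tau_eps_min[OF t] t(1) by (simp add: contact_def)
  qed
  have eq1: "AE w in M. tau_eps T \<xi> Y e S w = min (debut E w) T" using eq by eventually_elim (elim conjE)
  have nn: "0 \<le> tau_eps T \<xi> Y e S w" if "w \<in> space M" for w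
    unfolding tau_eps_def using S'(2)[OF that] by (intro real_of_ereal_pos INF_greatest) auto
  have "tau_eps T \<xi> Y e S \<in> stopping_times M F T (\<lambda>_. 0)"
    by (rule stopping_times_AE[OF debut_min_stopping_times[OF E] eq1 nn])
  then have "stopping_time F (tau_eps T \<xi> Y e S)" by (rule stopping_timesD(1))
  moreover have "AE w in M. S w \<le> tau_eps T \<xi> Y e S w \<and> tau_eps T \<xi> Y e S w \<le> T" using eq by eventually_elim (elim conjE, intro conjI)
  ultimately show ?thesis using nn by (simp add: stopping_times_def)
qed

text \<open>Strictly before the contact time Y > \<xi> + e, which freezes the left limits of
  \<open>C\<close> and the continuous part of \<open>A\<close>. The jumps of \<open>A\<close> need
  separate care, since one could occur at the contact time itself.\<close>

lemma contact_gap: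
  assumes w: "regular w" and S: "0 \<le> S w" and m: "t \<in> contact e S w" "\<forall>s\<in>contact e S w. t \<le> s"
    and e: "0 < e \<or> e = 0 \<and> (\<forall>t\<in>{0<..T}. A w t - left_lim 0 (A w) t = 0)" and \<tau>: "\<tau> w = t"
  shows "gap S \<tau> w \<le> e"
proof -
  note r = regularD[OF w] and p = pathwiseD[OF regularD(1)[OF w]]
  have t: "S w \<le> t" "t \<le> T" "Y w t \<le> \<xi> w t + e" using m(1) by (auto simp: contact_def)
  have e0: "0 \<le> e" using e by auto
  have above: "\<xi> w s + e < Y w s" if "S w \<le> s" "s < t" for s
    using bspec[OF m(2), of s] that t by (force simp: contact_def)
  have "CL w t = CL w (S w)" unfolding CL_def
  proof (rule pure_jump_flat[OF C_path(1) C_path(2-4)[OF r(1)] p(10) S t(1,2)])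
    fix s assume s: "S w \<le> s" "s < t"
    then have "s \<in> {0..T}" using S t by auto
    then have "(Y w s - \<xi> w s) * (C w s - CL w s) = 0" using r(3) by blast
    moreover have "Y w s - \<xi> w s \<noteq> 0" using above[OF s] e0 by simp
    ultimately show "C w s - left_lim 0 (C w) s = 0" by (simp add: CL_def)
  qed
  moreover have "A w t = A w (S w)"
  proof (cases "S w = t")
    case False
    then have lt: "S w < t" using t by simp
    show ?thesis
    proof (rule mono_flat[OF A_path(1) A_path(2-4)[OF r(1)] S lt t(2) _ p(12)])
      show "{S w<..<t} \<subseteq> {t \<in> {0..T}. \<xi> w t < Y w t}"
      proof
        fix s assume s: "s \<in> {S w<..<t}"
        then have "\<xi> w s + e < Y w s" by (intro above) auto
        then show "s \<in> {t \<in> {0..T}. \<xi> w t < Y w t}" using s S t e0 by auto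
      qed
      fix s assume s: "S w < s" "s \<le> t"
      then have sT: "0 < s" "s \<le> T" "s \<in> {0<..T}" using S t by auto
      obtain x where x: "(\<xi> w \<longlongrightarrow> x) (at_left s)" using p(13) sT(3) by blast
      note y = Y_left[OF r(1,2) sT(1,2)]
      show "A w s - left_lim 0 (A w) s = 0"
      \<comment> \<open>For e > 0 the inequality just before s passes to left limits, where the two
        processes still differ by at least e. The Skorokhod condition then excludes a jump at s,
        also when s is the contact time. For e = 0 strictness would be lost in the limit.\<close>
      proof (cases "0 < e")
        case True
        have "\<forall>\<^sub>F u in at_left s. \<xi> w u + e \<le> Y w u"
          using eventually_at_left_real[OF s(1)] by eventually_elim (use above s in \<open>auto intro!: less_imp_le\<close>)
        from tendsto_le[OF trivial_limit_at_left_real y tendsto_add[OF x tendsto_const] this]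
        have "x + e \<le> RL w s - CL w s" .
        then have "RL w s - CL w s \<noteq> x" using True by auto
        then show ?thesis using r(4) sT(3) x y by blast
      next
        case False
        then show ?thesis using e sT(3) by blast
      qed
    qed
  qed simp
  ultimately show ?thesis using t(3) by (simp add: gap_def \<tau>)
qed

text \<open>At a jump of \<open>A\<close> of size \<open>> d\<close> the Skorokhod condition and left upper semicontinuity force
  \<open>Y\<^bsub>t-\<^esub> = \<xi>\<^bsub>t-\<^esub> \<le> \<xi>\<^sub>t \<le> Y\<^sub>t\<close>, so that the compensated integral jumps by more than \<open>d\<close>;
  its total predictable jumps have mean zero, hence there are none.\<close>

lemma no_predictable_jumps:
  assumes usc: "left_usc M T \<xi>"
  shows "AE w in M. \<forall>t\<in>{0<..T}. A w t - left_lim 0 (A w) t = 0"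
proof -
  obtain A' where A': "predictable_process M F T A'" "AE w in M. \<forall>t\<in>{0<..T}. A' w t = left_lim 0 (A w) t" by (rule A_left_version)
  define E where "E d = {p \<in> space Prd. 0 < snd p \<and> d < (\<lambda>(w, t). A w t) p - (\<lambda>(w, t). A' w t) p}" for d
  have E: "E d \<in> sets Prd" for d unfolding E_def by (rule large_jumps_predictable[OF A'(1)])
  have none: "AE w in M. {t \<in> {0<..T}. d < A w t - left_lim 0 (A w) t} = {}" if d: "0 < d" for d
  proof -
    define h where "h = J (\<lambda>q. unc Z q * indicator (E d) (fst q))"
    have h: "integrable M h" "(\<integral>w. h w \<partial>M) = 0"
      unfolding h_def using compensated_mean_zero(2,3)[OF solD(2) E] by simp_all
    have ge: "AE w in M. d * real (card {t \<in> {0<..T}. d < A w t - left_lim 0 (A w) t}) \<le> h w"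
      using AE_regular A'(2) usc[unfolded left_usc_def]
    proof eventually_elim
      case (elim w)
      note r = regularD[OF elim(1)] and p = pathwiseD[OF regularD(1)[OF elim(1)]]
      let ?H = "{t \<in> {0<..T}. d < A w t - left_lim 0 (A w) t}"
      have fin: "finite ?H" by (rule finite_large_jumps[OF A_path(1) A_path(2-4)[OF r(1)] d])
      have sec: "{t. (w, t) \<in> E d} = ?H" using p(1) elim(2) by (auto simp: E_def space_Prd)
      have add: "N w G = (\<Sum>t\<in>G. N w {t})" if "finite G" for G
        using that
      proof induction
        case (insert t G)
        then have "G \<in> sets borel" by (intro finite_imp_closed borel_closed)
        with insert show ?case using N_Un[OF r(1), of "{t}" G] by simp
      qed (simp add: N_empty)
      have "h w = N w ?H" unfolding h_def
        using fin by (intro J_section[OF p(1) E sec]) (intro finite_imp_closed borel_closed)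
      also have "\<dots> = (\<Sum>t\<in>?H. N w {t})" by (rule add[OF fin])
      finally have hs: "h w = (\<Sum>t\<in>?H. N w {t})" .
      have "d \<le> N w {t}" if t: "t \<in> ?H" for t
      proof -
        have t': "0 < t" "t \<le> T" "t \<in> {0<..T}" "t \<in> {0..T}" using t by auto
        obtain x where x: "(\<xi> w \<longlongrightarrow> x) (at_left t)" using p(13) t'(3) by blast
        note y = Y_left[OF r(1,2) t'(1,2)]
        have "A w t - left_lim 0 (A w) t \<noteq> 0" using t d by simp
        then have yx: "RL w t - CL w t = x" using r(4) t'(3) x y by blast
        have "Limsup (at_left t) (\<lambda>s. ereal (\<xi> w s)) = ereal x"
          using x by (intro lim_imp_Limsup tendsto_ereal) auto
        then have "x \<le> \<xi> w t" using bspec[OF elim(3) t'(3)] by simp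
        also have "\<dots> \<le> Y w t" using p(11) t'(4) by blast
        finally have "x \<le> Y w t" .
        \<comment> \<open>The left limits of \<open>C\<close> form a left-continuous path, so the
          jump of \<open>Y\<close> from the left at t is the jump of the compensated integral minus
          the jump of \<open>A\<close>. It is nonnegative because \<open>x\<close> is the left limit
          of \<open>Y\<close>.\<close>
        then have "A w t - left_lim 0 (A w) t \<le> N w {t}"
          using bspec[OF r(2) t'(4)] R_eq[OF r(1) t'(2)] yx by (simp add: N_point[OF r(1)] RL_def)
        then show ?thesis using t by simp
      qed
      then have "(\<Sum>t\<in>?H. d) \<le> (\<Sum>t\<in>?H. N w {t})" by (rule sum_mono)
      then show ?case by (simp add: hs mult.commute)
    qed
    have "AE w in M. 0 \<le> h w"
      using ge
    proof eventually_elim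
      case (elim w)
      have "0 \<le> d * real (card {t \<in> {0<..T}. d < A w t - left_lim 0 (A w) t})" using d by simp
      then show ?case using elim by linarith
    qed
    then have "AE w in M. h w = 0" using integral_nonneg_eq_0_iff_AE[OF h(1)] h(2) by simp
    with ge AE_pathwise show ?thesis
    proof eventually_elim
      case (elim w)
      let ?H = "{t \<in> {0<..T}. d < A w t - left_lim 0 (A w) t}"
      have "d * real (card ?H) \<le> 0" using elim by simp
      then have "real (card ?H) \<le> 0" using d by (simp add: mult_le_0_iff)
      then have "card ?H = 0" by simp
      then show "?H = {}" using finite_large_jumps[OF A_path(1) A_path(2-4)[OF elim(2)] d] by simp
    qed
  qed
  have "AE w in M. \<forall>k :: nat. {t \<in> {0<..T}. inverse (real (Suc k)) < A w t - left_lim 0 (A w) t} = {}"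
    unfolding AE_all_countable by (intro allI none) simp
  with AE_pathwise show ?thesis
  proof eventually_elim
    case (elim w)
    show ?case
    proof (intro ballI, rule ccontr)
      fix t assume t: "t \<in> {0<..T}" and n: "A w t - left_lim 0 (A w) t \<noteq> 0"
      have "0 \<le> A w t - left_lim 0 (A w) t" using jump_nonneg[OF A_path(1) A_path(2-4)[OF elim(1)], of t] t by simp
      then have "0 < A w t - left_lim 0 (A w) t" using n by simp
      then obtain k where "inverse (real (Suc k)) < A w t - left_lim 0 (A w) t" using reals_Archimedean by blast
      then show False using elim(2) t by blast
    qed
  qed
qed

lemma tau_eps_reward:
  assumes S: "S \<in> stopping_times M F T (\<lambda>_. 0)" and e: "0 < e \<or> e = 0 \<and> left_usc M T \<xi>"
  shows "AE w in M. Y w (S w) \<le> reward M F f \<xi> Y Z S (tau_eps T \<xi> Y e S) w + e"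
proof (rule reward_ge[OF S tau_eps_stopping[OF S]])
  show e0: "0 \<le> e" using e by auto
  have "AE w in M. 0 < e \<or> e = 0 \<and> (\<forall>t\<in>{0<..T}. A w t - left_lim 0 (A w) t = 0)"
  proof (cases "0 < e")
    case False
    then have "left_usc M T \<xi>" "e = 0" using e by auto
    then show ?thesis using no_predictable_jumps by simp
  qed simp
  with AE_regular stopping_timesD(3)[OF S] show "AE w in M. gap S (tau_eps T \<xi> Y e S) w \<le> e"
  proof eventually_elim
    case (elim w)
    obtain t where t: "t \<in> contact e S w" "\<forall>s\<in>contact e S w. t \<le> s"
      by (rule contact_min[where S=S, OF elim(1) _ _ e0]) (use elim in simp, use elim in simp, rule that)
    show ?case by (rule contact_gap[where S=S and \<tau>="tau_eps T \<xi> Y e S", OF elim(1) _ t elim(3) tau_eps_min[OF t]]) (use elim in simp)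
  qed
qed

text \<open>No stopping time earns more than Y at \<open>S\<close>, and the contact times with
  tolerance 1/(k+1) come within 1/(k+1) of it. Countably many of them suffice to bound any other
  upper bound from below almost surely.\<close>

lemma value_at_eq:
  assumes S: "S \<in> stopping_times M F T (\<lambda>_. 0)"
  shows "AE w in M. value_at M F T f \<xi> Y Z S w = ereal (Y w (S w))"
  unfolding value_at_def
proof (rule ess_sup_eq)
  let ?X = "{\<lambda>w. ereal (reward M F f \<xi> Y Z S \<tau> w) |\<tau>. \<tau> \<in> stopping_times M F T S}"
  show "is_ess_sup M ?X (\<lambda>w. ereal (Y w (S w)))"
    unfolding is_ess_sup_def
  proof (intro conjI ballI impI)
    show "(\<lambda>w. ereal (Y w (S w))) \<in> borel_measurable M"
      using optional_at_stopping_time_M[OF optional(1) S] by simp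
    fix X assume "X \<in> ?X"
    then obtain \<tau> where \<tau>: "X = (\<lambda>w. ereal (reward M F f \<xi> Y Z S \<tau> w))" "\<tau> \<in> stopping_times M F T S"
      by (elim CollectE exE conjE) (rule that)
    show "AE w in M. X w \<le> ereal (Y w (S w))" using reward_le[OF S \<tau>(2)] by (simp add: \<tau>(1))
  next
    fix W assume W: "W \<in> borel_measurable M" "\<forall>X\<in>?X. AE w in M. X w \<le> W w"
    have "AE w in M. ereal (Y w (S w) - inverse (real (Suc k))) \<le> W w" for k :: nat
    proof -
      let ?e = "inverse (real (Suc k))"
      have "(\<lambda>w. ereal (reward M F f \<xi> Y Z S (tau_eps T \<xi> Y ?e S) w)) \<in> ?X"
        by (rule CollectI, rule exI, rule conjI, rule refl, rule tau_eps_stopping[OF S]) simp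
      then have "AE w in M. ereal (reward M F f \<xi> Y Z S (tau_eps T \<xi> Y ?e S) w) \<le> W w" using W(2) by (rule bspec[rotated])
      moreover have "AE w in M. Y w (S w) \<le> reward M F f \<xi> Y Z S (tau_eps T \<xi> Y ?e S) w + ?e"
        by (rule tau_eps_reward[OF S]) simp
      ultimately show ?thesis
      proof eventually_elim
        case (elim w)
        have "ereal (Y w (S w) - ?e) \<le> ereal (reward M F f \<xi> Y Z S (tau_eps T \<xi> Y ?e S) w)" using elim(2) by simp
        then show ?case using elim(1) by (rule order.trans)
      qed
    qed
    then have "AE w in M. \<forall>k :: nat. ereal (Y w (S w) - inverse (real (Suc k))) \<le> W w" unfolding AE_all_countable by (rule allI)
    then show "AE w in M. ereal (Y w (S w)) \<le> W w"
    proof eventually_elim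
      case (elim w)
      have "(\<lambda>k. Y w (S w) - inverse (real (Suc k))) \<longlonglongrightarrow> Y w (S w) - 0"
        by (intro tendsto_diff tendsto_const LIMSEQ_inverse_real_of_nat)
      then have "(\<lambda>k. ereal (Y w (S w) - inverse (real (Suc k)))) \<longlonglongrightarrow> ereal (Y w (S w))" by simp
      then show ?case by (rule LIMSEQ_le_const2) (use elim in blast)
    qed
  qed
qed

lemma tau_star_stopping:
  assumes S: "S \<in> stopping_times M F T (\<lambda>_. 0)"
  shows "tau_star T \<xi> Y S \<in> stopping_times M F T S" "AE w in M. tau_star T \<xi> Y S w = tau_eps T \<xi> Y 0 S w"
proof -
  show eq: "AE w in M. tau_star T \<xi> Y S w = tau_eps T \<xi> Y 0 S w"
    using AE_regular stopping_timesD(3)[OF S] by eventually_elim (simp add: tau_star_eq)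
  show "tau_star T \<xi> Y S \<in> stopping_times M F T S"
  proof (rule stopping_times_AE[OF tau_eps_stopping[OF S order_refl] eq])
    fix w assume "w \<in> space M"
    then have "0 \<le> S w" by (rule stopping_timesD(2)[OF S])
    then show "0 \<le> tau_star T \<xi> Y S w"
      unfolding tau_star_def using T_pos by (intro real_of_ereal_pos min.boundedI INF_greatest) auto
  qed
qed

lemma tau_star_optimal:
  assumes S: "S \<in> stopping_times M F T (\<lambda>_. 0)" and usc: "left_usc M T \<xi>"
  shows "optimal_stopping_time M F T f \<xi> Y Z S (tau_star T \<xi> Y S)"
  unfolding optimal_stopping_time_def
proof
  show st: "tau_star T \<xi> Y S \<in> stopping_times M F T S" by (rule tau_star_stopping[OF S])
  note st0 = tau_eps_stopping[OF S order_refl]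
  have "AE w in M. gap S (tau_star T \<xi> Y S) w = gap S (tau_eps T \<xi> Y 0 S) w"
    using tau_star_stopping(2)[OF S] by eventually_elim (simp add: gap_def)
  moreover have "AE w in M. gap S (tau_eps T \<xi> Y 0 S) w \<le> 0"
    using AE_regular stopping_timesD(3)[OF S] no_predictable_jumps[OF usc]
  proof eventually_elim
    case (elim w)
    obtain t where t: "t \<in> contact 0 S w" "\<forall>s\<in>contact 0 S w. t \<le> s"
      by (rule contact_min[where S=S, OF elim(1) _ _ order_refl]) (use elim in simp, use elim in simp, rule that)
    show ?case by (rule contact_gap[where S=S and \<tau>="tau_eps T \<xi> Y 0 S", OF elim(1) _ t _ tau_eps_min[OF t]]) (use elim in simp_all)
  qed
  ultimately have "AE w in M. gap S (tau_star T \<xi> Y S) w \<le> 0" by eventually_elim simp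
  from reward_ge[OF S st this] reward_le[OF S st] value_at_eq[OF S]
  show "AE w in M. value_at M F T f \<xi> Y Z S w = ereal (reward M F f \<xi> Y Z S (tau_star T \<xi> Y S) w)"
    by eventually_elim simp
qed

text \<open>An optimal time has a gap with conditional mean zero; as the gap is nonnegative, it
  vanishes. Since the gap dominates the difference of \<open>Y\<close> and \<open>\<xi>\<close> at
  \<open>\<tau>\<close>, the time \<open>\<tau>\<close> is itself a contact time and cannot precede
  the first one.\<close>

lemma tau_star_smallest:
  assumes S: "S \<in> stopping_times M F T (\<lambda>_. 0)" and opt: "optimal_stopping_time M F T f \<xi> Y Z S \<tau>"
  shows "AE w in M. tau_star T \<xi> Y S w \<le> \<tau> w"
proof -
  have \<tau>: "\<tau> \<in> stopping_times M F T S"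
    and v: "AE w in M. value_at M F T f \<xi> Y Z S w = ereal (reward M F f \<xi> Y Z S \<tau> w)"
    using opt unfolding optimal_stopping_time_def by auto
  interpret S: finite_measure_subalgebra M "pre_sigma S"
    by unfold_locales (rule subalgebra_pre_sigma[OF stopping_timesD(1)[OF S]])
  note iG = gap_integrable[OF S \<tau>]
  have "AE w in M. real_cond_exp M (pre_sigma S) (gap S \<tau>) w = 0"
    using v value_at_eq[OF S] reward_eq[OF S \<tau>] by eventually_elim simp
  then have "(\<integral>w. real_cond_exp M (pre_sigma S) (gap S \<tau>) w \<partial>M) = 0" by (rule integral_eq_zero_AE)
  then have z: "(\<integral>w. gap S \<tau> w \<partial>M) = 0" using S.real_cond_exp_int(2)[OF iG] by simp
  have "AE w in M. 0 \<le> gap S \<tau> w" using gap_nonneg[OF S \<tau>] by eventually_elim simp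
  then have "AE w in M. gap S \<tau> w = 0" using integral_nonneg_eq_0_iff_AE[OF iG] z by simp
  with gap_nonneg[OF S \<tau>] AE_regular stopping_timesD(3)[OF S] stopping_timesD(3)[OF \<tau>] tau_star_stopping(2)[OF S]
  show ?thesis
  proof eventually_elim
    case (elim w)
    obtain t where t: "t \<in> contact 0 S w" "\<forall>s\<in>contact 0 S w. t \<le> s"
      by (rule contact_min[where S=S, OF elim(2) _ _ order_refl]) (use elim in simp, use elim in simp, rule that)
    have "\<tau> w \<in> contact 0 S w" using elim by (simp add: contact_def)
    then show ?case using t(2) tau_eps_min[OF t] elim(5) by simp
  qed
qed

end

theorem proposition4p1:
  fixes M :: "'w measure" and F :: "real \<Rightarrow> 'w measure" and T :: real and U :: "'u measure"
    and \<mu> \<nu> :: "'w \<Rightarrow> (real \<times> 'u) measure"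
    and K :: "'w \<Rightarrow> real \<Rightarrow> real" and \<phi> :: "'w \<Rightarrow> real \<Rightarrow> 'u measure"
    and f :: "'w \<Rightarrow> real \<Rightarrow> real \<Rightarrow> ('u \<Rightarrow> real) \<Rightarrow> real"
    and \<xi> Y A C :: "'w \<Rightarrow> real \<Rightarrow> real" and Z :: "'w \<Rightarrow> real \<Rightarrow> 'u \<Rightarrow> real"
  assumes "0 < T" and "lusin_space U" and "prob_space M"
    and "right_continuous_filtration M F" and "complete_filtration M F"
    and "quasi_left_continuous_filtration M F"
    and "multivariate_point_process M U \<mu>" and "discrete_random_measure M U \<mu>"
    and "natural_filtration M U \<mu> F"
    and "predictable_compensator M F T U \<mu> \<nu>" and "compensator_disintegration M F T U \<nu> K \<phi>"
    and "predictable_driver M F T U f" and "lipschitz_driver M T U K \<phi> f"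
    and "\<xi> \<in> S20 M F T" and "left_limited M T \<xi>" and "right_usc M T \<xi>"
    and "rbsde_solution M F T U \<mu> \<nu> K f \<xi> Y Z A C"
  shows
    "(\<forall>S\<in>stopping_times M F T (\<lambda>_. 0).
        AE \<omega> in M. ereal (Y \<omega> (S \<omega>)) = value_at M F T f \<xi> Y Z S \<omega>) \<and>
     (\<forall>S\<in>stopping_times M F T (\<lambda>_. 0). \<forall>\<epsilon>>0.
        tau_eps T \<xi> Y \<epsilon> S \<in> stopping_times M F T S \<and>
        (AE \<omega> in M. Y \<omega> (S \<omega>) \<le> reward M F f \<xi> Y Z S (tau_eps T \<xi> Y \<epsilon> S) \<omega> + \<epsilon>)) \<and>
     (left_usc M T \<xi> \<longrightarrow>
        (\<forall>S\<in>stopping_times M F T (\<lambda>_. 0).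
           optimal_stopping_time M F T f \<xi> Y Z S (tau_star T \<xi> Y S) \<and>
           (\<forall>\<tau>. optimal_stopping_time M F T f \<xi> Y Z S \<tau> \<longrightarrow>
              (AE \<omega> in M. tau_star T \<xi> Y S \<omega> \<le> \<tau> \<omega>))))"
proof -
  interpret prob_space M by fact
  interpret rbsde M F T U \<mu> \<nu> K \<phi> f \<xi> Y A C Z
    by unfold_locales (rule assms)+
  show ?thesis
  proof (intro conjI ballI allI impI)
    fix S assume S: "S \<in> stopping_times M F T (\<lambda>_. 0)"
    show "AE \<omega> in M. ereal (Y \<omega> (S \<omega>)) = value_at M F T f \<xi> Y Z S \<omega>"
      using value_at_eq[OF S] by eventually_elim simp
    {
      fix \<epsilon> :: real assume "0 < \<epsilon>"
      then show "tau_eps T \<xi> Y \<epsilon> S \<in> stopping_times M F T S"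
        and "AE \<omega> in M. Y \<omega> (S \<omega>) \<le> reward M F f \<xi> Y Z S (tau_eps T \<xi> Y \<epsilon> S) \<omega> + \<epsilon>"
        using tau_eps_stopping[OF S] tau_eps_reward[OF S] by simp_all
    }
    show "optimal_stopping_time M F T f \<xi> Y Z S (tau_star T \<xi> Y S)" if "left_usc M T \<xi>"
      by (rule tau_star_optimal[OF S that])
    show "AE \<omega> in M. tau_star T \<xi> Y S \<omega> \<le> \<tau> \<omega>" if "optimal_stopping_time M F T f \<xi> Y Z S \<tau>" for \<tau>
      by (rule tau_star_smallest[OF S that])
  qed
qed

end
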